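(* Let $1/2<\delta<1$ and suppose that $\Gamma\backslash\Gamma N$ is closed in $\Gamma\backslash G$. For any integer $\ell\ge0$ and all $y>0$, $$\int_{(N\cap\Gamma)\backslash N}\phi_{\pm\ell}(n_xa_y)\,dx=c_0\,\frac{\sqrt{\Gamma(\delta)\Gamma(\ell+1-\delta)}}{\sqrt{\Gamma(1-\delta)\Gamma(\delta+\ell)}}\;y^{1-\delta},$$ where $\Gamma(\cdot)$ on the right denotes the Gamma function. In particular, for each $y>0$, $$\int_{(N\cap\Gamma)\backslash N}\phi_{\pm\ell}(n_xa_y)\,dx=O(y^{1-\delta})$$ with the implied constant independent of $\ell$.
   Context: Let $G=\mathrm{PSL}_2(\mathbb R)$, with $n_x=\begin{pmatrix}1&x\\0&1\end{pmatrix}$, $a_y=\begin{pmatrix}\sqrt y&0\\0&1/\sqrt y\end{pmatrix}$, $k_\theta=\begin{pmatrix}\cos\theta&\sin\theta\\-\sin\theta&\cos\theta\end{pmatrix}$; $N=\{n_x:x\in\mathbb R\}$, $K=\{k_\theta:0\le\theta<\pi\}$; every $g\in G$ is uniquely $n_xa_yk_\theta$. $\Gamma<G$ is a torsion-free, discrete, finitely generated subgroup, not virtually cyclic, with critical exponent $\delta$. Haar measure: $dg=y^{-2}dx\,dy\,dk$ for $g=n_xa_yk$, $dk$ the invariant probability measure on $K$; $\|\cdot\|_2$ is the norm of $L^2(\Gamma\backslash G,dg)$. The integral over $(N\cap\Gamma)\backslash N$ is over $x\in\mathbb R$ if $N\cap\Gamma$ is trivial, and otherwise over one period $[-x_0,x_0)$,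 where $2x_0$ is the smallest positive $x$ with $n_x\in\Gamma$. $\phi_0$ is the positive $K$-invariant eigenfunction in $L^2(\Gamma\backslash\mathbb H^2)=L^2(\Gamma\backslash G)^K$ of $-y^2(\partial_x^2+\partial_y^2)$ with eigenvalue $\delta(1-\delta)$ (a simple eigenvalue, the smallest one), with $\|\phi_0\|_2=1$. The constant $c_0>0$ is the one for which $\int_{(N\cap\Gamma)\backslash N}\phi_0(n_xa_y)\,dx=c_0y^{1-\delta}$ for all $y>0$ (such a constant exists). Raising and lowering operators: $\mathcal R=e^{2i\theta}\left(iy\frac{\partial}{\partial x}+y\frac{\partial}{\partial y}+\frac1{2i}\frac{\partial}{\partial\theta}\right)$ and $\mathcal L=e^{-2i\theta}\left(-iy\frac{\partial}{\partial x}+y\frac{\partial}{\partial y}-\frac1{2i}\frac{\partial}{\partial\theta}\right)$. For $\ell\ge0$, $\phi_\ell=\mathcal R^\ell\phi_0/\|\mathcal R^\ell\phi_0\|_2$ and $\phi_{-\ell}=\mathcal L^\ell\phi_0/\|\mathcal L^\ell\phi_0\|_2$. *)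

theory Defs
  imports "HOL-Analysis.Analysis" "HOL-Algebra.Coset" "HOL-Algebra.Generated_Groups"
begin

section \<open>The group \<open>PSL\<^sub>2(\<real>)\<close>\<close>

definition mat2 :: "real \<Rightarrow> real \<Rightarrow> real \<Rightarrow> real \<Rightarrow> real^2^2" where
  "mat2 a b c d = vector [vector [a, b], vector [c, d]]"

definition SL2 :: "(real^2^2) monoid" where
  "SL2 = \<lparr>carrier = {A. det A = 1}, mult = (**), one = mat 1\<rparr>"

text \<open>Elements of \<open>PSL2\<close> are the two-element classes \<open>{A, - A}\<close>.\<close>

definition PSL2 :: "(real^2^2) set monoid" where
  "PSL2 = SL2 Mod {mat 1, - mat 1}"

definition psl :: "real^2^2 \<Rightarrow> (real^2^2) set" where
  "psl A = {mat 1, - mat 1} #>\<^bsub>SL2\<^esub> A"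

definition n_elt :: "real \<Rightarrow> (real^2^2) set" where
  "n_elt x = psl (mat2 1 x 0 1)"

definition a_elt :: "real \<Rightarrow> (real^2^2) set" where
  "a_elt y = psl (mat2 (sqrt y) 0 0 (1 / sqrt y))"

definition k_elt :: "real \<Rightarrow> (real^2^2) set" where
  "k_elt t = psl (mat2 (cos t) (sin t) (- sin t) (cos t))"

definition N_group :: "(real^2^2) set set" where
  "N_group = range n_elt"

definition K_group :: "(real^2^2) set set" where
  "K_group = k_elt ` {0..<pi}"

definition nak :: "real \<Rightarrow> real \<Rightarrow> real \<Rightarrow> (real^2^2) set" where
  "nak x y t = n_elt x \<otimes>\<^bsub>PSL2\<^esub> a_elt y \<otimes>\<^bsub>PSL2\<^esub> k_elt t"

definition nak_coords :: "(real^2^2) set \<Rightarrow> real \<times> real \<times> real" where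
  "nak_coords = the_inv_into (UNIV \<times> {0<..} \<times> {0..<pi}) (\<lambda>(x, y, t). nak x y t)"


section \<open>Topology and Haar measure\<close>

text \<open>The quotient topology on a partition \<open>P\<close> of the space \<open>X\<close>.\<close>

definition partition_topology :: "'a topology \<Rightarrow> 'a set set \<Rightarrow> 'a set topology" where
  "partition_topology X P = topology (\<lambda>U. U \<subseteq> P \<and> openin X (\<Union>U))"

definition PSL2_top :: "(real^2^2) set topology" where
  "PSL2_top = partition_topology (top_of_set (carrier SL2)) (carrier PSL2)"

text \<open>\<open>\<Gamma>\G\<close> is the set of cosets \<open>\<Gamma>g\<close>, which HOL-Algebra calls right cosets.\<close>

definition quot_top :: "(real^2^2) set set \<Rightarrow> (real^2^2) set set topology" where
  "quot_top \<Gamma> = partition_topology PSL2_top (rcosets\<^bsub>PSL2\<^esub> \<Gamma>)"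

definition quot_proj :: "(real^2^2) set set \<Rightarrow> (real^2^2) set \<Rightarrow> (real^2^2) set set" where
  "quot_proj \<Gamma> g = \<Gamma> #>\<^bsub>PSL2\<^esub> g"

definition haar :: "(real^2^2) set measure" where
  "haar = distr
     (restrict_space (density lborel (\<lambda>(x, y, t). ennreal (1 / (pi * y\<^sup>2))))
        (UNIV \<times> {0<..} \<times> {0..<pi}))
     (sigma (carrier PSL2) {U. openin PSL2_top U})
     (\<lambda>(x, y, t). nak x y t)"

text \<open>The measure which \<open>haar\<close> induces on \<open>\<Gamma>\G\<close>: a Borel set meeting every \<open>\<Gamma>\<close>-orbit
  at most once has the same measure as its image.  The supremum below is attained at
  \<open>B = F \<inter> \<Union>U\<close> for every Borel set \<open>F\<close> of representatives of the orbits.\<close>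

definition quot_haar :: "(real^2^2) set set \<Rightarrow> (real^2^2) set set measure" where
  "quot_haar \<Gamma> = measure_of (rcosets\<^bsub>PSL2\<^esub> \<Gamma>) {U. openin (quot_top \<Gamma>) U}
     (\<lambda>U. SUP B \<in> {B \<in> sets haar. B \<subseteq> \<Union>U \<and> inj_on (quot_proj \<Gamma>) B}. emeasure haar B)"


section \<open>Functions on \<open>\<Gamma>\G\<close>\<close>

text \<open>Functions on \<open>\<Gamma>\G\<close> are written as left \<open>\<Gamma>\<close>-invariant functions on \<open>G\<close>.\<close>

definition left_invariant :: "(real^2^2) set set \<Rightarrow> ((real^2^2) set \<Rightarrow> 'b) \<Rightarrow> bool" where
  "left_invariant \<Gamma> f \<longleftrightarrow> (\<forall>\<gamma>\<in>\<Gamma>. \<forall>g\<in>carrier PSL2. f (\<gamma> \<otimes>\<^bsub>PSL2\<^esub> g) = f g)"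

definition descend :: "('a \<Rightarrow> 'b) \<Rightarrow> 'a set \<Rightarrow> 'b" where
  "descend f C = the_elem (f ` C)"

definition in_L2 ::
    "(real^2^2) set set \<Rightarrow> ((real^2^2) set \<Rightarrow> 'b::real_normed_vector) \<Rightarrow> bool" where
  "in_L2 \<Gamma> f \<longleftrightarrow> left_invariant \<Gamma> f \<and> descend f \<in> borel_measurable (quot_haar \<Gamma>) \<and>
     integrable (quot_haar \<Gamma>) (\<lambda>C. (norm (descend f C))\<^sup>2)"

definition L2_norm ::
    "(real^2^2) set set \<Rightarrow> ((real^2^2) set \<Rightarrow> 'b::real_normed_vector) \<Rightarrow> real" where
  "L2_norm \<Gamma> f = sqrt (LINT C|quot_haar \<Gamma>. (norm (descend f C))\<^sup>2)"

text \<open>\<open>C\<^sup>k\<close> functions on an open set.\<close>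

primrec Ck_on ::
    "nat \<Rightarrow> 'a::euclidean_space set \<Rightarrow> ('a \<Rightarrow> 'b::real_normed_vector) \<Rightarrow> bool" where
  "Ck_on 0 S f \<longleftrightarrow> continuous_on S f"
| "Ck_on (Suc k) S f \<longleftrightarrow> f differentiable_on S \<and>
     (\<forall>e\<in>Basis. Ck_on k S (\<lambda>p. frechet_derivative f (at p) e))"

definition smooth_on_G :: "((real^2^2) set \<Rightarrow> 'b::real_normed_vector) \<Rightarrow> bool" where
  "smooth_on_G f \<longleftrightarrow>
     (\<forall>k. Ck_on k (UNIV \<times> {0<..} \<times> UNIV) (\<lambda>(x, y, t). f (nak x y t)))"


section \<open>Discrete subgroups\<close>

definition discrete_in_PSL2 :: "(real^2^2) set set \<Rightarrow> bool" where
  "discrete_in_PSL2 \<Gamma> \<longleftrightarrow> subtopology PSL2_top \<Gamma> = discrete_topology \<Gamma>"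

definition torsion_free :: "('a, 'b) monoid_scheme \<Rightarrow> bool" where
  "torsion_free G \<longleftrightarrow>
     (\<forall>g\<in>carrier G. \<forall>n::nat. n > 0 \<longrightarrow> g [^]\<^bsub>G\<^esub> n = \<one>\<^bsub>G\<^esub> \<longrightarrow> g = \<one>\<^bsub>G\<^esub>)"

definition finitely_generated :: "('a, 'b) monoid_scheme \<Rightarrow> bool" where
  "finitely_generated G \<longleftrightarrow>
     (\<exists>S. finite S \<and> S \<subseteq> carrier G \<and> generate G S = carrier G)"

definition virtually_cyclic :: "('a, 'b) monoid_scheme \<Rightarrow> bool" where
  "virtually_cyclic G \<longleftrightarrow> (\<exists>g\<in>carrier G. finite (rcosets\<^bsub>G\<^esub> (generate G {g})))"

definition moebius :: "real^2^2 \<Rightarrow> complex \<Rightarrow> complex" where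
  "moebius A z = (of_real (A$1$1) * z + of_real (A$1$2)) / (of_real (A$2$1) * z + of_real (A$2$2))"

definition act :: "(real^2^2) set \<Rightarrow> complex \<Rightarrow> complex" where
  "act g z = the_elem ((\<lambda>A. moebius A z) ` g)"

text \<open>Hyperbolic distance in the upper half plane.\<close>

definition hdist :: "complex \<Rightarrow> complex \<Rightarrow> real" where
  "hdist z w = arcosh (1 + (cmod (z - w))\<^sup>2 / (2 * Im z * Im w))"

text \<open>The abscissa of convergence of the Poincare series.\<close>

definition critical_exponent :: "(real^2^2) set set \<Rightarrow> real" where
  "critical_exponent \<Gamma> =
     Inf {s. 0 \<le> s \<and> (\<lambda>\<gamma>. exp (- s * hdist \<i> (act \<gamma> \<i>))) summable_on \<Gamma>}"


section \<open>The base eigenfunction and the ladder of weight vectors\<close>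

text \<open>\<open>x + i y\<close> in the upper half plane corresponds to the coset \<open>n\<^sub>x a\<^sub>y K\<close>.
  An \<open>L\<^sup>2\<close> eigenfunction is smooth by elliptic regularity; \<open>\<phi>\<close> is its smooth
  representative, to which \<open>raising\<close> and \<open>lowering\<close> can be applied repeatedly.\<close>

definition base_eigenfunction ::
    "(real^2^2) set set \<Rightarrow> real \<Rightarrow> ((real^2^2) set \<Rightarrow> real) \<Rightarrow> bool" where
  "base_eigenfunction \<Gamma> \<delta> \<phi> \<longleftrightarrow>
     in_L2 \<Gamma> \<phi> \<and> L2_norm \<Gamma> \<phi> = 1 \<and>
     (\<forall>g\<in>carrier PSL2. \<forall>k\<in>K_group. \<phi> (g \<otimes>\<^bsub>PSL2\<^esub> k) = \<phi> g) \<and>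
     (\<forall>g\<in>carrier PSL2. \<phi> g > 0) \<and>
     smooth_on_G \<phi> \<and>
     (\<forall>x y. y > 0 \<longrightarrow>
        - (y\<^sup>2 * ((deriv ^^ 2) (\<lambda>u. \<phi> (n_elt u \<otimes>\<^bsub>PSL2\<^esub> a_elt y)) x
               + (deriv ^^ 2) (\<lambda>v. \<phi> (n_elt x \<otimes>\<^bsub>PSL2\<^esub> a_elt v)) y))
        = \<delta> * (1 - \<delta>) * \<phi> (n_elt x \<otimes>\<^bsub>PSL2\<^esub> a_elt y))"

definition raising :: "((real^2^2) set \<Rightarrow> complex) \<Rightarrow> (real^2^2) set \<Rightarrow> complex" where
  "raising f g = (case nak_coords g of (x, y, t) \<Rightarrow>
     exp (2 * \<i> * of_real t) *
       (\<i> * of_real y * vector_derivative (\<lambda>u. f (nak u y t)) (at x)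
        + of_real y * vector_derivative (\<lambda>v. f (nak x v t)) (at y)
        + 1 / (2 * \<i>) * vector_derivative (\<lambda>s. f (nak x y s)) (at t)))"

definition lowering :: "((real^2^2) set \<Rightarrow> complex) \<Rightarrow> (real^2^2) set \<Rightarrow> complex" where
  "lowering f g = (case nak_coords g of (x, y, t) \<Rightarrow>
     exp (- 2 * \<i> * of_real t) *
       (- \<i> * of_real y * vector_derivative (\<lambda>u. f (nak u y t)) (at x)
        + of_real y * vector_derivative (\<lambda>v. f (nak x v t)) (at y)
        - 1 / (2 * \<i>) * vector_derivative (\<lambda>s. f (nak x y s)) (at t)))"

definition L2_normalize ::
    "(real^2^2) set set \<Rightarrow> ((real^2^2) set \<Rightarrow> complex) \<Rightarrow> (real^2^2) set \<Rightarrow> complex" where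
  "L2_normalize \<Gamma> f = (\<lambda>g. f g / of_real (L2_norm \<Gamma> f))"

definition phi_plus ::
    "(real^2^2) set set \<Rightarrow> ((real^2^2) set \<Rightarrow> real) \<Rightarrow> nat \<Rightarrow> (real^2^2) set \<Rightarrow> complex" where
  "phi_plus \<Gamma> \<phi>0 l = L2_normalize \<Gamma> ((raising ^^ l) (\<lambda>g. complex_of_real (\<phi>0 g)))"

definition phi_minus ::
    "(real^2^2) set set \<Rightarrow> ((real^2^2) set \<Rightarrow> real) \<Rightarrow> nat \<Rightarrow> (real^2^2) set \<Rightarrow> complex" where
  "phi_minus \<Gamma> \<phi>0 l = L2_normalize \<Gamma> ((lowering ^^ l) (\<lambda>g. complex_of_real (\<phi>0 g)))"


section \<open>Integrals over horocycles\<close>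

definition N_domain :: "(real^2^2) set set \<Rightarrow> real set" where
  "N_domain \<Gamma> =
     (if N_group \<inter> \<Gamma> = {\<one>\<^bsub>PSL2\<^esub>} then UNIV
      else let x0 = (LEAST x. 0 < x \<and> n_elt x \<in> \<Gamma>) / 2 in {- x0..<x0})"

definition horocycle_integral ::
    "(real^2^2) set set \<Rightarrow> ((real^2^2) set \<Rightarrow> 'b::{banach, second_countable_topology}) \<Rightarrow>
     real \<Rightarrow> 'b" where
  "horocycle_integral \<Gamma> f y =
     (LINT x:N_domain \<Gamma>|lborel. f (n_elt x \<otimes>\<^bsub>PSL2\<^esub> a_elt y))"


section \<open>Well-definedness\<close>

lemma openin_partition_topology:
  assumes "disjoint P"
  shows "openin (partition_topology X P) U \<longleftrightarrow> U \<subseteq> P \<and> openin X (\<Union>U)"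
proof -
  have "istopology (\<lambda>U. U \<subseteq> P \<and> openin X (\<Union>U))"
    unfolding istopology_def
  proof (intro conjI allI impI)
    fix S T assume S: "S \<subseteq> P \<and> openin X (\<Union>S)" and T: "T \<subseteq> P \<and> openin X (\<Union>T)"
    have "\<Union>(S \<inter> T) = \<Union>S \<inter> \<Union>T"
    proof (intro equalityI subsetI)
      fix x assume "x \<in> \<Union>S \<inter> \<Union>T"
      then obtain A B where AB: "A \<in> S" "B \<in> T" "x \<in> A" "x \<in> B" by blast
      moreover from AB have "A \<in> P" "B \<in> P" using S T by auto
      ultimately have "A = B" using assms by (auto simp: disjoint_def)
      then show "x \<in> \<Union>(S \<inter> T)" using AB by blast
    qed blast
    then show "openin X (\<Union>(S \<inter> T))" using S T by auto
    show "S \<inter> T \<subseteq> P" using S by auto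
  next
    fix \<K> assume K: "\<forall>S\<in>\<K>. S \<subseteq> P \<and> openin X (\<Union>S)"
    then show "\<Union>\<K> \<subseteq> P" by auto
    have "\<Union>(\<Union>\<K>) = \<Union>(Union ` \<K>)" by auto
    then show "openin X (\<Union>(\<Union>\<K>))" using K by auto
  qed
  then show ?thesis by (simp add: partition_topology_def)
qed

lemma group_SL2: "group SL2"
proof (rule groupI)
  fix A assume A: "A \<in> carrier SL2"
  then have "invertible A" by (simp add: SL2_def invertible_det_nz)
  then obtain B where B: "A ** B = mat 1" "B ** A = mat 1" by (auto simp: invertible_def)
  then have "det B = 1" using A det_mul[of B A] by (simp add: SL2_def)
  then show "\<exists>B\<in>carrier SL2. B \<otimes>\<^bsub>SL2\<^esub> A = \<one>\<^bsub>SL2\<^esub>"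
    using B by (auto simp: SL2_def)
qed (auto simp: SL2_def det_mul matrix_mul_assoc)

lemma det_uminus_2: "det (- A) = det (A :: real^2^2)"
  by (simp add: det_2)

lemma uminus_mat_1_mult: "- mat 1 ** A = - (A :: real^2^2)" "A ** - mat 1 = - A"
  by (simp_all add: vec_eq_iff matrix_matrix_mult_def mat_def sum_2 forall_2)

lemma centre_normal: "{mat 1, - mat 1} \<lhd> SL2"
proof -
  interpret group SL2 by (rule group_SL2)
  have "subgroup {mat 1, - mat 1} SL2"
  proof (rule subgroupI)
    fix A assume "A \<in> {mat 1, - mat 1 :: real^2^2}"
    then have "A \<otimes>\<^bsub>SL2\<^esub> A = \<one>\<^bsub>SL2\<^esub>" "A \<in> carrier SL2"
      by (auto simp: SL2_def uminus_mat_1_mult det_uminus_2)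
    then have "inv\<^bsub>SL2\<^esub> A = A" by (simp add: inv_equality)
    then show "inv\<^bsub>SL2\<^esub> A \<in> {mat 1, - mat 1}" using \<open>A \<in> {mat 1, - mat 1}\<close> by simp
  qed (auto simp: SL2_def uminus_mat_1_mult det_uminus_2)
  then show ?thesis
    by (rule normalI) (auto simp: r_coset_def l_coset_def SL2_def uminus_mat_1_mult)
qed

lemma group_PSL2: "group PSL2"
  unfolding PSL2_def by (rule normal.factorgroup_is_group[OF centre_normal])

lemma psl_eq: "psl A = {A, - A}"
  by (auto simp: psl_def r_coset_def SL2_def uminus_mat_1_mult)

lemma carrier_PSL2: "carrier PSL2 = psl ` {A. det A = 1}"
  by (auto simp: PSL2_def FactGroup_def RCOSETS_def psl_def SL2_def)

lemma openin_PSL2_top: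
  "openin PSL2_top U \<longleftrightarrow> U \<subseteq> carrier PSL2 \<and> openin (top_of_set (carrier SL2)) (\<Union>U)"
proof -
  have "disjoint (carrier PSL2)"
    by (auto simp: disjoint_def carrier_PSL2 psl_eq)
  then show ?thesis by (simp add: PSL2_top_def openin_partition_topology)
qed

lemma openin_quot_top:
  assumes "subgroup \<Gamma> PSL2"
  shows "openin (quot_top \<Gamma>) U \<longleftrightarrow> U \<subseteq> rcosets\<^bsub>PSL2\<^esub> \<Gamma> \<and> openin PSL2_top (\<Union>U)"
proof -
  have "disjoint (rcosets\<^bsub>PSL2\<^esub> \<Gamma>)"
    using group.rcos_disjoint[OF group_PSL2 assms] by (simp add: disjoint_def pairwise_def disjnt_def)
  then show ?thesis by (simp add: quot_top_def openin_partition_topology)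
qed

end

theory Submission
  imports Defs
begin

text \<open>Put \<open>u(x, y) = \<phi>0(n\<^sub>x a\<^sub>y)\<close>, \<open>\<lambda> = \<delta>(1 - \<delta>)\<close> and \<open>c\<^sub>j = (\<delta> + j)(1 - \<delta> + j)\<close>.  On \<open>n\<^sub>x a\<^sub>y k\<^sub>\<theta>\<close> the function
  \<open>R\<^sup>l \<phi>0\<close> is \<open>e\<^bsup>2il\<theta>\<^esup> f\<^sub>l(x, y)\<close>, where \<open>f\<^sub>0 = u\<close> and \<open>f\<^sub>l\<^sub>+\<^sub>1 = (i y \<partial>\<^sub>x + y \<partial>\<^sub>y + l) f\<^sub>l\<close>, and \<open>L\<^sup>l \<phi>0\<close> is
  its complex conjugate (\<open>raising_power_phi\<close>, \<open>lowering_power_phi\<close>).  The theorem is the quotient of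
  two computations, the horocycle integral of \<open>f\<^sub>l\<close> and the norm of \<open>R\<^sup>l \<phi>0\<close>:
  \<open>\<integral> f\<^sub>l dx = (1 - \<delta>)\<^sub>l c0 y\<^bsup>1-\<delta>\<^esup>\<close> and \<open>\<parallel>R\<^sup>l \<phi>0\<parallel>\<^sup>2 = (\<delta>)\<^sub>l (1 - \<delta>)\<^sub>l\<close>, with rising factorials \<open>(a)\<^sub>l\<close>.
  The quotient is \<open>c0 ((1 - \<delta>)\<^sub>l / (\<delta>)\<^sub>l)\<^bsup>1/2\<^esup> y\<^bsup>1-\<delta>\<^esup>\<close>; it is at most \<open>c0 y\<^bsup>1-\<delta>\<^esup>\<close> because \<open>1 - \<delta> < \<delta>\<close>.

  The horocycle integral.  The equation \<open>y\<^sup>2 (u\<^sub>x\<^sub>x + u\<^sub>y\<^sub>y) = - \<lambda> u\<close> allows every \<open>f\<^sub>l\<close> to be written as a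
  combination, with constant coefficients, of \<open>y\<^sup>k \<partial>\<^sub>x\<^sup>k u\<close> and \<open>y\<^bsup>k+1\<^esup> \<partial>\<^sub>x\<^sup>k \<partial>\<^sub>y u\<close>.  For \<open>k > 0\<close> these are
  \<open>x\<close>-derivatives and integrate to zero; for \<open>k = 0\<close> they give \<open>I(y) = c0 y\<^bsup>1-\<delta>\<^esup>\<close> and \<open>y I'(y) = (1 - \<delta>) I(y)\<close>.
  A linear recursion for the two coefficients with \<open>k = 0\<close> yields the factor \<open>(1 - \<delta>)\<^sub>l\<close> (\<open>ladder_coeff_0\<close>).
  If the horocycle is closed this is all.  If it is a line, the derivatives have to be shown
  integrable.  What is given is that the positive function \<open>u(_, y)\<close> is integrable for each \<open>y\<close>.
  A parametrix for the Laplacian bounds an eigenfunction at a point by its \<open>L\<^sup>1\<close> mean over a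
  hyperbolic neighbourhood (\<open>sup_estimate\<close>), an energy inequality then bounds its gradient by its
  supremum over such a neighbourhood (\<open>gradient_bound\<close>), and iteration bounds all derivatives of \<open>u\<close>
  by the integral of \<open>u\<close> itself over a larger neighbourhood (\<open>p_bound\<close>, \<open>q_bound\<close>), because \<open>u > 0\<close>.
  By Fubini that integral is integrable along the horocycle (\<open>mass_integrable_line\<close>).

  The norm.  The functions \<open>s\<^sub>l = |f\<^sub>l|\<^sup>2\<close> are \<open>\<Gamma>\<close>-invariant (\<open>fl_equivariant\<close>) and satisfy
  \<open>y\<^sup>2 \<Delta> s\<^sub>l = s\<^sub>l\<^sub>+\<^sub>1 + c\<^sub>l\<^sub>-\<^sub>1\<^sup>2 s\<^sub>l\<^sub>-\<^sub>1 - (c\<^sub>l\<^sub>-\<^sub>1 + c\<^sub>l) s\<^sub>l\<close> (\<open>sl_laplacian\<close>; for \<open>l = 0\<close> it is \<open>2 s\<^sub>1 - 2 \<lambda> s\<^sub>0\<close>).  If the left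
  side integrates to zero over \<open>\<Gamma>\H\<close>, induction gives \<open>\<integral> s\<^sub>l\<^sub>+\<^sub>1 = c\<^sub>l \<integral> s\<^sub>l\<close>.  That it does,
  \<open>area_integral_laplacian\<close>, is seen by averaging: for a compactly supported point-pair kernel \<open>k\<close>,
  Green's formula moves the Laplacian from \<open>s\<close> to \<open>k\<close>, and integrating over the base point of the
  kernel turns both sides into multiples of integrals over \<open>\<Gamma>\H\<close>, where the multiple for the
  Laplacian of \<open>k\<close> is \<open>0\<close>.  All terms are kept nonnegative, so the
  integrals over \<open>\<Gamma>\H\<close> can be taken with values in \<open>[0, \<infinity>]\<close>.

  To read the norm of \<open>L\<^sup>2(\<Gamma>\G)\<close> as such an integral, a Borel set of representatives of the
  \<open>\<Gamma>\<close>-orbits in the group is constructed (\<open>fundamental_set\<close>), and the quotient measure is identified with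
  Haar measure on this set (\<open>quot_haar_eq\<close>); this uses the left invariance of Haar measure, which is
  derived from its formula in the coordinates \<open>x, y, \<theta>\<close> (\<open>haar_left_invariant\<close>).\<close>


section \<open>Coordinates on the group\<close>

lemma mat2_nth [simp]:
  "mat2 a b c d $ 1 $ 1 = a" "mat2 a b c d $ 1 $ 2 = b"
  "mat2 a b c d $ 2 $ 1 = c" "mat2 a b c d $ 2 $ 2 = d"
  by (simp_all add: mat2_def)

lemma mat2_eqI:
  fixes A B :: "real^2^2"
  assumes "A$1$1 = B$1$1" "A$1$2 = B$1$2" "A$2$1 = B$2$1" "A$2$2 = B$2$2"
  shows "A = B"
  using assms by (simp add: vec_eq_iff forall_2)

lemma mat2_nth_mult [simp]:
  fixes A B :: "real^2^2"
  shows "(A ** B) $ 1 $ 1 = A$1$1 * B$1$1 + A$1$2 * B$2$1"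
        "(A ** B) $ 1 $ 2 = A$1$1 * B$1$2 + A$1$2 * B$2$2"
        "(A ** B) $ 2 $ 1 = A$2$1 * B$1$1 + A$2$2 * B$2$1"
        "(A ** B) $ 2 $ 2 = A$2$1 * B$1$2 + A$2$2 * B$2$2"
  by (simp_all add: matrix_matrix_mult_def sum_2)

lemma psl_mult:
  assumes "det A = 1" "det B = 1"
  shows "psl A \<otimes>\<^bsub>PSL2\<^esub> psl B = psl (A ** B)"
  using normal.rcos_sum[OF centre_normal, of A B] assms
  by (simp add: psl_def PSL2_def FactGroup_def SL2_def)

lemma psl_in_carrier: "det A = 1 \<Longrightarrow> psl A \<in> carrier PSL2"
  by (auto simp: carrier_PSL2)

lemma psl_cases:
  assumes "g \<in> carrier PSL2"
  obtains A where "det A = 1" "g = psl A"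
  using assms by (auto simp: carrier_PSL2)

lemma psl_eq_iff: "psl A = psl B \<longleftrightarrow> A = B \<or> A = - B"
  by (auto simp: psl_eq doubleton_eq_iff)

lemma one_PSL2: "\<one>\<^bsub>PSL2\<^esub> = psl (mat 1)"
  by (auto simp: PSL2_def FactGroup_def psl_eq)

definition nak_mat :: "real \<Rightarrow> real \<Rightarrow> real \<Rightarrow> real^2^2" where
  "nak_mat x y t = mat2 1 x 0 1 ** mat2 (sqrt y) 0 0 (1 / sqrt y) ** mat2 (cos t) (sin t) (- sin t) (cos t)"

lemma det_mat2: "det (mat2 a b c d) = a * d - b * c"
  by (simp add: det_2)

lemma det_nak_factors:
  "det (mat2 1 x 0 1) = 1" "y > 0 \<Longrightarrow> det (mat2 (sqrt y) 0 0 (1 / sqrt y)) = 1"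
  "det (mat2 (cos t) (sin t) (- sin t) (cos t)) = 1"
  by (simp_all add: det_mat2 flip: power2_eq_square)

lemma det_nak_mat: "y > 0 \<Longrightarrow> det (nak_mat x y t) = 1"
  by (simp add: nak_mat_def det_mul det_nak_factors)

lemma nak_eq: "y > 0 \<Longrightarrow> nak x y t = psl (nak_mat x y t)"
  by (simp add: nak_def n_elt_def a_elt_def k_elt_def psl_mult det_nak_factors det_mul nak_mat_def)

lemma nak_in_carrier: "y > 0 \<Longrightarrow> nak x y t \<in> carrier PSL2"
  by (simp add: nak_eq psl_in_carrier det_nak_mat)

lemma na_eq_nak: "y > 0 \<Longrightarrow> n_elt x \<otimes>\<^bsub>PSL2\<^esub> a_elt y = nak x y 0"
  by (simp add: nak_eq n_elt_def a_elt_def psl_mult det_nak_factors nak_mat_def)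
     (rule arg_cong[where f = psl], rule mat2_eqI, simp_all)

text \<open>The value of \<open>A\<close> at \<open>\<i>\<close> is \<open>num A / den A\<close>, and \<open>den A = e\<^bsup>-i\<theta>\<^esup> / \<surd>y\<close> for \<open>A = n\<^sub>x a\<^sub>y k\<^sub>\<theta>\<close>.  Hence \<open>matpt\<close>
  and \<open>matang\<close> below record \<open>x + i y\<close> and \<open>e\<^bsup>2i\<theta>\<^esup>\<close>.  Both are even in \<open>A\<close>, so they descend to the group
  and give coordinates that do not depend on a choice of \<open>\<theta>\<close> modulo \<open>\<pi>\<close>.\<close>

definition den :: "real^2^2 \<Rightarrow> complex" where "den A = Complex (A$2$2) (A$2$1)"
definition num :: "real^2^2 \<Rightarrow> complex" where "num A = Complex (A$1$2) (A$1$1)"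

lemma den_nonzero: "det A = 1 \<Longrightarrow> den A \<noteq> 0"
  by (auto simp: den_def det_2 complex_eq_iff)

lemma cmod_den: "(cmod (den A))\<^sup>2 = (A$2$1)\<^sup>2 + (A$2$2)\<^sup>2"
  by (simp add: den_def cmod_power2)

definition matpt :: "real^2^2 \<Rightarrow> complex" where "matpt A = num A / den A"

definition matang :: "real^2^2 \<Rightarrow> complex" where "matang A = cnj (den A) / den A"

lemma cmod_matang: "det A = 1 \<Longrightarrow> cmod (matang A) = 1"
  using den_nonzero[of A] by (simp add: matang_def norm_divide)

lemma Im_matpt: "det A = 1 \<Longrightarrow> Im (matpt A) = 1 / ((A$2$1)\<^sup>2 + (A$2$2)\<^sup>2)"
  by (simp add: matpt_def num_def den_def Im_divide det_2 algebra_simps power2_eq_square)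

lemma Im_matpt_pos: "det A = 1 \<Longrightarrow> Im (matpt A) > 0"
  using den_nonzero[of A] cmod_den[of A]
  by (simp add: Im_matpt) (metis zero_less_norm_iff zero_less_power)

text \<open>The automorphy factor \<open>c z + d\<close>, through which left multiplication changes the angle.\<close>

definition mden :: "real^2^2 \<Rightarrow> complex \<Rightarrow> complex" where
  "mden A z = of_real (A$2$1) * z + of_real (A$2$2)"

lemma mden_nonzero: "det A = 1 \<Longrightarrow> Im z > 0 \<Longrightarrow> mden A z \<noteq> 0"
  by (auto simp: mden_def det_2 complex_eq_iff)

lemma den_mult: "det B = 1 \<Longrightarrow> den (A ** B) = mden A (matpt B) * den B"
  using den_nonzero[of B] unfolding matpt_def
  by (simp add: mden_def field_simps) (simp add: den_def num_def complex_eq_iff algebra_simps)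

lemma num_mult: "det B = 1 \<Longrightarrow> num (A ** B) = (of_real (A$1$1) * matpt B + of_real (A$1$2)) * den B"
  using den_nonzero[of B] unfolding matpt_def
  by (simp add: mden_def field_simps) (simp add: den_def num_def complex_eq_iff algebra_simps)

lemma matpt_mult:
  assumes "det B = 1" shows "matpt (A ** B) = moebius A (matpt B)"
  using den_nonzero[OF assms]
  by (simp add: matpt_def[of "A ** B"] num_mult den_mult assms moebius_def mden_def)

lemma matang_mult:
  assumes "det B = 1" shows "matang (A ** B) = cnj (mden A (matpt B)) / mden A (matpt B) * matang B"
  using den_nonzero[OF assms] by (simp add: matang_def den_mult assms)

lemma matpt_nak_mat: "y > 0 \<Longrightarrow> matpt (nak_mat x y t) = Complex x y"
proof -
  assume y: "y > 0"
  have "den (nak_mat x y t) = cis (- t) / sqrt y"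
       "num (nak_mat x y t) = cis (-t) * (Complex x y) / sqrt y"
    using y by (simp_all add: den_def num_def nak_mat_def complex_eq_iff field_simps)
  then show ?thesis using y by (simp add: matpt_def)
qed

lemma matang_nak_mat: "y > 0 \<Longrightarrow> matang (nak_mat x y t) = cis (2 * t)"
proof -
  assume y: "y > 0"
  have "den (nak_mat x y t) = cis (- t) / sqrt y"
    using y by (simp_all add: den_def nak_mat_def complex_eq_iff field_simps)
  then show ?thesis using y by (simp add: matang_def cis_cnj cis_divide)
qed

lemma num_uminus: "num (- A) = - num A" and den_uminus: "den (- A) = - den A"
  by (simp_all add: num_def den_def complex_eq_iff)

lemma matpt_uminus [simp]: "matpt (- A) = matpt A"
  by (simp add: matpt_def num_uminus den_uminus)

lemma matang_uminus [simp]: "matang (- A) = matang A"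
  by (simp add: matang_def den_uminus)

text \<open>\<open>Im (matpt A)\<close> fixes the modulus of \<open>den A\<close>, the angle then fixes its square, and \<open>num A\<close> is
  the product of \<open>matpt A\<close> and \<open>den A\<close>; the sign that remains is the one divided out in the group.\<close>

lemma psl_eqI:
  assumes "det A = 1" "det B = 1" "matpt A = matpt B" "matang A = matang B"
  shows "psl A = psl B"
proof -
  have nz: "den A \<noteq> 0" "den B \<noteq> 0" using assms den_nonzero by auto
  have "Im (matpt A) = Im (matpt B)" using assms by simp
  then have "(cmod (den A))\<^sup>2 = (cmod (den B))\<^sup>2"
    unfolding Im_matpt[OF assms(1)] Im_matpt[OF assms(2)] cmod_den by (metis inverse_eq_divide inverse_inverse_eq)
  then have n: "cmod (den A) = cmod (den B)" by simp
  have "cnj z / z = of_real ((cmod z)\<^sup>2) / z\<^sup>2" if "z \<noteq> 0" for z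
    unfolding complex_norm_square using that by (simp add: power2_eq_square)
  from this[OF nz(1)] this[OF nz(2)]
  have "(den A)\<^sup>2 = (den B)\<^sup>2" using assms(4) n nz by (simp add: matang_def)
  then have d: "den A = den B \<or> den A = - den B" by (simp add: power2_eq_iff)
  have "num A = matpt A * den A" "num B = matpt B * den B" using nz by (simp_all add: matpt_def)
  with d assms(3) have "(den A = den B \<and> num A = num B) \<or> (den A = - den B \<and> num A = - num B)" by auto
  then have "A = B \<or> A = - B"
  proof (elim disjE conjE)
    assume "den A = den B" "num A = num B"
    then show ?thesis by (intro disjI1 mat2_eqI) (simp_all add: den_def num_def)
  next
    assume "den A = - den B" "num A = - num B"
    then show ?thesis by (intro disjI2 mat2_eqI) (simp_all add: den_def num_def complex_eq_iff)
  qed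
  then show ?thesis by (simp add: psl_eq_iff)
qed

text \<open>The point \<open>g \<i>\<close> of the upper half plane and the angle \<open>e\<^bsup>2i\<theta>\<^esup>\<close> of \<open>g\<close>.\<close>

definition hpt :: "(real^2^2) set \<Rightarrow> complex" where "hpt g = the_elem (matpt ` g)"
definition hang :: "(real^2^2) set \<Rightarrow> complex" where "hang g = the_elem (matang ` g)"

lemma hpt_psl [simp]: "hpt (psl A) = matpt A" by (simp add: hpt_def psl_eq)
lemma hang_psl [simp]: "hang (psl A) = matang A" by (simp add: hang_def psl_eq)

lemma hpt_nak: "y > 0 \<Longrightarrow> hpt (nak x y t) = Complex x y"
  by (simp add: nak_eq matpt_nak_mat)
lemma hang_nak: "y > 0 \<Longrightarrow> hang (nak x y t) = cis (2 * t)"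
  by (simp add: nak_eq matang_nak_mat)

lemma PSL2_eqI:
  assumes "g \<in> carrier PSL2" "h \<in> carrier PSL2" "hpt g = hpt h" "hang g = hang h"
  shows "g = h"
proof -
  obtain A B where "det A = 1" "g = psl A" "det B = 1" "h = psl B"
    using assms(1,2) by (meson psl_cases)
  then show ?thesis using assms(3,4) psl_eqI[of A B] by simp
qed

lemma Im_hpt_pos: "g \<in> carrier PSL2 \<Longrightarrow> Im (hpt g) > 0"
  by (auto elim!: psl_cases simp: Im_matpt_pos)

lemma cmod_hang: "g \<in> carrier PSL2 \<Longrightarrow> cmod (hang g) = 1"
  by (auto elim!: psl_cases simp: cmod_matang)

lemma nak_exists:
  assumes "g \<in> carrier PSL2"
  shows "\<exists>t. g = nak (Re (hpt g)) (Im (hpt g)) t"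
proof -
  obtain s where s: "hang g = cis s"
    using cmod_hang[OF assms] complex_unimodular_polar by (metis cis.ctr)
  show ?thesis
    using Im_hpt_pos[OF assms] s
    by (intro exI[of _ "s/2"] PSL2_eqI assms) (simp_all add: nak_in_carrier hpt_nak hang_nak)
qed

lemma nak_add_int_pi: "y > 0 \<Longrightarrow> nak x y (t + of_int n * pi) = nak x y t"
proof -
  assume "y > 0"
  have "cis (2 * (t + of_int n * pi)) = cis (2 * t)"
    using cis_multiple_2pi[of "of_int n"] cis_mult[of "2 * t" "2 * pi * of_int n"]
    by (simp add: distrib_left mult_ac)
  with \<open>y > 0\<close> show ?thesis
    by (intro PSL2_eqI) (auto simp: nak_in_carrier hpt_nak hang_nak)
qed

lemma ex_shift_pi: "\<exists>n::int. t + of_int n * pi \<in> {0..<pi}"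
proof -
  have 1: "of_int \<lfloor>t/pi\<rfloor> * pi \<le> t" using of_int_floor_le[of "t/pi"] pi_gt_zero
    by (simp only: pos_le_divide_eq)
  have "t / pi < of_int \<lfloor>t/pi\<rfloor> + 1" by linarith
  then have 2: "t < of_int \<lfloor>t/pi\<rfloor> * pi + pi" by (simp add: field_simps)
  show ?thesis using 1 2 by (intro exI[of _ "- \<lfloor>t/pi\<rfloor>"]) simp
qed

lemma cis_2_inj:
  assumes "cis (2 * s) = cis (2 * t)" "s \<in> {0..<pi}" "t \<in> {0..<pi}"
  shows "s = t"
proof -
  have "2 * s \<in> {0..<2*pi}" "2 * t \<in> {0..<2*pi}" using assms by auto
  then show ?thesis using assms(1)
    by (metis Arg2pi_unique atLeastLessThan_iff cis_conv_exp mult.commute mult_cancel_left mult_1 of_real_1 zero_less_one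
          zero_neq_numeral)
qed

lemma nak_inj_on: "inj_on (\<lambda>(x, y, t). nak x y t) (UNIV \<times> {0<..} \<times> {0..<pi})"
proof (rule inj_onI, clarsimp)
  fix x y t x' y' t' :: real
  assume a: "0 < y" "0 < y'" "0 \<le> t" "t < pi" "0 \<le> t'" "t' < pi" "nak x y t = nak x' y' t'"
  have "Complex x y = Complex x' y'" "cis (2*t) = cis (2*t')"
    using a hpt_nak hang_nak by metis+
  with a cis_2_inj[of t t'] show "x = x' \<and> y = y' \<and> t = t'" by simp
qed

lemma nak_coords_nak:
  assumes "y > 0" "t \<in> {0..<pi}" shows "nak_coords (nak x y t) = (x, y, t)"
proof -
  have "(\<lambda>(x, y, t). nak x y t) (x, y, t) = nak x y t" by simp
  then show ?thesis unfolding nak_coords_def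
    by (intro the_inv_into_f_eq nak_inj_on) (use assms in auto)
qed
lemma hpt_mult: "\<lbrakk>det A = 1; g \<in> carrier PSL2\<rbrakk> \<Longrightarrow> hpt (psl A \<otimes>\<^bsub>PSL2\<^esub> g) = moebius A (hpt g)"
  by (auto elim!: psl_cases simp: psl_mult matpt_mult)

lemma hang_mult: "\<lbrakk>det A = 1; g \<in> carrier PSL2\<rbrakk> \<Longrightarrow>
   hang (psl A \<otimes>\<^bsub>PSL2\<^esub> g) = cnj (mden A (hpt g)) / mden A (hpt g) * hang g"
  by (auto elim!: psl_cases simp: psl_mult matang_mult)


section \<open>Partial derivatives of smooth functions on the group\<close>

text \<open>Differentiating \<open>\<integral> fx ds\<close> over \<open>[x - 1, t]\<close> in \<open>y\<close> under the integral sign gives the difference of two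
  values of \<open>fy\<close>, so \<open>fxy\<close> and \<open>fyx\<close> have the same integral over \<open>[x - 1, t]\<close> for all \<open>t\<close> near \<open>x\<close>, and the claim follows
  by differentiating in \<open>t\<close>.\<close>

lemma mixed_partials_eq:
  fixes f fx fy fxy fyx :: "real \<Rightarrow> real \<Rightarrow> real"
  assumes fx: "\<And>x y. y > 0 \<Longrightarrow> ((\<lambda>x. f x y) has_real_derivative fx x y) (at x)"
    and fy: "\<And>x y. y > 0 \<Longrightarrow> ((\<lambda>y. f x y) has_real_derivative fy x y) (at y)"
    and fxy: "\<And>x y. y > 0 \<Longrightarrow> ((\<lambda>y. fx x y) has_real_derivative fxy x y) (at y)"
    and fyx: "\<And>x y. y > 0 \<Longrightarrow> ((\<lambda>x. fy x y) has_real_derivative fyx x y) (at x)"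
    and c1: "continuous_on (UNIV \<times> {0<..}) (\<lambda>(x, y). fxy x y)"
    and c2: "continuous_on (UNIV \<times> {0<..}) (\<lambda>(x, y). fyx x y)"
    and y: "y > 0"
  shows "fxy x y = fyx x y"
proof -
  have cx: "continuous_on S (\<lambda>s. g s y)" if "continuous_on (UNIV \<times> {0<..}) (\<lambda>(x, y). g x y)" "y > 0"
    for S y and g :: "real \<Rightarrow> real \<Rightarrow> real"
  proof -
    have "continuous_on S (\<lambda>s. (s, y))" by (intro continuous_intros)
    moreover have "(\<lambda>s. (s, y)) ` S \<subseteq> UNIV \<times> {0<..}" using that(2) by auto
    ultimately show ?thesis using continuous_on_compose2[OF that(1), of S "\<lambda>s. (s, y)"] by simp
  qed
  have ev: "integral {x-1..t} (\<lambda>s. fxy s y) = integral {x-1..t} (\<lambda>s. fyx s y)" if t: "t \<in> {x-1<..<x+1}" for t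
  proof -
    have I: "((\<lambda>s. fx s y') has_integral f t y' - f (x-1) y') {x-1..t}" if "y' > 0" for y'
      using t that fx
      by (intro fundamental_theorem_of_calculus)
         (auto simp flip: has_real_derivative_iff_has_vector_derivative intro: DERIV_subset)
    have L: "((\<lambda>y'. integral (cbox (x-1) t) (\<lambda>s. fx s y')) has_field_derivative
             integral (cbox (x-1) t) (\<lambda>s. fxy s y)) (at y within {y/2..2*y})"
    proof (rule leibniz_rule_field_derivative)
      fix y' s assume "y' \<in> {y/2..2*y}"
      then have "y' > 0" using y by auto
      from fxy[OF this] show "((\<lambda>y. fx s y) has_field_derivative fxy s y') (at y' within {y/2..2*y})"
        by (rule DERIV_subset) auto
    next
      fix y' assume "y' \<in> {y/2..2*y}"
      then have "y' > 0" using y by auto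
      from I[OF this] show "(\<lambda>s. fx s y') integrable_on cbox (x-1) t" by auto
    next
      show "continuous_on ({y/2..2*y} \<times> cbox (x-1) t) (\<lambda>(y, s). fxy s y)"
      proof -
        have "continuous_on ({y/2..2*y} \<times> cbox (x-1) t) (\<lambda>z. (snd z, fst z))" by (intro continuous_intros)
        moreover have "(\<lambda>z. (snd z, fst z)) ` ({y/2..2*y} \<times> cbox (x-1) t) \<subseteq> UNIV \<times> {0<..}" using y by auto
        ultimately show ?thesis
          using continuous_on_compose2[OF c1, of "{y/2..2*y} \<times> cbox (x-1) t" "\<lambda>z. (snd z, fst z)"]
          by (simp add: case_prod_unfold)
      qed
    qed (use y in auto)
    have "((\<lambda>y'. f t y' - f (x-1) y') has_real_derivative integral (cbox (x-1) t) (\<lambda>s. fxy s y)) (at y within {y/2..2*y})"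
      by (rule DERIV_cong[OF has_field_derivative_transform_within[OF L, of "y/2"]])
         (use y I in \<open>auto simp: dist_real_def intro!: integral_unique\<close>)
    then have "((\<lambda>y'. f t y' - f (x-1) y') has_real_derivative integral (cbox (x-1) t) (\<lambda>s. fxy s y)) (at y)"
      using y by (subst (asm) at_within_interior) (auto simp: interior_atLeastAtMost_real)
    moreover have "((\<lambda>y'. f t y' - f (x-1) y') has_real_derivative fy t y - fy (x-1) y) (at y)"
      using fy y by (auto intro!: derivative_intros)
    ultimately have "integral (cbox (x-1) t) (\<lambda>s. fxy s y) = fy t y - fy (x-1) y"
      by (rule DERIV_unique)
    also have "((\<lambda>s. fyx s y) has_integral fy t y - fy (x-1) y) {x-1..t}"
      using t y fyx
      by (intro fundamental_theorem_of_calculus)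
         (auto simp flip: has_real_derivative_iff_has_vector_derivative intro: DERIV_subset)
    then have "fy t y - fy (x-1) y = integral {x-1..t} (\<lambda>s. fyx s y)" by (simp add: integral_unique)
    finally show ?thesis by simp
  qed
  have D: "((\<lambda>t. integral {x-1..t} (\<lambda>s. g s y)) has_real_derivative g x y) (at x)"
    if "continuous_on (UNIV \<times> {0<..}) (\<lambda>(x, y). g x y)" for g :: "real \<Rightarrow> real \<Rightarrow> real"
  proof -
    have i: "x \<in> interior {x-1..x+1}" by (simp add: interior_atLeastAtMost_real)
    then show ?thesis
      using integral_has_real_derivative[OF cx[OF that y, of "{x-1..x+1}"], of x] at_within_interior[OF i]
      by auto
  qed
  have "((\<lambda>t. integral {x-1..t} (\<lambda>s. fxy s y)) has_real_derivative fyx x y) (at x)"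
    by (rule has_field_derivative_transform_within_open[OF D[OF c2], of "{x-1<..<x+1}"]) (use ev in auto)
  with D[OF c1] show ?thesis by (rule DERIV_unique)
qed

definition Cinf :: "'a::euclidean_space set \<Rightarrow> ('a \<Rightarrow> real) \<Rightarrow> bool" where
  "Cinf S f \<longleftrightarrow> (\<forall>k. Ck_on k S f)"

definition pd :: "'a::euclidean_space \<Rightarrow> ('a \<Rightarrow> real) \<Rightarrow> 'a \<Rightarrow> real" where
  "pd e f = (\<lambda>p. frechet_derivative f (at p) e)"

lemma Cinf_pd: "Cinf S f \<Longrightarrow> e \<in> Basis \<Longrightarrow> Cinf S (pd e f)"
  unfolding Cinf_def pd_def using Ck_on.simps(2) by blast

lemma Cinf_continuous: "Cinf S f \<Longrightarrow> continuous_on S f"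
  unfolding Cinf_def using Ck_on.simps(1) by blast

lemma Cinf_has_derivative:
  "Cinf S f \<Longrightarrow> open S \<Longrightarrow> p \<in> S \<Longrightarrow> (f has_derivative frechet_derivative f (at p)) (at p)"
  unfolding Cinf_def using Ck_on.simps(2)
  by (metis differentiable_on_eq_differentiable_at frechet_derivative_works)

lemma Cinf_pd_line:
  assumes "Cinf S f" "open S" "p + s *\<^sub>R e \<in> S"
  shows "((\<lambda>s. f (p + s *\<^sub>R e)) has_real_derivative pd e f (p + s *\<^sub>R e)) (at s)"
proof -
  let ?D = "frechet_derivative f (at (p + s *\<^sub>R e))"
  have D: "(f has_derivative ?D) (at (p + s *\<^sub>R e))"
    using Cinf_has_derivative[OF assms] .
  have "((\<lambda>s. p + s *\<^sub>R e) has_derivative (\<lambda>h. h *\<^sub>R e)) (at s)"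
    by (auto intro!: derivative_eq_intros)
  from has_derivative_compose[OF this D]
  have "((\<lambda>s. f (p + s *\<^sub>R e)) has_derivative (\<lambda>h. ?D (h *\<^sub>R e))) (at s)" .
  moreover have "?D (h *\<^sub>R e) = pd e f (p + s *\<^sub>R e) * h" for h
    using has_derivative_bounded_linear[OF D] by (simp add: pd_def linear_simps)
  ultimately show ?thesis by (simp add: has_field_derivative_def)
qed

abbreviation HG :: "(real \<times> real \<times> real) set" where "HG \<equiv> UNIV \<times> {0<..} \<times> UNIV"
abbreviation "dirX \<equiv> ((1, 0, 0) :: real \<times> real \<times> real)"
abbreviation "dirY \<equiv> ((0, 1, 0) :: real \<times> real \<times> real)"

lemma HG_open: "open HG" by (intro open_Times) auto

lemma pd_x: "Cinf HG f \<Longrightarrow> y > 0 \<Longrightarrow> ((\<lambda>x. f (x, y, t)) has_real_derivative pd dirX f (x, y, t)) (at x)"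
  using Cinf_pd_line[of HG f "(0, y, t)" x dirX] HG_open by simp

lemma pd_y: "Cinf HG f \<Longrightarrow> y > 0 \<Longrightarrow> ((\<lambda>y. f (x, y, t)) has_real_derivative pd dirY f (x, y, t)) (at y)"
  using Cinf_pd_line[of HG f "(x, 0, t)" y dirY] HG_open by simp

lemma dir_Basis: "dirX \<in> Basis" "dirY \<in> Basis" by (auto simp: Basis_prod_def zero_prod_def)

lemma Cinf_slice_cont: "Cinf HG f \<Longrightarrow> continuous_on (UNIV \<times> {0<..}) (\<lambda>(x, y). f (x, y, t))"
proof -
  assume f: "Cinf HG f"
  have "continuous_on (UNIV \<times> {0<..}) (\<lambda>z::real \<times> real. (fst z, snd z, t))" by (intro continuous_intros)
  moreover have "(\<lambda>z. (fst z, snd z, t)) ` (UNIV \<times> {0<..}) \<subseteq> HG" by auto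
  ultimately show ?thesis
    using continuous_on_compose2[OF Cinf_continuous[OF f], of "UNIV \<times> {0<..}" "\<lambda>z. (fst z, snd z, t)"]
    by (simp add: case_prod_unfold)
qed

lemma pd_swap:
  assumes f: "Cinf HG f" and y: "y > 0"
  shows "pd dirY (pd dirX f) (x, y, t) = pd dirX (pd dirY f) (x, y, t)"
proof -
  note c = Cinf_pd[OF f dir_Basis(1)] Cinf_pd[OF f dir_Basis(2)]
  note c2 = Cinf_pd[OF c(1) dir_Basis(2)] Cinf_pd[OF c(2) dir_Basis(1)]
  show ?thesis
    by (rule mixed_partials_eq[where f = "\<lambda>x y. f (x, y, t)" and fx = "\<lambda>x y. pd dirX f (x, y, t)" and
         fy = "\<lambda>x y. pd dirY f (x, y, t)" and fxy = "\<lambda>x y. pd dirY (pd dirX f) (x, y, t)" and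
         fyx = "\<lambda>x y. pd dirX (pd dirY f) (x, y, t)"])
       (intro pd_x pd_y f c Cinf_slice_cont c2 y | assumption)+
qed

lemma Cinf_pd_pow: "Cinf S f \<Longrightarrow> e \<in> Basis \<Longrightarrow> Cinf S ((pd e ^^ i) f)"
  by (induction i) (auto intro: Cinf_pd)

lemma pd_swap_pow:
  assumes f: "Cinf HG f"
  shows "y > 0 \<Longrightarrow> pd dirY ((pd dirX ^^ i) f) (x, y, t) = (pd dirX ^^ i) (pd dirY f) (x, y, t)"
proof (induction i arbitrary: x y t)
  case (Suc i)
  note c = Cinf_pd_pow[OF f dir_Basis(1), of i]
  have "pd dirY ((pd dirX ^^ Suc i) f) (x, y, t) = pd dirX (pd dirY ((pd dirX ^^ i) f)) (x, y, t)"
    using pd_swap[OF c] Suc.prems by simp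
  also have "\<dots> = pd dirX ((pd dirX ^^ i) (pd dirY f)) (x, y, t)"
  proof (rule DERIV_unique)
    show "((\<lambda>x. pd dirY ((pd dirX ^^ i) f) (x, y, t)) has_real_derivative pd dirX (pd dirY ((pd dirX ^^ i) f)) (x,
        y, t)) (at x)"
      by (intro pd_x Suc.prems Cinf_pd c dir_Basis)
    show "((\<lambda>x. pd dirY ((pd dirX ^^ i) f) (x, y, t)) has_real_derivative pd dirX ((pd dirX ^^ i) (pd dirY f)) (x,
        y, t)) (at x)"
      using pd_x[OF Cinf_pd_pow[OF Cinf_pd[OF f dir_Basis(2)] dir_Basis(1)], of y i t x] Suc
      by simp
  qed
  finally show ?case by simp
qed simp

text \<open>\<open>U i j\<close> is \<open>\<partial>\<^sub>x\<^sup>i \<partial>\<^sub>y\<^sup>j\<close> of the function on the slice \<open>\<theta> = 0\<close>.  The definition applies \<open>\<partial>\<^sub>y\<close> first, so it is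
  the \<open>y\<close>-derivative that needs the partials to commute.\<close>

lemma smooth_partials:
  assumes "smooth_on_G \<phi>"
  obtains U :: "nat \<Rightarrow> nat \<Rightarrow> real \<Rightarrow> real \<Rightarrow> real" where
    "\<And>x y. U 0 0 x y = \<phi> (nak x y 0)"
    "\<And>i j x y. y > 0 \<Longrightarrow> ((\<lambda>x. U i j x y) has_real_derivative U (Suc i) j x y) (at x)"
    "\<And>i j x y. y > 0 \<Longrightarrow> ((\<lambda>y. U i j x y) has_real_derivative U i (Suc j) x y) (at y)"
    "\<And>i j. continuous_on (UNIV \<times> {0<..}) (\<lambda>(x, y). U i j x y)"
proof -
  let ?F = "\<lambda>(x, y, t). \<phi> (nak x y t)"
  define U where "U = (\<lambda>i j x y. (pd dirX ^^ i) ((pd dirY ^^ j) ?F) (x, y, 0))"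
  have F: "Cinf HG ?F" using assms by (simp add: smooth_on_G_def Cinf_def)
  have C: "Cinf HG ((pd dirX ^^ i) ((pd dirY ^^ j) ?F))" for i j
    by (intro Cinf_pd_pow F dir_Basis)
  show ?thesis
  proof (rule that[of U])
    show "U 0 0 x y = \<phi> (nak x y 0)" for x y by (simp add: U_def)
    show "((\<lambda>x. U i j x y) has_real_derivative U (Suc i) j x y) (at x)" if "y > 0" for i j x y
      using pd_x[OF C that, of i j 0 x] by (simp add: U_def)
    show "((\<lambda>y. U i j x y) has_real_derivative U i (Suc j) x y) (at y)" if "y > 0" for i j x y
      unfolding U_def funpow.simps(2) o_apply pd_swap_pow[OF Cinf_pd_pow[OF F dir_Basis(2)] that, symmetric]
      by (rule pd_y[OF C that])
    show "continuous_on (UNIV \<times> {0<..}) (\<lambda>(x, y). U i j x y)" for i j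
      unfolding U_def by (rule Cinf_slice_cont[OF C])
  qed
qed


section \<open>Green's formula for point-pair functions\<close>

lemma box_integral_dx_zero:
  fixes G Gx :: "real \<Rightarrow> real \<Rightarrow> real"
  assumes "continuous_on (cbox (a, c) (b, d)) (\<lambda>(x, y). Gx x y)" "a \<le> b"
    and "\<And>x y. x \<in> {a..b} \<Longrightarrow> y \<in> {c..d} \<Longrightarrow> ((\<lambda>x. G x y) has_real_derivative Gx x y) (at x)"
    and "\<And>y. y \<in> {c..d} \<Longrightarrow> G a y = 0" "\<And>y. y \<in> {c..d} \<Longrightarrow> G b y = 0"
  shows "integral (cbox (a, c) (b, d)) (\<lambda>(x, y). Gx x y) = 0"
proof -
  have "integral (cbox a b) (\<lambda>x. Gx x y) = 0" if "y \<in> {c..d}" for y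
  proof -
    have "((\<lambda>x. Gx x y) has_integral G b y - G a y) {a..b}"
      using assms(2,3) that
      by (intro fundamental_theorem_of_calculus)
         (auto simp flip: has_real_derivative_iff_has_vector_derivative intro: DERIV_subset)
    then show ?thesis using assms(4,5) that by (simp add: integral_unique)
  qed
  then have "integral (cbox c d) (\<lambda>y. integral (cbox a b) (\<lambda>x. Gx x y)) = integral (cbox c d) (\<lambda>y. 0)"
    by (intro integral_cong) auto
  then show ?thesis
    using integral_prod_continuous[OF assms(1)] integral_swap_continuous[OF assms(1)]
    by (simp add: case_prod_unfold)
qed

lemma box_integral_dy_zero:
  fixes G Gy :: "real \<Rightarrow> real \<Rightarrow> real"
  assumes "continuous_on (cbox (a, c) (b, d)) (\<lambda>(x, y). Gy x y)" "c \<le> d"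
    and "\<And>x y. x \<in> {a..b} \<Longrightarrow> y \<in> {c..d} \<Longrightarrow> ((\<lambda>y. G x y) has_real_derivative Gy x y) (at y)"
    and "\<And>x. x \<in> {a..b} \<Longrightarrow> G x c = 0" "\<And>x. x \<in> {a..b} \<Longrightarrow> G x d = 0"
  shows "integral (cbox (a, c) (b, d)) (\<lambda>(x, y). Gy x y) = 0"
proof -
  have "integral (cbox c d) (\<lambda>y. Gy x y) = 0" if "x \<in> {a..b}" for x
  proof -
    have "((\<lambda>y. Gy x y) has_integral G x d - G x c) {c..d}"
      using assms(2,3) that
      by (intro fundamental_theorem_of_calculus)
         (auto simp flip: has_real_derivative_iff_has_vector_derivative intro: DERIV_subset)
    then show ?thesis using assms(4,5) that by (simp add: integral_unique)
  qed
  then have "integral (cbox a b) (\<lambda>x. integral (cbox c d) (\<lambda>y. Gy x y)) = integral (cbox a b) (\<lambda>x. 0)"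
    by (intro integral_cong) auto
  then show ?thesis
    using integral_prod_continuous[OF assms(1)]
    by (simp add: case_prod_unfold)
qed

text \<open>The point-pair invariant \<open>|z - z\<^sub>0|\<^sup>2 / (4 y y\<^sub>0) = sinh\<^sup>2(d(z, z\<^sub>0)/2)\<close>; the four definitions
  after it are its partial derivatives in \<open>(x, y)\<close>.\<close>

definition uu :: "real \<Rightarrow> real \<Rightarrow> real \<Rightarrow> real \<Rightarrow> real" where
  "uu x0 y0 x y = ((x - x0)\<^sup>2 + (y - y0)\<^sup>2) / (4 * y0 * y)"

definition uu_x :: "real \<Rightarrow> real \<Rightarrow> real \<Rightarrow> real \<Rightarrow> real" where
  "uu_x x0 y0 x y = (x - x0) / (2 * y0 * y)"
definition uu_y :: "real \<Rightarrow> real \<Rightarrow> real \<Rightarrow> real \<Rightarrow> real" where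
  "uu_y x0 y0 x y = (1 - (y0\<^sup>2 + (x - x0)\<^sup>2) / y\<^sup>2) / (4 * y0)"
definition uu_xx :: "real \<Rightarrow> real \<Rightarrow> real \<Rightarrow> real \<Rightarrow> real" where
  "uu_xx x0 y0 x y = 1 / (2 * y0 * y)"
definition uu_yy :: "real \<Rightarrow> real \<Rightarrow> real \<Rightarrow> real \<Rightarrow> real" where
  "uu_yy x0 y0 x y = (y0\<^sup>2 + (x - x0)\<^sup>2) / (2 * y0 * y ^ 3)"

context
  fixes x0 y0 :: real
  assumes y0: "y0 > 0"
begin

lemma uu_nonneg: "y > 0 \<Longrightarrow> uu x0 y0 x y \<ge> 0"
  using y0 by (simp add: uu_def)

lemma uu_dx: "y > 0 \<Longrightarrow> ((\<lambda>x. uu x0 y0 x y) has_real_derivative uu_x x0 y0 x y) (at x)"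
  unfolding uu_def uu_x_def using y0
  by (auto intro!: derivative_eq_intros simp: field_simps)

lemma uu_dxx: "y > 0 \<Longrightarrow> ((\<lambda>x. uu_x x0 y0 x y) has_real_derivative uu_xx x0 y0 x y) (at x)"
  unfolding uu_xx_def uu_x_def using y0
  by (auto intro!: derivative_eq_intros simp: field_simps)

lemma uu_dy: "y > 0 \<Longrightarrow> ((\<lambda>y. uu x0 y0 x y) has_real_derivative uu_y x0 y0 x y) (at y)"
  unfolding uu_def uu_y_def using y0
  by (auto intro!: derivative_eq_intros simp: field_simps power2_eq_square)

lemma uu_dyy: "y > 0 \<Longrightarrow> ((\<lambda>y. uu_y x0 y0 x y) has_real_derivative uu_yy x0 y0 x y) (at y)"
  unfolding uu_yy_def uu_y_def using y0
  by (auto intro!: derivative_eq_intros simp: field_simps power2_eq_square power3_eq_cube)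

lemma uu_grad: "y > 0 \<Longrightarrow> y\<^sup>2 * ((uu_x x0 y0 x y)\<^sup>2 + (uu_y x0 y0 x y)\<^sup>2) = (uu x0 y0 x y)\<^sup>2 + uu x0 y0 x y"
  unfolding uu_def uu_y_def uu_x_def using y0
  by (simp add: divide_simps) algebra

lemma uu_lap: "y > 0 \<Longrightarrow> y\<^sup>2 * (uu_xx x0 y0 x y + uu_yy x0 y0 x y) = 2 * uu x0 y0 x y + 1"
  unfolding uu_def uu_yy_def uu_xx_def using y0
  by (simp add: divide_simps) algebra

text \<open>Outside the box \<open>ubox x0 y0\<close> defined below the invariant is at least \<open>4\<close>.  A function of it that
  is supported in \<open>[0, 4]\<close> therefore has no boundary terms on that box.\<close>

lemma uu_large_x:
  assumes "y > 0" "(x - x0)\<^sup>2 \<ge> (20 * y0)\<^sup>2" shows "uu x0 y0 x y \<ge> 4"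
proof -
  have "16 * y0 * y \<le> (20 * y0)\<^sup>2 + (y - y0)\<^sup>2"
    using zero_le_square[of "y - 9 * y0"] zero_le_square[of y0]
    unfolding power2_eq_square by (simp only: algebra_simps)
  then show ?thesis using assms y0 by (simp add: uu_def le_divide_eq)
qed

lemma uu_large_y:
  assumes "y > 0" "y \<ge> 20 * y0 \<or> y \<le> y0 / 20" shows "uu x0 y0 x y \<ge> 4"
proof -
  have "0 \<le> (20 * y - y0) * (y - 20 * y0)"
  proof (cases "y \<ge> 20 * y0")
    case True then show ?thesis using y0 by (intro mult_nonneg_nonneg) auto
  next
    case False then have "y \<le> y0 / 20" using assms by auto
    then show ?thesis using False by (intro mult_nonpos_nonpos) auto
  qed
  then have "16 * y0 * y \<le> (y - y0)\<^sup>2"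
    using mult_pos_pos[OF y0 assms(1)]
    unfolding power2_eq_square by (simp only: algebra_simps)
  then have "16 * y0 * y \<le> (x - x0)\<^sup>2 + (y - y0)\<^sup>2" by (rule order_trans) simp
  then show ?thesis using assms(1) y0 by (simp add: uu_def le_divide_eq)
qed

end

abbreviation ubox :: "real \<Rightarrow> real \<Rightarrow> (real \<times> real) set" where
  "ubox x0 y0 \<equiv> cbox (x0 - 20 * y0, y0 / 20) (x0 + 20 * y0, 20 * y0)"

text \<open>The hyperbolic Laplacian on functions of the invariant: if \<open>f1\<close>, \<open>f2\<close> are the first two derivatives
  of \<open>f\<close>, then \<open>y\<^sup>2 \<Delta> f(uu) = radial_lap f1 f2 uu\<close>, by \<open>uu_grad\<close> and \<open>uu_lap\<close>.\<close>

definition radial_lap :: "(real \<Rightarrow> real) \<Rightarrow> (real \<Rightarrow> real) \<Rightarrow> real \<Rightarrow> real" where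
  "radial_lap f1 f2 u = (u\<^sup>2 + u) * f2 u + (2 * u + 1) * f1 u"

lemma continuous_on_uu_parts:
  assumes y0: "y0 > 0" and S: "S \<subseteq> UNIV \<times> {0<..}"
  shows "continuous_on S (\<lambda>z. uu x0 y0 (fst z) (snd z))"
    "continuous_on S (\<lambda>z. uu_x x0 y0 (fst z) (snd z))"
    "continuous_on S (\<lambda>z. uu_y x0 y0 (fst z) (snd z))"
    "continuous_on S (\<lambda>z. uu_xx x0 y0 (fst z) (snd z))"
    "continuous_on S (\<lambda>z. uu_yy x0 y0 (fst z) (snd z))"
  unfolding uu_def uu_x_def uu_y_def uu_xx_def uu_yy_def
  using S y0 by (auto intro!: continuous_intros)

lemma ubox_subset: "y0 > 0 \<Longrightarrow> ubox x0 y0 \<subseteq> UNIV \<times> {0<..}"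
  by (auto simp: cbox_Pair_eq)

lemma continuous_on_radial:
  assumes y0: "y0 > 0" and S: "S \<subseteq> UNIV \<times> {0<..}" and "continuous_on {0..} f"
  shows "continuous_on S (\<lambda>z. f (uu x0 y0 (fst z) (snd z)))"
  by (rule continuous_on_compose2[OF assms(3) continuous_on_uu_parts(1)[OF y0 S]])
     (use S uu_nonneg[OF y0] in auto)

text \<open>The difference of the two integrands is the divergence of
  \<open>f(uu) \<nabla>w - w \<nabla>f(uu)\<close>, a field that vanishes on the boundary of the box.\<close>

lemma green_radial:
  fixes w wx wy wxx wyy :: "real \<Rightarrow> real \<Rightarrow> real" and f f1 f2 :: "real \<Rightarrow> real"
  assumes y0: "y0 > 0"
    and wx: "\<And>x y. y > 0 \<Longrightarrow> ((\<lambda>x. w x y) has_real_derivative wx x y) (at x)"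
    and wxx: "\<And>x y. y > 0 \<Longrightarrow> ((\<lambda>x. wx x y) has_real_derivative wxx x y) (at x)"
    and wy: "\<And>x y. y > 0 \<Longrightarrow> ((\<lambda>y. w x y) has_real_derivative wy x y) (at y)"
    and wyy: "\<And>x y. y > 0 \<Longrightarrow> ((\<lambda>y. wy x y) has_real_derivative wyy x y) (at y)"
    and cw: "continuous_on (UNIV \<times> {0<..}) (\<lambda>(x, y). w x y)"
    and cwxx: "continuous_on (UNIV \<times> {0<..}) (\<lambda>(x, y). wxx x y)"
    and cwyy: "continuous_on (UNIV \<times> {0<..}) (\<lambda>(x, y). wyy x y)"
    and f1: "\<And>u. u \<ge> 0 \<Longrightarrow> (f has_real_derivative f1 u) (at u)"
    and f2: "\<And>u. u \<ge> 0 \<Longrightarrow> (f1 has_real_derivative f2 u) (at u)"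
    and cf2: "continuous_on {0..} f2"
    and supp: "\<And>u. u \<ge> 4 \<Longrightarrow> f u = 0" "\<And>u. u \<ge> 4 \<Longrightarrow> f1 u = 0"
  shows "integral (ubox x0 y0) (\<lambda>(x, y). (wxx x y + wyy x y) * f (uu x0 y0 x y)) =
         integral (ubox x0 y0) (\<lambda>(x, y). w x y * radial_lap f1 f2 (uu x0 y0 x y) / y\<^sup>2)"
proof -
  let ?Q = "ubox x0 y0"
  note Q = ubox_subset[OF y0, of x0]
  note pos = uu_nonneg[OF y0]
  have Qc: "cbox (x0 - 20 * y0) (x0 + 20 * y0) = {x0 - 20 * y0..x0 + 20 * y0}" by simp
  have cf: "continuous_on {0..} f" "continuous_on {0..} f1"
    using f1 f2 by (auto intro!: DERIV_continuous_on intro: DERIV_subset)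
  note cr = continuous_on_radial[OF y0 Q cf(1), of x0] continuous_on_radial[OF y0 Q cf(2), of x0]
     continuous_on_radial[OF y0 Q cf2, of x0]
  note cu = continuous_on_uu_parts[OF y0 Q, of x0]
  note cws = continuous_on_subset[OF cw Q, unfolded case_prod_unfold] continuous_on_subset[OF cwxx Q, unfolded
      case_prod_unfold]
    continuous_on_subset[OF cwyy Q, unfolded case_prod_unfold]
  define u where "u = uu x0 y0"
  define ux where "ux = uu_x x0 y0" define uy where "uy = uu_y x0 y0"
  define uxx where "uxx = uu_xx x0 y0" define uyy where "uyy = uu_yy x0 y0"
  note defs = u_def ux_def uy_def uxx_def uyy_def
  define G1 where "G1 = (\<lambda>x y. wxx x y * f (u x y) - w x y * (f2 (u x y) * (ux x y)\<^sup>2 + f1 (u x y) * uxx x y))"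
  define G2 where "G2 = (\<lambda>x y. wyy x y * f (u x y) - w x y * (f2 (u x y) * (uy x y)\<^sup>2 + f1 (u x y) * uyy x y))"
  have c1: "continuous_on ?Q (\<lambda>(x, y). G1 x y)" and c2: "continuous_on ?Q (\<lambda>(x, y). G2 x y)"
    unfolding G1_def G2_def case_prod_unfold defs by (intro continuous_intros cr cu cws)+
  have fu: "((\<lambda>x. g (u x y)) has_real_derivative g' (u x y) * ux x y) (at x)"
           "((\<lambda>y. g (u x y)) has_real_derivative g' (u x y) * uy x y) (at y)"
    if "\<And>u. u \<ge> 0 \<Longrightarrow> (g has_real_derivative g' u) (at u)" "y > 0" for g g' x y
    using DERIV_chain2[OF that(1)[OF pos[OF that(2)]] uu_dx[OF y0 that(2)]]
       DERIV_chain2[OF that(1)[OF pos[OF that(2)]] uu_dy[OF y0 that(2)]] by (simp_all add: defs)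
  have dux: "((\<lambda>x. ux x y) has_real_derivative uxx x y) (at x)"
    and duy: "((\<lambda>y. uy x y) has_real_derivative uyy x y) (at y)" if "y > 0" for x y
    using uu_dxx[OF y0 that] uu_dyy[OF y0 that] by (simp_all add: defs)
  have I1: "integral ?Q (\<lambda>(x, y). G1 x y) = 0"
  proof (rule box_integral_dx_zero[where G = "\<lambda>x y. wx x y * f (u x y) - w x y * (f1 (u x y) * ux x y)"])
    fix x y assume "x \<in> {x0 - 20 * y0..x0 + 20 * y0}" "y \<in> {y0 / 20..20 * y0}"
    then have y: "y > 0" using y0 by auto
    show "((\<lambda>x. wx x y * f (u x y) - w x y * (f1 (u x y) * ux x y)) has_real_derivative G1 x y) (at x)"
      unfolding G1_def
      by (auto intro!: derivative_eq_intros wx[OF y] wxx[OF y] fu[OF f1 y] fu[OF f2 y] dux[OF y]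
           simp: algebra_simps power2_eq_square)
  next
    fix y assume "y \<in> {y0 / 20..20 * y0}"
    then have y: "y > 0" using y0 by auto
    have "u (x0 - 20 * y0) y \<ge> 4" "u (x0 + 20 * y0) y \<ge> 4"
      unfolding defs by (intro uu_large_x[OF y0 y]; simp)+
    then show "wx (x0 - 20 * y0) y * f (u (x0 - 20 * y0) y) - w (x0 - 20 * y0) y * (f1 (u (x0 - 20 * y0) y) * ux
        (x0 - 20 * y0) y) = 0"
     "wx (x0 + 20 * y0) y * f (u (x0 + 20 * y0) y) - w (x0 + 20 * y0) y * (f1 (u (x0 + 20 * y0) y) * ux (x0
         + 20 * y0) y) = 0"
      by (simp_all add: supp)
  qed (use c1 y0 in auto)
  have I2: "integral ?Q (\<lambda>(x, y). G2 x y) = 0"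
  proof (rule box_integral_dy_zero[where G = "\<lambda>x y. wy x y * f (u x y) - w x y * (f1 (u x y) * uy x y)"])
    fix x y assume "x \<in> {x0 - 20 * y0..x0 + 20 * y0}" "y \<in> {y0 / 20..20 * y0}"
    then have y: "y > 0" using y0 by auto
    show "((\<lambda>y. wy x y * f (u x y) - w x y * (f1 (u x y) * uy x y)) has_real_derivative G2 x y) (at y)"
      unfolding G2_def
      by (auto intro!: derivative_eq_intros wy[OF y] wyy[OF y] fu[OF f1 y] fu[OF f2 y] duy[OF y]
           simp: algebra_simps power2_eq_square)
  next
    fix x
    have "u x (y0 / 20) \<ge> 4" "u x (20 * y0) \<ge> 4"
      unfolding defs using y0 by (intro uu_large_y; simp)+
    then show "wy x (y0 / 20) * f (u x (y0 / 20)) - w x (y0 / 20) * (f1 (u x (y0 / 20)) * uy x (y0 / 20)) = 0"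
     "wy x (20 * y0) * f (u x (20 * y0)) - w x (20 * y0) * (f1 (u x (20 * y0)) * uy x (20 * y0)) = 0"
      by (simp_all add: supp)
  qed (use c2 y0 in auto)
  have "integral ?Q (\<lambda>(x, y). (wxx x y + wyy x y) * f (u x y)) -
      integral ?Q (\<lambda>(x, y). w x y * radial_lap f1 f2 (u x y) / y\<^sup>2)
     = integral ?Q (\<lambda>z. (case z of (x, y) \<Rightarrow> (wxx x y + wyy x y) * f (u x y))
           - (case z of (x, y) \<Rightarrow> w x y * radial_lap f1 f2 (u x y) / y\<^sup>2))"
  proof (rule integral_diff[symmetric])
    show "(\<lambda>(x, y). (wxx x y + wyy x y) * f (u x y)) integrable_on ?Q"
      unfolding case_prod_unfold defs by (intro integrable_continuous continuous_intros cws cr)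
    show "(\<lambda>(x, y). w x y * radial_lap f1 f2 (u x y) / y\<^sup>2) integrable_on ?Q"
      unfolding case_prod_unfold defs radial_lap_def
      using Q by (intro integrable_continuous continuous_intros cws cr cu) auto
  qed
  also have "\<dots> = integral ?Q (\<lambda>z. (case z of (x, y) \<Rightarrow> G1 x y) + (case z of (x, y) \<Rightarrow> G2 x y))"
  proof (rule integral_cong)
    fix z assume z: "z \<in> ?Q"
    obtain x y where zxy: "z = (x, y)" by (cases z)
    from z have y: "y > 0" using y0 unfolding zxy by (auto simp: cbox_Pair_eq)
    have "radial_lap f1 f2 (u x y) / y\<^sup>2 =
      (f2 (u x y) * (ux x y)\<^sup>2 + f1 (u x y) * uxx x y) + (f2 (u x y) * (uy x y)\<^sup>2 + f1 (u x y) * uyy x y)"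
    proof -
      have "radial_lap f1 f2 (u x y) = f2 (u x y) * (y\<^sup>2 * ((ux x y)\<^sup>2 + (uy x y)\<^sup>2))
          + f1 (u x y) * (y\<^sup>2 * (uxx x y + uyy x y))"
        unfolding radial_lap_def defs uu_grad[OF y0 y] uu_lap[OF y0 y] by (simp add: algebra_simps)
      then show ?thesis using y by (simp add: field_simps)
    qed
    then show "(case z of (x, y) \<Rightarrow> (wxx x y + wyy x y) * f (u x y)) -
        (case z of (x, y) \<Rightarrow> w x y * radial_lap f1 f2 (u x y) / y\<^sup>2) =
        (case z of (x, y) \<Rightarrow> G1 x y) + (case z of (x, y) \<Rightarrow> G2 x y)"
      unfolding zxy prod.case G1_def G2_def times_divide_eq_right[symmetric] by (simp add: algebra_simps)
  qed
  also have "\<dots> = 0"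
    using I1 I2 by (subst integral_add) (use c1 c2 in \<open>auto intro!: integrable_continuous\<close>)
  finally show ?thesis by (simp add: defs)
qed


section \<open>A cutoff and a parametrix for the hyperbolic Laplacian\<close>

text \<open>Powers of the positive part of an affine function serve as cutoffs.  They have as
  many continuous derivatives as are needed here, and these derivatives are explicit.\<close>

lemma pos_part_power_deriv:
  "((\<lambda>u. (max 0 (1 - u / c)) ^ Suc (Suc n)) has_real_derivative
     - (real (Suc (Suc n)) / c) * (max 0 (1 - u / c)) ^ Suc n) (at u)" if c: "c > 0" for c u :: real
proof -
  have P: "((\<lambda>u. (1 - u / c) ^ Suc (Suc n)) has_real_derivative
     - (real (Suc (Suc n)) / c) * (1 - u / c) ^ Suc n) (at u)" for u
    by (rule derivative_eq_intros refl | use c in \<open>simp add: field_simps\<close>)+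
  consider "u < c" | "u > c" | "u = c" by linarith
  then show ?thesis
  proof cases
    case 1
    have "((\<lambda>u. (max 0 (1 - u / c)) ^ Suc (Suc n)) has_real_derivative
     - (real (Suc (Suc n)) / c) * (1 - u / c) ^ Suc n) (at u)"
      by (rule has_field_derivative_transform_within_open[OF P, where S
          = "{..<c}"]) (use 1 c in \<open>auto simp: max_def field_simps\<close>)
    then show ?thesis using 1 c by (simp add: max_def field_simps)
  next
    case 2
    have "((\<lambda>u. (max 0 (1 - u / c)) ^ Suc (Suc n)) has_real_derivative 0) (at u)"
      by (rule has_field_derivative_transform_within_open[OF DERIV_const[of 0], where S
          = "{c<..}"]) (use 2 c in \<open>auto simp: max_def field_simps\<close>)
    then show ?thesis using 2 c by (simp add: max_def field_simps)
  next
    case 3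
    have "((\<lambda>u. (max 0 (1 - u / c)) ^ Suc (Suc n)) has_real_derivative 0) (at c)"
      unfolding has_field_derivative_iff
    proof (rule Lim_null_comparison)
      show "\<forall>\<^sub>F x in at c. norm (((max 0 (1 - x / c)) ^ Suc (Suc n) - (max 0 (1 - c / c)) ^ Suc (Suc n)) / (x - c))
              \<le> (max 0 (1 - x / c)) ^ Suc n / c"
      proof (rule eventuallyI)
        fix x show "norm (((max 0 (1 - x / c)) ^ Suc (Suc n) - (max 0 (1 - c / c)) ^ Suc (Suc n)) / (x - c))
              \<le> (max 0 (1 - x / c)) ^ Suc n / c"
        proof (cases "x < c")
          case True
          then have m: "max 0 (1 - x / c) = 1 - x / c" using c by (simp add: field_simps)
          have "x - c = - c * (1 - x / c)" "1 - x / c > 0" using c True by (auto simp: field_simps)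
          then show ?thesis using c unfolding m by (simp add: abs_mult)
        qed (use c in \<open>auto simp: max_def field_simps\<close>)
      qed
      have "((\<lambda>x. (max 0 (1 - x / c)) ^ Suc n / c) \<longlongrightarrow> (max 0 (1 - c / c)) ^ Suc n / c) (at c)"
        using c by (intro tendsto_intros) auto
      then show "((\<lambda>x. (max 0 (1 - x / c)) ^ Suc n / c) \<longlongrightarrow> 0) (at c)" using c by simp
    qed
    then show ?thesis using 3 c by simp
  qed
qed
definition bump :: "real \<Rightarrow> real" where "bump u = (max 0 (1 - u / 4)) ^ 4"
definition bump1 :: "real \<Rightarrow> real" where "bump1 u = - ((max 0 (1 - u / 4)) ^ 3)"
definition bump2 :: "real \<Rightarrow> real" where "bump2 u = 3 / 4 * (max 0 (1 - u / 4)) ^ 2"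

lemma bump_d1: "(bump has_real_derivative bump1 u) (at u)"
  using pos_part_power_deriv[of 4 2 u] unfolding bump_def[abs_def] bump1_def
  by (simp add: eval_nat_numeral)

lemma bump_d2: "(bump1 has_real_derivative bump2 u) (at u)"
  using DERIV_minus[OF pos_part_power_deriv[of 4 1 u]] unfolding bump1_def[abs_def] bump2_def
  by (simp add: eval_nat_numeral)

lemma bump_cont: "continuous_on S bump" "continuous_on S bump1" "continuous_on S bump2"
  unfolding bump_def[abs_def] bump1_def[abs_def] bump2_def[abs_def] by (intro continuous_intros; simp)+

lemma bump_supp: "u \<ge> 4 \<Longrightarrow> bump u = 0" "u \<ge> 4 \<Longrightarrow> bump1 u = 0" "u \<ge> 4 \<Longrightarrow> bump2 u = 0"
  by (auto simp: bump_def bump1_def bump2_def max_def)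

lemma bump_nonneg: "bump u \<ge> 0" by (simp add: bump_def)

lemma bump_le_1: "u \<ge> 0 \<Longrightarrow> bump u \<le> 1"
  unfolding bump_def by (intro power_le_one) auto

lemma bump_ge: "u \<le> 1 \<Longrightarrow> bump u \<ge> 1/4"
proof -
  assume "u \<le> 1"
  then have "(3/4) ^ 4 \<le> bump u" unfolding bump_def by (intro power_mono) auto
  then show ?thesis by (simp add: eval_nat_numeral)
qed

lemma radial_bump_bound: "u \<ge> 0 \<Longrightarrow> \<bar>radial_lap bump1 bump2 u\<bar> \<le> 24"
proof (cases "u \<ge> 4")
  case True then show ?thesis by (simp add: radial_lap_def bump_supp)
next
  case False
  assume u: "u \<ge> 0"
  have m: "max 0 (1 - u/4) \<le> 1" using u by auto
  have "\<bar>bump1 u\<bar> \<le> 1" "\<bar>bump2 u\<bar> \<le> 3/4"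
    unfolding bump1_def bump2_def using power_le_one[OF _ m, of 3] power_le_one[OF _ m, of 2] by (auto simp: abs_mult)
  moreover have "u\<^sup>2 + u \<le> 20" "0 \<le> u\<^sup>2 + u"
    using u False mult_mono[of u 4 u 4] by (auto simp: power2_eq_square)
  ultimately have "\<bar>(u\<^sup>2 + u) * bump2 u\<bar> \<le> 20 * (3/4)" "\<bar>(2 * u + 1) * bump1 u\<bar> \<le> 9 * 1"
    unfolding abs_mult using u False by (intro mult_mono; simp)+
  then show ?thesis unfolding radial_lap_def by linarith
qed
context
  fixes lam :: real
  assumes lam: "0 \<le> lam" "lam \<le> 1"
begin

text \<open>A constant multiple of \<open>ln u\<close> has the singularity of the Green function at \<open>u = 0\<close>.  Regularized as \<open>ln (u + e)\<close>
  it satisfies \<open>(u\<^sup>2 + u) f'' + (2u + 1) f' = 1 + e(1 - e)/(u + e)\<^sup>2\<close>, and the last term tends to a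
  point mass.  The profile \<open>pr\<close> cuts the logarithm off at \<open>u = 1\<close>; the slope \<open>4 - lam\<close> is chosen so
  that \<open>pr 0 = 1\<close> and \<open>pr' 0 = - lam\<close>.\<close>

definition pr :: "real \<Rightarrow> real" where "pr u = (max 0 (1 - u)) ^ 4 * (1 + (4 - lam) * u)"
definition pr1 :: "real \<Rightarrow> real" where
  "pr1 u = - 4 * (max 0 (1 - u)) ^ 3 * (1 + (4 - lam) * u) + (max 0 (1 - u)) ^ 4 * (4 - lam)"
definition pr2 :: "real \<Rightarrow> real" where
  "pr2 u = 12 * (max 0 (1 - u)) ^ 2 * (1 + (4 - lam) * u) - 8 * (max 0 (1 - u)) ^ 3 * (4 - lam)"

lemma pos_part_derivs:
  "((\<lambda>u. (max 0 (1 - u)) ^ 4) has_real_derivative - 4 * (max 0 (1 - u)) ^ 3) (at u)"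
  "((\<lambda>u. (max 0 (1 - u)) ^ 3) has_real_derivative - 3 * (max 0 (1 - u)) ^ 2) (at u)" for u :: real
  using pos_part_power_deriv[of 1 2 u] pos_part_power_deriv[of 1 1 u]
  by (simp_all add: eval_nat_numeral)

lemma affine_deriv: "((\<lambda>u. 1 + (4 - lam) * u) has_real_derivative 4 - lam) (at u)"
  by (auto intro!: derivative_eq_intros)

lemma pr_d1: "(pr has_real_derivative pr1 u) (at u)"
  unfolding pr_def[abs_def] pr1_def
  by (rule DERIV_cong[OF DERIV_mult[OF pos_part_derivs(1) affine_deriv]]) simp

lemma pr_d2: "(pr1 has_real_derivative pr2 u) (at u)"
  unfolding pr1_def[abs_def] pr2_def
  by (rule DERIV_cong[OF DERIV_add[OF DERIV_mult[OF DERIV_cmult[OF pos_part_derivs(2)] affine_deriv]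
        DERIV_cmult_right[OF pos_part_derivs(1)]]]) simp

lemma pr_cont: "continuous_on S pr" "continuous_on S pr1" "continuous_on S pr2"
  unfolding pr_def[abs_def] pr1_def[abs_def] pr2_def[abs_def] by (intro continuous_intros; simp)+

lemma pr_supp: "u \<ge> 1 \<Longrightarrow> pr u = 0" "u \<ge> 1 \<Longrightarrow> pr1 u = 0" "u \<ge> 1 \<Longrightarrow> pr2 u = 0"
  by (auto simp: pr_def pr1_def pr2_def max_def)

lemma pr_nonneg: "u \<ge> 0 \<Longrightarrow> pr u \<ge> 0"
  using lam by (simp add: pr_def)

lemma abs_mult_le: "\<bar>a\<bar> \<le> A \<Longrightarrow> \<bar>b\<bar> \<le> B \<Longrightarrow> \<bar>a * b\<bar> \<le> A * B" for a b A B :: real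
  unfolding abs_mult by (rule mult_mono) auto

lemma pr_bounds:
  assumes "0 \<le> u" "u \<le> 1"
  shows "\<bar>pr u\<bar> \<le> 5" "\<bar>pr1 u\<bar> \<le> 24" "\<bar>pr2 u\<bar> \<le> 92"
proof -
  let ?m = "max 0 (1 - u)"
  have m: "\<bar>?m ^ n\<bar> \<le> 1" for n using assms by (auto intro!: power_le_one)
  have b: "\<bar>1 + (4 - lam) * u\<bar> \<le> 5"
    using assms lam mult_mono[of "4 - lam" 4 u 1] mult_nonneg_nonneg[of "4 - lam" u] by auto
  have l: "\<bar>4 - lam\<bar> \<le> 4" using lam by auto
  note M = abs_mult_le[OF m b] abs_mult_le[OF m l]
  show "\<bar>pr u\<bar> \<le> 5" using M(1)[of 4] by (simp add: pr_def)
  show "\<bar>pr1 u\<bar> \<le> 24" using M(1)[of 3] M(2)[of 4] unfolding pr1_def mult.assoc by linarith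
  show "\<bar>pr2 u\<bar> \<le> 92" using M(1)[of 2] M(2)[of 3] unfolding pr2_def mult.assoc by linarith
qed

text \<open>At \<open>u = 0\<close> the left side is \<open>pr' 0 + lam pr 0 = 0\<close>.  The factor \<open>u\<close> gained in this way
  absorbs the logarithm that multiplies this expression in \<open>pf_operator\<close>.\<close>

lemma pr_residual:
  assumes "0 \<le> u" "u \<le> 1"
  shows "\<bar>(u\<^sup>2 + u) * pr2 u + (2 * u + 1) * pr1 u + lam * pr u\<bar> \<le> 300 * u"
proof -
  let ?b = "4 - lam"
  let ?m = "1 - u"
  have m: "max 0 (1 - u) = 1 - u" using assms by auto
  define r where "r = (- 5 * ?b - lam + lam * ?b) - lam * ?b * u"
  have "pr1 u + lam * pr u = ?m ^ 3 * (u * r)"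
    unfolding pr1_def pr_def m r_def by (simp add: eval_nat_numeral) (simp add: algebra_simps)
  then have e: "(u\<^sup>2 + u) * pr2 u + (2 * u + 1) * pr1 u + lam * pr u = u * ((u + 1) * pr2 u + 2 * pr1 u + ?m ^ 3 * r)"
    by (simp add: power2_eq_square algebra_simps)
  have lb: "\<bar>lam * ?b\<bar> \<le> 1 * 4" using lam by (intro abs_mult_le) auto
  have lbu: "\<bar>lam * ?b * u\<bar> \<le> 1 * 4 * 1" using assms by (intro abs_mult_le lb) auto
  have "\<bar>- 5 * b - lam + s - t\<bar> \<le> 29" if "\<bar>s\<bar> \<le> 4" "\<bar>t\<bar> \<le> 4" "b \<le> 4" "b \<ge> 3" for s t b
    using that lam by linarith
  from this[of "lam * ?b" "lam * ?b * u" ?b] have r: "\<bar>r\<bar> \<le> 29"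
    using lb lbu lam unfolding r_def by (simp only: mult_1_right mult_1_left)
  have "\<bar>?m ^ 3\<bar> \<le> 1" using assms by (auto intro!: power_le_one)
  from abs_mult_le[OF this r] have "\<bar>?m ^ 3 * r\<bar> \<le> 29" by simp
  moreover have "\<bar>(u + 1) * pr2 u\<bar> \<le> 2 * 92" using assms by (intro abs_mult_le pr_bounds) auto
  ultimately have "\<bar>(u + 1) * pr2 u + 2 * pr1 u + ?m ^ 3 * r\<bar> \<le> 300"
    using pr_bounds(2)[OF assms] by linarith
  then show ?thesis unfolding e abs_mult using assms
    by (simp add: mult.commute mult_left_mono)
qed

lemma u_log_bound:
  assumes "0 \<le> u" "u \<le> 1" "0 < e" "e \<le> 1"
  shows "u * \<bar>ln (u + e)\<bar> \<le> (1::real)"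
proof (cases "u + e \<ge> 1")
  case True
  have "ln (u + e) \<le> u + e - 1" by (rule ln_le_minus_one) (use assms in auto)
  then have "\<bar>ln (u + e)\<bar> \<le> 1" using True assms by simp
  then show ?thesis using assms mult_mono[of u 1 "\<bar>ln (u + e)\<bar>" 1] by simp
next
  case False
  have "ln (1 / (u + e)) \<le> 1 / (u + e) - 1" by (rule ln_le_minus_one) (use assms in auto)
  then have l: "\<bar>ln (u + e)\<bar> \<le> 1 / (u + e)" using False assms by (simp add: ln_div)
  have "u * \<bar>ln (u + e)\<bar> \<le> (u + e) * (1 / (u + e))" using assms l by (intro mult_mono) auto
  also have "\<dots> = 1" using assms by simp
  finally show ?thesis .
qed

text \<open>The regularized parametrix and its first two derivatives.\<close>

definition pf :: "real \<Rightarrow> real \<Rightarrow> real" where "pf e u = pr u * ln (u + e)"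
definition pf1 :: "real \<Rightarrow> real \<Rightarrow> real" where "pf1 e u = pr1 u * ln (u + e) + pr u / (u + e)"
definition pf2 :: "real \<Rightarrow> real \<Rightarrow> real" where
  "pf2 e u = pr2 u * ln (u + e) + 2 * pr1 u / (u + e) - pr u / (u + e)\<^sup>2"

lemma pf_d1: "e > 0 \<Longrightarrow> u \<ge> 0 \<Longrightarrow> (pf e has_real_derivative pf1 e u) (at u)"
  unfolding pf_def[abs_def] pf1_def by (auto intro!: derivative_eq_intros pr_d1)

lemma pf_d2: "e > 0 \<Longrightarrow> u \<ge> 0 \<Longrightarrow> (pf1 e has_real_derivative pf2 e u) (at u)"
  unfolding pf1_def[abs_def] pf2_def
proof -
  assume e: "e > 0" "u \<ge> 0"
  have l: "((\<lambda>u. ln (u + e)) has_real_derivative 1 / (u + e)) (at u)"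
    and a: "((\<lambda>u. u + e) has_real_derivative 1) (at u)"
    using e by (auto intro!: derivative_eq_intros)
  have s: "(a * s - b * 1) / (s * s) = a / s - b / s\<^sup>2" if "s \<noteq> 0" for a b s :: real
    using that by (simp add: diff_divide_distrib power2_eq_square)
  have nz: "u + e \<noteq> 0" using e by auto
  show "((\<lambda>u. pr1 u * ln (u + e) + pr u / (u + e)) has_real_derivative
      pr2 u * ln (u + e) + 2 * pr1 u / (u + e) - pr u / (u + e)\<^sup>2) (at u)"
    by (rule DERIV_cong[OF DERIV_add[OF DERIV_mult[OF pr_d2 l] DERIV_divide[OF pr_d1 a nz]]], subst s[OF nz]) simp
qed

lemma pf_cont: "e > 0 \<Longrightarrow> continuous_on {0..} (pf2 e)"
  unfolding pf2_def[abs_def] by (auto intro!: continuous_intros pr_cont)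

lemma pf_supp: "u \<ge> 1 \<Longrightarrow> pf e u = 0" "u \<ge> 1 \<Longrightarrow> pf1 e u = 0" "u \<ge> 1 \<Longrightarrow> pf2 e u = 0"
  by (simp_all add: pf_def pf1_def pf2_def pr_supp)

text \<open>Applied to the parametrix, Laplacian plus \<open>lam\<close> is an approximate point mass, up to an error that is
  bounded independently of \<open>e\<close>.\<close>

lemma pf_operator:
  assumes "e > 0" "e \<le> 1" "u \<ge> 0"
  shows "\<bar>radial_lap (pf1 e) (pf2 e) u + lam * pf e u - pr u * (e * (1 - e) / (u + e)\<^sup>2)\<bar> \<le> 2000 * bump u"
proof (cases "u \<ge> 1")
  case True then show ?thesis by (simp add: radial_lap_def pf_supp pr_supp bump_nonneg)
next
  case False
  then have u: "0 \<le> u" "u \<le> 1" using assms by auto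
  have nz: "u + e > 0" using assms by auto
  have "(u\<^sup>2 + u) * (- pr u / (u + e)\<^sup>2) + (2 * u + 1) * (pr u / (u + e)) = pr u * (1 + e * (1 - e) / (u + e)\<^sup>2)"
  proof -
    have "- (u\<^sup>2 + u) / (u + e)\<^sup>2 + (2 * u + 1) / (u + e) = 1 + e * (1 - e) / (u + e)\<^sup>2"
    proof -
      define s where "s = u + e"
      have us: "u = s - e" and "s \<noteq> 0" using nz by (auto simp: s_def)
      then show ?thesis
        unfolding s_def[symmetric] us by (simp add: divide_simps) (simp add: power2_eq_square algebra_simps)
    qed
    moreover have "A * (- p / s) + B * (p / t) = p * (- A / s + B / t)" for A B p s t :: real
      by (simp add: divide_inverse algebra_simps)
    ultimately show ?thesis by (simp only:)
  qed
  then have "radial_lap (pf1 e) (pf2 e) u + lam * pf e u - pr u * (e * (1 - e) / (u + e)\<^sup>2)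
    = ln (u + e) * ((u\<^sup>2 + u) * pr2 u + (2 * u + 1) * pr1 u + lam * pr u) + (u / (u + e)) * (2 * (u + 1) * pr1 u) + pr u"
    unfolding radial_lap_def pf1_def pf2_def pf_def
    by (simp add: algebra_simps power2_eq_square add_divide_distrib)
  also have "\<bar>\<dots>\<bar> \<le> 300 + 1 * (4 * 24) + 5"
  proof -
    have "\<bar>ln (u + e) * ((u\<^sup>2 + u) * pr2 u + (2 * u + 1) * pr1 u + lam * pr u)\<bar> \<le> \<bar>ln (u + e)\<bar> * (300 * u)"
      by (intro abs_mult_le pr_residual u) simp
    also have "\<dots> \<le> 300" using u_log_bound[OF u assms(1,2)] by (simp add: mult_ac)
    finally have 1: "\<bar>ln (u + e) * ((u\<^sup>2 + u) * pr2 u + (2 * u + 1) * pr1 u + lam * pr u)\<bar> \<le> 300" .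
    have 2: "\<bar>(u / (u + e)) * (2 * (u + 1) * pr1 u)\<bar> \<le> 1 * (4 * 24)"
      using u assms by (intro abs_mult_le pr_bounds) auto
    show ?thesis using 1 2 pr_bounds(1)[OF u] by linarith
  qed
  also have "\<dots> \<le> 2000 * bump u" using bump_ge[OF u(2)] by simp
  finally show ?thesis .
qed

end


section \<open>Eigenfunctions are bounded by their local means\<close>

text \<open>\<open>w\<close> solves \<open>y\<^sup>2 \<Delta> w = - lam w\<close>, where \<open>wx\<close>, \<open>wy\<close>, \<open>wxx\<close> are its derivatives and
  the equation has been solved for the second \<open>y\<close>-derivative.\<close>

definition eigen_jet :: "real \<Rightarrow> (real \<Rightarrow> real \<Rightarrow> real) \<Rightarrow> (real \<Rightarrow> real \<Rightarrow> real) \<Rightarrow> (real \<Rightarrow> real \<Rightarrow> real) \<Rightarrow> (real \<Rightarrow> real \<Rightarrow>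
    real) \<Rightarrow> bool" where
  "eigen_jet lam w wx wy wxx \<longleftrightarrow>
     (\<forall>x. \<forall>y>0. ((\<lambda>x. w x y) has_real_derivative wx x y) (at x) \<and>
        ((\<lambda>x. wx x y) has_real_derivative wxx x y) (at x) \<and>
        ((\<lambda>y. w x y) has_real_derivative wy x y) (at y) \<and>
        ((\<lambda>y. wy x y) has_real_derivative - lam / y\<^sup>2 * w x y - wxx x y) (at y)) \<and>
     continuous_on (UNIV \<times> {0<..}) (\<lambda>(x, y). w x y) \<and>
     continuous_on (UNIV \<times> {0<..}) (\<lambda>(x, y). wx x y) \<and>
     continuous_on (UNIV \<times> {0<..}) (\<lambda>(x, y). wy x y) \<and>
     continuous_on (UNIV \<times> {0<..}) (\<lambda>(x, y). wxx x y)"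

lemma eigen_jet_uminus:
  assumes "eigen_jet lam w wx wy wxx"
  shows "eigen_jet lam (\<lambda>x y. - w x y) (\<lambda>x y. - wx x y) (\<lambda>x y. - wy x y) (\<lambda>x y. - wxx x y)"
proof -
  have "continuous_on S (\<lambda>(x, y). - g x y)" if "continuous_on S (\<lambda>(x, y). g x y)"
     for S and g :: "real \<Rightarrow> real \<Rightarrow> real"
    using continuous_on_minus[OF that] by (simp add: case_prod_unfold)
  then show ?thesis using assms unfolding eigen_jet_def
    by (auto intro!: derivative_eq_intros simp: algebra_simps)
qed

lemma cont_case_prodD:
  assumes "continuous_on (UNIV \<times> {0<..}) (\<lambda>(x, y). g x y)" "S \<subseteq> UNIV \<times> {0<..}"
  shows "continuous_on S (\<lambda>z. g (fst z) (snd z))"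
  using continuous_on_subset[OF assms] by (simp add: case_prod_unfold)

lemma green_eigen:
  assumes E: "eigen_jet lam w wx wy wxx" and y0: "y0 > 0"
    and f1: "\<And>u. u \<ge> 0 \<Longrightarrow> (f has_real_derivative f1 u) (at u)"
    and f2: "\<And>u. u \<ge> 0 \<Longrightarrow> (f1 has_real_derivative f2 u) (at u)"
    and cf2: "continuous_on {0..} f2"
    and supp: "\<And>u. u \<ge> 4 \<Longrightarrow> f u = 0" "\<And>u. u \<ge> 4 \<Longrightarrow> f1 u = 0"
  shows "integral (ubox x0 y0) (\<lambda>(x, y). w x y * (radial_lap f1 f2 (uu x0 y0 x y) + lam * f (uu x0 y0 x y)) / y\<^sup>2) = 0"
proof -
  let ?Q = "ubox x0 y0"
  note Q = ubox_subset[OF y0, of x0]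
  define wyy where "wyy = (\<lambda>x y. - lam / y\<^sup>2 * w x y - wxx x y)"
  have c: "continuous_on (UNIV \<times> {0<..}) (\<lambda>(x, y). wyy x y)"
    using E unfolding wyy_def case_prod_unfold eigen_jet_def by (auto intro!: continuous_intros)
  have cf: "continuous_on {0..} f" "continuous_on {0..} f1"
    using f1 f2 by (auto intro!: DERIV_continuous_on intro: DERIV_subset)
  note cr = continuous_on_radial[OF y0 Q cf(1), of x0] continuous_on_radial[OF y0 Q cf(2), of x0]
     continuous_on_radial[OF y0 Q cf2, of x0]
  note cu = continuous_on_uu_parts[OF y0 Q, of x0]
  have cw: "continuous_on ?Q (\<lambda>z. w (fst z) (snd z))"
    using E cont_case_prodD[OF _ Q] unfolding eigen_jet_def by auto
  have "integral ?Q (\<lambda>(x, y). (wxx x y + wyy x y) * f (uu x0 y0 x y)) =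
         integral ?Q (\<lambda>(x, y). w x y * radial_lap f1 f2 (uu x0 y0 x y) / y\<^sup>2)"
    by (rule green_radial[OF y0 _ _ _ _ _ _ c f1 f2 cf2 supp, of w wx wxx wy])
       (use E in \<open>auto simp: eigen_jet_def wyy_def\<close>)
  moreover have "integral ?Q (\<lambda>(x, y). (wxx x y + wyy x y) * f (uu x0 y0 x y)) =
      - integral ?Q (\<lambda>(x, y). w x y * (lam * f (uu x0 y0 x y)) / y\<^sup>2)"
    unfolding integral_neg[symmetric]
    by (rule integral_cong) (auto simp: wyy_def)
  moreover have "integral ?Q (\<lambda>(x, y). w x y * (radial_lap f1 f2 (uu x0 y0 x y) + lam * f (uu x0 y0 x y)) / y\<^sup>2)
    = integral ?Q (\<lambda>(x, y). w x y * radial_lap f1 f2 (uu x0 y0 x y) / y\<^sup>2)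
    + integral ?Q (\<lambda>(x, y). w x y * (lam * f (uu x0 y0 x y)) / y\<^sup>2)"
  proof (subst integral_add[symmetric])
    show "(\<lambda>(x, y). w x y * radial_lap f1 f2 (uu x0 y0 x y) / y\<^sup>2) integrable_on ?Q"
         "(\<lambda>(x, y). w x y * (lam * f (uu x0 y0 x y)) / y\<^sup>2) integrable_on ?Q"
      using Q unfolding radial_lap_def case_prod_unfold
      by (auto intro!: integrable_continuous continuous_intros cw cr cu)
  qed (auto simp: distrib_left add_divide_distrib case_prod_unfold)
  ultimately show ?thesis by simp
qed

text \<open>By \<open>green_eigen\<close> the pairing of \<open>w\<close> with Laplacian plus \<open>lam\<close> of the parametrix is zero,
  so by \<open>pf_operator\<close> the approximate point mass, paired with \<open>w\<close>, is at most a constant times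
  the mean of \<open>|w|\<close>.  The parameter \<open>e\<close> depends on \<open>w\<close>: it is so small that \<open>w\<close> is at least half its
  central value where the point mass concentrates.  The constant does not depend on it, because the point mass of a
  square of side comparable to \<open>y0 \<surd>e\<close> is bounded below.\<close>

lemma sup_estimate_pos:
  assumes E: "eigen_jet lam w wx wy wxx" and lam: "0 \<le> lam" "lam \<le> 1" and y0: "y0 > 0" and m: "w x0 y0 > 0"
  shows "w x0 y0 \<le> 100000 * integral (ubox x0 y0) (\<lambda>(x, y). \<bar>w x y\<bar> * bump (uu x0 y0 x y) / y\<^sup>2)"
proof -
  let ?Q = "ubox x0 y0"
  define m where "m = w x0 y0"
  define u where "u = uu x0 y0"
  note Q = ubox_subset[OF y0, of x0]
  have Qpos: "y > 0" if "(x, y) \<in> ?Q" for x y using that y0 by (auto simp: cbox_Pair_eq)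
  have cw: "continuous_on ?Q (\<lambda>z. w (fst z) (snd z))"
    using E cont_case_prodD[OF _ Q] unfolding eigen_jet_def by auto
  have cu: "continuous_on ?Q (\<lambda>z. u (fst z) (snd z))"
    using continuous_on_uu_parts(1)[OF y0 Q] by (simp add: u_def)
  have z0: "(x0, y0) \<in> ?Q" using y0 by (simp add: cbox_Pair_eq)
  obtain d where d: "d > 0" "\<And>x y. (x, y) \<in> ?Q \<Longrightarrow> (x - x0)\<^sup>2 + (y - y0)\<^sup>2 < d\<^sup>2 \<Longrightarrow> w x y \<ge> m / 2"
  proof -
    from cw z0 have "\<forall>e>0. \<exists>d>0. \<forall>z\<in>?Q. dist z (x0, y0) < d \<longrightarrow> dist (w (fst z) (snd z)) (w (fst (x0, y0)) (snd (x0, y0))) < e"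
      unfolding continuous_on_iff by blast
    then obtain d where "d > 0" and d: "\<And>z. z\<in>?Q \<Longrightarrow> dist z (x0, y0) < d \<Longrightarrow> dist (w (fst z) (snd z)) m < m/2"
      using \<open>w x0 y0 > 0\<close> unfolding m_def by (metis fst_conv snd_conv half_gt_zero)
    show ?thesis
    proof (rule that[OF \<open>d > 0\<close>])
      fix x y assume "(x, y) \<in> ?Q" and "(x - x0)\<^sup>2 + (y - y0)\<^sup>2 < d\<^sup>2"
      then have "dist (x, y) (x0, y0) < d"
        using \<open>d > 0\<close> by (simp add: dist_prod_def dist_real_def real_less_lsqrt)
      from d[OF \<open>(x, y) \<in> ?Q\<close> this] show "w x y \<ge> m / 2" by (simp add: dist_real_def abs_if split: if_splits)
    qed
  qed
  \<comment> \<open>near the centre means \<open>u \<le> t\<close>; on the box \<open>y \<le> 20 y0\<close>, so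
    \<open>|z - z0|\<^sup>2 = 4 y0 y u \<le> 80 y0\<^sup>2 t\<close>, which is below \<open>d\<^sup>2\<close>\<close>
  define t where "t = min (1/2) (d\<^sup>2 / (81 * y0\<^sup>2))"
  have t: "0 < t" "t \<le> 1/2" using d(1) y0 by (auto simp: t_def)
  have near: "w x y \<ge> m / 2" if "(x, y) \<in> ?Q" "u x y \<le> t" for x y
  proof (rule d(2)[OF that(1)])
    have y: "y > 0" "y \<le> 20 * y0" using Qpos[OF that(1)] that(1) by (auto simp: cbox_Pair_eq)
    have "(x - x0)\<^sup>2 + (y - y0)\<^sup>2 = u x y * (4 * y0 * y)" using y y0 by (simp add: u_def uu_def)
    also have "\<dots> \<le> t * (4 * y0 * (20 * y0))" using that(2) y y0 t uu_nonneg[OF y0 y(1)]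
        by (intro mult_mono) (auto simp: u_def)
    also have "\<dots> = t * (80 * y0\<^sup>2)" by (simp add: power2_eq_square)
    also have "\<dots> \<le> (d\<^sup>2 / (81 * y0\<^sup>2)) * (80 * y0\<^sup>2)" by (intro mult_right_mono) (auto simp: t_def)
    also have "\<dots> < d\<^sup>2" using d(1) y0 by (simp add: field_simps)
    finally show "(x - x0)\<^sup>2 + (y - y0)\<^sup>2 < d\<^sup>2" .
  qed
  \<comment> \<open>away from the centre, for \<open>u > t\<close>, the kernel is at most \<open>e / t\<^sup>2 = 1\<close>\<close>
  define e where "e = t\<^sup>2"
  have e: "0 < e" "e \<le> 1/4" "e \<le> t"
    using t mult_mono[of t "1/2" t "1/2"] mult_mono[of t 1 t t] by (auto simp: e_def power2_eq_square)
  define r where "r = t * y0"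
  have r: "r > 0" "r \<le> y0 / 2" "r\<^sup>2 = e * y0\<^sup>2" using t y0 by (auto simp: r_def e_def power_mult_distrib)
  let ?B = "cbox (x0 - r, y0 - r) (x0 + r, y0 + r)"
  have BQ: "?B \<subseteq> ?Q" using r y0 by (auto simp: cbox_Pair_eq)
  \<comment> \<open>a lower bound for the kernel divided by \<open>y\<^sup>2\<close> on the square \<open>B\<close>, where \<open>u \<le> e\<close>\<close>
  define c where "c = (1/4) * (3 / (16 * e)) * (1 / (4 * y0\<^sup>2))"
  have c0: "c \<ge> 0" using e y0 by (simp add: c_def)
  define A where "A = integral ?Q (\<lambda>(x, y). \<bar>w x y\<bar> * bump (u x y) / y\<^sup>2)"
  define F where "F = (\<lambda>(x, y). w x y * (pr lam (u x y) * (e * (1 - e) / (u x y + e)\<^sup>2)) / y\<^sup>2)"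
  define G where "G = (\<lambda>(x, y). \<bar>w x y\<bar> * bump (u x y) / y\<^sup>2)"
  have un: "u x y \<ge> 0" if "(x, y) \<in> ?Q" for x y unfolding u_def by (rule uu_nonneg[OF y0 Qpos[OF that]])
  have nz: "\<And>z. z \<in> ?Q \<Longrightarrow> u (fst z) (snd z) + e \<noteq> 0"
  proof -
    fix z assume "z \<in> ?Q"
    then have "u (fst z) (snd z) \<ge> 0" by (intro un) simp
    then show "u (fst z) (snd z) + e \<noteq> 0" using e(1) by simp
  qed
  have nzy: "\<And>z. z \<in> ?Q \<Longrightarrow> snd z \<noteq> 0"
  proof -
    fix z assume "z \<in> ?Q"
    then have "snd z > 0" by (intro Qpos[of "fst z"]) simp
    then show "snd z \<noteq> 0" by simp
  qed
  have cr: "continuous_on ?Q (\<lambda>z. pr lam (u (fst z) (snd z)))" "continuous_on ?Q (\<lambda>z. bump (u (fst z) (snd z)))"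
    by (rule continuous_on_compose2[OF _ cu, of UNIV]; simp add: pr_cont[OF lam] bump_cont)+
  have IF: "F integrable_on ?Q" and IG: "G integrable_on ?Q"
    unfolding F_def G_def case_prod_unfold
    by (rule integrable_continuous, intro continuous_on_divide continuous_on_mult continuous_on_power
        continuous_on_add continuous_on_rabs
          continuous_on_const continuous_on_snd continuous_on_id cw cu cr ballI power_not_zero nz nzy; assumption)+
  have IB: "((\<lambda>z. if z \<in> ?B then m / 2 * c else 0) has_integral (m/2 * c * (2 * r)\<^sup>2)) ?Q"
  proof -
    have "((\<lambda>z. m / 2 * c) has_integral measure lborel ?B *\<^sub>R (m/2*c)) ?B" by (rule has_integral_const)
    moreover have "measure lborel ?B = (2 * r)\<^sup>2" using r by (simp add: content_Pair power2_eq_square)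
    ultimately have "((\<lambda>z. m / 2 * c) has_integral (m/2*c*(2*r)\<^sup>2)) ?B" by (simp add: mult.commute)
    then show ?thesis using BQ by (simp add: has_integral_restrict)
  qed
  have "m/2 * c * (2 * r)\<^sup>2 - 20 * A = integral ?Q (\<lambda>z. (if z \<in> ?B then m / 2 * c else 0) - 20 * G z)"
    unfolding A_def G_def[symmetric] u_def[symmetric]
    by (subst integral_diff) (use IB IG in \<open>auto simp: integral_unique\<close>)
  also have "\<dots> \<le> integral ?Q F"
  proof (rule integral_le)
    fix z assume z: "z \<in> ?Q"
    obtain x y where zz: "z = (x, y)" by (cases z)
    have y: "y > 0" using Qpos[of x y] z zz by simp
    have u0: "u x y \<ge> 0" using un[of x y] z zz by simp
    have Gn: "G z \<ge> 0" by (simp add: G_def zz bump_nonneg)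
    define K where "K = pr lam (u x y) * (e * (1 - e) / (u x y + e)\<^sup>2)"
    have K0: "K \<ge> 0" using pr_nonneg[OF lam u0] e by (simp add: K_def)
    have Fz: "F z = w x y * K / y\<^sup>2" by (simp add: F_def zz K_def)
    show "(if z \<in> ?B then m / 2 * c else 0) - 20 * G z \<le> F z"
    proof (cases "z \<in> ?B")
      case True
      then have xy: "\<bar>x - x0\<bar> \<le> r" "\<bar>y - y0\<bar> \<le> r" by (auto simp: zz cbox_Pair_eq)
      then have y2: "y \<ge> y0 / 2" "y \<le> 2 * y0" using r by auto
      have "(x - x0)\<^sup>2 + (y - y0)\<^sup>2 \<le> r\<^sup>2 + r\<^sup>2" using xy by (intro add_mono) (auto simp: abs_le_square_iff[symmetric])
      also have "\<dots> = e * (2 * y0\<^sup>2)" using r by simp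
      also have "\<dots> \<le> e * (4 * y0 * y)" using y2 y0 e by (simp add: power2_eq_square)
      finally have ue: "u x y \<le> e" using y y0 by (simp add: u_def uu_def divide_le_eq)
      have "(1/4::real) \<le> (3/4) ^ 4" by (simp add: eval_nat_numeral)
      also have "(3/4) ^ 4 \<le> (max 0 (1 - u x y)) ^ 4" using ue e by (intro power_mono) auto
      also have "\<dots> \<le> (max 0 (1 - u x y)) ^ 4 * (1 + (4 - lam) * u x y)"
        using u0 lam by (simp add: mult_le_cancel_left1)
      finally have p: "1/4 \<le> pr lam (u x y)" using lam by (simp add: pr_def)
      have "3 / (16 * e) = (e * (3/4)) / (2 * e)\<^sup>2" using e by (simp add: power2_eq_square field_simps)
      also have "\<dots> \<le> e * (1 - e) / (u x y + e)\<^sup>2"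
        using e u0 ue by (intro frac_le mult_left_mono power_mono) auto
      finally have k: "3 / (16 * e) \<le> e * (1 - e) / (u x y + e)\<^sup>2" .
      have "1 / (4 * y0\<^sup>2) \<le> 1 / y\<^sup>2"
        using y y2 y0 power_mono[of y "2 * y0" 2] by (intro divide_left_mono) auto
      then have "c \<le> K * (1 / y\<^sup>2)"
        unfolding c_def K_def using p k e by (intro mult_mono) auto
      moreover have "m / 2 \<le> w x y" using near[of x y] z zz ue e by simp
      ultimately have "m / 2 * c \<le> w x y * (K * (1 / y\<^sup>2))"
        using \<open>w x0 y0 > 0\<close> c0 by (intro mult_mono) (auto simp: m_def)
      also have "w x y * (K * (1 / y\<^sup>2)) = F z" using Fz by simp
      finally show ?thesis using True Gn by (simp only: if_True)
    next
      case False
      have "- 20 * G z \<le> F z"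
      proof (cases "u x y \<le> t")
        case True
        then have "w x y \<ge> 0" using near[of x y] z zz m by (auto simp: m_def)
        then show ?thesis using K0 Gn Fz by (simp add: order_trans[of _ 0])
      next
        case False
        have "K \<le> 20 * bump (u x y)"
        proof (cases "u x y \<le> 1")
          case True
          have "e * (1 - e) / (u x y + e)\<^sup>2 \<le> e / t\<^sup>2"
            using False e t by (intro frac_le power_mono) (auto simp: mult_le_cancel_left1)
          then have "e * (1 - e) / (u x y + e)\<^sup>2 \<le> 1" using t by (simp add: e_def)
          moreover have "pr lam (u x y) \<le> 5" using pr_bounds(1)[OF lam u0 True] by auto
          ultimately have "K \<le> 5 * 1" unfolding K_def using e pr_nonneg[OF lam u0] by (intro mult_mono) auto
          then show ?thesis using bump_ge[OF True] by simp
        qed (simp add: K_def pr_supp[OF lam] bump_nonneg)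
        then have "\<bar>w x y\<bar> * K / y\<^sup>2 \<le> \<bar>w x y\<bar> * (20 * bump (u x y)) / y\<^sup>2" by (intro divide_right_mono mult_left_mono) auto
        moreover have "- (\<bar>w x y\<bar> * K / y\<^sup>2) \<le> F z"
        proof -
          have "(- \<bar>w x y\<bar>) * K / y\<^sup>2 \<le> w x y * K / y\<^sup>2"
            using K0 by (intro divide_right_mono mult_right_mono) auto
          then show ?thesis unfolding Fz by simp
        qed
        ultimately show ?thesis by (simp add: G_def zz)
      qed
      then show ?thesis using False by simp
    qed
  qed (use IB IG IF in \<open>auto intro!: integrable_diff integrable_on_cmult_left simp: has_integral_integrable\<close>)
  also have "integral ?Q F \<le> 2000 * A"
  proof -
    define H where "H = (\<lambda>(x, y). w x y * (radial_lap (pf1 lam e) (pf2 lam e) (u x y) + lam * pf lam e (u x y)) / y\<^sup>2)"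
    have e1: "e \<le> 1" using e by auto
    have "integral ?Q H = 0"
      unfolding H_def u_def
      by (rule green_eigen[OF E y0]) (use e pf_d1[OF lam] pf_d2[OF lam] pf_cont[OF lam] pf_supp[OF lam] in auto)
    moreover have "H integrable_on ?Q"
    proof -
      have "continuous_on {0..} (pf1 lam e)" "continuous_on {0..} (pf lam e)"
        using pf_d1[OF lam e(1)] pf_d2[OF lam e(1)] by (auto intro!: DERIV_continuous_on intro: DERIV_subset)
      note cc = continuous_on_radial[OF y0 Q this(1), of x0, folded u_def] continuous_on_radial[OF y0 Q this(2), of
          x0, folded u_def]
        continuous_on_radial[OF y0 Q pf_cont[OF lam e(1)], of x0, folded u_def]
      show ?thesis unfolding H_def case_prod_unfold radial_lap_def
        by (rule integrable_continuous, intro continuous_on_divide continuous_on_mult continuous_on_power continuous_on_add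
          continuous_on_const continuous_on_snd continuous_on_id cw cu cc ballI power_not_zero nzy; assumption)
    qed
    ultimately have "integral ?Q F = integral ?Q (\<lambda>z. F z - H z)" using IF by (subst integral_diff) auto
    also have "\<dots> \<le> integral ?Q (\<lambda>z. 2000 * G z)"
    proof (rule integral_le)
      fix z assume z: "z \<in> ?Q"
      obtain x y where zz: "z = (x, y)" by (cases z)
      have u0: "u x y \<ge> 0" using un[of x y] z zz by simp
      let ?D = "radial_lap (pf1 lam e) (pf2 lam e) (u x y)
          + lam * pf lam e (u x y) - pr lam (u x y) * (e * (1 - e) / (u x y + e)\<^sup>2)"
      have "F z - H z = - (w x y * ?D / y\<^sup>2)"
        by (simp add: F_def H_def zz divide_inverse algebra_simps)
      also have "\<dots> \<le> \<bar>w x y * ?D / y\<^sup>2\<bar>" by (rule abs_ge_minus_self)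
      also have "\<dots> = \<bar>w x y\<bar> * \<bar>?D\<bar> / y\<^sup>2" by (simp add: abs_mult)
      also have "\<dots> \<le> \<bar>w x y\<bar> * (2000 * bump (u x y)) / y\<^sup>2"
        by (intro divide_right_mono mult_left_mono pf_operator[OF lam e(1) e1 u0]) auto
      finally show "F z - H z \<le> 2000 * G z" by (simp add: G_def zz mult_ac)
    qed (use IF IG \<open>H integrable_on ?Q\<close> in \<open>auto intro!: integrable_diff integrable_on_cmult_left\<close>)
    also have "\<dots> = 2000 * A" by (simp add: A_def G_def)
    finally show ?thesis .
  qed
  finally have "m/2 * (c * (2 * r)\<^sup>2) - 20 * A \<le> 2000 * A" by (simp only: mult.assoc)
  moreover have cr: "c * (2 * r)\<^sup>2 = 3/64" using r e y0 by (simp add: c_def power_mult_distrib)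
  ultimately have "m * (3/128) \<le> 2020 * A" unfolding cr by simp
  moreover have "A \<ge> 0" unfolding A_def G_def[symmetric]
    by (rule integral_nonneg[OF IG]) (auto simp: G_def bump_nonneg)
  ultimately have "m \<le> 100000 * A" by simp
  then show ?thesis by (simp add: m_def A_def u_def)
qed

lemma sup_estimate:
  assumes E: "eigen_jet lam w wx wy wxx" and lam: "0 \<le> lam" "lam \<le> 1" and y0: "y0 > 0"
  shows "\<bar>w x0 y0\<bar> \<le> 100000 * integral (ubox x0 y0) (\<lambda>(x, y). \<bar>w x y\<bar> * bump (uu x0 y0 x y) / y\<^sup>2)"
proof (cases "w x0 y0" "0::real" rule: linorder_cases)
  case greater
  then show ?thesis using sup_estimate_pos[OF E lam y0 greater] by simp
next
  case less
  then show ?thesis using sup_estimate_pos[OF eigen_jet_uminus[OF E] lam y0, of x0] by simp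
next
  case equal
  note Q = ubox_subset[OF y0, of x0]
  have cw: "continuous_on (ubox x0 y0) (\<lambda>z. w (fst z) (snd z))"
    using E cont_case_prodD[OF _ Q] unfolding eigen_jet_def by auto
  have nzy: "\<And>z. z \<in> ubox x0 y0 \<Longrightarrow> snd z \<noteq> 0" using Q by auto
  have "(\<lambda>(x, y). \<bar>w x y\<bar> * bump (uu x0 y0 x y) / y\<^sup>2) integrable_on (ubox x0 y0)"
    unfolding case_prod_unfold using nzy
    by (intro integrable_continuous continuous_intros cw
          continuous_on_compose2[OF bump_cont(1)[of UNIV] continuous_on_uu_parts(1)[OF y0 Q]]) auto
  then have "0 \<le> integral (ubox x0 y0) (\<lambda>(x, y). \<bar>w x y\<bar> * bump (uu x0 y0 x y) / y\<^sup>2)"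
    by (rule Henstock_Kurzweil_Integration.integral_nonneg) (auto simp: bump_nonneg)
  then show ?thesis using equal by simp
qed


section \<open>Derivatives of positive eigenfunctions\<close>

lemma content_ubox: "y0 > 0 \<Longrightarrow> measure lborel (ubox x0 y0) \<le> 800 * y0\<^sup>2"
  by (simp add: content_Pair power2_eq_square)

lemma ubox_y_bound: "y0 > 0 \<Longrightarrow> (x, y) \<in> ubox x0 y0 \<Longrightarrow> y > 0 \<and> 1 / y\<^sup>2 \<le> 400 / y0\<^sup>2"
proof -
  assume y0: "y0 > 0" and "(x, y) \<in> ubox x0 y0"
  then have y: "y \<ge> y0 / 20" by (auto simp: cbox_Pair_eq)
  then have "(y0 / 20)\<^sup>2 \<le> y\<^sup>2" using y0 by (intro power_mono) auto
  moreover have "y > 0" using y y0 by linarith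
  ultimately show ?thesis using y0 by (simp add: field_simps power2_eq_square)
qed

text \<open>Green's formula for \<open>w\<^sup>2\<close> against the cutoff bounds the mean of \<open>wx\<^sup>2\<close> by \<open>M\<^sup>2\<close>, since
  \<open>y\<^sup>2 \<Delta> w\<^sup>2 = 2 y\<^sup>2 |\<nabla>w|\<^sup>2 - 2 lam w\<^sup>2\<close>.  As \<open>wx\<close> is again an eigenfunction, its value at the centre is
  bounded by the mean of \<open>|wx|\<close>, and \<open>2 |wx| \<le> y0 wx\<^sup>2 / M + M / y0\<close> reduces that to the mean of \<open>wx\<^sup>2\<close>.\<close>

lemma gradient_bound_pos:
  assumes E: "eigen_jet lam w wx wy wxx" and E': "eigen_jet lam wx wxx wxy wxxx"
    and lam: "0 \<le> lam" "lam \<le> 1" and y0: "y0 > 0"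
    and M: "M > 0" "\<And>x y. (x, y) \<in> ubox x0 y0 \<Longrightarrow> \<bar>w x y\<bar> \<le> M"
  shows "\<bar>wx x0 y0\<bar> \<le> 10 ^ 14 * M / y0"
proof -
  let ?Q = "ubox x0 y0"
  define u where "u = uu x0 y0"
  note Q = ubox_subset[OF y0, of x0]
  have cw: "continuous_on ?Q (\<lambda>z. w (fst z) (snd z))" and cwx: "continuous_on ?Q (\<lambda>z. wx (fst z) (snd z))"
    and cwy: "continuous_on ?Q (\<lambda>z. wy (fst z) (snd z))" and cwxx: "continuous_on ?Q (\<lambda>z. wxx (fst z) (snd z))"
    using E cont_case_prodD[OF _ Q] unfolding eigen_jet_def by auto
  have cu: "continuous_on ?Q (\<lambda>z. u (fst z) (snd z))"
    using continuous_on_uu_parts(1)[OF y0 Q] by (simp add: u_def)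
  have cb: "continuous_on ?Q (\<lambda>z. bump (u (fst z) (snd z)))" "continuous_on ?Q (\<lambda>z. bump1 (u (fst z) (snd z)))"
     "continuous_on ?Q (\<lambda>z. bump2 (u (fst z) (snd z)))"
    by (rule continuous_on_compose2[OF _ cu, of UNIV]; simp add: bump_cont)+
  have nzy: "\<And>z. z \<in> ?Q \<Longrightarrow> snd z \<noteq> 0"
  proof -
    fix z assume "z \<in> ?Q"
    then show "snd z \<noteq> 0" using ubox_y_bound[OF y0, of "fst z" "snd z" x0] by simp
  qed
  note ci = continuous_on_divide continuous_on_mult continuous_on_power continuous_on_add continuous_on_diff
      continuous_on_rabs
          continuous_on_const continuous_on_snd continuous_on_id cw cwx cwy cwxx cu cb
  define T where "T = (\<lambda>x y. - lam / y\<^sup>2 * w x y - wxx x y)"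
  define W where "W = (\<lambda>x y. 2 * (wx x y)\<^sup>2 + 2 * w x y * wxx x y + (2 * (wy x y)\<^sup>2 + 2 * w x y * T x y))"
  have W: "W x y = 2 * (wx x y)\<^sup>2 + 2 * (wy x y)\<^sup>2 - 2 * lam * (w x y)\<^sup>2 / y\<^sup>2" for x y
    by (simp add: W_def T_def power2_eq_square algebra_simps)
  have G: "integral ?Q (\<lambda>(x, y). W x y * bump (u x y)) = integral ?Q (\<lambda>(x, y). (w x y)\<^sup>2 * radial_lap bump1 bump2
      (u x y) / y\<^sup>2)"
    unfolding W_def u_def
  proof (rule green_radial[OF y0, where wx = "\<lambda>x y. 2 * w x y * wx x y" and wy = "\<lambda>x y. 2 * w x y * wy x y"])
    fix x y :: real assume y: "y > 0"
    from E y have d: "((\<lambda>x. w x y) has_real_derivative wx x y) (at x)"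
        "((\<lambda>x. wx x y) has_real_derivative wxx x y) (at x)"
        "((\<lambda>y. w x y) has_real_derivative wy x y) (at y)"
        "((\<lambda>y. wy x y) has_real_derivative T x y) (at y)"
      by (auto simp: eigen_jet_def T_def)
    show "((\<lambda>x. (w x y)\<^sup>2) has_real_derivative 2 * w x y * wx x y) (at x)"
      by (auto intro!: derivative_eq_intros d)
    show "((\<lambda>x. 2 * w x y * wx x y) has_real_derivative 2 * (wx x y)\<^sup>2 + 2 * w x y * wxx x y) (at x)"
      by (auto intro!: derivative_eq_intros d simp: power2_eq_square)
    show "((\<lambda>y. (w x y)\<^sup>2) has_real_derivative 2 * w x y * wy x y) (at y)"
      by (auto intro!: derivative_eq_intros d)
    show "((\<lambda>y. 2 * w x y * wy x y) has_real_derivative 2 * (wy x y)\<^sup>2 + 2 * w x y * T x y) (at y)"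
      by (auto intro!: derivative_eq_intros d simp: power2_eq_square)
  next
    have c: "continuous_on (UNIV \<times> {0<..}) (\<lambda>z. w (fst z) (snd z))" "continuous_on (UNIV \<times> {0<..}) (\<lambda>z. wx (fst z) (snd z))"
      "continuous_on (UNIV \<times> {0<..}) (\<lambda>z. wy (fst z) (snd z))" "continuous_on (UNIV \<times> {0<..}) (\<lambda>z. wxx (fst z) (snd z))"
      using E cont_case_prodD[OF _ subset_refl] unfolding eigen_jet_def by auto
    show "continuous_on (UNIV \<times> {0<..}) (\<lambda>(x, y). (w x y)\<^sup>2)"
      "continuous_on (UNIV \<times> {0<..}) (\<lambda>(x, y). 2 * (wx x y)\<^sup>2 + 2 * w x y * wxx x y)"
      unfolding case_prod_unfold by (intro continuous_intros c)+
    show "continuous_on (UNIV \<times> {0<..}) (\<lambda>(x, y). 2 * (wy x y)\<^sup>2 + 2 * w x y * T x y)"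
      unfolding case_prod_unfold T_def by (intro continuous_intros c ballI) auto
  qed (use bump_d1 bump_d2 bump_cont bump_supp in auto)
  define J where "J = integral ?Q (\<lambda>(x, y). (wx x y)\<^sup>2 * bump (u x y))"
  have IJ: "(\<lambda>(x, y). (wx x y)\<^sup>2 * bump (u x y)) integrable_on ?Q"
    unfolding case_prod_unfold by (rule integrable_continuous, intro ci)
  have IW: "(\<lambda>(x, y). W x y * bump (u x y)) integrable_on ?Q"
    unfolding case_prod_unfold W by (rule integrable_continuous, intro ci ballI power_not_zero nzy; assumption)
  have IL: "(\<lambda>(x, y). 2 * lam * (w x y)\<^sup>2 / y\<^sup>2 * bump (u x y)) integrable_on ?Q"
    unfolding case_prod_unfold by (rule integrable_continuous, intro ci ballI power_not_zero nzy; assumption)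
  have IR: "(\<lambda>(x, y). (w x y)\<^sup>2 * radial_lap bump1 bump2 (u x y) / y\<^sup>2) integrable_on ?Q"
    unfolding case_prod_unfold radial_lap_def by (rule integrable_continuous, intro ci ballI power_not_zero nzy; assumption)
  have "2 * J = integral ?Q (\<lambda>z. 2 * (case z of (x, y) \<Rightarrow> (wx x y)\<^sup>2 * bump (u x y)))"
    by (simp add: J_def)
  also have "\<dots> \<le> integral ?Q (\<lambda>z. (case z of (x, y) \<Rightarrow> W x y * bump (u x y))
      + (case z of (x, y) \<Rightarrow> 2 * lam * (w x y)\<^sup>2 / y\<^sup>2 * bump (u x y)))"
  proof (rule integral_le)
    fix z assume "z \<in> ?Q"
    obtain x y where z: "z = (x, y)" by (cases z)
    have "2 * (wx x y)\<^sup>2 * bump (u x y) \<le> (W x y + 2 * lam * (w x y)\<^sup>2 / y\<^sup>2) * bump (u x y)"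
      using bump_nonneg by (intro mult_right_mono) (auto simp: W)
    then show "2 * (case z of (x, y) \<Rightarrow> (wx x y)\<^sup>2 * bump (u x y)) \<le>
       (case z of (x, y) \<Rightarrow> W x y * bump (u x y)) + (case z of (x, y) \<Rightarrow> 2 * lam * (w x y)\<^sup>2 / y\<^sup>2 * bump (u x y))"
      by (simp add: z distrib_right mult.assoc)
  qed (use IJ IW IL in \<open>auto intro!: integrable_add integrable_on_cmult_left\<close>)
  also have "\<dots> = integral ?Q (\<lambda>z. (case z of (x, y) \<Rightarrow> (w x y)\<^sup>2 * radial_lap bump1 bump2 (u x y) / y\<^sup>2)
      + (case z of (x, y) \<Rightarrow> 2 * lam * (w x y)\<^sup>2 / y\<^sup>2 * bump (u x y)))"
    using IW IL IR G by (simp add: integral_add)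
  also have "\<dots> \<le> integral ?Q (\<lambda>z. M\<^sup>2 * 26 * (400 / y0\<^sup>2))"
  proof (rule integral_le)
    fix z assume zQ: "z \<in> ?Q"
    obtain x y where z: "z = (x, y)" by (cases z)
    have yb: "y > 0" "1 / y\<^sup>2 \<le> 400 / y0\<^sup>2" using ubox_y_bound[OF y0, of x y x0] zQ z by auto
    have u0: "u x y \<ge> 0" unfolding u_def using uu_nonneg[OF y0 yb(1)] .
    have w2: "(w x y)\<^sup>2 \<le> M\<^sup>2" using M(2)[of x y] zQ z M(1) by (simp add: abs_le_square_iff[symmetric])
    have "\<bar>2 * lam * bump (u x y)\<bar> \<le> 2 * 1"
      using bump_le_1[OF u0] bump_nonneg[of "u x y"] lam mult_mono[of lam 1 "bump (u x y)" 1] by (simp add: abs_mult)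
    then have "radial_lap bump1 bump2 (u x y) + 2 * lam * bump (u x y) \<le> 26"
      using radial_bump_bound[OF u0] by linarith
    then have "(w x y)\<^sup>2 * (radial_lap bump1 bump2 (u x y) + 2 * lam * bump (u x y)) \<le> (w x y)\<^sup>2 * 26"
      by (intro mult_left_mono) auto
    also have "\<dots> \<le> M\<^sup>2 * 26" using w2 by simp
    finally have "((w x y)\<^sup>2 * (radial_lap bump1 bump2 (u x y) + 2 * lam * bump (u x y))) * (1 / y\<^sup>2)
        \<le> (M\<^sup>2 * 26) * (1 / y\<^sup>2)"
      by (intro mult_right_mono) auto
    also have "\<dots> \<le> (M\<^sup>2 * 26) * (400 / y0\<^sup>2)" using yb(2) by (intro mult_left_mono) auto
    finally show "(case z of (x, y) \<Rightarrow> (w x y)\<^sup>2 * radial_lap bump1 bump2 (u x y) / y\<^sup>2)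
        + (case z of (x, y) \<Rightarrow> 2 * lam * (w x y)\<^sup>2 / y\<^sup>2 * bump (u x y))
      \<le> M\<^sup>2 * 26 * (400 / y0\<^sup>2)"
      by (simp add: z algebra_simps add_divide_distrib)
  qed (use IL IR in \<open>auto intro!: integrable_add\<close>)
  also have "\<dots> = measure lborel ?Q * (M\<^sup>2 * 26 * (400 / y0\<^sup>2))"
    by (simp add: mult.commute)
  also have "\<dots> \<le> (800 * y0\<^sup>2) * (M\<^sup>2 * 26 * (400 / y0\<^sup>2))"
    by (intro mult_right_mono content_ubox[OF y0]) auto
  also have "\<dots> = 8320000 * M\<^sup>2" using y0 by simp
  finally have J: "J \<le> 4160000 * M\<^sup>2" by simp
  have "\<bar>wx x0 y0\<bar> \<le> 100000 * integral ?Q (\<lambda>(x, y). \<bar>wx x y\<bar> * bump (u x y) / y\<^sup>2)"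
    unfolding u_def by (rule sup_estimate[OF E' lam y0])
  also have "integral ?Q (\<lambda>(x, y). \<bar>wx x y\<bar> * bump (u x y) / y\<^sup>2) \<le>
      integral ?Q (\<lambda>z. (400 / y0\<^sup>2) * (y0 / (2 * M) * (case z of (x, y) \<Rightarrow> (wx x y)\<^sup>2 * bump (u x y)) + M / (2 * y0)))"
  proof (rule integral_le)
    show "(\<lambda>(x, y). \<bar>wx x y\<bar> * bump (u x y) / y\<^sup>2) integrable_on ?Q"
      unfolding case_prod_unfold by (rule integrable_continuous, intro ci ballI power_not_zero nzy; assumption)
    show "(\<lambda>z. (400 / y0\<^sup>2) * (y0 / (2 * M) * (case z of (x, y) \<Rightarrow> (wx x y)\<^sup>2 * bump (u x y))
        + M / (2 * y0))) integrable_on ?Q"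
      by (intro integrable_on_mult_right integrable_add IJ integrable_const)
  next
    fix z assume zQ: "z \<in> ?Q"
    obtain x y where z: "z = (x, y)" by (cases z)
    have yb: "y > 0" "1 / y\<^sup>2 \<le> 400 / y0\<^sup>2" using ubox_y_bound[OF y0, of x y x0] zQ z by auto
    have u0: "u x y \<ge> 0" unfolding u_def using uu_nonneg[OF y0 yb(1)] .
    let ?a = "\<bar>wx x y\<bar>" let ?b = "bump (u x y)"
    have "2 * ?a * (y0 * M) \<le> ?a\<^sup>2 * y0\<^sup>2 + M\<^sup>2"
      using zero_le_power2[of "?a * y0 - M"] by (simp only: power2_diff power_mult_distrib)
    then have "?a \<le> (?a\<^sup>2 * y0\<^sup>2 + M\<^sup>2) / (2 * (y0 * M))"
      using y0 M(1) by (simp add: le_divide_eq mult_ac)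
    also have "\<dots> = y0 / (2 * M) * ?a\<^sup>2 + M / (2 * y0)"
      using y0 M(1) by (simp add: field_simps power2_eq_square)
    finally have "?a * ?b \<le> (y0 / (2 * M) * ?a\<^sup>2 + M / (2 * y0)) * ?b"
      using bump_nonneg by (intro mult_right_mono)
    also have "\<dots> = y0 / (2 * M) * (?a\<^sup>2 * ?b) + M / (2 * y0) * ?b" by (simp add: distrib_right)
    also have "\<dots> \<le> y0 / (2 * M) * (?a\<^sup>2 * ?b) + M / (2 * y0) * 1"
      using bump_le_1[OF u0] y0 M(1) by (intro add_left_mono mult_left_mono) auto
    finally have "?a * ?b \<le> y0 / (2 * M) * (?a\<^sup>2 * ?b) + M / (2 * y0)" by simp
    moreover have "0 \<le> ?a * ?b" using bump_nonneg by simp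
    ultimately have "(1 / y\<^sup>2) * (?a * ?b) \<le> (400 / y0\<^sup>2) * (y0 / (2 * M) * (?a\<^sup>2 * ?b) + M / (2 * y0))"
      using yb by (intro mult_mono) auto
    then show "(case z of (x, y) \<Rightarrow> \<bar>wx x y\<bar> * bump (u x y) / y\<^sup>2)
         \<le> (400 / y0\<^sup>2) * (y0 / (2 * M) * (case z of (x, y) \<Rightarrow> (wx x y)\<^sup>2 * bump (u x y)) + M / (2 * y0))"
      by (simp add: z)
  qed
  also have "\<dots> = (400 / y0\<^sup>2) * (y0 / (2 * M) * J + measure lborel ?Q * (M / (2 * y0)))"
  proof -
    have I1: "(\<lambda>z. y0 / (2 * M) * (case z of (x, y) \<Rightarrow> (wx x y)\<^sup>2 * bump (u x y))) integrable_on ?Q"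
      by (intro integrable_on_mult_right IJ)
    have I2: "(\<lambda>z. M / (2 * y0)) integrable_on ?Q" by (rule integrable_const)
    show ?thesis unfolding integral_mult_right integral_add[OF I1 I2] J_def integral_const by simp
  qed
  also have "\<dots> \<le> (400 / y0\<^sup>2) * (y0 / (2 * M) * (4160000 * M\<^sup>2) + (800 * y0\<^sup>2) * (M / (2 * y0)))"
    using J y0 M(1) content_ubox[OF y0] by (intro mult_left_mono add_mono mult_right_mono) auto
  also have "\<dots> = 832160000 * M / y0" using y0 M(1) by (simp add: field_simps power2_eq_square)
  finally have "\<bar>wx x0 y0\<bar> \<le> 100000 * (832160000 * M / y0)" by simp
  also have "\<dots> \<le> 10 ^ 14 * M / y0" using y0 M(1) by (simp add: divide_right_mono)
  finally show ?thesis .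
qed

lemma gradient_bound:
  assumes E: "eigen_jet lam w wx wy wxx" and E': "eigen_jet lam wx wxx wxy wxxx"
    and lam: "0 \<le> lam" "lam \<le> 1" and y0: "y0 > 0"
    and M: "\<And>x y. (x, y) \<in> ubox x0 y0 \<Longrightarrow> \<bar>w x y\<bar> \<le> M"
  shows "\<bar>wx x0 y0\<bar> \<le> 10 ^ 14 * M / y0"
proof (rule field_le_epsilon)
  fix e :: real assume e: "e > 0"
  have "(x0, y0) \<in> ubox x0 y0" using y0 by (simp add: cbox_Pair_eq)
  from M[OF this] have M0: "M \<ge> 0" by linarith
  define h where "h = e * y0 / 10 ^ 14"
  have h: "h > 0" using e y0 by (simp add: h_def)
  have "\<bar>wx x0 y0\<bar> \<le> 10 ^ 14 * (M + h) / y0"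
  proof (rule gradient_bound_pos[OF E E' lam y0])
    fix x y assume "(x, y) \<in> ubox x0 y0"
    from M[OF this] h show "\<bar>w x y\<bar> \<le> M + h" by linarith
  qed (use M0 h in linarith)
  also have "\<dots> = 10 ^ 14 * M / y0 + e" using y0 by (simp add: h_def field_simps)
  finally show "\<bar>wx x0 y0\<bar> \<le> 10 ^ 14 * M / y0 + e" .
qed

text \<open>\<open>p k\<close> and \<open>q k\<close> stand for \<open>\<partial>\<^sub>x\<^sup>k u\<close> and \<open>\<partial>\<^sub>x\<^sup>k \<partial>\<^sub>y u\<close>, where \<open>u = p 0\<close> is an eigenfunction.  The equation is
  invariant under translation in \<open>x\<close>, so it holds for every \<open>p k\<close>.\<close>

locale eigen_system =
  fixes lam :: real and p q :: "nat \<Rightarrow> real \<Rightarrow> real \<Rightarrow> real"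
  assumes lam: "0 \<le> lam" "lam \<le> 1"
    and px: "\<And>k x y. y > 0 \<Longrightarrow> ((\<lambda>x. p k x y) has_real_derivative p (Suc k) x y) (at x)"
    and py: "\<And>k x y. y > 0 \<Longrightarrow> ((\<lambda>y. p k x y) has_real_derivative q k x y) (at y)"
    and qx: "\<And>k x y. y > 0 \<Longrightarrow> ((\<lambda>x. q k x y) has_real_derivative q (Suc k) x y) (at x)"
    and qy: "\<And>k x y. y > 0 \<Longrightarrow> ((\<lambda>y. q k x y) has_real_derivative - lam / y\<^sup>2 * p k x y - p (Suc (Suc k)) x y) (at y)"
    and pcont: "\<And>k. continuous_on (UNIV \<times> {0<..}) (\<lambda>(x, y). p k x y)"
    and qcont: "\<And>k. continuous_on (UNIV \<times> {0<..}) (\<lambda>(x, y). q k x y)"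
begin

lemma jet: "eigen_jet lam (p k) (p (Suc k)) (q k) (p (Suc (Suc k)))"
  unfolding eigen_jet_def using px py qy pcont qcont by auto

end

text \<open>Hyperbolic neighbourhoods of \<open>(x0, y0)\<close>, with \<open>ubox\<close> as the case \<open>R = 20\<close>.  A neighbourhood of a point of
  a neighbourhood lies in a larger one of the same family (\<open>hbox_subset_hbox\<close>), which is what iterating the
  estimates requires.\<close>

abbreviation hbox :: "real \<Rightarrow> real \<Rightarrow> real \<Rightarrow> (real \<times> real) set" where
  "hbox R x0 y0 \<equiv> cbox (x0 - R * y0, y0 / R) (x0 + R * y0, R * y0)"

lemma hbox_subset_hbox:
  assumes y0: "y0 > 0" and R: "R \<ge> 1" and S: "S \<ge> 1" and xy: "(x, y) \<in> hbox S x0 y0"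
  shows "hbox R x y \<subseteq> hbox (S * (R + 1)) x0 y0"
proof (rule subsetI)
  fix z assume z: "z \<in> hbox R x y"
  obtain x' y' where zz: "z = (x', y')" by (cases z)
  have a: "\<bar>x - x0\<bar> \<le> S * y0" "y0 / S \<le> y" "y \<le> S * y0" using xy by (auto simp: cbox_Pair_eq)
  have b: "\<bar>x' - x\<bar> \<le> R * y" "y / R \<le> y'" "y' \<le> R * y" using z by (auto simp: zz cbox_Pair_eq)
  have Ry: "R * y \<le> R * (S * y0)" using a R by (intro mult_left_mono) auto
  have "\<bar>x' - x0\<bar> \<le> S * (R + 1) * y0" using a(1) b(1) Ry by (simp add: algebra_simps)
  moreover have "y' \<le> S * (R + 1) * y0"
  proof -
    have "0 \<le> S * y0" using S y0 by simp
    then show ?thesis using b(3) Ry by (simp add: algebra_simps)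
  qed
  moreover have "y0 / (S * (R + 1)) \<le> y'"
  proof -
    have "y0 / (S * (R + 1)) \<le> y0 / (S * R)" using S R y0 by (intro divide_left_mono) auto
    also have "\<dots> = (y0 / S) / R" by simp
    also have "\<dots> \<le> y / R" using a R by (intro divide_right_mono) auto
    finally show ?thesis using b by simp
  qed
  ultimately show "z \<in> hbox (S * (R + 1)) x0 y0" by (auto simp: zz cbox_Pair_eq)
qed

lemma hbox_pos: "y0 > 0 \<Longrightarrow> R \<ge> 1 \<Longrightarrow> (x, y) \<in> hbox R x0 y0 \<Longrightarrow> y > 0"
proof -
  assume "y0 > 0" "R \<ge> 1" "(x, y) \<in> hbox R x0 y0"
  then have "y0 / R > 0" "y0 / R \<le> y" by (auto simp: cbox_Pair_eq)
  then show ?thesis by linarith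
qed

locale pos_eigen_system = eigen_system +
  assumes pos: "\<And>x y. y > 0 \<Longrightarrow> p 0 x y > 0"
begin

definition mass :: "real \<Rightarrow> real \<Rightarrow> real \<Rightarrow> real" where
  "mass R x0 y0 = integral (hbox R x0 y0) (\<lambda>(x, y). p 0 x y / y\<^sup>2)"

lemma mass_integrand_continuous:
  assumes "y0 > 0" "R \<ge> 1"
  shows "continuous_on (hbox R x0 y0) (\<lambda>(x, y). p 0 x y / y\<^sup>2)"
proof -
  have S: "hbox R x0 y0 \<subseteq> UNIV \<times> {0<..}" using hbox_pos[OF assms] by auto
  have nz: "snd z \<noteq> 0" if "z \<in> hbox R x0 y0" for z
    using hbox_pos[OF assms, of "fst z" "snd z" x0] that by auto
  show ?thesis unfolding case_prod_unfold
    by (intro continuous_on_divide continuous_on_power continuous_on_snd continuous_on_id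
      cont_case_prodD[OF pcont S] ballI power_not_zero nz; assumption)
qed

lemma mass_integrable:
  "y0 > 0 \<Longrightarrow> R \<ge> 1 \<Longrightarrow> (\<lambda>(x, y). p 0 x y / y\<^sup>2) integrable_on hbox R x0 y0"
  by (intro integrable_continuous mass_integrand_continuous)

lemma mass_integrand_nonneg: "y0 > 0 \<Longrightarrow> R \<ge> 1 \<Longrightarrow> z \<in> hbox R x0 y0 \<Longrightarrow> 0 \<le> (case z of (x, y) \<Rightarrow> p 0 x y / y\<^sup>2)"
proof -
  assume a: "y0 > 0" "R \<ge> 1" "z \<in> hbox R x0 y0"
  obtain x y where z: "z = (x, y)" by (cases z)
  have "y > 0" using hbox_pos[of y0 R x y x0] a z by simp
  from pos[OF this, of x] show ?thesis by (simp add: z)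
qed

lemma mass_nonneg: "y0 > 0 \<Longrightarrow> R \<ge> 1 \<Longrightarrow> mass R x0 y0 \<ge> 0"
  unfolding mass_def
  by (intro Henstock_Kurzweil_Integration.integral_nonneg mass_integrable mass_integrand_nonneg)

lemma mass_mono:
  assumes y0: "y0 > 0" and y: "y > 0" and R: "R \<ge> 1" "S \<ge> 1" and sub: "hbox R x y \<subseteq> hbox S x0 y0"
  shows "mass R x y \<le> mass S x0 y0"
  unfolding mass_def
  by (rule integral_subset_le[OF sub mass_integrable[OF y R(1)] mass_integrable[OF y0 R(2)]])
     (use mass_integrand_nonneg[OF y0 R(2)] in blast)

lemma mass_nearby:
  assumes y0: "y0 > 0" and R: "R \<ge> 1" "S \<ge> 1" and xy: "(x, y) \<in> hbox S x0 y0"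
  shows "mass R x y \<le> mass (S * (R + 1)) x0 y0"
proof (rule mass_mono[OF y0 hbox_pos[OF y0 R(2) xy] R(1) _ hbox_subset_hbox[OF y0 R xy]])
  show "1 \<le> S * (R + 1)" using R mult_mono[of 1 S 1 "R + 1"] by simp
qed

text \<open>For \<open>k = 0\<close> this is \<open>sup_estimate\<close>, in which \<open>|u| = u\<close>; each further derivative costs one application of
  \<open>gradient_bound\<close> and an enlargement of the neighbourhood.\<close>

lemma p_bound: "\<exists>C\<ge>0. \<exists>R\<ge>1. \<forall>x y. y > 0 \<longrightarrow> \<bar>p k x y\<bar> \<le> C / y ^ k * mass R x y"
proof (induction k)
  case 0
  have "\<bar>p 0 x0 y0\<bar> \<le> 100000 * mass 20 x0 y0" if y0: "y0 > 0" for x0 y0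
  proof -
    have "\<bar>p 0 x0 y0\<bar> \<le> 100000 * integral (ubox x0 y0) (\<lambda>(x, y). \<bar>p 0 x y\<bar> * bump (uu x0 y0 x y) / y\<^sup>2)"
      by (rule sup_estimate[OF jet lam y0])
    also have "integral (ubox x0 y0) (\<lambda>(x, y). \<bar>p 0 x y\<bar> * bump (uu x0 y0 x y) / y\<^sup>2) \<le> mass 20 x0 y0"
      unfolding mass_def
    proof (rule integral_le)
      note Q = ubox_subset[OF y0, of x0]
      have nz: "snd z \<noteq> 0" if "z \<in> ubox x0 y0" for z
        using hbox_pos[OF y0, of 20 "fst z" "snd z" x0] that by auto
      have cb: "continuous_on (ubox x0 y0) (\<lambda>z. bump (uu x0 y0 (fst z) (snd z)))"
        by (rule continuous_on_compose2[OF _ continuous_on_uu_parts(1)[OF y0 Q], of UNIV]; simp add: bump_cont)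
      show "(\<lambda>(x, y). \<bar>p 0 x y\<bar> * bump (uu x0 y0 x y) / y\<^sup>2) integrable_on ubox x0 y0"
        unfolding case_prod_unfold
        by (rule integrable_continuous, intro continuous_on_divide continuous_on_mult continuous_on_rabs
            continuous_on_power continuous_on_snd continuous_on_id
      cont_case_prodD[OF pcont Q] cb ballI power_not_zero nz; assumption)
      show "(\<lambda>(x, y). p 0 x y / y\<^sup>2) integrable_on ubox x0 y0" using mass_integrable[OF y0] by simp
      fix z assume z: "z \<in> ubox x0 y0"
      obtain x y where zz: "z = (x, y)" by (cases z)
      have y: "y > 0" using hbox_pos[OF y0, of 20 x y x0] z zz by auto
      have "p 0 x y * bump (uu x0 y0 x y) \<le> p 0 x y * 1"
        using pos[OF y, of x] bump_le_1[OF uu_nonneg[OF y0 y]] by (intro mult_left_mono) auto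
      then show "(case z of (x, y) \<Rightarrow> \<bar>p 0 x y\<bar> * bump (uu x0 y0 x y) / y\<^sup>2) \<le> (case z of (x, y) \<Rightarrow> p 0 x y / y\<^sup>2)"
        using pos[OF y, of x] by (simp add: zz divide_right_mono)
    qed
    finally show ?thesis by simp
  qed
  then show ?case by (intro exI[of _ 100000] conjI exI[of _ 20]) auto
next
  case (Suc k)
  then obtain C R where C: "C \<ge> 0" and R: "R \<ge> 1" and b: "\<And>x y. y > 0 \<Longrightarrow> \<bar>p k x y\<bar> \<le> C / y ^ k * mass R x y" by blast
  define R' where "R' = 20 * (R + 1)"
  have "\<bar>p (Suc k) x0 y0\<bar> \<le> (10 ^ 14 * (C * 20 ^ k)) / y0 ^ Suc k * mass R' x0 y0" if y0: "y0 > 0" for x0 y0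
  proof -
    have "\<bar>p (Suc k) x0 y0\<bar> \<le> 10 ^ 14 * (C * 20 ^ k / y0 ^ k * mass R' x0 y0) / y0"
    proof (rule gradient_bound[OF jet jet lam y0])
      fix x y assume xy: "(x, y) \<in> ubox x0 y0"
      have y: "y > 0" using hbox_pos[OF y0 _ xy] by simp
      have "y0 / 20 \<le> y" using xy by (simp add: cbox_Pair_eq)
      then have "C / y ^ k \<le> C / (y0 / 20) ^ k" using C y y0 by (intro divide_left_mono power_mono) auto
      then have "C / y ^ k \<le> C * 20 ^ k / y0 ^ k" by (simp add: power_divide)
      moreover have "mass R x y \<le> mass R' x0 y0" unfolding R'_def using mass_nearby[OF y0 R _ xy] by simp
      ultimately have "C / y ^ k * mass R x y \<le> C * 20 ^ k / y0 ^ k * mass R' x0 y0"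
        using C y y0 mass_nonneg[OF y R] by (intro mult_mono) auto
      with b[OF y, of x] show "\<bar>p k x y\<bar> \<le> C * 20 ^ k / y0 ^ k * mass R' x0 y0" by linarith
    qed
    then show ?thesis by (simp add: mult_ac)
  qed
  moreover have "10 ^ 14 * (C * 20 ^ k) \<ge> 0" "R' \<ge> 1" using C R by (auto simp: R'_def)
  ultimately show ?case by blast
qed

text \<open>The mean value theorem on \<open>[y, 2 y]\<close> gives a height \<open>s\<close> where \<open>q k\<close> is controlled by \<open>p k\<close>; from
  there to \<open>y\<close> the change of \<open>q k\<close> is controlled by its \<open>y\<close>-derivative, which the equation expresses through \<open>p k\<close> and
  \<open>p (k + 2)\<close>.\<close>

lemma q_bound: "\<exists>C\<ge>0. \<exists>R\<ge>1. \<forall>x y. y > 0 \<longrightarrow> \<bar>q k x y\<bar> \<le> C / y ^ Suc k * mass R x y"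
proof -
  obtain C R where C: "C \<ge> 0" and R: "R \<ge> 1" and b: "\<And>x y. y > 0 \<Longrightarrow> \<bar>p k x y\<bar> \<le> C / y ^ k * mass R x y"
    using p_bound[of k] by blast
  obtain D S where D: "D \<ge> 0" and S: "S \<ge> 1" and d: "\<And>x y. y > 0 \<Longrightarrow> \<bar>p (Suc (Suc k)) x y\<bar> \<le> D / y ^ Suc (Suc k) * mass S x y"
    using p_bound[of "Suc (Suc k)"] by blast
  define T where "T = 2 * (R + 1) + 2 * (S + 1)"
  have T: "T \<ge> 1" using R S by (simp add: T_def)
  have "\<bar>q k x y\<bar> \<le> (3 * C + D) / y ^ Suc k * mass T x y" if y: "y > 0" for x y
  proof -
    have near: "mass R x t \<le> mass T x y" "mass S x t \<le> mass T x y" if "t \<in> {y..2*y}" for t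
    proof -
      have "(x, t) \<in> hbox 2 x y" using that y by (auto simp: cbox_Pair_eq)
      from hbox_subset_hbox[OF y R _ this] hbox_subset_hbox[OF y S _ this]
      have h: "hbox R x t \<subseteq> hbox (2 * (R + 1)) x y" "hbox S x t \<subseteq> hbox (2 * (S + 1)) x y" by auto
      have m: "hbox A x y \<subseteq> hbox T x y" if "A \<le> T" "A > 0" for A
      proof -
        have "A * y \<le> T * y" "y / T \<le> y / A" using that y T by (auto intro!: divide_left_mono mult_pos_pos)
        then show ?thesis by (auto simp: cbox_Pair_eq)
      qed
      have "hbox R x t \<subseteq> hbox T x y" "hbox S x t \<subseteq> hbox T x y"
        using h m[of "2 * (R + 1)"] m[of "2 * (S + 1)"] R S by (auto simp: T_def)
      then show "mass R x t \<le> mass T x y" "mass S x t \<le> mass T x y"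
        using mass_mono[OF y _ R T] mass_mono[OF y _ S T] that y by auto
    qed
    have N: "0 \<le> mass T x y" using mass_nonneg[OF y T] .
    have pb: "\<bar>p k x t\<bar> \<le> C / y ^ k * mass T x y" if t: "t \<in> {y..2*y}" for t
    proof -
      have "C / t ^ k \<le> C / y ^ k" using t y C by (intro divide_left_mono power_mono) auto
      then have "C / t ^ k * mass R x t \<le> C / y ^ k * mass T x y"
        using near(1)[OF t] mass_nonneg[of t R x] t y R C by (intro mult_mono) auto
      then show ?thesis using b[of t x] t y by force
    qed
    have pd: "\<bar>p (Suc (Suc k)) x t\<bar> \<le> D / y ^ Suc (Suc k) * mass T x y" if t: "t \<in> {y..2*y}" for t
    proof -
      have "D / t ^ Suc (Suc k) \<le> D / y ^ Suc (Suc k)" using t y D by (intro divide_left_mono power_mono) auto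
      then have "D / t ^ Suc (Suc k) * mass S x t \<le> D / y ^ Suc (Suc k) * mass T x y"
        using near(2)[OF t] mass_nonneg[of t S x] t y S D by (intro mult_mono) auto
      then show ?thesis using d[of t x] t y by force
    qed
    obtain s where s: "s > y" "s < 2 * y" "p k x (2 * y) - p k x y = (2 * y - y) * q k x s"
      using MVT2[of y "2 * y" "\<lambda>t. p k x t" "\<lambda>t. q k x t"] py y by auto
    obtain r where r: "r > y" "r < s" "q k x s - q k x y = (s - y) * (- lam / r\<^sup>2 * p k x r - p (Suc (Suc k)) x r)"
      using MVT2[of y s "\<lambda>t. q k x t" "\<lambda>t. - lam / t\<^sup>2 * p k x t - p (Suc (Suc k)) x t"] qy y s(1) by auto
    define m where "m = mass T x y / y ^ Suc k"
    have m0: "m \<ge> 0" using N y by (simp add: m_def)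
    have "\<bar>q k x s\<bar> * y = \<bar>p k x (2 * y) - p k x y\<bar>" using s y by (simp add: abs_mult)
    also have "\<dots> \<le> 2 * (C / y ^ k * mass T x y)" using pb[of y] pb[of "2 * y"] y by auto
    also have "\<dots> = 2 * C * m * y" using y by (simp add: m_def)
    finally have 1: "\<bar>q k x s\<bar> \<le> 2 * C * m" using y by simp
    have 2: "\<bar>- lam / r\<^sup>2 * p k x r - p (Suc (Suc k)) x r\<bar> \<le> (C * m + D * m) / y"
    proof -
      have "lam / r\<^sup>2 \<le> 1 / y\<^sup>2" using lam r y by (intro frac_le power_mono) auto
      then have "\<bar>- lam / r\<^sup>2\<bar> \<le> 1 / y\<^sup>2" using lam by simp
      from abs_mult_le[OF lam this pb[of r]] have "\<bar>- lam / r\<^sup>2 * p k x r\<bar> \<le> 1 / y\<^sup>2 * (C / y ^ k * mass T x y)"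
        using r s by auto
      also have "\<dots> = C * m / y" using y by (simp add: m_def power2_eq_square)
      finally have "\<bar>- lam / r\<^sup>2 * p k x r\<bar> \<le> C * m / y" .
      moreover have "\<bar>p (Suc (Suc k)) x r\<bar> \<le> D * m / y"
        using pd[of r] r s y by (simp add: m_def mult_ac)
      ultimately show ?thesis unfolding add_divide_distrib by linarith
    qed
    have "\<bar>q k x s - q k x y\<bar> \<le> y * ((C * m + D * m) / y)"
      unfolding r(3) using s by (intro abs_mult_le[OF lam] 2) auto
    also have "\<dots> = C * m + D * m" using y by simp
    finally have "\<bar>q k x y\<bar> \<le> 3 * C * m + D * m" using 1 by linarith
    also have "\<dots> = (3 * C + D) / y ^ Suc k * mass T x y"
      by (simp add: m_def add_divide_distrib distrib_right)
    finally show ?thesis .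
  qed
  then show ?thesis using C D T by (intro exI[of _ "3 * C + D"] conjI exI[of _ T]) auto
qed

end


section \<open>The ladder as an algebra of coefficient polynomials\<close>

text \<open>A pair \<open>(A, B)\<close> of polynomials stands for \<open>\<Sum>\<^sub>k A\<^sub>k y\<^sup>k \<partial>\<^sub>x\<^sup>k u + \<Sum>\<^sub>k B\<^sub>k y\<^bsup>k+1\<^esup> \<partial>\<^sub>x\<^sup>k \<partial>\<^sub>y u\<close>, see \<open>rv\<close>
  below.  By the eigenvalue equation the operators \<open>y \<partial>\<^sub>x\<close> and \<open>y \<partial>\<^sub>y\<close> preserve this class; \<open>opX\<close> and \<open>opY\<close> are
  their effect on the coefficients.\<close>

type_synonym jet_comb = "complex poly \<times> complex poly"

definition scl :: "complex \<Rightarrow> jet_comb \<Rightarrow> jet_comb" where "scl c P = (smult c (fst P), smult c (snd P))"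
definition opX :: "jet_comb \<Rightarrow> jet_comb" where "opX P = (pCons 0 (fst P), pCons 0 (snd P))"
definition opY :: "real \<Rightarrow> jet_comb \<Rightarrow> jet_comb" where
  "opY lam P = (pCons 0 (pderiv (fst P)) - smult (of_real lam) (snd P) - pCons 0 (pCons 0 (snd P)),
                fst P + snd P + pCons 0 (pderiv (snd P)))"

lemma jet_comb_eqI: "fst P = fst Q \<Longrightarrow> snd P = snd Q \<Longrightarrow> P = (Q :: jet_comb)"
  by (simp add: prod_eq_iff)

lemmas op_defs = scl_def opX_def opY_def

lemma opX_add: "opX (P + Q) = opX P + opX Q" and opX_diff: "opX (P - Q) = opX P - opX Q"
  and opX_scl: "opX (scl c P) = scl c (opX P)"
  by (auto intro!: jet_comb_eqI simp: op_defs)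

lemma opY_add: "opY lam (P + Q) = opY lam P + opY lam Q" and opY_diff: "opY lam (P - Q) = opY lam P - opY lam Q"
  and opY_scl: "opY lam (scl c P) = scl c (opY lam P)"
  by (auto intro!: jet_comb_eqI simp: op_defs pderiv_add pderiv_diff pderiv_smult smult_add_right smult_diff_right
      algebra_simps)

text \<open>The commutator of \<open>y \<partial>\<^sub>y\<close> and \<open>y \<partial>\<^sub>x\<close> is \<open>y \<partial>\<^sub>x\<close>.\<close>

lemma opXY: "opY lam (opX P) = opX (opY lam P) + opX P"
  by (rule jet_comb_eqI) (simp_all add: op_defs pderiv_pCons algebra_simps)

text \<open>\<open>y\<^sup>2 (\<partial>\<^sub>x\<^sup>2 + \<partial>\<^sub>y\<^sup>2) = (y \<partial>\<^sub>x)\<^sup>2 + (y \<partial>\<^sub>y)\<^sup>2 - y \<partial>\<^sub>y\<close>.\<close>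

definition opLap :: "real \<Rightarrow> jet_comb \<Rightarrow> jet_comb" where
  "opLap lam P = opX (opX P) + opY lam (opY lam P) - opY lam P"

text \<open>The raising and lowering operators on \<open>e\<^bsup>2il\<theta>\<^esup> f(x, y)\<close>, expressed by their effect on \<open>f\<close>.\<close>

definition rais :: "real \<Rightarrow> nat \<Rightarrow> jet_comb \<Rightarrow> jet_comb" where
  "rais lam l P = scl \<i> (opX P) + opY lam P + scl (of_nat l) P"
definition lowr :: "real \<Rightarrow> nat \<Rightarrow> jet_comb \<Rightarrow> jet_comb" where
  "lowr lam l P = opY lam P - scl \<i> (opX P) - scl (of_nat l) P"

text \<open>For \<open>lam = \<delta>(1 - \<delta>)\<close> this is \<open>(\<delta> + l)(1 - \<delta> + l)\<close>.\<close>

definition cc :: "real \<Rightarrow> nat \<Rightarrow> real" where "cc lam l = lam + real l + (real l)\<^sup>2"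

primrec ladder :: "real \<Rightarrow> nat \<Rightarrow> jet_comb" where
  "ladder lam 0 = (1, 0)"
| "ladder lam (Suc l) = rais lam l (ladder lam l)"

lemma jet_comb_eq_iff:
  fixes P Q :: jet_comb shows "P = Q \<longleftrightarrow> (\<forall>i. coeff (fst P) i = coeff (fst Q) i) \<and> (\<forall>i. coeff (snd P) i = coeff (snd Q) i)"
  by (auto simp: prod_eq_iff poly_eq_iff)

lemma scl_coeffs: "coeff (fst (scl c P)) i = c * coeff (fst P) i" "coeff (snd (scl c P)) i = c * coeff (snd P) i"
  by (simp_all add: scl_def)

lemma lowr_rais:
  "lowr lam (Suc l) (rais lam l P) = opLap lam P - scl (2 * \<i> * of_nat l) (opX P) - scl (of_nat (l * (l + 1))) P"
  unfolding lowr_def rais_def opLap_def opX_add opX_diff opX_scl opY_add opY_diff opY_scl opXY jet_comb_eq_iff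
  by (simp add: scl_coeffs algebra_simps)

lemma rais_lowr:
  "rais lam l (lowr lam (Suc l) P) = opLap lam P - scl (2 * \<i> * of_nat (Suc l)) (opX P) - scl (of_nat (l * (l + 1))) P"
  unfolding lowr_def rais_def opLap_def opX_add opX_diff opX_scl opY_add opY_diff opY_scl opXY jet_comb_eq_iff
  by (simp add: scl_coeffs algebra_simps)

lemma rais_scl: "rais lam l (scl c P) = scl c (rais lam l P)"
  unfolding rais_def opX_scl opY_scl jet_comb_eq_iff by (simp add: scl_coeffs algebra_simps)

text \<open>Lowering after raising, and raising after lowering, differ from the weight \<open>l\<close>
  Laplacian \<open>y\<^sup>2 \<Delta> - 2 i l y \<partial>\<^sub>x\<close> of \<open>lowr_rais\<close> and \<open>rais_lowr\<close> by constants.  If the \<open>l\<close>-th rung is an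
  eigenvector of it, lowering the next rung gives a multiple of the \<open>l\<close>-th one, and raising that again shows
  that the next rung is an eigenvector.\<close>

lemma casimir:
  "opLap lam (ladder lam l) - scl (2 * \<i> * of_nat l) (opX (ladder lam l)) = scl (- of_real lam) (ladder lam l)"
  and lower_ladder: "lowr lam (Suc l) (ladder lam (Suc l)) = scl (- of_real (cc lam l)) (ladder lam l)"
proof -
  have step: "lowr lam (Suc l) (ladder lam (Suc l)) = scl (- of_real (cc lam l)) (ladder lam l)"
    if "opLap lam (ladder lam l) - scl (2 * \<i> * of_nat l) (opX (ladder lam l)) = scl (- of_real lam) (ladder lam l)" for l
    unfolding ladder.simps lowr_rais that
    by (simp add: jet_comb_eq_iff scl_coeffs cc_def algebra_simps power2_eq_square)
  have C: "opLap lam (ladder lam l) - scl (2 * \<i> * of_nat l) (opX (ladder lam l)) = scl (- of_real lam) (ladder lam l)" for l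
  proof (induction l)
    case 0
    show ?case
      by (rule jet_comb_eqI) (simp_all add: opLap_def op_defs pderiv_pCons one_pCons)
  next
    case (Suc l)
    have "rais lam l (lowr lam (Suc l) (ladder lam (Suc l))) = scl (- of_real (cc lam l)) (ladder lam (Suc l))"
      unfolding step[OF Suc.IH] rais_scl by simp
    then have "opLap lam (ladder lam (Suc l)) - scl (2 * \<i> * of_nat (Suc l)) (opX (ladder lam (Suc l))) =
      scl (- of_real (cc lam l)) (ladder lam (Suc l)) + scl (of_nat (l * (l + 1))) (ladder lam (Suc l))"
      unfolding rais_lowr by (simp add: diff_eq_eq)
    also have "\<dots> = scl (- of_real lam) (ladder lam (Suc l))"
      by (simp add: jet_comb_eq_iff scl_coeffs cc_def algebra_simps power2_eq_square)
    finally show ?case .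
  qed
  show "opLap lam (ladder lam l) - scl (2 * \<i> * of_nat l) (opX (ladder lam l))
      = scl (- of_real lam) (ladder lam l)" by (rule C)
  show "lowr lam (Suc l) (ladder lam (Suc l)) = scl (- of_real (cc lam l)) (ladder lam l)" by (rule step[OF C])
qed
definition pev :: "complex poly \<Rightarrow> (nat \<Rightarrow> complex) \<Rightarrow> complex" where
  "pev A g = (\<Sum>j\<le>degree A. coeff A j * g j)"

lemma pev_alt: "degree A \<le> n \<Longrightarrow> pev A g = (\<Sum>j\<le>n. coeff A j * g j)"
  unfolding pev_def by (rule sum.mono_neutral_left) (auto simp: coeff_eq_0)

lemma pev_add: "pev (A + B) g = pev A g + pev B g"
  using pev_alt[of A "max (degree A) (degree B)" g] pev_alt[of B "max (degree A) (degree B)" g]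
    pev_alt[of "A + B" "max (degree A) (degree B)" g] degree_add_le_max[of A B]
  by (simp add: sum.distrib distrib_right)

lemma pev_diff: "pev (A - B) g = pev A g - pev B g"
  using pev_alt[of A "max (degree A) (degree B)" g] pev_alt[of B "max (degree A) (degree B)" g]
    pev_alt[of "A - B" "max (degree A) (degree B)" g] degree_diff_le_max[of A B]
  by (simp add: sum_subtractf left_diff_distrib)

lemma pev_smult: "pev (smult c A) g = c * pev A g"
  using pev_alt[of "smult c A" "degree A" g] by (simp add: pev_def sum_distrib_left mult.assoc)

lemma pev_pCons: "pev (pCons 0 A) g = pev A (\<lambda>j. g (Suc j))"
proof -
  have "pev (pCons 0 A) g = (\<Sum>j\<le>Suc (degree A). coeff (pCons 0 A) j * g j)"
    by (rule pev_alt) (rule degree_pCons_le)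
  also have "\<dots> = pev A (\<lambda>j. g (Suc j))" by (subst sum.atMost_Suc_shift) (simp add: pev_def)
  finally show ?thesis .
qed

lemma pev_euler: "pev (pCons 0 (pderiv A)) g = (\<Sum>j\<le>degree A. coeff A j * (of_nat j * g j))"
proof -
  have "coeff (pCons 0 (pderiv A)) j = of_nat j * coeff A j" for j
    by (cases j) (auto simp: coeff_pderiv)
  moreover have "degree (pCons 0 (pderiv A)) \<le> degree A"
    using degree_pderiv[of A] by (cases "pderiv A = 0") (auto simp: pderiv_eq_0_iff)
  ultimately show ?thesis by (subst pev_alt) (auto simp: mult_ac)
qed

context eigen_system
begin

definition pterm :: "real \<Rightarrow> real \<Rightarrow> nat \<Rightarrow> complex" where "pterm x y j = of_real (y ^ j * p j x y)"
definition qterm :: "real \<Rightarrow> real \<Rightarrow> nat \<Rightarrow> complex" where "qterm x y j = of_real (y ^ Suc j * q j x y)"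

definition rv :: "jet_comb \<Rightarrow> real \<Rightarrow> real \<Rightarrow> complex" where
  "rv P x y = pev (fst P) (pterm x y) + pev (snd P) (qterm x y)"

lemma rv_add: "rv (P + Q) x y = rv P x y + rv Q x y" and rv_diff: "rv (P - Q) x y = rv P x y - rv Q x y"
  and rv_scl: "rv (scl c P) x y = c * rv P x y"
  by (simp_all add: rv_def scl_def pev_add pev_diff pev_smult algebra_simps)

lemma has_vd_of_real: "(f has_real_derivative D) (at t) \<Longrightarrow> ((\<lambda>t. complex_of_real (f t)) has_vector_derivative
    of_real D) (at t)"
  using has_vector_derivative_of_real by (simp add: has_real_derivative_iff_has_vector_derivative)

lemma rv_dx:
  assumes y: "y > 0"
  shows "((\<lambda>x. rv P x y) has_vector_derivative rv (opX P) x y / of_real y) (at x)"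
proof -
  have a: "((\<lambda>x. pterm x y j) has_vector_derivative pterm x y (Suc j) / of_real y) (at x)" for j
    unfolding pterm_def of_real_divide[symmetric]
    using y by (intro has_vd_of_real) (auto intro!: derivative_eq_intros px)
  have b: "((\<lambda>x. qterm x y j) has_vector_derivative qterm x y (Suc j) / of_real y) (at x)" for j
    unfolding qterm_def of_real_divide[symmetric]
    using y by (intro has_vd_of_real) (auto intro!: derivative_eq_intros qx)
  have "((\<lambda>x. rv P x y) has_vector_derivative
     pev (fst P) (\<lambda>j. pterm x y (Suc j) / of_real y) + pev (snd P) (\<lambda>j. qterm x y (Suc j) / of_real y)) (at x)"
    unfolding rv_def pev_def
    by (intro has_vector_derivative_add has_vector_derivative_sum has_vector_derivative_mult_right a b)
  also have "pev (fst P) (\<lambda>j. pterm x y (Suc j) / of_real y) + pev (snd P) (\<lambda>j. qterm x y (Suc j) / of_real y)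
     = rv (opX P) x y / of_real y"
    by (simp add: rv_def opX_def pev_pCons) (simp add: pev_def sum_divide_distrib add_divide_distrib)
  finally show ?thesis .
qed

lemma rv_dy:
  assumes y: "y > 0"
  shows "((\<lambda>y. rv P x y) has_vector_derivative rv (opY lam P) x y / of_real y) (at y)"
proof -
  have a: "((\<lambda>y. pterm x y j) has_vector_derivative (of_nat j * pterm x y j + qterm x y j) / of_real y) (at y)" for j
  proof -
    have "((\<lambda>y. y ^ j * p j x y) has_real_derivative (real j * (y ^ j * p j x y) + y ^ Suc j * q j x y) / y) (at y)"
      by (rule DERIV_cong[OF DERIV_mult[OF DERIV_pow py[OF y]]])
         (use y in \<open>cases j; simp add: field_simps\<close>)
    from has_vd_of_real[OF this] show ?thesis by (simp add: pterm_def qterm_def)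
  qed
  have b: "((\<lambda>y. qterm x y j) has_vector_derivative
      (of_nat j * qterm x y j + qterm x y j - of_real lam * pterm x y j - pterm x y (Suc (Suc j))) / of_real y) (at y)" for j
  proof -
    have "((\<lambda>y. y ^ Suc j * q j x y) has_real_derivative (real j * (y ^ Suc j * q j x y)
        + (y ^ Suc j * q j x y) - lam * (y ^ j * p j x y) - y ^ Suc (Suc j) * p (Suc (Suc j)) x y) / y) (at y)"
      by (rule DERIV_cong[OF DERIV_mult[OF DERIV_pow qy[OF y]]])
         (use y in \<open>simp add: field_simps power2_eq_square\<close>)
    from has_vd_of_real[OF this] show ?thesis by (simp add: pterm_def qterm_def)
  qed
  have "((\<lambda>y. rv P x y) has_vector_derivative
     pev (fst P) (\<lambda>j. (of_nat j * pterm x y j + qterm x y j) / of_real y) +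
     pev (snd P) (\<lambda>j. (of_nat j * qterm x y j + qterm x y j - of_real lam * pterm x y j - pterm x y (Suc (Suc j)))
         / of_real y)) (at y)"
    unfolding rv_def pev_def
    by (intro has_vector_derivative_add has_vector_derivative_sum has_vector_derivative_mult_right a b)
  also have "pev (fst P) (\<lambda>j. (of_nat j * pterm x y j + qterm x y j) / of_real y) +
     pev (snd P) (\<lambda>j. (of_nat j * qterm x y j + qterm x y j - of_real lam * pterm x y j - pterm x y (Suc (Suc j)))
         / of_real y)
     = rv (opY lam P) x y / of_real y"
    unfolding rv_def opY_def fst_conv snd_conv pev_add pev_diff pev_smult pev_euler
    unfolding pev_pCons
    unfolding pev_def
    by (simp add: sum_divide_distrib[symmetric] sum.distrib sum_subtractf distrib_left right_diff_distrib sum_distrib_left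
         add_divide_distrib diff_divide_distrib mult.left_commute)
  finally show ?thesis .
qed

lemma rv_cont: "continuous_on (UNIV \<times> {0<..}) (\<lambda>(x, y). rv P x y)"
  unfolding rv_def pev_def pterm_def qterm_def case_prod_unfold
  by (intro continuous_intros cont_case_prodD[OF pcont subset_refl] cont_case_prodD[OF qcont subset_refl])

text \<open>The function \<open>f\<^sub>l\<close>, which is \<open>R\<^sup>l \<phi>0\<close> on the slice \<open>\<theta> = 0\<close>.\<close>

definition fl :: "nat \<Rightarrow> real \<Rightarrow> real \<Rightarrow> complex" where "fl l = rv (ladder lam l)"

lemma fl_0: "fl 0 x y = of_real (p 0 x y)"
  by (simp add: fl_def rv_def pev_def pterm_def)

end


section \<open>Weight functions: Laplacian and automorphy\<close>

lemma moebius_derivative: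
  assumes A: "det A = 1" and z: "Im z > 0"
  shows "(moebius A has_field_derivative 1 / (mden A z)\<^sup>2) (at z)"
proof -
  have nz: "of_real (A$2$1) * z + of_real (A$2$2) \<noteq> 0" using mden_nonzero[OF A z] by (simp add: mden_def)
  have "of_real (A$1$1) * of_real (A$2$2) - of_real (A$1$2) * of_real (A$2$1) = (1::complex)"
    using A by (simp add: det_2 flip: of_real_mult of_real_diff)
  then have e: "of_real (A$1$1) * (of_real (A$2$1) * z + of_real (A$2$2)) - (of_real (A$1$1) * z
      + of_real (A$1$2)) * of_real (A$2$1) = 1"
    by (simp add: algebra_simps)
  show ?thesis
    unfolding moebius_def[abs_def] mden_def
    by (rule derivative_eq_intros refl nz | simp add: e power2_eq_square)+
qed

lemma Im_moebius:
  assumes A: "det A = 1" and z: "Im z > 0"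
  shows "complex_of_real (Im (moebius A z)) = of_real (Im z) / (mden A z * cnj (mden A z))" "Im (moebius A z) > 0"
proof -
  have nz: "mden A z \<noteq> 0" using mden_nonzero[OF A z] .
  have "Im (moebius A z) = Im z / (cmod (mden A z))\<^sup>2"
  proof -
    have "moebius A z = (of_real (A$1$1) * z + of_real (A$1$2)) * cnj (mden A z) / of_real ((cmod (mden A z))\<^sup>2)"
      using nz unfolding complex_norm_square by (simp add: moebius_def mden_def[symmetric])
    then have "Im (moebius A z) = Im ((of_real (A$1$1) * z + of_real (A$1$2)) * cnj (mden A z)) / (cmod (mden A z))\<^sup>2"
      by (simp only: Im_divide_of_real)
    also have "Im ((of_real (A$1$1) * z + of_real (A$1$2)) * cnj (mden A z)) = (A$1$1 * A$2$2 - A$1$2 * A$2$1) * Im z"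
      by (simp add: mden_def algebra_simps)
    finally show ?thesis using A by (simp add: det_2)
  qed
  then show "complex_of_real (Im (moebius A z)) = of_real (Im z) / (mden A z * cnj (mden A z))" "Im (moebius A z) > 0"
    using nz z by (simp_all add: complex_norm_square[symmetric])
qed

context eigen_system
begin

text \<open>\<open>y \<partial>\<^sub>x f\<^sub>l\<close> and \<open>y \<partial>\<^sub>y f\<^sub>l\<close>.\<close>

definition flX :: "nat \<Rightarrow> real \<Rightarrow> real \<Rightarrow> complex" where "flX l = rv (opX (ladder lam l))"
definition flY :: "nat \<Rightarrow> real \<Rightarrow> real \<Rightarrow> complex" where "flY l = rv (opY lam (ladder lam l))"

lemma fl_Suc: "fl (Suc l) x y = \<i> * flX l x y + flY l x y + of_nat l * fl l x y"
  by (simp add: fl_def flX_def flY_def rais_def rv_add rv_scl)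

lemma fl_lower: "flY (Suc l) x y - \<i> * flX (Suc l) x y - of_nat (Suc l) * fl (Suc l) x y = - of_real (cc lam l) * fl l x y"
proof -
  have "rv (lowr lam (Suc l) (ladder lam (Suc l))) x y = rv (scl (- of_real (cc lam l)) (ladder lam l)) x y"
    by (simp only: lower_ladder)
  then show ?thesis unfolding lowr_def rv_diff rv_scl fl_def flX_def flY_def .
qed

lemma fl_casimir:
  "rv (opX (opX (ladder lam l))) x y + rv (opY lam (opY lam (ladder lam l))) x y - flY l x y
     = 2 * \<i> * of_nat l * flX l x y - of_real lam * fl l x y"
proof -
  have "rv (opLap lam (ladder lam l) - scl (2 * \<i> * of_nat l) (opX (ladder lam l))) x y
      = rv (scl (- of_real lam) (ladder lam l)) x y"
    by (simp only: casimir)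
  then show ?thesis unfolding opLap_def rv_diff rv_add rv_scl fl_def flX_def flY_def by (simp add: algebra_simps)
qed

lemma flX_0: "flX 0 x y = of_real (y * p 1 x y)"
  by (simp add: flX_def opX_def rv_def pev_pCons pterm_def qterm_def) (simp add: pev_def pterm_def)

lemma flY_0: "flY 0 x y = of_real (y * q 0 x y)"
  by (simp add: flY_def opY_def rv_def pev_def pterm_def qterm_def)

text \<open>The squared moduli of \<open>f\<^sub>l\<close> and of what the lowering operator makes of it.\<close>

definition sl :: "nat \<Rightarrow> real \<Rightarrow> real \<Rightarrow> real" where "sl l x y = (cmod (fl l x y))\<^sup>2"
definition tl :: "nat \<Rightarrow> real \<Rightarrow> real \<Rightarrow> real" where
  "tl l x y = (cmod (flY l x y - \<i> * flX l x y - of_nat l * fl l x y))\<^sup>2"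

text \<open>At the bottom of the ladder lowering leads to the conjugate ladder: \<open>u\<close> is real, so its lowered
  function is the conjugate of the raised one.\<close>

lemma tl_0: "tl 0 x y = sl 1 x y"
proof -
  have "flY 0 x y - \<i> * flX 0 x y = cnj (fl 1 x y)"
    unfolding One_nat_def fl_Suc by (simp add: flX_0 flY_0 algebra_simps)
  then show ?thesis by (simp add: tl_def sl_def)
qed

lemma tl_Suc: "tl (Suc l) x y = (cc lam l)\<^sup>2 * sl l x y"
  unfolding tl_def sl_def fl_lower by (simp add: norm_mult power_mult_distrib)

definition slx :: "nat \<Rightarrow> real \<Rightarrow> real \<Rightarrow> real" where "slx l x y = 2 * (fl l x y \<bullet> flX l x y) / y"
definition sly :: "nat \<Rightarrow> real \<Rightarrow> real \<Rightarrow> real" where "sly l x y = 2 * (fl l x y \<bullet> flY l x y) / y"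
definition slxx :: "nat \<Rightarrow> real \<Rightarrow> real \<Rightarrow> real" where
  "slxx l x y = 2 * (flX l x y \<bullet> flX l x y + fl l x y \<bullet> rv (opX (opX (ladder lam l))) x y) / y\<^sup>2"
definition slyy :: "nat \<Rightarrow> real \<Rightarrow> real \<Rightarrow> real" where
  "slyy l x y = 2 * (flY l x y \<bullet> flY l x y + fl l x y \<bullet> (rv (opY lam (opY lam (ladder lam l))) x y - flY l x y)) / y\<^sup>2"

lemma inner_deriv:
  fixes f g :: "real \<Rightarrow> complex"
  assumes "(f has_vector_derivative f') (at t)" "(g has_vector_derivative g') (at t)"
  shows "((\<lambda>t. f t \<bullet> g t) has_real_derivative (f t \<bullet> g' + f' \<bullet> g t)) (at t)"
  using bounded_bilinear.has_vector_derivative[OF bounded_bilinear_inner assms]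
  by (simp add: has_real_derivative_iff_has_vector_derivative)

lemma sl_derivs:
  assumes y: "y > 0"
  shows "((\<lambda>x. sl l x y) has_real_derivative slx l x y) (at x)"
    "((\<lambda>x. slx l x y) has_real_derivative slxx l x y) (at x)"
    "((\<lambda>y. sl l x y) has_real_derivative sly l x y) (at y)"
    "((\<lambda>y. sly l x y) has_real_derivative slyy l x y) (at y)"
proof -
  have s: "sl l = (\<lambda>x y. fl l x y \<bullet> fl l x y)" by (simp add: sl_def power2_norm_eq_inner fun_eq_iff)
  have dX: "((\<lambda>x. fl l x y) has_vector_derivative flX l x y / of_real y) (at x)"
    and dXX: "((\<lambda>x. flX l x y) has_vector_derivative rv (opX (opX (ladder lam l))) x y / of_real y) (at x)"
    and dY: "((\<lambda>y. fl l x y) has_vector_derivative flY l x y / of_real y) (at y)"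
    and dYY: "((\<lambda>y. flY l x y) has_vector_derivative rv (opY lam (opY lam (ladder lam l))) x y / of_real y) (at y)"
    using rv_dx[OF y] rv_dy[OF y] by (simp_all add: fl_def flX_def flY_def)
  have d: "z / of_real y = (1 / y) *\<^sub>R z" for z :: complex
    by (simp add: scaleR_conv_of_real)
  show "((\<lambda>x. sl l x y) has_real_derivative slx l x y) (at x)"
    unfolding s by (rule DERIV_cong[OF inner_deriv[OF dX dX]]) (simp add: slx_def d inner_commute)
  show "((\<lambda>y. sl l x y) has_real_derivative sly l x y) (at y)"
    unfolding s by (rule DERIV_cong[OF inner_deriv[OF dY dY]]) (simp add: sly_def d inner_commute)
  show "((\<lambda>x. slx l x y) has_real_derivative slxx l x y) (at x)"
    unfolding slx_def slxx_def
    by (rule DERIV_cong[OF DERIV_cdivide[OF DERIV_cmult[OF inner_deriv[OF dX dXX]]]])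
       (use y in \<open>simp add: d inner_commute field_simps power2_eq_square\<close>)
  have "((\<lambda>y. y) has_real_derivative 1) (at y)" by (rule DERIV_ident)
  from DERIV_divide[OF DERIV_cmult[OF inner_deriv[OF dY dYY], of 2] this]
  show "((\<lambda>y. sly l x y) has_real_derivative slyy l x y) (at y)"
    unfolding sly_def slyy_def
    by (rule DERIV_cong) (use y in \<open>simp_all add: d inner_commute inner_diff_right field_simps power2_eq_square\<close>)
qed

lemma sl_cont:
  "continuous_on (UNIV \<times> {0<..}) (\<lambda>(x, y). sl l x y)"
  "continuous_on (UNIV \<times> {0<..}) (\<lambda>(x, y). tl l x y)"
  "continuous_on (UNIV \<times> {0<..}) (\<lambda>(x, y). slxx l x y)"
  "continuous_on (UNIV \<times> {0<..}) (\<lambda>(x, y). slyy l x y)"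
proof -
  have c: "continuous_on (UNIV \<times> {0<..}) (\<lambda>z. rv P (fst z) (snd z))" for P
    using rv_cont[of P] by (simp add: case_prod_unfold)
  show "continuous_on (UNIV \<times> {0<..}) (\<lambda>(x, y). sl l x y)"
  "continuous_on (UNIV \<times> {0<..}) (\<lambda>(x, y). tl l x y)"
  "continuous_on (UNIV \<times> {0<..}) (\<lambda>(x, y). slxx l x y)"
  "continuous_on (UNIV \<times> {0<..}) (\<lambda>(x, y). slyy l x y)"
    unfolding case_prod_unfold sl_def tl_def slxx_def slyy_def fl_def flX_def flY_def
    by (intro continuous_intros c ballI; auto)+
qed

text \<open>The gradient term \<open>2 (|X|\<^sup>2 + |Y|\<^sup>2)\<close> with \<open>X = y \<partial>\<^sub>x f\<^sub>l\<close>, \<open>Y = y \<partial>\<^sub>y f\<^sub>l\<close> is, up to lower order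
  terms, \<open>|i X + Y|\<^sup>2 + |Y - i X|\<^sup>2\<close>; by \<open>fl_casimir\<close> the second derivatives contribute terms of the same lower order.\<close>

lemma sl_laplacian:
  assumes y: "y > 0"
  shows "y\<^sup>2 * (slxx l x y + slyy l x y) = sl (Suc l) x y + tl l x y - (2 * lam + 2 * (real l)\<^sup>2) * sl l x y"
proof -
  define f X Y XX YY where d: "f = fl l x y" "X = flX l x y" "Y = flY l x y"
    "XX = rv (opX (opX (ladder lam l))) x y" "YY = rv (opY lam (opY lam (ladder lam l))) x y"
  have "XX + (YY - Y) = 2 * \<i> * of_nat l * X - of_real lam * f"
    using fl_casimir[of l x y] by (simp add: d algebra_simps)
  then have H: "f \<bullet> XX + f \<bullet> (YY - Y) = f \<bullet> (2 * \<i> * of_nat l * X - of_real lam * f)"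
    by (simp flip: inner_add_right)
  have e: "y\<^sup>2 * (a / y\<^sup>2 + b / y\<^sup>2) = a + b" for a b :: real
    using y by (simp add: field_simps)
  have g: "2 * (s + a) + 2 * (t + b) = 2 * (s + t + c)" if "a + b = c" for a b c s t :: real
    using that by simp
  have "y\<^sup>2 * (slxx l x y + slyy l x y) = 2 * (X \<bullet> X + f \<bullet> XX) + 2 * (Y \<bullet> Y + f \<bullet> (YY - Y))"
    unfolding slxx_def slyy_def d[symmetric] by (rule e)
  also have "\<dots> = 2 * (X \<bullet> X + Y \<bullet> Y + f \<bullet> (2 * \<i> * of_nat l * X - of_real lam * f))"
    by (rule g[OF H])
  also have "\<dots> = (cmod (\<i> * X + Y + of_nat l * f))\<^sup>2 + (cmod (Y - \<i> * X - of_nat l * f))\<^sup>2 - (2 * lam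
      + 2 * (real l)\<^sup>2) * (cmod f)\<^sup>2"
    unfolding cmod_power2 inner_complex_def by (simp add: power2_eq_square algebra_simps)
  finally show ?thesis by (simp add: sl_def tl_def fl_Suc flip: d)
qed
lemma rv_has_derivative:
  assumes z: "Im z > 0"
  shows "((\<lambda>z. rv P (Re z) (Im z)) has_derivative
    (\<lambda>h. of_real (Re h) * (rv (opX P) (Re z) (Im z) / of_real (Im z))
        + of_real (Im h) * (rv (opY lam P) (Re z) (Im z) / of_real (Im z)))) (at z)"
proof -
  define fy where "fy = (\<lambda>x y. rv (opY lam P) x y / complex_of_real y)"
  define FY where "FY = (\<lambda>x y. blinfun_scaleR_left (fy x y))"
  have "((\<lambda>(x, y). rv P x y) has_derivative (\<lambda>(tx, ty). tx *\<^sub>R (rv (opX P) (Re z) (Im z) / of_real (Im z))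
      + blinfun_apply (FY (Re z) (Im z)) ty))
      (at (Re z, Im z) within UNIV \<times> {0<..})"
  proof (rule has_derivative_partialsI)
    show "((\<lambda>x. rv P x (Im z)) has_derivative (\<lambda>t. t *\<^sub>R (rv (opX P) (Re z) (Im z) / of_real (Im z)))) (at (Re z)
        within UNIV)"
      using rv_dx[OF z, of P "Re z"] by (simp add: has_vector_derivative_def)
    show "((\<lambda>y. rv P x y) has_derivative blinfun_apply (FY x y)) (at y within {0<..})" if "y \<in> {0<..}" for x y
      using rv_dy[of y P x] that unfolding FY_def fy_def has_vector_derivative_def
      by (auto intro: has_derivative_at_withinI)
    have "continuous_on (UNIV \<times> {0<..}) (\<lambda>z. rv (opY lam P) (fst z) (snd z))"
      using rv_cont[of "opY lam P"] by (simp add: case_prod_unfold)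
    then have "continuous_on (UNIV \<times> {0<..}) (\<lambda>(x, y). FY x y)"
      unfolding FY_def fy_def case_prod_unfold
      by (intro continuous_intros bounded_linear.continuous_on[OF bounded_linear_blinfun_scaleR_left]) auto
    then show "continuous (at (Re z, Im z) within UNIV \<times> {0<..}) (\<lambda>(x, y). FY x y)"
      using z by (auto simp: continuous_on_eq_continuous_within)
  qed (use z in auto)
  then have D: "((\<lambda>(x, y). rv P x y) has_derivative (\<lambda>(tx, ty). tx *\<^sub>R (rv (opX P) (Re z) (Im z) / of_real (Im z))
      + blinfun_apply (FY (Re z) (Im z)) ty))
      (at (Re z, Im z))"
    by (subst (asm) at_within_open) (use z in \<open>auto intro: open_Times\<close>)
  have "((\<lambda>z. (Re z, Im z)) has_derivative (\<lambda>h. (Re h, Im h))) (at z)"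
    by (auto intro!: derivative_eq_intros)
  from has_derivative_compose[OF this D]
  show ?thesis by (simp add: FY_def fy_def scaleR_conv_of_real)
qed

text \<open>Induction on \<open>l\<close>.  The transformation law of \<open>f\<^sub>l\<close> is differentiated at \<open>z\<close>; evaluating the derivative in
  the directions \<open>1\<close> and \<open>i\<close> isolates its complex linear part, which is the part that enters
  \<open>f\<^sub>l\<^sub>+\<^sub>1\<close>.  The derivative of the automorphy factor is absorbed by the term \<open>l f\<^sub>l\<close>, thanks to
  \<open>2 i c Im z + cnj j = j\<close> for \<open>j = c z + d\<close>.\<close>

lemma fl_equivariant:
  assumes A: "det A = 1" and inv: "\<And>z. Im z > 0 \<Longrightarrow> p 0 (Re (moebius A z)) (Im (moebius A z)) = p 0 (Re z) (Im z)"
  shows "Im z > 0 \<Longrightarrow> cnj (mden A z) ^ l * fl l (Re (moebius A z)) (Im (moebius A z)) = mden A z ^ l * fl l (Re z) (Im z)"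
proof (induction l arbitrary: z)
  case 0
  then show ?case using inv by (simp add: fl_0)
next
  case (Suc l)
  define M where "M = moebius A z"
  define j where "j = mden A z"
  define c where "c = complex_of_real (A$2$1)"
  have z: "Im z > 0" by fact
  have M: "Im M > 0" using Im_moebius(2)[OF A z] by (simp add: M_def)
  have j0: "j \<noteq> 0" using mden_nonzero[OF A z] by (simp add: j_def)
  let ?F = "\<lambda>z. fl l (Re z) (Im z)"
  define D where "D = (\<lambda>z h. of_real (Re h) * (flX l (Re z) (Im z) / of_real (Im z))
      + of_real (Im h) * (flY l (Re z) (Im z) / of_real (Im z)))"
  have FD: "(?F has_derivative D z) (at z)" if "Im z > 0" for z
    using rv_has_derivative[OF that, of "ladder lam l"] by (simp add: fl_def flX_def flY_def D_def)
  have md: "(moebius A has_derivative (\<lambda>h. 1 / j\<^sup>2 * h)) (at z)"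
    using moebius_derivative[OF A z] unfolding has_field_derivative_def j_def .
  have L1: "((\<lambda>z. ?F (moebius A z)) has_derivative (\<lambda>h. D M (1 / j\<^sup>2 * h))) (at z)"
    using has_derivative_compose[OF md, of ?F "D M"] FD[OF M] by (simp add: M_def)
  have jd: "((mden A) has_derivative (\<lambda>h. c * h)) (at z)"
    unfolding mden_def[abs_def] c_def by (auto intro!: derivative_eq_intros)
  have cjd: "((\<lambda>z. cnj (mden A z)) has_derivative (\<lambda>h. c * cnj h)) (at z)"
    unfolding mden_def[abs_def] c_def by (auto intro!: derivative_eq_intros)
  have L: "((\<lambda>z. cnj (mden A z) ^ l * ?F (moebius A z)) has_derivative
      (\<lambda>h. cnj j ^ l * D M (1 / j\<^sup>2 * h) + of_nat l * (c * cnj h) * cnj j ^ (l - 1) * ?F M)) (at z)"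
    using has_derivative_mult[OF has_derivative_power[OF cjd, of l] L1] by (simp add: j_def M_def mult_ac)
  have R: "((\<lambda>z. mden A z ^ l * ?F z) has_derivative
      (\<lambda>h. j ^ l * D z h + of_nat l * (c * h) * j ^ (l - 1) * ?F z)) (at z)"
    using has_derivative_mult[OF has_derivative_power[OF jd, of l] FD[OF z]] by (simp add: j_def mult_ac)
  have o: "open {z. Im z > 0}" by (intro open_Collect_less continuous_intros)
  have L': "((\<lambda>z. mden A z ^ l * ?F z) has_derivative
      (\<lambda>h. cnj j ^ l * D M (1 / j\<^sup>2 * h) + of_nat l * (c * cnj h) * cnj j ^ (l - 1) * ?F M)) (at z)"
    by (rule has_derivative_transform_within_open[OF L o]) (use z Suc.IH in auto)
  have E: "cnj j ^ l * D M (1 / j\<^sup>2 * h) + of_nat l * (c * cnj h) * cnj j ^ (l - 1) * ?F M =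
     j ^ l * D z h + of_nat l * (c * h) * j ^ (l - 1) * ?F z" for h
    using has_derivative_unique[OF L' R] by meson
  \<comment> \<open>\<open>W\<close> is twice the holomorphic derivative \<open>\<partial>f\<^sub>l/\<partial>z\<close>\<close>
  define W where "W = (\<lambda>z. (flX l (Re z) (Im z) - \<i> * flY l (Re z) (Im z)) / of_real (Im z))"
  have DW: "D z h - \<i> * D z (\<i> * h) = h * W z" for z h
    by (simp add: D_def W_def complex_eq_iff Re_divide_of_real Im_divide_of_real add_divide_distrib
        diff_divide_distrib algebra_simps)
  have "cnj j ^ l * (D M (1 / j\<^sup>2 * 1) - \<i> * D M (\<i> * (1 / j\<^sup>2 * 1))) =
     j ^ l * (D z 1 - \<i> * D z (\<i> * 1)) + 2 * of_nat l * c * j ^ (l - 1) * ?F z"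
    using E[of 1] E[of \<i>] by (simp add: algebra_simps)
  then have key: "cnj j ^ l * (1 / j\<^sup>2 * W M) = j ^ l * W z + 2 * of_nat l * c * j ^ (l - 1) * ?F z"
    unfolding DW by simp
  have fs: "fl (Suc l) (Re z) (Im z) = \<i> * of_real (Im z) * W z + of_nat l * ?F z" if "Im z > 0" for z
  proof -
    have "of_real (Im z) * W z = flX l (Re z) (Im z) - \<i> * flY l (Re z) (Im z)" using that by (simp add: W_def)
    then show ?thesis by (simp add: fl_Suc mult.assoc) (simp add: algebra_simps)
  qed
  have IH: "cnj j ^ l * ?F M = j ^ l * ?F z" using Suc.IH[OF z] by (simp add: j_def M_def)
  have yM: "complex_of_real (Im M) = of_real (Im z) / (j * cnj j)"
    using Im_moebius(1)[OF A z] by (simp add: M_def j_def)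
  have cj: "2 * \<i> * of_real (Im z) * c + cnj j = j"
    by (simp add: j_def mden_def c_def complex_eq_iff)
  have jl: "of_nat l * j ^ (l - 1) * j = of_nat l * j ^ l" by (cases l) auto
  have "cnj j ^ Suc l * fl (Suc l) (Re M) (Im M) =
     cnj j * (\<i> * of_real (Im M) * (cnj j ^ l * W M) + of_nat l * (cnj j ^ l * ?F M))"
    unfolding fs[OF M] by (simp add: algebra_simps)
  also have "\<dots> = \<i> * of_real (Im z) * j * (cnj j ^ l * (1 / j\<^sup>2 * W M)) + of_nat l * cnj j * (j ^ l * ?F z)"
    unfolding yM IH using j0 by (simp add: field_simps power2_eq_square)
  also have "\<dots> = \<i> * of_real (Im z) * j * j ^ l * W z + (of_nat l * j ^ (l - 1) * j) * (2 * \<i> * of_real (Im z) * c)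
      * ?F z + of_nat l * cnj j * (j ^ l * ?F z)"
    unfolding key by (simp add: algebra_simps)
  also have "\<dots> = \<i> * of_real (Im z) * j * j ^ l * W z + of_nat l * j ^ l * ?F z * (2 * \<i> * of_real (Im z) * c + cnj j)"
    unfolding jl by (simp add: algebra_simps)
  also have "\<dots> = j ^ Suc l * fl (Suc l) (Re z) (Im z)"
    unfolding cj fs[OF z] by (simp add: algebra_simps)
  finally show ?case by (simp add: j_def M_def)
qed

end


section \<open>Haar measure as an iterated integral\<close>

lemma openin_PSL2_iff:
  "openin PSL2_top U \<longleftrightarrow> U \<subseteq> carrier PSL2 \<and> openin (top_of_set (carrier SL2)) {A \<in> carrier SL2. psl A \<in> U}"
proof -
  have "\<Union>U = {A \<in> carrier SL2. psl A \<in> U}" if sub: "U \<subseteq> carrier PSL2"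
  proof (intro equalityI subsetI)
    fix A assume "A \<in> \<Union>U"
    then obtain g where g: "g \<in> U" "A \<in> g" by blast
    then obtain B where B: "det B = 1" "g = psl B" using sub psl_cases by blast
    then have "A = B \<or> A = - B" using g by (auto simp: psl_eq)
    then have "psl A = g" "det A = 1" using B by (auto simp: psl_eq det_uminus_2)
    then show "A \<in> {A \<in> carrier SL2. psl A \<in> U}" using g by (simp add: SL2_def)
  qed (auto simp: psl_eq)
  then show ?thesis by (auto simp: openin_PSL2_top)
qed

lemma openin_psl_image:
  assumes "openin (top_of_set (carrier SL2)) V" "\<And>A. A \<in> V \<Longrightarrow> - A \<in> V"
  shows "openin PSL2_top (psl ` V)"
proof -
  have sub: "V \<subseteq> carrier SL2" using assms(1) openin_imp_subset by blast
  have "{A \<in> carrier SL2. psl A \<in> psl ` V} = V"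
    using sub assms(2) by (auto simp: psl_eq_iff)
  then show ?thesis using assms(1) sub by (auto simp: openin_PSL2_iff SL2_def intro!: psl_in_carrier)
qed

lemma continuous_uminus_SL2: "A \<in> carrier SL2 \<Longrightarrow> - A \<in> carrier SL2"
  by (simp add: SL2_def det_uminus_2)

definition borelG :: "(real^2^2) set measure" where
  "borelG = sigma (carrier PSL2) {U. openin PSL2_top U}"

lemma space_borelG: "space borelG = carrier PSL2"
  unfolding borelG_def by (rule space_measure_of) (auto simp: openin_PSL2_iff)

lemma sets_borelG: "sets borelG = sigma_sets (carrier PSL2) {U. openin PSL2_top U}"
  unfolding borelG_def by (rule sets_measure_of) (auto simp: openin_PSL2_iff)

lemma open_in_borelG: "openin PSL2_top U \<Longrightarrow> U \<in> sets borelG"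
  unfolding sets_borelG by (rule sigma_sets.Basic) simp

lemma measurable_to_borelG:
  assumes "f \<in> space M \<rightarrow> carrier PSL2" "\<And>U. openin PSL2_top U \<Longrightarrow> f -` U \<inter> space M \<in> sets M"
  shows "f \<in> measurable M borelG"
  unfolding borelG_def by (rule measurable_measure_of) (use assms in \<open>auto simp: openin_PSL2_iff\<close>)

lemma measurable_from_borelG:
  fixes f :: "(real^2^2) set \<Rightarrow> 'b::topological_space"
  assumes "continuous_on (carrier SL2) (\<lambda>A. f (psl A))"
  shows "f \<in> borel_measurable borelG"
proof (rule borel_measurableI)
  fix S :: "'b set" assume "open S"
  then have "openin (top_of_set (carrier SL2)) (carrier SL2 \<inter> (\<lambda>A. f (psl A)) -` S)"
    using assms by (simp add: continuous_openin_preimage_gen)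
  moreover have "carrier SL2 \<inter> (\<lambda>A. f (psl A)) -` S = {A \<in> carrier SL2. psl A \<in> f -` S \<inter> carrier PSL2}"
    by (auto simp: SL2_def psl_in_carrier)
  ultimately have "openin PSL2_top (f -` S \<inter> carrier PSL2)"
    by (simp add: openin_PSL2_iff)
  then show "f -` S \<inter> space borelG \<in> sets borelG" by (simp add: space_borelG open_in_borelG)
qed

lemma continuous_on_matrix_mult:
  fixes f g :: "'a::topological_space \<Rightarrow> real^2^2"
  assumes "continuous_on S f" "continuous_on S g"
  shows "continuous_on S (\<lambda>x. f x ** g x)"
  unfolding matrix_matrix_mult_def by (intro continuous_intros assms)

lemma continuous_on_mat2:
  assumes "continuous_on S a" "continuous_on S b" "continuous_on S c" "continuous_on S d"
  shows "continuous_on S (\<lambda>x. mat2 (a x) (b x) (c x) (d x))"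
proof -
  have e: "mat2 (a x) (b x) (c x) (d x) = (\<chi> i j. if i = 1 then (if j = 1 then a x else b x) else (if j
      = 1 then c x else d x))" for x
    by (rule mat2_eqI) auto
  show ?thesis unfolding e
  proof (intro continuous_on_vec_lambda)
    fix i j :: 2
    show "continuous_on S (\<lambda>x. if i = 1 then if j = 1 then a x else b x else if j = 1 then c x else d x)"
      by (cases "i = 1"; cases "j = 1"; simp add: assms)
  qed
qed

lemma openin_mult_preimage:
  assumes g: "g \<in> carrier PSL2" and U: "openin PSL2_top U"
  shows "openin PSL2_top ((\<lambda>h. g \<otimes>\<^bsub>PSL2\<^esub> h) -` U \<inter> carrier PSL2)"
proof -
  obtain A where A: "det A = 1" "g = psl A" using g by (rule psl_cases)
  have "continuous_on (carrier SL2) (\<lambda>B. A ** B)" by (intro continuous_on_matrix_mult continuous_intros)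
  moreover have "(\<lambda>B. A ** B) ` carrier SL2 \<subseteq> carrier SL2" using A by (auto simp: SL2_def det_mul)
  ultimately have "openin (top_of_set (carrier SL2)) (carrier SL2 \<inter> (\<lambda>B. A ** B) -` {B \<in> carrier SL2. psl B \<in> U})"
    using U by (intro continuous_openin_preimage[where T = "carrier SL2"]) (auto simp: openin_PSL2_iff)
  moreover have "carrier SL2 \<inter> (\<lambda>B. A ** B) -` {B \<in> carrier SL2. psl B \<in> U} =
      {B \<in> carrier SL2. psl B \<in> (\<lambda>h. g \<otimes>\<^bsub>PSL2\<^esub> h) -` U \<inter> carrier PSL2}"
    using A by (auto simp: SL2_def det_mul psl_mult psl_in_carrier)
  ultimately show ?thesis by (simp add: openin_PSL2_iff)
qed

interpretation G: group PSL2 by (rule group_PSL2)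

lemma mult_measurable [measurable]:
  assumes g: "g \<in> carrier PSL2" shows "(\<lambda>h. g \<otimes>\<^bsub>PSL2\<^esub> h) \<in> measurable borelG borelG"
  by (rule measurable_to_borelG)
     (use g openin_mult_preimage[OF g] in \<open>auto simp: space_borelG intro: open_in_borelG\<close>)

lemma hpt_measurable: "hpt \<in> borel_measurable borelG"
proof (rule measurable_from_borelG)
  show "continuous_on (carrier SL2) (\<lambda>A. hpt (psl A))"
    unfolding hpt_psl matpt_def num_def den_def complex_eq
    using den_nonzero unfolding den_def complex_eq
    by (intro continuous_intros ballI) (auto simp: SL2_def)
qed

lemma nak_continuous: "continuous_on (UNIV \<times> {0<..} \<times> UNIV) (\<lambda>(x, y, t). nak_mat x y t)"
  unfolding nak_mat_def case_prod_unfold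
  by (intro continuous_on_matrix_mult continuous_on_mat2 continuous_intros) auto

abbreviation coordD :: "(real \<times> real \<times> real) set" where "coordD \<equiv> UNIV \<times> {0<..} \<times> {0..<pi}"

definition coordM :: "(real \<times> real \<times> real) measure" where
  "coordM = restrict_space (density lborel (\<lambda>(x, y, t). ennreal (1 / (pi * y\<^sup>2)))) coordD"

lemma coordD_borel: "coordD \<in> sets borel"
proof -
  have "UNIV \<times> {0<..} \<times> {0..<pi} \<in> sets (borel \<Otimes>\<^sub>M (borel \<Otimes>\<^sub>M borel :: (real \<times> real) measure) :: (real \<times> real \<times>
      real) measure)"
    by (intro pair_measureI) auto
  then show ?thesis unfolding borel_prod .
qed

lemma space_coordM: "space coordM = coordD" by (simp add: coordM_def space_restrict_space)

lemma sets_coordM: "sets coordM = sets (restrict_space borel coordD)"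
  unfolding coordM_def by (intro sets_restrict_space_cong) simp

lemma nak_measurable: "(\<lambda>(x, y, t). nak x y t) \<in> measurable coordM borelG"
proof (rule measurable_to_borelG)
  show "(\<lambda>(x, y, t). nak x y t) \<in> space coordM \<rightarrow> carrier PSL2"
    by (auto simp: space_coordM nak_in_carrier)
  fix U assume U: "openin PSL2_top U"
  let ?S = "(UNIV \<times> {0<..} \<times> UNIV) :: (real \<times> real \<times> real) set"
  have "(\<lambda>(x, y, t). nak_mat x y t) ` ?S \<subseteq> carrier SL2" by (auto simp: SL2_def det_nak_mat)
  then have "openin (top_of_set ?S) (?S \<inter> (\<lambda>(x, y, t). nak_mat x y t) -` {B \<in> carrier SL2. psl B \<in> U})"
    using U by (intro continuous_openin_preimage[OF nak_continuous, where T
        = "carrier SL2"]) (auto simp: openin_PSL2_iff SL2_def det_nak_mat)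
  moreover have "open ?S" by (intro open_Times) auto
  ultimately have "open (?S \<inter> (\<lambda>(x, y, t). nak_mat x y t) -` {B \<in> carrier SL2. psl B \<in> U})"
    using openin_open_trans by blast
  then have "(?S \<inter> (\<lambda>(x, y, t). nak_mat x y t) -` {B \<in> carrier SL2. psl B \<in> U}) \<inter> coordD \<in> sets coordM"
    unfolding sets_coordM sets_restrict_space
    by (subst Int_commute) (intro imageI borel_open)
  also have "(?S \<inter> (\<lambda>(x, y, t). nak_mat x y t) -` {B \<in> carrier SL2. psl B \<in> U}) \<inter> coordD
      = (\<lambda>(x, y, t). nak x y t) -` U \<inter> space coordM"
  proof (intro equalityI subsetI)
    fix z assume "z \<in> (?S \<inter> (\<lambda>(x, y, t). nak_mat x y t) -` {B \<in> carrier SL2. psl B \<in> U}) \<inter> coordD"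
    then show "z \<in> (\<lambda>(x, y, t). nak x y t) -` U \<inter> space coordM"
      by (cases z) (auto simp: space_coordM simp flip: nak_eq)
  next
    fix z assume "z \<in> (\<lambda>(x, y, t). nak x y t) -` U \<inter> space coordM"
    then show "z \<in> (?S \<inter> (\<lambda>(x, y, t). nak_mat x y t) -` {B \<in> carrier SL2. psl B \<in> U}) \<inter> coordD"
      by (cases z) (auto simp: space_coordM SL2_def det_nak_mat simp flip: nak_eq)
  qed
  finally show "(\<lambda>(x, y, t). nak x y t) -` U \<inter> space coordM \<in> sets coordM" .
qed

lemma haar_eq: "haar = distr coordM borelG (\<lambda>(x, y, t). nak x y t)"
  by (simp add: haar_def coordM_def borelG_def)

lemma sets_haar: "sets haar = sets borelG" and space_haar: "space haar = carrier PSL2"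
  by (simp_all add: haar_eq space_borelG)
lemma borel_measurable_coord:
  fixes F :: "(real^2^2) set \<Rightarrow> ennreal"
  assumes "F \<in> borel_measurable borelG"
  shows "(\<lambda>(x, y, t). indicator coordD (x, y, t) * F (nak x y t)) \<in> borel_measurable (borel :: (real \<times> real \<times> real) measure)"
proof -
  have "(\<lambda>z. F (case z of (x, y, t) \<Rightarrow> nak x y t)) \<in> borel_measurable coordM"
    using measurable_compose[OF nak_measurable assms] .
  then have "(\<lambda>z. F (case z of (x, y, t) \<Rightarrow> nak x y t)) \<in> borel_measurable (restrict_space borel coordD)"
    by (simp add: measurable_cong_sets[OF sets_coordM refl])
  then have "(\<lambda>z. F (case z of (x, y, t) \<Rightarrow> nak x y t) * indicator coordD z) \<in> borel_measurable borel"
    using coordD_borel by (simp add: borel_measurable_restrict_space_iff_ennreal)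
  then show ?thesis by (simp add: case_prod_unfold mult.commute)
qed

lemma nn_integral_haar:
  fixes F :: "(real^2^2) set \<Rightarrow> ennreal"
  assumes F: "F \<in> borel_measurable borelG"
  shows "(\<integral>\<^sup>+g. F g \<partial>haar) =
    (\<integral>\<^sup>+x. (\<integral>\<^sup>+y. (\<integral>\<^sup>+t. ennreal (1 / (pi * y\<^sup>2)) * (indicator coordD (x, y, t) * F (nak x y t)) \<partial>lborel) \<partial>lborel) \<partial>lborel)"
proof -
  note bm = borel_measurable_coord[OF F]
  have dm: "(\<lambda>(x, y, t). ennreal (1 / (pi * y\<^sup>2))) \<in> borel_measurable (borel :: (real \<times> real \<times> real) measure)"
    unfolding borel_prod[symmetric] by measurable
  have pm: "(\<lambda>z. case z of (x, y, t) \<Rightarrow> ennreal (1 / (pi * y\<^sup>2)) * (indicator coordD (x, y, t) * F (nak x y t))) \<in>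
      borel_measurable borel"
    using borel_measurable_times_ennreal[OF dm bm] by (simp add: case_prod_unfold)
  have "(\<integral>\<^sup>+g. F g \<partial>haar) = (\<integral>\<^sup>+z. F (case z of (x, y, t) \<Rightarrow> nak x y t) \<partial>coordM)"
    unfolding haar_eq by (rule nn_integral_distr[OF nak_measurable]) (simp add: F)
  also have "\<dots> = (\<integral>\<^sup>+z. F (case z of (x, y, t) \<Rightarrow> nak x y t) * indicator coordD z \<partial>(density lborel (\<lambda>(x, y, t).
      ennreal (1 / (pi * y\<^sup>2)))))"
    unfolding coordM_def by (rule nn_integral_restrict_space) (use coordD_borel in simp)
  also have "\<dots> = (\<integral>\<^sup>+z. (case z of (x, y, t) \<Rightarrow> ennreal (1 / (pi * y\<^sup>2)) * (indicator coordD (x, y, t) * F (nak x y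
      t))) \<partial>lborel)"
  proof -
    have d: "(\<lambda>(x, y, t). ennreal (1 / (pi * y\<^sup>2))) \<in> borel_measurable (lborel :: (real \<times> real \<times> real) measure)"
      using dm by simp
    show ?thesis
      using bm by (subst nn_integral_density[OF d]) (simp_all add: case_prod_unfold mult_ac)
  qed
  also have "\<dots> = (\<integral>\<^sup>+z. (case z of (x, y, t) \<Rightarrow> ennreal (1 / (pi * y\<^sup>2)) * (indicator coordD (x, y, t) * F (nak x y
      t))) \<partial>(lborel \<Otimes>\<^sub>M lborel \<Otimes>\<^sub>M lborel))"
    by (simp add: lborel_prod)
  also have "\<dots> = (\<integral>\<^sup>+x. (\<integral>\<^sup>+z. (case z of (y, t) \<Rightarrow> ennreal (1 / (pi * y\<^sup>2)) * (indicator coordD (x, y, t) * F (nak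
      x y t))) \<partial>(lborel \<Otimes>\<^sub>M lborel)) \<partial>lborel)"
    by (subst lborel_pair.nn_integral_fst[symmetric]) (use pm in \<open>simp_all add: lborel_prod case_prod_unfold\<close>)
  also have "\<dots> = (\<integral>\<^sup>+x. (\<integral>\<^sup>+y. (\<integral>\<^sup>+t. ennreal (1 / (pi * y\<^sup>2)) * (indicator coordD (x, y, t) * F (nak x y t))
      \<partial>lborel) \<partial>lborel) \<partial>lborel)"
  proof (rule nn_integral_cong)
    fix x
    have "(\<lambda>z. case z of (y, t) \<Rightarrow> ennreal (1 / (pi * y\<^sup>2)) * (indicator coordD (x, y, t) * F (nak x y t))) \<in>
        borel_measurable (lborel \<Otimes>\<^sub>M lborel)"
    proof -
      have "(\<lambda>z::real\<times>real. (x, z)) \<in> borel_measurable borel"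
        by (intro borel_measurable_continuous_onI continuous_intros)
      from measurable_compose[OF this pm] show ?thesis by (simp add: lborel_prod case_prod_unfold)
    qed
    then show "(\<integral>\<^sup>+z. (case z of (y, t) \<Rightarrow> ennreal (1 / (pi * y\<^sup>2)) * (indicator coordD (x, y, t) * F (nak x y t)))
        \<partial>(lborel \<Otimes>\<^sub>M lborel)) =
      (\<integral>\<^sup>+y. (\<integral>\<^sup>+t. ennreal (1 / (pi * y\<^sup>2)) * (indicator coordD (x, y, t) * F (nak x y t)) \<partial>lborel) \<partial>lborel)"
      by (subst lborel.nn_integral_fst[symmetric]) simp_all
  qed
  finally show ?thesis .
qed


section \<open>Hyperbolic area\<close>

lemma nn_integral_exp_substitution:
  fixes f :: "real \<Rightarrow> ennreal"
  assumes f [measurable]: "f \<in> borel_measurable borel"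
  shows "(\<integral>\<^sup>+y. indicator {0<..} y * f y \<partial>lborel) = (\<integral>\<^sup>+s. ennreal (exp s) * f (exp s) \<partial>lborel)"
proof -
  have 1: "(\<integral>\<^sup>+y. f y * indicator {exp (- real (Suc n))..exp (real (Suc n))} y \<partial>lborel)
      = (\<integral>\<^sup>+s. f (exp s) * ennreal (exp s) * indicator {- real (Suc n)..real (Suc n)} s \<partial>lborel)" for n
    by (rule nn_integral_substitution_aux[where g' = exp])
       (auto intro!: continuous_intros f)
  have "(\<integral>\<^sup>+y. indicator {0<..} y * f y \<partial>lborel) = (\<integral>\<^sup>+y. (SUP n. f y * indicator {exp (- real (Suc n))..exp (real
      (Suc n))} y) \<partial>lborel)"
  proof (rule nn_integral_cong)
    fix y :: real
    show "indicator {0<..} y * f y = (SUP n. f y * indicator {exp (- real (Suc n))..exp (real (Suc n))} y)"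
    proof (cases "y > 0")
      case True
      obtain N :: nat where N: "\<bar>ln y\<bar> \<le> N" using real_arch_simple by blast
      then have "- real (Suc N) \<le> ln y" "ln y \<le> real (Suc N)" by auto
      then have "exp (- real (Suc N)) \<le> exp (ln y)" "exp (ln y) \<le> exp (real (Suc N))"
        by (simp_all only: exp_le_cancel_iff)
      then have "y \<in> {exp (- real (Suc N))..exp (real (Suc N))}" using True by simp
      then have "f y \<le> (SUP n. f y * indicator {exp (- real (Suc n))..exp (real (Suc n))} y)"
        by (intro SUP_upper2[of N]) auto
      moreover have "(SUP n. f y * indicator {exp (- real (Suc n))..exp (real (Suc n))} y) \<le> f y"
        by (intro SUP_least) (auto simp: indicator_def)
      ultimately show ?thesis using True by simp
    next
      case False
      then have "y \<notin> {exp (- real (Suc n))..exp (real (Suc n))}" for n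
        using exp_gt_zero[of "- real (Suc n)"] by (auto simp del: exp_gt_zero)
      then show ?thesis using False by simp
    qed
  qed
  also have "\<dots> = (SUP n. \<integral>\<^sup>+y. f y * indicator {exp (- real (Suc n))..exp (real (Suc n))} y \<partial>lborel)"
  proof (rule nn_integral_monotone_convergence_SUP)
    show "incseq (\<lambda>n y. f y * indicator {exp (- real (Suc n))..exp (real (Suc n))} y)"
    proof (intro incseq_SucI le_funI mult_left_mono indicator_leI)
      fix n and y :: real assume "y \<in> {exp (- real (Suc n))..exp (real (Suc n))}"
      moreover have "exp (- real (Suc (Suc n))) \<le> exp (- real (Suc n))" "exp (real (Suc n))
          \<le> exp (real (Suc (Suc n)))" by auto
      ultimately show "y \<in> {exp (- real (Suc (Suc n)))..exp (real (Suc (Suc n)))}" by (auto simp del: exp_le_cancel_iff)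
    qed simp
  qed simp
  also have "\<dots> = (SUP n. \<integral>\<^sup>+s. f (exp s) * ennreal (exp s) * indicator {- real (Suc n)..real (Suc n)} s \<partial>lborel)"
    unfolding 1 ..
  also have "\<dots> = (\<integral>\<^sup>+s. (SUP n. f (exp s) * ennreal (exp s) * indicator {- real (Suc n)..real (Suc n)} s) \<partial>lborel)"
  proof (rule nn_integral_monotone_convergence_SUP[symmetric])
    show "incseq (\<lambda>n s. f (exp s) * ennreal (exp s) * indicator {- real (Suc n)..real (Suc n)} s)"
      by (intro incseq_SucI le_funI mult_left_mono indicator_leI) auto
  qed simp
  also have "\<dots> = (\<integral>\<^sup>+s. ennreal (exp s) * f (exp s) \<partial>lborel)"
  proof (rule nn_integral_cong)
    fix s :: real
    obtain N :: nat where N: "\<bar>s\<bar> \<le> N" using real_arch_simple by blast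
    show "(SUP n. f (exp s) * ennreal (exp s) * indicator {- real (Suc n)..real (Suc n)} s) = ennreal (exp s) * f (exp s)"
    proof (rule antisym)
      show "(SUP n. f (exp s) * ennreal (exp s) * indicator {- real (Suc n)..real (Suc n)} s) \<le> ennreal (exp s) * f (exp s)"
        by (intro SUP_least) (auto simp: indicator_def mult.commute)
      show "ennreal (exp s) * f (exp s) \<le> (SUP n. f (exp s) * ennreal (exp s) * indicator {- real (Suc n)..real (Suc n)} s)"
        using N by (intro SUP_upper2[of N]) (auto simp: mult.commute indicator_def)
    qed
  qed
  finally show ?thesis .
qed

lemma section_nn_integral_measurable:
  fixes g :: "'a::second_countable_topology \<times> real \<Rightarrow> ennreal"
  assumes "g \<in> borel_measurable borel"
  shows "(\<lambda>y. \<integral>\<^sup>+x. g (y, x) \<partial>lborel) \<in> borel_measurable borel"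
proof -
  have "sets (borel \<Otimes>\<^sub>M lborel) = sets (borel \<Otimes>\<^sub>M borel :: ('a \<times> real) measure)"
    by (intro sets_pair_measure_cong) simp_all
  then have "sets (borel \<Otimes>\<^sub>M lborel) = sets (borel :: ('a \<times> real) measure)"
    unfolding borel_prod .
  then have "g \<in> borel_measurable (borel \<Otimes>\<^sub>M lborel)"
    using assms measurable_cong_sets by blast
  then show ?thesis by (rule lborel.borel_measurable_nn_integral_fst)
qed

text \<open>The hyperbolic area, regarded as a measure on the whole plane that lives on \<open>y > 0\<close>.\<close>

definition harea :: "(real \<times> real) measure" where
  "harea = density lborel (\<lambda>(x, y). indicator {0<..} y * ennreal (1 / y\<^sup>2))"

lemma harea_density_measurable: "(\<lambda>(x, y). indicator {0<..} y * ennreal (1 / y\<^sup>2)) \<in> borel_measurable (borel ::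
    (real \<times> real) measure)"
  unfolding borel_prod[symmetric] by measurable

lemma sets_harea [measurable_cong, simp]: "sets harea = sets borel" and space_harea [simp]: "space harea = UNIV"
  by (simp_all add: harea_def)

lemma borel_pair_section:
  fixes f :: "real \<times> real \<Rightarrow> ennreal"
  assumes "f \<in> borel_measurable borel" "g \<in> borel_measurable M" "h \<in> borel_measurable M"
  shows "(\<lambda>w. f (g w, h w)) \<in> borel_measurable M"
  using measurable_compose[OF borel_measurable_Pair[OF assms(2,3)] assms(1)] .

lemma nn_integral_lborel2:
  fixes f :: "real \<times> real \<Rightarrow> ennreal"
  assumes f: "f \<in> borel_measurable borel"
  shows "(\<integral>\<^sup>+z. f z \<partial>lborel) = (\<integral>\<^sup>+x. \<integral>\<^sup>+y. f (x, y) \<partial>lborel \<partial>lborel)"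
    "(\<integral>\<^sup>+z. f z \<partial>lborel) = (\<integral>\<^sup>+y. \<integral>\<^sup>+x. f (x, y) \<partial>lborel \<partial>lborel)"
  using lborel.nn_integral_fst[of f lborel] lborel_pair.nn_integral_snd[of f] f
  by (simp_all add: lborel_prod case_prod_unfold)

lemma nn_integral_harea:
  fixes f :: "real \<times> real \<Rightarrow> ennreal"
  assumes f: "f \<in> borel_measurable borel"
  shows "(\<integral>\<^sup>+z. f z \<partial>harea) = (\<integral>\<^sup>+x. \<integral>\<^sup>+y. indicator {0<..} y * ennreal (1 / y\<^sup>2) * f (x, y) \<partial>lborel \<partial>lborel)"
    "(\<integral>\<^sup>+z. f z \<partial>harea) = (\<integral>\<^sup>+y. \<integral>\<^sup>+x. indicator {0<..} y * ennreal (1 / y\<^sup>2) * f (x, y) \<partial>lborel \<partial>lborel)"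
proof -
  have d: "(\<lambda>(x, y). indicator {0<..} y * ennreal (1 / y\<^sup>2)) \<in> borel_measurable (lborel :: (real \<times> real) measure)"
    using harea_density_measurable by simp
  have m: "(\<lambda>z. (case z of (x, y) \<Rightarrow> indicator {0<..} y * ennreal (1 / y\<^sup>2)) * f z) \<in> borel_measurable borel"
    using borel_measurable_times_ennreal[OF harea_density_measurable f] .
  have "(\<integral>\<^sup>+z. f z \<partial>harea) = (\<integral>\<^sup>+z. (case z of (x, y) \<Rightarrow> indicator {0<..} y * ennreal (1 / y\<^sup>2)) * f z \<partial>lborel)"
    unfolding harea_def using f by (subst nn_integral_density[OF d]) simp_all
  then show "(\<integral>\<^sup>+z. f z \<partial>harea) = (\<integral>\<^sup>+x. \<integral>\<^sup>+y. indicator {0<..} y * ennreal (1 / y\<^sup>2) * f (x, y) \<partial>lborel \<partial>lborel)"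
    "(\<integral>\<^sup>+z. f z \<partial>harea) = (\<integral>\<^sup>+y. \<integral>\<^sup>+x. indicator {0<..} y * ennreal (1 / y\<^sup>2) * f (x, y) \<partial>lborel \<partial>lborel)"
    using nn_integral_lborel2[OF m] by simp_all
qed

text \<open>In the coordinates \<open>x = e\<^sup>s p\<close>, \<open>y = e\<^sup>s\<close> the hyperbolic area is Lebesgue measure.\<close>

lemma nn_integral_harea_exp:
  fixes f :: "real \<times> real \<Rightarrow> ennreal"
  assumes f: "f \<in> borel_measurable borel"
  shows "(\<integral>\<^sup>+z. f z \<partial>harea) = (\<integral>\<^sup>+p. \<integral>\<^sup>+s. f (exp s * p, exp s) \<partial>lborel \<partial>lborel)"
proof -
  have fm: "(\<lambda>w. f (g w, h w)) \<in> borel_measurable M" if "g \<in> borel_measurable M" "h \<in> borel_measurable M" for g h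
      and M :: "'b measure"
    using borel_pair_section[OF f that] .
  have m1: "(\<lambda>z. f (exp (snd z) * fst z, exp (snd z))) \<in> borel_measurable borel"
    by (intro fm borel_measurable_continuous_onI continuous_intros)
  have "(\<integral>\<^sup>+z. f z \<partial>harea) = (\<integral>\<^sup>+y. \<integral>\<^sup>+x. indicator {0<..} y * ennreal (1 / y\<^sup>2) * f (x, y) \<partial>lborel \<partial>lborel)"
    by (rule nn_integral_harea(2)[OF f])
  also have "\<dots> = (\<integral>\<^sup>+y. indicator {0<..} y * (\<integral>\<^sup>+p. ennreal (1 / y) * f (y * p, y) \<partial>lborel) \<partial>lborel)"
  proof (rule nn_integral_cong)
    fix y :: real
    show "(\<integral>\<^sup>+x. indicator {0<..} y * ennreal (1 / y\<^sup>2) * f (x, y) \<partial>lborel)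
        = indicator {0<..} y * (\<integral>\<^sup>+p. ennreal (1 / y) * f (y * p, y) \<partial>lborel)"
    proof (cases "y > 0")
      case True
      have fy: "(\<lambda>x. f (x, y)) \<in> borel_measurable borel" "(\<lambda>p. f (y * p, y)) \<in> borel_measurable borel" by (intro fm; simp)+
      have "(\<integral>\<^sup>+x. f (x, y) \<partial>lborel) = ennreal y * (\<integral>\<^sup>+p. f (y * p, y) \<partial>lborel)"
        using nn_integral_real_affine[OF fy(1), of y 0] True by simp
      then have "(\<integral>\<^sup>+x. indicator {0<..} y * ennreal (1 / y\<^sup>2) * f (x, y) \<partial>lborel)
          = ennreal (1 / y\<^sup>2) * (ennreal y * (\<integral>\<^sup>+p. f (y * p, y) \<partial>lborel))"
        using True fy by (simp add: nn_integral_cmult)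
      also have "\<dots> = ennreal (1 / y) * (\<integral>\<^sup>+p. f (y * p, y) \<partial>lborel)"
        using True by (simp add: mult.assoc[symmetric] ennreal_mult'[symmetric] power2_eq_square)
      finally show ?thesis using True fy by (simp add: nn_integral_cmult)
    qed simp
  qed
  also have "\<dots> = (\<integral>\<^sup>+s. ennreal (exp s) * (\<integral>\<^sup>+p. ennreal (1 / exp s) * f (exp s * p, exp s) \<partial>lborel) \<partial>lborel)"
  proof (rule nn_integral_exp_substitution)
    have "(\<lambda>z. ennreal (1 / fst z) * f (fst z * snd z, fst z)) \<in> borel_measurable (borel :: (real \<times> real) measure)"
      by (intro borel_measurable_times_ennreal fm) (unfold borel_prod[symmetric], measurable)
    then show "(\<lambda>y. \<integral>\<^sup>+p. ennreal (1 / y) * f (y * p, y) \<partial>lborel) \<in> borel_measurable borel"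
      using section_nn_integral_measurable by fastforce
  qed
  also have "\<dots> = (\<integral>\<^sup>+s. \<integral>\<^sup>+p. f (exp s * p, exp s) \<partial>lborel \<partial>lborel)"
  proof (rule nn_integral_cong)
    fix s :: real
    have fy: "(\<lambda>p. f (exp s * p, exp s)) \<in> borel_measurable borel" by (intro fm; simp)
    show "ennreal (exp s) * (\<integral>\<^sup>+p. ennreal (1 / exp s) * f (exp s * p, exp s) \<partial>lborel)
        = (\<integral>\<^sup>+p. f (exp s * p, exp s) \<partial>lborel)"
      using fy by (simp add: nn_integral_cmult mult.assoc[symmetric] ennreal_mult'[symmetric])
  qed
  also have "\<dots> = (\<integral>\<^sup>+p. \<integral>\<^sup>+s. f (exp s * p, exp s) \<partial>lborel \<partial>lborel)"
    using nn_integral_lborel2[OF m1] by simp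
  finally show ?thesis .
qed

lemma harea_affine:
  fixes f :: "real \<times> real \<Rightarrow> ennreal"
  assumes f: "f \<in> borel_measurable borel" and r: "r > 0"
  shows "(\<integral>\<^sup>+z. f (b + r * fst z, r * snd z) \<partial>harea) = (\<integral>\<^sup>+z. f z \<partial>harea)"
proof -
  have fm: "(\<lambda>w. f (g w, h w)) \<in> borel_measurable M" if "g \<in> borel_measurable M" "h \<in> borel_measurable M" for g h
      and M :: "'b measure"
    using borel_pair_section[OF f that] .
  have m0: "(\<lambda>z. f (b + r * fst z, r * snd z)) \<in> borel_measurable borel"
    by (intro fm borel_measurable_continuous_onI continuous_intros)
  have *: "(\<integral>\<^sup>+x. indicator {0<..} y * ennreal (1 / y\<^sup>2) * f (b + r * x, r * y) \<partial>lborel)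
    = ennreal r * (\<integral>\<^sup>+x. indicator {0<..} (r * y) * ennreal (1 / (r * y)\<^sup>2) * f (x, r * y) \<partial>lborel)" for y
  proof (cases "y > 0")
    case True
    have fy: "(\<lambda>x. f (x, r * y)) \<in> borel_measurable borel" "(\<lambda>x. f (b + r * x, r * y)) \<in> borel_measurable borel"
        by (intro fm; simp)+
    have "ennreal r * (\<integral>\<^sup>+x. indicator {0<..} (r * y) * ennreal (1 / (r * y)\<^sup>2) * f (x, r * y) \<partial>lborel)
      = ennreal r * (ennreal (1 / (r * y)\<^sup>2) * (ennreal r * (\<integral>\<^sup>+x. f (b + r * x, r * y) \<partial>lborel)))"
      using nn_integral_real_affine[OF fy(1), of r b] r True fy by (simp add: nn_integral_cmult)
    also have "\<dots> = ennreal (1 / y\<^sup>2) * (\<integral>\<^sup>+x. f (b + r * x, r * y) \<partial>lborel)"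
      using r True by (simp add: mult.assoc[symmetric] ennreal_mult'[symmetric] power2_eq_square)
    finally show ?thesis using True fy by (simp add: nn_integral_cmult)
  next
    case False
    then have "\<not> r * y > 0" using r by (simp add: zero_less_mult_iff)
    then show ?thesis using False by simp
  qed
  have m2: "(\<lambda>z. indicator {0<..} (fst z) * ennreal (1 / (fst z)\<^sup>2) * f (snd z, fst z)) \<in> borel_measurable (borel
      :: (real \<times> real) measure)"
    by (intro borel_measurable_times_ennreal fm) (unfold borel_prod[symmetric], measurable)
  have m1: "(\<lambda>y. \<integral>\<^sup>+x. indicator {0<..} y * ennreal (1 / y\<^sup>2) * f (x, y) \<partial>lborel) \<in> borel_measurable borel"
    using section_nn_integral_measurable[OF m2] by simp
  have "(\<integral>\<^sup>+z. f (b + r * fst z, r * snd z) \<partial>harea) = (\<integral>\<^sup>+y. \<integral>\<^sup>+x. indicator {0<..} y * ennreal (1 / y\<^sup>2) * f (b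
      + r * x, r * y) \<partial>lborel \<partial>lborel)"
    using nn_integral_harea(2)[OF m0] by simp
  also have "\<dots> = (\<integral>\<^sup>+y. ennreal r * (\<integral>\<^sup>+x. indicator {0<..} (r * y) * ennreal (1 / (r * y)\<^sup>2) * f (x, r * y)
      \<partial>lborel) \<partial>lborel)"
    unfolding * ..
  also have "\<dots> = ennreal r * (\<integral>\<^sup>+y. (\<integral>\<^sup>+x. indicator {0<..} (r * y) * ennreal (1 / (r * y)\<^sup>2) * f (x, r * y)
      \<partial>lborel) \<partial>lborel)"
    by (rule nn_integral_cmult) (use measurable_compose[OF _ m1, of "\<lambda>y. r * y" lborel] in simp)
  also have "\<dots> = (\<integral>\<^sup>+y. (\<integral>\<^sup>+x. indicator {0<..} y * ennreal (1 / y\<^sup>2) * f (x, y) \<partial>lborel) \<partial>lborel)"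
    using nn_integral_real_affine[OF m1, of r 0] r by simp
  also have "\<dots> = (\<integral>\<^sup>+z. f z \<partial>harea)" by (rule nn_integral_harea(2)[OF f, symmetric])
  finally show ?thesis .
qed

text \<open>In the coordinates of \<open>nn_integral_harea_exp\<close> the inversion \<open>z \<mapsto> - 1/z\<close> is
  \<open>(p, s) \<mapsto> (- p, - ln (1 + p\<^sup>2) - s)\<close>: reflections and a translation on each line.  Substitutions in one
  variable are therefore enough.\<close>

lemma harea_inversion:
  fixes f :: "real \<times> real \<Rightarrow> ennreal"
  assumes f: "f \<in> borel_measurable borel"
  shows "(\<integral>\<^sup>+z. f (- fst z / ((fst z)\<^sup>2 + (snd z)\<^sup>2), snd z / ((fst z)\<^sup>2 + (snd z)\<^sup>2)) \<partial>harea) = (\<integral>\<^sup>+z. f z \<partial>harea)"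
proof -
  have fm: "(\<lambda>w. f (g w, h w)) \<in> borel_measurable M" if "g \<in> borel_measurable M" "h \<in> borel_measurable M" for g h
      and M :: "'b measure"
    using borel_pair_section[OF f that] .
  have m0: "(\<lambda>z. f (- fst z / ((fst z)\<^sup>2 + (snd z)\<^sup>2), snd z / ((fst z)\<^sup>2
      + (snd z)\<^sup>2))) \<in> borel_measurable (borel :: (real \<times> real) measure)"
    by (intro fm) (unfold borel_prod[symmetric], measurable)
  have "(\<integral>\<^sup>+z. f (- fst z / ((fst z)\<^sup>2 + (snd z)\<^sup>2), snd z / ((fst z)\<^sup>2 + (snd z)\<^sup>2)) \<partial>harea) =
     (\<integral>\<^sup>+p. \<integral>\<^sup>+s. f (- (exp s * p) / ((exp s * p)\<^sup>2 + (exp s)\<^sup>2), exp s / ((exp s * p)\<^sup>2 + (exp s)\<^sup>2)) \<partial>lborel \<partial>lborel)"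
    using nn_integral_harea_exp[OF m0] by simp
  also have "\<dots> = (\<integral>\<^sup>+p. \<integral>\<^sup>+s. f (exp (- ln (1 + p\<^sup>2) + (-1) * s) * (- p), exp (- ln (1 + p\<^sup>2) + (-1) * s)) \<partial>lborel \<partial>lborel)"
  proof (intro nn_integral_cong)
    fix p s :: real
    have q: "1 + p\<^sup>2 > 0" by (simp add: add_pos_nonneg)
    have "exp (- ln (1 + p\<^sup>2) + (-1) * s) = 1 / (exp s * (1 + p\<^sup>2))"
      using q by (simp add: exp_diff exp_minus field_simps)
    moreover have "(exp s * p)\<^sup>2 + (exp s)\<^sup>2 = exp s * (exp s * (1 + p\<^sup>2))" by (simp add: power2_eq_square algebra_simps)
    ultimately show "f (- (exp s * p) / ((exp s * p)\<^sup>2 + (exp s)\<^sup>2), exp s / ((exp s * p)\<^sup>2 + (exp s)\<^sup>2)) =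
      f (exp (- ln (1 + p\<^sup>2) + (-1) * s) * (- p), exp (- ln (1 + p\<^sup>2) + (-1) * s))"
      by simp
  qed
  also have "\<dots> = (\<integral>\<^sup>+p. \<integral>\<^sup>+s. f (exp s * (- p), exp s) \<partial>lborel \<partial>lborel)"
  proof (rule nn_integral_cong)
    fix p :: real
    have "(\<lambda>s. f (exp s * (- p), exp s)) \<in> borel_measurable borel" by (intro fm; simp)
    from nn_integral_real_affine[OF this, of "-1" "- ln (1 + p\<^sup>2)"]
    show "(\<integral>\<^sup>+s. f (exp (- ln (1 + p\<^sup>2) + (-1) * s) * (- p), exp (- ln (1 + p\<^sup>2) + (-1) * s)) \<partial>lborel)
        = (\<integral>\<^sup>+s. f (exp s * (- p), exp s) \<partial>lborel)"
      by simp
  qed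
  also have "\<dots> = (\<integral>\<^sup>+p. \<integral>\<^sup>+s. f (exp s * p, exp s) \<partial>lborel \<partial>lborel)"
  proof -
    have "(\<lambda>z. f (exp (snd z) * fst z, exp (snd z))) \<in> borel_measurable borel"
      by (intro fm borel_measurable_continuous_onI continuous_intros)
    then have "(\<lambda>p. \<integral>\<^sup>+s. f (exp s * p, exp s) \<partial>lborel) \<in> borel_measurable borel"
      using section_nn_integral_measurable by fastforce
    from nn_integral_real_affine[OF this, of "-1" 0] show ?thesis by simp
  qed
  also have "\<dots> = (\<integral>\<^sup>+z. f z \<partial>harea)" by (rule nn_integral_harea_exp[OF f, symmetric])
  finally show ?thesis .
qed

definition mob :: "real^2^2 \<Rightarrow> real \<times> real \<Rightarrow> real \<times> real" where
  "mob A z = (Re (moebius A (Complex (fst z) (snd z))), Im (moebius A (Complex (fst z) (snd z))))"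

lemma mob_measurable: "mob A \<in> borel_measurable borel"
proof -
  have c: "(\<lambda>z::real \<times> real. Complex (fst z) (snd z)) \<in> borel_measurable borel"
    unfolding complex_eq by (intro borel_measurable_continuous_onI continuous_intros)
  have q: "(\<lambda>z::real \<times> real. moebius A (Complex (fst z) (snd z))) \<in> borel_measurable borel"
    unfolding moebius_def
    by (intro borel_measurable_divide borel_measurable_add borel_measurable_times c borel_measurable_const)
  have "Re \<in> borel_measurable borel" "Im \<in> borel_measurable borel"
    by (intro borel_measurable_continuous_onI continuous_intros)+
  from this[THEN measurable_compose[OF q]] show ?thesis unfolding mob_def[abs_def]
    by (rule borel_measurable_Pair)
qed

lemma nn_integral_harea_cong:
  assumes "\<And>x y. y > 0 \<Longrightarrow> f (x, y) = g (x, y)" "f \<in> borel_measurable borel" "g \<in> borel_measurable borel"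
  shows "(\<integral>\<^sup>+z. f z \<partial>harea) = (\<integral>\<^sup>+z. g z \<partial>harea)"
  unfolding nn_integral_harea(1)[OF assms(2)] nn_integral_harea(1)[OF assms(3)]
  by (intro nn_integral_cong) (auto simp: assms(1) indicator_def)

text \<open>A Moebius transformation is affine or the composition of an affine map, the inversion and a
  translation.\<close>

lemma harea_invariant:
  fixes f :: "real \<times> real \<Rightarrow> ennreal"
  assumes A: "det A = 1" and f: "f \<in> borel_measurable borel"
  shows "(\<integral>\<^sup>+z. f (mob A z) \<partial>harea) = (\<integral>\<^sup>+z. f z \<partial>harea)"
proof -
  have fm: "(\<lambda>w. f (g w, h w)) \<in> borel_measurable M" if "g \<in> borel_measurable M" "h \<in> borel_measurable M" for g h
      and M :: "'b measure"
    using borel_pair_section[OF f that] .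
  have fmob: "(\<lambda>z. f (mob A z)) \<in> borel_measurable borel" using measurable_compose[OF mob_measurable f] .
  let ?a = "A$1$1" let ?b = "A$1$2" let ?c = "A$2$1" let ?d = "A$2$2"
  have det: "?a * ?d - ?b * ?c = 1" using A by (simp add: det_2)
  show ?thesis
  proof (cases "?c = 0")
    case True
    then have ad: "?a * ?d = 1" using det by simp
    then have d0: "?d \<noteq> 0" by auto
    have r: "?a / ?d > 0" using ad d0 by (metis divide_pos_pos mult_pos_pos not_square_less_zero
        zero_less_divide_iff zero_less_mult_iff zero_less_one)
    have "(\<integral>\<^sup>+z. f (mob A z) \<partial>harea) = (\<integral>\<^sup>+z. f (?b / ?d + ?a / ?d * fst z, ?a / ?d * snd z) \<partial>harea)"
    proof (rule nn_integral_harea_cong[OF _ fmob])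
      fix x y :: real
      show "f (mob A (x, y)) = f (?b / ?d + ?a / ?d * fst (x, y), ?a / ?d * snd (x, y))"
        using True d0 by (simp add: mob_def moebius_def Re_divide_of_real Im_divide_of_real add_divide_distrib add.commute)
      show "(\<lambda>z. f (?b / ?d + ?a / ?d * fst z, ?a / ?d * snd z)) \<in> borel_measurable borel"
        by (intro fm borel_measurable_continuous_onI continuous_intros)
    qed
    also have "\<dots> = (\<integral>\<^sup>+z. f z \<partial>harea)" by (rule harea_affine[OF f r])
    finally show ?thesis .
  next
    case False
    define h where "h = (\<lambda>z::real\<times>real. f (?a / ?c + 1 * fst z, 1 * snd z))"
    define k where "k = (\<lambda>z::real\<times>real. h (- fst z / ((fst z)\<^sup>2 + (snd z)\<^sup>2), snd z / ((fst z)\<^sup>2 + (snd z)\<^sup>2)))"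
    have h: "h \<in> borel_measurable borel" unfolding h_def
      by (intro fm borel_measurable_continuous_onI continuous_intros)
    have k: "k \<in> borel_measurable borel" unfolding k_def
      by (intro borel_pair_section[OF h]) (unfold borel_prod[symmetric], measurable)
    have k': "(\<lambda>z. k (?c * ?d + ?c\<^sup>2 * fst z, ?c\<^sup>2 * snd z)) \<in> borel_measurable borel"
      by (intro borel_pair_section[OF k] borel_measurable_continuous_onI continuous_intros)
    have "(\<integral>\<^sup>+z. f (mob A z) \<partial>harea) = (\<integral>\<^sup>+z. k (?c * ?d + ?c\<^sup>2 * fst z, ?c\<^sup>2 * snd z) \<partial>harea)"
    proof (rule nn_integral_harea_cong[OF _ fmob k'])
      fix x y :: real assume y: "y > 0"
      define w where "w = Complex (?c * ?d + ?c\<^sup>2 * x) (?c\<^sup>2 * y)"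
      define j where "j = mden A (Complex x y)"
      have j0: "j \<noteq> 0" using mden_nonzero[OF A, of "Complex x y"] y by (simp add: j_def)
      have w: "w = of_real ?c * j" by (simp add: w_def j_def mden_def complex_eq_iff algebra_simps power2_eq_square)
      have "of_real ?a * of_real ?d - of_real ?b * of_real ?c = (1::complex)"
        using det by (simp flip: of_real_mult of_real_diff)
      then have "moebius A (Complex x y) = of_real (?a / ?c) - 1 / w"
        using False j0 unfolding moebius_def w mden_def[symmetric] j_def[symmetric]
        by (simp add: field_simps) (simp add: j_def mden_def algebra_simps)
      moreover have "Re (1 / w) = Re w / ((Re w)\<^sup>2 + (Im w)\<^sup>2)" "Im (1 / w) = - Im w / ((Re w)\<^sup>2 + (Im w)\<^sup>2)"
        by (simp_all add: Re_divide Im_divide)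
      ultimately show "f (mob A (x, y)) = k (?c * ?d + ?c\<^sup>2 * fst (x, y), ?c\<^sup>2 * snd (x, y))"
        by (simp add: k_def h_def mob_def w_def)
    qed
    also have "\<dots> = (\<integral>\<^sup>+z. k z \<partial>harea)" by (rule harea_affine[OF k]) (use False in simp)
    also have "\<dots> = (\<integral>\<^sup>+z. h z \<partial>harea)" unfolding k_def by (rule harea_inversion[OF h])
    also have "\<dots> = (\<integral>\<^sup>+z. f z \<partial>harea)" unfolding h_def by (rule harea_affine[OF f]) simp
    finally show ?thesis .
  qed
qed


section \<open>Invariance of Haar measure and a Borel fundamental set\<close>

lemma circle_shift:
  fixes G :: "real \<Rightarrow> ennreal"
  assumes G: "G \<in> borel_measurable borel" and per: "\<And>t n. G (t + of_int n * pi) = G t"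
  shows "(\<integral>\<^sup>+t. indicator {0..<pi} t * G (t + a) \<partial>lborel) = (\<integral>\<^sup>+t. indicator {0..<pi} t * G t \<partial>lborel)"
proof -
  note [measurable] = G
  obtain n :: int where n: "a + of_int n * pi \<in> {0..<pi}" using ex_shift_pi by blast
  define b where "b = a + of_int n * pi"
  have b: "0 \<le> b" "b < pi" using n by (auto simp: b_def)
  have Gb: "G (t + a) = G (t + b)" for t using per[of "t + a" n] by (simp add: b_def add.assoc)
  have per1: "G (t + pi) = G t" for t using per[of t 1] by simp
  have "(\<integral>\<^sup>+t. indicator {0..<pi} t * G (t + b) \<partial>lborel) = (\<integral>\<^sup>+t. indicator {b..<b + pi} (b + 1 * t) * G (b
      + 1 * t) \<partial>lborel)"
    by (intro nn_integral_cong) (auto simp: indicator_def add.commute)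
  also have "\<dots> = (\<integral>\<^sup>+t. indicator {b..<b + pi} t * G t \<partial>lborel)"
    using nn_integral_real_affine[of "\<lambda>t. indicator {b..<b + pi} t * G t" 1 b] by simp
  also have "\<dots> = (\<integral>\<^sup>+t. indicator {b..<pi} t * G t + indicator {pi..<b + pi} t * G t \<partial>lborel)"
    using b by (intro nn_integral_cong) (auto simp: indicator_def)
  also have "\<dots> = (\<integral>\<^sup>+t. indicator {b..<pi} t * G t \<partial>lborel) + (\<integral>\<^sup>+t. indicator {pi..<b + pi} t * G t \<partial>lborel)"
    by (rule nn_integral_add) auto
  also have "(\<integral>\<^sup>+t. indicator {pi..<b + pi} t * G t \<partial>lborel) = (\<integral>\<^sup>+t. indicator {pi..<b + pi} (pi + 1 * t) * G (pi
      + 1 * t) \<partial>lborel)"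
    using nn_integral_real_affine[of "\<lambda>t. indicator {pi..<b + pi} t * G t" 1 pi] by simp
  also have "\<dots> = (\<integral>\<^sup>+t. indicator {0..<b} t * G t \<partial>lborel)"
    using per1 by (intro nn_integral_cong) (auto simp: indicator_def add.commute)
  also have "(\<integral>\<^sup>+t. indicator {b..<pi} t * G t \<partial>lborel) + (\<integral>\<^sup>+t. indicator {0..<b} t * G t \<partial>lborel)
     = (\<integral>\<^sup>+t. indicator {b..<pi} t * G t + indicator {0..<b} t * G t \<partial>lborel)"
    by (rule nn_integral_add[symmetric]) auto
  also have "\<dots> = (\<integral>\<^sup>+t. indicator {0..<pi} t * G t \<partial>lborel)"
    using b by (intro nn_integral_cong) (auto simp: indicator_def)
  finally show ?thesis using Gb by simp
qed

text \<open>The average of \<open>F\<close> over the fibre \<open>K\<close> above the point \<open>z\<close>.\<close>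

definition Kavg :: "((real^2^2) set \<Rightarrow> ennreal) \<Rightarrow> real \<times> real \<Rightarrow> ennreal" where
  "Kavg F z = (\<integral>\<^sup>+t. ennreal (1 / pi) * (indicator coordD (fst z, snd z, t) * F (nak (fst z) (snd z) t)) \<partial>lborel)"

lemma borel_assoc: "(\<lambda>w::(real \<times> real) \<times> real. (fst (fst w), snd (fst w), snd w)) \<in> borel_measurable borel"
  by (intro borel_measurable_continuous_onI continuous_intros)

lemma Kavg_measurable:
  assumes F: "F \<in> borel_measurable borelG"
  shows "Kavg F \<in> borel_measurable borel"
  unfolding Kavg_def
proof (rule section_nn_integral_measurable[where g = "\<lambda>w. ennreal (1 / pi) * (indicator coordD (fst (fst w), snd
    (fst w), snd w) * F (nak (fst (fst w)) (snd (fst w)) (snd w)))", simplified fst_conv snd_conv])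
  show "(\<lambda>w. ennreal (1 / pi) * (indicator coordD (fst (fst w), snd (fst w), snd w) * F (nak (fst (fst w)) (snd
      (fst w)) (snd w)))) \<in> borel_measurable borel"
    using measurable_compose[OF borel_assoc borel_measurable_coord[OF F]]
    by (intro borel_measurable_times_ennreal[OF borel_measurable_const]) simp
qed

lemma nn_integral_haar_Kavg:
  assumes F: "F \<in> borel_measurable borelG"
  shows "(\<integral>\<^sup>+g. F g \<partial>haar) = (\<integral>\<^sup>+z. Kavg F z \<partial>harea)"
proof -
  have fixm: "(\<lambda>t. indicator coordD (x, y, t) * F (nak x y t)) \<in> borel_measurable borel" for x y
  proof -
    have "(\<lambda>t::real. (x, y, t)) \<in> borel_measurable borel" by (intro borel_measurable_continuous_onI continuous_intros)
    from measurable_compose[OF this borel_measurable_coord[OF F]] show ?thesis by simp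
  qed
  show ?thesis
    unfolding nn_integral_haar[OF F] nn_integral_harea(1)[OF Kavg_measurable[OF F]]
  proof (intro nn_integral_cong)
    fix x y :: real
    show "(\<integral>\<^sup>+t. ennreal (1 / (pi * y\<^sup>2)) * (indicator coordD (x, y, t) * F (nak x y t)) \<partial>lborel) =
       indicator {0<..} y * ennreal (1 / y\<^sup>2) * Kavg F (x, y)"
    proof (cases "y > 0")
      case True
      have "(\<integral>\<^sup>+t. ennreal (1 / (pi * y\<^sup>2)) * (indicator coordD (x, y, t) * F (nak x y t)) \<partial>lborel) =
         (\<integral>\<^sup>+t. ennreal (1 / y\<^sup>2) * (ennreal (1 / pi) * (indicator coordD (x, y, t) * F (nak x y t))) \<partial>lborel)"
        by (simp add: mult.assoc[symmetric] ennreal_mult'[symmetric] mult.commute[of pi])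
      also have "\<dots> = ennreal (1 / y\<^sup>2) * Kavg F (x, y)"
        unfolding Kavg_def fst_conv snd_conv
        by (rule nn_integral_cmult) (use borel_measurable_times_ennreal[OF borel_measurable_const fixm] in simp)
      finally show ?thesis using True by simp
    qed (simp add: indicator_def)
  qed
qed

definition pt :: "(real^2^2) set \<Rightarrow> real \<times> real" where "pt g = (Re (hpt g), Im (hpt g))"

lemma pt_nak: "y > 0 \<Longrightarrow> pt (nak x y t) = (x, y)" by (simp add: pt_def hpt_nak)

lemma pt_measurable: "pt \<in> borel_measurable borelG"
proof -
  have "Re \<in> borel_measurable borel" "Im \<in> borel_measurable borel"
    by (intro borel_measurable_continuous_onI continuous_intros)+
  from this[THEN measurable_compose[OF hpt_measurable]] show ?thesis unfolding pt_def[abs_def]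
    by (rule borel_measurable_Pair)
qed

lemma pt_mult: "\<lbrakk>det A = 1; g \<in> carrier PSL2\<rbrakk> \<Longrightarrow> pt (psl A \<otimes>\<^bsub>PSL2\<^esub> g) = mob A (pt g)"
  by (simp add: pt_def mob_def hpt_mult)

text \<open>Left multiplication rotates each fibre by an angle that is constant on the fibre.\<close>

lemma mult_nak:
  assumes A: "det A = 1" and y: "y > 0"
  shows "\<exists>a. \<forall>t. psl A \<otimes>\<^bsub>PSL2\<^esub> nak x y t = nak (fst (mob A (x, y))) (snd (mob A (x, y))) (t + a)"
proof -
  let ?g = "\<lambda>t. psl A \<otimes>\<^bsub>PSL2\<^esub> nak x y t"
  have c: "?g t \<in> carrier PSL2" for t using A y by (simp add: psl_in_carrier nak_in_carrier)
  have h: "hpt (?g t) = moebius A (Complex x y)" for t using A y by (simp add: hpt_mult nak_in_carrier hpt_nak)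
  have y': "Im (moebius A (Complex x y)) > 0" using Im_hpt_pos[OF c] h by simp
  obtain a where a: "?g 0 = nak (Re (hpt (?g 0))) (Im (hpt (?g 0))) a" using nak_exists[OF c] by blast
  have "hang (?g t) = cis (2 * (t + a))" for t
  proof -
    have "hang (?g t) = hang (?g 0) * cis (2 * t)"
      using A y by (simp add: hang_mult nak_in_carrier hpt_nak hang_nak)
    also have "hang (?g 0) = cis (2 * a)" by (subst a) (use y' h in \<open>simp add: hang_nak\<close>)
    finally show ?thesis by (simp add: cis_mult distrib_left add.commute)
  qed
  then have "?g t = nak (fst (mob A (x, y))) (snd (mob A (x, y))) (t + a)" for t
    using y' h by (intro PSL2_eqI[OF c]) (simp_all add: mob_def nak_in_carrier hpt_nak hang_nak)
  then show ?thesis by blast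
qed

lemma Kavg_mult:
  assumes F: "F \<in> borel_measurable borelG" and A: "det A = 1" and y: "y > 0"
  shows "Kavg (\<lambda>g. F (psl A \<otimes>\<^bsub>PSL2\<^esub> g)) (x, y) = Kavg F (mob A (x, y))"
proof -
  obtain a where a: "\<And>t. psl A \<otimes>\<^bsub>PSL2\<^esub> nak x y t = nak (fst (mob A (x, y))) (snd (mob A (x, y))) (t + a)"
    using mult_nak[OF A y, of x] by blast
  define x' y' where "x' = fst (mob A (x, y))" and "y' = snd (mob A (x, y))"
  have y': "y' > 0"
    using Im_hpt_pos[of "psl A \<otimes>\<^bsub>PSL2\<^esub> nak x y 0"] A y by (simp add: y'_def mob_def hpt_mult nak_in_carrier hpt_nak
        psl_in_carrier)
  define G where "G = (\<lambda>t. F (nak x' y' t))"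
  have per: "G (t + of_int n * pi) = G t" for t n using y' by (simp add: G_def nak_add_int_pi)
  have Gm: "G \<in> borel_measurable borel"
  proof -
    have "(\<lambda>t. nak x' y' t) \<in> measurable borel borelG"
    proof (rule measurable_to_borelG)
      fix U assume U: "openin PSL2_top U"
      have "continuous_on UNIV (\<lambda>t. nak_mat x' y' t)" unfolding nak_mat_def
        by (intro continuous_on_matrix_mult continuous_on_mat2 continuous_intros)
      then have "openin (top_of_set UNIV) (UNIV \<inter> (\<lambda>t. nak_mat x' y' t) -` {B \<in> carrier SL2. psl B \<in> U})"
        using U y' by (intro continuous_openin_preimage[where T
            = "carrier SL2"]) (auto simp: openin_PSL2_iff SL2_def det_nak_mat)
      then have "open ((\<lambda>t. nak_mat x' y' t) -` {B \<in> carrier SL2. psl B \<in> U})" by simp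
      also have "(\<lambda>t. nak_mat x' y' t) -` {B \<in> carrier SL2. psl B \<in> U} = (\<lambda>t. nak x' y' t) -` U"
        using y' by (auto simp: nak_eq SL2_def det_nak_mat)
      finally show "(\<lambda>t. nak x' y' t) -` U \<inter> space borel \<in> sets borel" by simp
    qed (use y' in \<open>simp add: nak_in_carrier\<close>)
    from measurable_compose[OF this F] show ?thesis by (simp add: G_def)
  qed
  note [measurable] = Gm
  have "Kavg (\<lambda>g. F (psl A \<otimes>\<^bsub>PSL2\<^esub> g)) (x, y) = (\<integral>\<^sup>+t. ennreal (1 / pi) * (indicator {0..<pi} t * G (t + a)) \<partial>lborel)"
    unfolding Kavg_def fst_conv snd_conv a using y by (simp add: G_def x'_def y'_def indicator_def)
  also have "\<dots> = ennreal (1 / pi) * (\<integral>\<^sup>+t. indicator {0..<pi} t * G (t + a) \<partial>lborel)"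
    by (rule nn_integral_cmult) measurable
  also have "\<dots> = ennreal (1 / pi) * (\<integral>\<^sup>+t. indicator {0..<pi} t * G t \<partial>lborel)"
    using circle_shift[OF Gm per] by simp
  also have "\<dots> = (\<integral>\<^sup>+t. ennreal (1 / pi) * (indicator {0..<pi} t * G t) \<partial>lborel)"
    by (rule nn_integral_cmult[symmetric]) measurable
  also have "\<dots> = Kavg F (mob A (x, y))"
    unfolding Kavg_def x'_def[symmetric] y'_def[symmetric] using y' by (simp add: G_def indicator_def)
  finally show ?thesis .
qed

text \<open>The integral over the fibres is unchanged by \<open>circle_shift\<close>, the integral over the base by
  \<open>harea_invariant\<close>.\<close>

lemma haar_left_invariant:
  assumes F: "F \<in> borel_measurable borelG" and g: "g \<in> carrier PSL2"
  shows "(\<integral>\<^sup>+h. F (g \<otimes>\<^bsub>PSL2\<^esub> h) \<partial>haar) = (\<integral>\<^sup>+h. F h \<partial>haar)"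
proof -
  obtain A where A: "det A = 1" "g = psl A" using g by (rule psl_cases)
  have Fg: "(\<lambda>h. F (g \<otimes>\<^bsub>PSL2\<^esub> h)) \<in> borel_measurable borelG"
    using measurable_compose[OF mult_measurable[OF g] F] .
  have "(\<integral>\<^sup>+h. F (g \<otimes>\<^bsub>PSL2\<^esub> h) \<partial>haar) = (\<integral>\<^sup>+z. Kavg F (mob A z) \<partial>harea)"
    unfolding nn_integral_haar_Kavg[OF Fg]
    by (rule nn_integral_harea_cong)
       (use Kavg_mult[OF F A(1)] A(2) Kavg_measurable[OF Fg] measurable_compose[OF mob_measurable
           Kavg_measurable[OF F]] in auto)
  also have "\<dots> = (\<integral>\<^sup>+h. F h \<partial>haar)"
    unfolding harea_invariant[OF A(1) Kavg_measurable[OF F]] nn_integral_haar_Kavg[OF F] ..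
  finally show ?thesis .
qed

lemma haar_pt:
  assumes f: "f \<in> borel_measurable borel"
  shows "(\<integral>\<^sup>+g. f (pt g) \<partial>haar) = (\<integral>\<^sup>+z. f z \<partial>harea)"
proof -
  have F: "(\<lambda>g. f (pt g)) \<in> borel_measurable borelG" using measurable_compose[OF pt_measurable f] .
  show ?thesis
    unfolding nn_integral_haar_Kavg[OF F]
  proof (rule nn_integral_harea_cong[OF _ Kavg_measurable[OF F] f])
    fix x y :: real assume y: "y > 0"
    have "Kavg (\<lambda>g. f (pt g)) (x, y) = (\<integral>\<^sup>+t. (ennreal (1 / pi) * f (x, y)) * indicator {0..<pi} t \<partial>lborel)"
      unfolding Kavg_def using y by (intro nn_integral_cong) (auto simp: indicator_def pt_nak)
    also have "\<dots> = (ennreal (1 / pi) * f (x, y)) * ennreal pi"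
      by (subst nn_integral_cmult_indicator) auto
    also have "\<dots> = f (x, y) * (ennreal (1 / pi) * ennreal pi)" by (simp only: mult_ac)
    also have "ennreal (1 / pi) * ennreal pi = 1" by (simp flip: ennreal_mult')
    finally show "Kavg (\<lambda>g. f (pt g)) (x, y) = f (x, y)" by simp
  qed
qed

text \<open>The adjugate, which is the inverse for determinant \<open>1\<close> and is continuous in the entries.\<close>

definition adj :: "real^2^2 \<Rightarrow> real^2^2" where "adj A = mat2 (A$2$2) (- (A$1$2)) (- (A$2$1)) (A$1$1)"

lemma adj_mult: "det A = 1 \<Longrightarrow> A ** adj A = mat 1" "det A = 1 \<Longrightarrow> adj A ** A = mat 1" "det (adj A) = det A"
  by (auto intro!: mat2_eqI simp: adj_def det_2 mat_def mult_ac)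

lemma inv_psl: "det A = 1 \<Longrightarrow> inv\<^bsub>PSL2\<^esub> (psl A) = psl (adj A)"
  by (rule G.inv_equality) (simp_all add: psl_mult adj_mult one_PSL2 psl_in_carrier)

lemma discrete_isolated:
  assumes "\<one>\<^bsub>PSL2\<^esub> \<in> \<Gamma>" "discrete_in_PSL2 \<Gamma>"
  obtains U where "openin PSL2_top U" "U \<inter> \<Gamma> = {\<one>\<^bsub>PSL2\<^esub>}"
proof -
  have "openin (subtopology PSL2_top \<Gamma>) {\<one>\<^bsub>PSL2\<^esub>}"
    using assms unfolding discrete_in_PSL2_def by simp
  then show ?thesis using that by (auto simp: openin_subtopology)
qed

lemma separated_neighbourhood:
  assumes B: "det B = 1" and U: "openin PSL2_top U" "\<one>\<^bsub>PSL2\<^esub> \<in> U"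
  shows "\<exists>e>0. \<forall>A A'. det A = 1 \<longrightarrow> det A' = 1 \<longrightarrow> dist A B < e \<longrightarrow> dist A' B < e \<longrightarrow> psl (A' ** adj A) \<in> U"
proof -
  let ?S = "carrier SL2 \<times> carrier SL2"
  let ?h = "\<lambda>z. snd z ** adj (fst z)"
  have "continuous_on ?S ?h"
    unfolding adj_def by (intro continuous_on_matrix_mult continuous_on_mat2 continuous_intros)
  moreover have "?h \<in> ?S \<rightarrow> carrier SL2" by (auto simp: SL2_def det_mul adj_mult)
  ultimately have "openin (top_of_set ?S) (?S \<inter> ?h -` {A \<in> carrier SL2. psl A \<in> U})"
    using U by (intro continuous_openin_preimage[where T = "carrier SL2"]) (auto simp: openin_PSL2_iff)
  moreover have "(B, B) \<in> ?S \<inter> ?h -` {A \<in> carrier SL2. psl A \<in> U}"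
    using B U(2) by (simp add: SL2_def adj_mult one_PSL2)
  ultimately obtain e where e: "e > 0" "ball (B, B) e \<inter> ?S \<subseteq> ?S \<inter> ?h -` {A \<in> carrier SL2. psl A \<in> U}"
    by (meson openin_contains_ball)
  show ?thesis
  proof (intro exI[of _ "e / 2"] conjI allI impI)
    fix A A' :: "real^2^2" assume a: "det A = 1" "det A' = 1" "dist A B < e / 2" "dist A' B < e / 2"
    have "dist (B, B) (A, A') \<le> dist B A + dist B A'"
      unfolding dist_prod_def by (simp add: sqrt_sum_squares_le_sum)
    also have "\<dots> < e" using a by (simp add: dist_commute)
    finally have "(A, A') \<in> ball (B, B) e \<inter> ?S" using a by (simp add: SL2_def)
    with e(2) show "psl (A' ** adj A) \<in> U" by auto
  qed (use e in simp)
qed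

lemma openin_psl_ball: "openin PSL2_top (psl ` (carrier SL2 \<inter> ball B e))"
proof -
  let ?W = "carrier SL2 \<inter> (ball B e \<union> ball (- B) e)"
  have "psl ` (carrier SL2 \<inter> ball B e) = psl ` ?W"
  proof (intro equalityI subsetI)
    fix g assume "g \<in> psl ` ?W"
    then obtain A where A: "A \<in> carrier SL2" "A \<in> ball B e \<or> A \<in> ball (- B) e" "g = psl A" by auto
    moreover have "dist B (- A) = dist (- B) A" by (simp add: dist_norm norm_minus_commute add.commute)
    moreover have "psl (- A) = psl A" by (auto simp: psl_eq)
    ultimately show "g \<in> psl ` (carrier SL2 \<inter> ball B e)"
      using continuous_uminus_SL2[of A] by (metis IntI imageI mem_ball)
  qed auto
  moreover have "openin PSL2_top (psl ` ?W)"
  proof (rule openin_psl_image)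
    show "openin (top_of_set (carrier SL2)) ?W" by (intro openin_open_Int) auto
    fix A assume "A \<in> ?W"
    moreover have "dist B (- A) = dist (- B) A" "dist (- B) (- A) = dist B A"
      by (simp_all add: dist_norm norm_minus_commute add.commute)
    ultimately show "- A \<in> ?W" using continuous_uminus_SL2[of A] by auto
  qed
  ultimately show ?thesis by simp
qed

locale discrete_group =
  fixes \<Gamma> :: "(real^2^2) set set"
  assumes subgroup: "subgroup \<Gamma> PSL2" and discrete: "discrete_in_PSL2 \<Gamma>"
begin

lemma in_carrier: "\<gamma> \<in> \<Gamma> \<Longrightarrow> \<gamma> \<in> carrier PSL2" using subgroup.subset[OF subgroup] by auto

text \<open>Near each matrix the quotients \<open>A' A\<^sup>-\<^sup>1\<close> stay in a neighbourhood of the identity that meets \<open>\<Gamma>\<close> in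
  the identity only; the Lindelof property of the matrix space reduces the resulting cover to a countable one.\<close>

lemma separating_cover:
  obtains V :: "nat \<Rightarrow> (real^2^2) set set" where
    "\<And>n. openin PSL2_top (V n)" "(\<Union>n. V n) = carrier PSL2"
    "\<And>n \<gamma> g. \<gamma> \<in> \<Gamma> \<Longrightarrow> g \<in> V n \<Longrightarrow> \<gamma> \<otimes>\<^bsub>PSL2\<^esub> g \<in> V n \<Longrightarrow> \<gamma> = \<one>\<^bsub>PSL2\<^esub>"
proof -
  obtain U where U: "openin PSL2_top U" "U \<inter> \<Gamma> = {\<one>\<^bsub>PSL2\<^esub>}"
    using discrete_isolated[OF subgroup.one_closed[OF subgroup] discrete] .
  define P where "P = (\<lambda>B e. e > 0 \<and> (\<forall>A A'. det A = 1 \<longrightarrow> det A' = 1 \<longrightarrow> dist A B < e \<longrightarrow> dist A' B < e \<longrightarrow> psl (A' ** adj A) \<in> U))"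
  have "\<forall>B. det B = 1 \<longrightarrow> (\<exists>e. P B e)"
    using separated_neighbourhood[OF _ U(1)] U(2) unfolding P_def by blast
  then obtain e where e: "\<And>B. det B = 1 \<Longrightarrow> P B (e B)" by metis
  define W where "W = (\<lambda>B. carrier SL2 \<inter> ball B (e B))"
  have "\<And>S. S \<in> W ` carrier SL2 \<Longrightarrow> openin (top_of_set (carrier SL2)) S"
    unfolding W_def by (auto intro: openin_open_Int)
  then obtain \<F> where F: "\<F> \<subseteq> W ` carrier SL2" "countable \<F>" "\<Union>\<F> = \<Union>(W ` carrier SL2)"
    by (rule Lindelof_openin)
  have all: "\<Union>(W ` carrier SL2) = carrier SL2"
    using e by (auto simp: W_def P_def SL2_def)
  obtain C where C: "countable C" "C \<subseteq> carrier SL2" "\<F> = W ` C"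
    using F(1,2) by (meson countable_subset_image)
  have "mat 1 \<in> carrier SL2" by (simp add: SL2_def)
  then have "C \<noteq> {}" using F(3) all C(3) by auto
  define B where "B = from_nat_into C"
  have B: "range B = C" "\<And>n. B n \<in> carrier SL2"
    using range_from_nat_into[OF \<open>C \<noteq> {}\<close> C(1)] C(2) from_nat_into[OF \<open>C \<noteq> {}\<close>] by (auto simp: B_def)
  show ?thesis
  proof (rule that[of "\<lambda>n. psl ` W (B n)"])
    show "openin PSL2_top (psl ` W (B n))" for n unfolding W_def by (rule openin_psl_ball)
    have "(\<Union>n. W (B n)) = carrier SL2" using F(3) all C(3) B(1) by auto
    then have "(\<Union>n. psl ` W (B n)) = psl ` carrier SL2" by blast
    then show "(\<Union>n. psl ` W (B n)) = carrier PSL2" by (simp add: carrier_PSL2 SL2_def)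
    fix n \<gamma> g assume a: "\<gamma> \<in> \<Gamma>" "g \<in> psl ` W (B n)" "\<gamma> \<otimes>\<^bsub>PSL2\<^esub> g \<in> psl ` W (B n)"
    then obtain A A' where A: "A \<in> W (B n)" "g = psl A" "A' \<in> W (B n)" "\<gamma> \<otimes>\<^bsub>PSL2\<^esub> g = psl A'" by auto
    have d: "det A = 1" "det A' = 1" "dist A (B n) < e (B n)" "dist A' (B n) < e (B n)" "det (B n) = 1"
      using A B(2)[of n] by (auto simp: W_def SL2_def dist_commute)
    then have "psl (A' ** adj A) \<in> U" using e[OF d(5)] unfolding P_def by blast
    moreover have "\<gamma> = psl (A' ** adj A)"
    proof -
      have "\<gamma> = (\<gamma> \<otimes>\<^bsub>PSL2\<^esub> g) \<otimes>\<^bsub>PSL2\<^esub> inv\<^bsub>PSL2\<^esub> g"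
        using in_carrier[OF a(1)] d A(2) by (simp add: G.m_assoc psl_in_carrier)
      also have "\<dots> = psl A' \<otimes>\<^bsub>PSL2\<^esub> psl (adj A)" using A d by (simp add: inv_psl)
      finally show ?thesis using d by (simp add: psl_mult adj_mult)
    qed
    ultimately show "\<gamma> = \<one>\<^bsub>PSL2\<^esub>" using a(1) U(2) by auto
  qed
qed

lemma mult_cancel_group:
  assumes "\<gamma> \<in> \<Gamma>" "\<gamma>' \<in> \<Gamma>" "g \<in> carrier PSL2"
  shows "(\<gamma>' \<otimes>\<^bsub>PSL2\<^esub> inv\<^bsub>PSL2\<^esub> \<gamma>) \<otimes>\<^bsub>PSL2\<^esub> (\<gamma> \<otimes>\<^bsub>PSL2\<^esub> g) = \<gamma>' \<otimes>\<^bsub>PSL2\<^esub> g"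
    and "\<gamma>' \<otimes>\<^bsub>PSL2\<^esub> inv\<^bsub>PSL2\<^esub> \<gamma> \<in> \<Gamma>" "\<gamma>' \<otimes>\<^bsub>PSL2\<^esub> inv\<^bsub>PSL2\<^esub> \<gamma> = \<one>\<^bsub>PSL2\<^esub> \<Longrightarrow> \<gamma>' = \<gamma>"
proof -
  have c: "\<gamma> \<in> carrier PSL2" "\<gamma>' \<in> carrier PSL2" using assms in_carrier by auto
  have "inv\<^bsub>PSL2\<^esub> \<gamma> \<otimes>\<^bsub>PSL2\<^esub> (\<gamma> \<otimes>\<^bsub>PSL2\<^esub> g) = g"
    using c assms(3) by (simp add: G.m_assoc[symmetric])
  then show "(\<gamma>' \<otimes>\<^bsub>PSL2\<^esub> inv\<^bsub>PSL2\<^esub> \<gamma>) \<otimes>\<^bsub>PSL2\<^esub> (\<gamma> \<otimes>\<^bsub>PSL2\<^esub> g) = \<gamma>' \<otimes>\<^bsub>PSL2\<^esub> g"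
    using c assms(3) by (simp add: G.m_assoc)
  show "\<gamma>' \<otimes>\<^bsub>PSL2\<^esub> inv\<^bsub>PSL2\<^esub> \<gamma> \<in> \<Gamma>"
    using assms subgroup by (simp add: subgroup.m_closed subgroup.m_inv_closed)
  show "\<gamma>' = \<gamma>" if "\<gamma>' \<otimes>\<^bsub>PSL2\<^esub> inv\<^bsub>PSL2\<^esub> \<gamma> = \<one>\<^bsub>PSL2\<^esub>"
    using G.inv_equality[OF that] c by simp
qed

text \<open>Each orbit is represented by its point in the first set of the separating cover that the orbit meets; a
  set of the cover contains at most one point of an orbit.\<close>

lemma fundamental_set:
  obtains F where "F \<in> sets borelG" "\<And>g. g \<in> carrier PSL2 \<Longrightarrow> \<exists>!\<gamma>. \<gamma> \<in> \<Gamma> \<and> \<gamma> \<otimes>\<^bsub>PSL2\<^esub> g \<in> F" "countable \<Gamma>"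
proof -
  obtain V where V: "\<And>n::nat. openin PSL2_top (V n)" "(\<Union>n. V n) = carrier PSL2"
    "\<And>n \<gamma> g. \<gamma> \<in> \<Gamma> \<Longrightarrow> g \<in> V n \<Longrightarrow> \<gamma> \<otimes>\<^bsub>PSL2\<^esub> g \<in> V n \<Longrightarrow> \<gamma> = \<one>\<^bsub>PSL2\<^esub>"
    by (rule separating_cover) blast
  have Vc: "V n \<subseteq> carrier PSL2" for n using V(2) by blast
  have same: "\<gamma>' = \<gamma>" if "\<gamma> \<in> \<Gamma>" "\<gamma>' \<in> \<Gamma>" "g \<in> carrier PSL2" "\<gamma> \<otimes>\<^bsub>PSL2\<^esub> g \<in> V n" "\<gamma>' \<otimes>\<^bsub>PSL2\<^esub> g \<in> V n" for \<gamma> \<gamma>' g n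
    using mult_cancel_group[OF that(1-3)] V(3) that(4,5) by metis
  have "\<forall>\<gamma>\<in>\<Gamma>. \<exists>n. \<gamma> \<in> V n" using V(2) in_carrier by blast
  then obtain N where N: "\<And>\<gamma>. \<gamma> \<in> \<Gamma> \<Longrightarrow> \<gamma> \<in> V (N \<gamma>)" by metis
  have count: "countable \<Gamma>"
  proof (rule countableI'[of N])
    show "inj_on N \<Gamma>"
    proof (rule inj_onI)
      fix a b assume ab: "a \<in> \<Gamma>" "b \<in> \<Gamma>" "N a = N b"
      have "a \<otimes>\<^bsub>PSL2\<^esub> \<one>\<^bsub>PSL2\<^esub> \<in> V (N a)" "b \<otimes>\<^bsub>PSL2\<^esub> \<one>\<^bsub>PSL2\<^esub> \<in> V (N a)"
        using N[OF ab(1)] N[OF ab(2)] ab in_carrier by auto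
      then show "a = b" using same[OF ab(2,1) G.one_closed] by blast
    qed
  qed
  \<comment> \<open>\<open>S m\<close> is the union of the orbits that meet \<open>V m\<close>\<close>
  define S where "S = (\<lambda>m. \<Union>\<gamma>\<in>\<Gamma>. ((\<lambda>g. \<gamma> \<otimes>\<^bsub>PSL2\<^esub> g) -` V m \<inter> carrier PSL2))"
  define F where "F = (\<Union>n. V n - (\<Union>m\<in>{..<n}. S m))"
  have "openin PSL2_top (S m)" for m
    unfolding S_def by (intro openin_Union) (auto intro: openin_mult_preimage V(1) in_carrier)
  then have "F \<in> sets borelG"
    unfolding F_def
    by (intro sets.countable_nat_UN sets.Diff sets.finite_UN image_subsetI) (auto intro: open_in_borelG V(1))
  moreover have "\<exists>!\<gamma>. \<gamma> \<in> \<Gamma> \<and> \<gamma> \<otimes>\<^bsub>PSL2\<^esub> g \<in> F" if g: "g \<in> carrier PSL2" for g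
  proof -
    define hit where "hit = (\<lambda>n. \<exists>\<gamma>\<in>\<Gamma>. \<gamma> \<otimes>\<^bsub>PSL2\<^esub> g \<in> V n)"
    have "\<exists>n. hit n" using V(2) g subgroup.one_closed[OF subgroup] unfolding hit_def
      by (metis G.l_one UN_E)
    define n0 where "n0 = (LEAST n. hit n)"
    have h: "hit n0" "\<And>m. m < n0 \<Longrightarrow> \<not> hit m"
      using \<open>\<exists>n. hit n\<close> by (auto simp: n0_def intro: LeastI_ex dest: not_less_Least)
    have orbit: "hit m" if "\<gamma> \<in> \<Gamma>" "\<gamma>' \<in> \<Gamma>" "\<gamma>' \<otimes>\<^bsub>PSL2\<^esub> (\<gamma> \<otimes>\<^bsub>PSL2\<^esub> g) \<in> V m" for \<gamma> \<gamma>' m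
    proof -
      have "\<gamma>' \<otimes>\<^bsub>PSL2\<^esub> \<gamma> \<otimes>\<^bsub>PSL2\<^esub> g \<in> V m" using that g in_carrier by (simp add: G.m_assoc)
      moreover have "\<gamma>' \<otimes>\<^bsub>PSL2\<^esub> \<gamma> \<in> \<Gamma>" using that subgroup by (simp add: subgroup.m_closed)
      ultimately show ?thesis unfolding hit_def by blast
    qed
    have Siff: "\<gamma> \<otimes>\<^bsub>PSL2\<^esub> g \<in> S m \<longleftrightarrow> (\<exists>\<gamma>'\<in>\<Gamma>. \<gamma>' \<otimes>\<^bsub>PSL2\<^esub> (\<gamma> \<otimes>\<^bsub>PSL2\<^esub> g) \<in> V m)" if "\<gamma> \<in> \<Gamma>" for \<gamma> m
      using in_carrier[OF that] g by (simp add: S_def)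
    have inF: "\<gamma> \<otimes>\<^bsub>PSL2\<^esub> g \<in> F \<longleftrightarrow> \<gamma> \<otimes>\<^bsub>PSL2\<^esub> g \<in> V n0" if "\<gamma> \<in> \<Gamma>" for \<gamma>
    proof
      assume "\<gamma> \<otimes>\<^bsub>PSL2\<^esub> g \<in> V n0"
      moreover have "\<gamma> \<otimes>\<^bsub>PSL2\<^esub> g \<notin> S m" if "m < n0" for m
        using h(2)[OF that] orbit[OF \<open>\<gamma> \<in> \<Gamma>\<close>] Siff[OF \<open>\<gamma> \<in> \<Gamma>\<close>] by metis
      ultimately show "\<gamma> \<otimes>\<^bsub>PSL2\<^esub> g \<in> F" unfolding F_def by (intro UN_I[of n0] DiffI) auto
    next
      assume "\<gamma> \<otimes>\<^bsub>PSL2\<^esub> g \<in> F"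
      then obtain n where n1: "\<gamma> \<otimes>\<^bsub>PSL2\<^esub> g \<in> V n" "\<And>m. m < n \<Longrightarrow> \<gamma> \<otimes>\<^bsub>PSL2\<^esub> g \<notin> S m"
        unfolding F_def by auto
      have n: "\<gamma> \<otimes>\<^bsub>PSL2\<^esub> g \<in> V n"
        "\<And>m \<gamma>'. m < n \<Longrightarrow> \<gamma>' \<in> \<Gamma> \<Longrightarrow> \<gamma>' \<otimes>\<^bsub>PSL2\<^esub> (\<gamma> \<otimes>\<^bsub>PSL2\<^esub> g) \<notin> V m"
        using n1 Siff[OF that] by metis+
      have "hit n" using n(1) that unfolding hit_def by blast
      then have "n0 \<le> n" unfolding n0_def by (rule Least_le)
      moreover have "\<not> n0 < n"
      proof
        assume l: "n0 < n"
        obtain \<gamma>' where g': "\<gamma>' \<in> \<Gamma>" "\<gamma>' \<otimes>\<^bsub>PSL2\<^esub> g \<in> V n0" using h(1) unfolding hit_def by blast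
        then show False using n(2)[OF l mult_cancel_group(2)[OF that g'(1) g]] mult_cancel_group(1)[OF that g'(1) g] by simp
      qed
      ultimately show "\<gamma> \<otimes>\<^bsub>PSL2\<^esub> g \<in> V n0" using n(1) by simp
    qed
    obtain \<gamma> where "\<gamma> \<in> \<Gamma>" "\<gamma> \<otimes>\<^bsub>PSL2\<^esub> g \<in> V n0" using h(1) unfolding hit_def by blast
    then show ?thesis using inF same[OF _ _ g] by blast
  qed
  ultimately show ?thesis using that count by blast
qed

end


section \<open>Unfolding\<close>

context discrete_group
begin

definition lift_mat :: "(real^2^2) set \<Rightarrow> real^2^2" where "lift_mat \<gamma> = (SOME A. det A = 1 \<and> \<gamma> = psl A)"

lemma lift_mat: "\<gamma> \<in> \<Gamma> \<Longrightarrow> det (lift_mat \<gamma>) = 1" "\<gamma> \<in> \<Gamma> \<Longrightarrow> psl (lift_mat \<gamma>) = \<gamma>"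
proof -
  assume "\<gamma> \<in> \<Gamma>"
  then obtain A where "det A = 1 \<and> \<gamma> = psl A" using in_carrier psl_cases by metis
  then have "det (lift_mat \<gamma>) = 1 \<and> \<gamma> = psl (lift_mat \<gamma>)" unfolding lift_mat_def by (rule someI)
  then show "det (lift_mat \<gamma>) = 1" "psl (lift_mat \<gamma>) = \<gamma>" by auto
qed

definition gact :: "(real^2^2) set \<Rightarrow> real \<times> real \<Rightarrow> real \<times> real" where "gact \<gamma> = mob (lift_mat \<gamma>)"

lemma gact_measurable: "gact \<gamma> \<in> borel_measurable borel" by (simp add: gact_def mob_measurable)

lemma gact_pt: "\<gamma> \<in> \<Gamma> \<Longrightarrow> g \<in> carrier PSL2 \<Longrightarrow> pt (\<gamma> \<otimes>\<^bsub>PSL2\<^esub> g) = gact \<gamma> (pt g)"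
  using pt_mult[of "lift_mat \<gamma>" g] lift_mat[of \<gamma>] by (simp add: gact_def)

lemma pt_exists: "y > 0 \<Longrightarrow> \<exists>g\<in>carrier PSL2. pt g = (x, y)"
  using pt_nak nak_in_carrier by blast

lemma gact_inv:
  assumes "\<gamma> \<in> \<Gamma>" "y > 0"
  shows "gact \<gamma> (gact (inv\<^bsub>PSL2\<^esub> \<gamma>) (x, y)) = (x, y)" "snd (gact \<gamma> (x, y)) > 0"
proof -
  obtain g where g: "g \<in> carrier PSL2" "pt g = (x, y)" using pt_exists[OF assms(2)] by blast
  have c: "\<gamma> \<in> carrier PSL2" "inv\<^bsub>PSL2\<^esub> \<gamma> \<in> \<Gamma>" using assms in_carrier subgroup by (auto simp: subgroup.m_inv_closed)
  have "gact \<gamma> (gact (inv\<^bsub>PSL2\<^esub> \<gamma>) (pt g)) = pt (\<gamma> \<otimes>\<^bsub>PSL2\<^esub> (inv\<^bsub>PSL2\<^esub> \<gamma> \<otimes>\<^bsub>PSL2\<^esub> g))"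
    using c g assms by (simp add: gact_pt)
  also have "\<gamma> \<otimes>\<^bsub>PSL2\<^esub> (inv\<^bsub>PSL2\<^esub> \<gamma> \<otimes>\<^bsub>PSL2\<^esub> g) = g" using c g by (simp add: G.m_assoc[symmetric])
  finally show "gact \<gamma> (gact (inv\<^bsub>PSL2\<^esub> \<gamma>) (x, y)) = (x, y)" using g by simp
  have "gact \<gamma> (x, y) = pt (\<gamma> \<otimes>\<^bsub>PSL2\<^esub> g)" using g assms by (simp add: gact_pt)
  then show "snd (gact \<gamma> (x, y)) > 0" using Im_hpt_pos[of "\<gamma> \<otimes>\<^bsub>PSL2\<^esub> g"] c g by (simp add: pt_def)
qed

text \<open>A Borel set that contains exactly one point of every \<open>\<Gamma>\<close>-orbit, by \<open>fundamental_set\<close>.\<close>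

definition fund :: "(real^2^2) set set" where
  "fund = (SOME F. F \<in> sets borelG \<and> (\<forall>g\<in>carrier PSL2. \<exists>!\<gamma>. \<gamma> \<in> \<Gamma> \<and> \<gamma> \<otimes>\<^bsub>PSL2\<^esub> g \<in> F))"

lemma fund: "fund \<in> sets borelG" "\<And>g. g \<in> carrier PSL2 \<Longrightarrow> \<exists>!\<gamma>. \<gamma> \<in> \<Gamma> \<and> \<gamma> \<otimes>\<^bsub>PSL2\<^esub> g \<in> fund"
  and countable_group: "countable \<Gamma>"
proof -
  obtain F where F: "F \<in> sets borelG" "\<And>g. g \<in> carrier PSL2 \<Longrightarrow> \<exists>!\<gamma>. \<gamma> \<in> \<Gamma> \<and> \<gamma> \<otimes>\<^bsub>PSL2\<^esub> g \<in> F" "countable \<Gamma>"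
    by (rule fundamental_set) blast
  then show "countable \<Gamma>" by simp
  have "fund \<in> sets borelG \<and> (\<forall>g\<in>carrier PSL2. \<exists>!\<gamma>. \<gamma> \<in> \<Gamma> \<and> \<gamma> \<otimes>\<^bsub>PSL2\<^esub> g \<in> fund)"
    unfolding fund_def by (rule someI[of _ F]) (use F in blast)
  then show "fund \<in> sets borelG" "\<And>g. g \<in> carrier PSL2 \<Longrightarrow> \<exists>!\<gamma>. \<gamma> \<in> \<Gamma> \<and> \<gamma> \<otimes>\<^bsub>PSL2\<^esub> g \<in> fund" by blast+
qed

text \<open>The image on the half plane of Haar measure on the set of representatives.  Integrals of
  \<open>\<Gamma>\<close>-invariant functions against it are integrals over \<open>\<Gamma>\H\<close>.\<close>

definition \<rho> :: "(real \<times> real) measure" where "\<rho> = distr (restrict_space haar fund) borel pt"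

lemma sets_rho [measurable_cong, simp]: "sets \<rho> = sets borel" and space_rho [simp]: "space \<rho> = UNIV"
  by (simp_all add: \<rho>_def)

lemma fund_sub: "fund \<subseteq> carrier PSL2" using sets.sets_into_space[OF fund(1)] by (simp add: space_borelG)

lemma pt_measurable_restrict: "pt \<in> borel_measurable (restrict_space haar fund)"
proof -
  have "pt \<in> borel_measurable haar" using pt_measurable measurable_cong_sets[OF sets_haar refl] by blast
  then show ?thesis by (rule measurable_restrict_space1)
qed

lemma nn_integral_rho:
  assumes f: "f \<in> borel_measurable borel"
  shows "(\<integral>\<^sup>+z. f z \<partial>\<rho>) = (\<integral>\<^sup>+g. f (pt g) * indicator fund g \<partial>haar)"
proof -
  have "(\<integral>\<^sup>+z. f z \<partial>\<rho>) = (\<integral>\<^sup>+g. f (pt g) \<partial>restrict_space haar fund)"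
    unfolding \<rho>_def by (rule nn_integral_distr[OF pt_measurable_restrict]) (simp add: f)
  also have "\<dots> = (\<integral>\<^sup>+g. f (pt g) * indicator fund g \<partial>haar)"
    by (rule nn_integral_restrict_space) (use fund(1) fund_sub in \<open>simp add: sets_haar space_haar Int_absorb2\<close>)
  finally show ?thesis .
qed

text \<open>Every \<open>g\<close> lies in exactly one translate of the set of representatives; insert the corresponding
  sum of indicators and use left invariance in each term.\<close>

lemma unfolding_haar:
  fixes F :: "(real^2^2) set \<Rightarrow> ennreal"
  assumes F: "F \<in> borel_measurable borelG"
  shows "(\<integral>\<^sup>+g. F g \<partial>haar) = (\<integral>\<^sup>+\<gamma>. \<integral>\<^sup>+g. F (\<gamma> \<otimes>\<^bsub>PSL2\<^esub> g) * indicator fund g \<partial>haar \<partial>count_space \<Gamma>)"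
proof -
  have inv: "inv\<^bsub>PSL2\<^esub> \<gamma> \<in> \<Gamma>" if "\<gamma> \<in> \<Gamma>" for \<gamma> using that subgroup by (simp add: subgroup.m_inv_closed)
  have ind: "(\<lambda>g. indicator fund (inv\<^bsub>PSL2\<^esub> \<gamma> \<otimes>\<^bsub>PSL2\<^esub> g) * F g :: ennreal) \<in> borel_measurable borelG" if "\<gamma> \<in> \<Gamma>" for \<gamma>
    using measurable_compose[OF mult_measurable[OF in_carrier[OF inv[OF that]]] borel_measurable_indicator[OF fund(1)]] F
    by (intro borel_measurable_times_ennreal)
  have "(\<integral>\<^sup>+g. F g \<partial>haar) = (\<integral>\<^sup>+g. (\<integral>\<^sup>+\<gamma>. indicator fund (inv\<^bsub>PSL2\<^esub> \<gamma> \<otimes>\<^bsub>PSL2\<^esub> g) * F g \<partial>count_space \<Gamma>) \<partial>haar)"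
  proof (rule nn_integral_cong)
    fix g assume "g \<in> space haar"
    then have g: "g \<in> carrier PSL2" by (simp add: space_haar)
    obtain \<gamma>0 where g0: "\<gamma>0 \<in> \<Gamma>" "\<gamma>0 \<otimes>\<^bsub>PSL2\<^esub> g \<in> fund" "\<And>\<gamma>. \<gamma> \<in> \<Gamma> \<Longrightarrow> \<gamma> \<otimes>\<^bsub>PSL2\<^esub> g \<in> fund \<Longrightarrow> \<gamma> = \<gamma>0"
      using fund(2)[OF g] by blast
    have e: "inv\<^bsub>PSL2\<^esub> \<gamma> \<otimes>\<^bsub>PSL2\<^esub> g \<in> fund \<longleftrightarrow> \<gamma> = inv\<^bsub>PSL2\<^esub> \<gamma>0" if "\<gamma> \<in> \<Gamma>" for \<gamma>
      using g0(3)[OF inv[OF that]] g0(1,2) in_carrier that by (metis G.inv_inv)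
    have "(\<integral>\<^sup>+\<gamma>. indicator fund (inv\<^bsub>PSL2\<^esub> \<gamma> \<otimes>\<^bsub>PSL2\<^esub> g) * F g \<partial>count_space \<Gamma>)
      = (\<integral>\<^sup>+\<gamma>. F g * indicator {inv\<^bsub>PSL2\<^esub> \<gamma>0} \<gamma> \<partial>count_space \<Gamma>)"
      by (rule nn_integral_cong) (simp add: indicator_def e)
    also have "\<dots> = F g"
      using inv[OF g0(1)] by (subst nn_integral_cmult_indicator) (auto simp: emeasure_count_space)
    finally show "F g = (\<integral>\<^sup>+\<gamma>. indicator fund (inv\<^bsub>PSL2\<^esub> \<gamma> \<otimes>\<^bsub>PSL2\<^esub> g) * F g \<partial>count_space \<Gamma>)" ..
  qed
  also have "\<dots> = (\<integral>\<^sup>+\<gamma>. (\<integral>\<^sup>+g. indicator fund (inv\<^bsub>PSL2\<^esub> \<gamma> \<otimes>\<^bsub>PSL2\<^esub> g) * F g \<partial>haar) \<partial>count_space \<Gamma>)"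
    using ind measurable_cong_sets[OF sets_haar refl]
    by (intro nn_integral_count_space_nn_integral countable_group) blast
  also have "\<dots> = (\<integral>\<^sup>+\<gamma>. \<integral>\<^sup>+g. F (\<gamma> \<otimes>\<^bsub>PSL2\<^esub> g) * indicator fund g \<partial>haar \<partial>count_space \<Gamma>)"
  proof (rule nn_integral_cong)
    fix \<gamma> assume "\<gamma> \<in> space (count_space \<Gamma>)"
    then have g: "\<gamma> \<in> \<Gamma>" by simp
    have "(\<integral>\<^sup>+g. indicator fund (inv\<^bsub>PSL2\<^esub> \<gamma> \<otimes>\<^bsub>PSL2\<^esub> g) * F g \<partial>haar) =
       (\<integral>\<^sup>+g. indicator fund (inv\<^bsub>PSL2\<^esub> \<gamma> \<otimes>\<^bsub>PSL2\<^esub> (\<gamma> \<otimes>\<^bsub>PSL2\<^esub> g)) * F (\<gamma> \<otimes>\<^bsub>PSL2\<^esub> g) \<partial>haar)"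
      by (rule haar_left_invariant[OF ind[OF g] in_carrier[OF g], symmetric])
    also have "\<dots> = (\<integral>\<^sup>+h. F (\<gamma> \<otimes>\<^bsub>PSL2\<^esub> h) * indicator fund h \<partial>haar)"
    proof (rule nn_integral_cong)
      fix h assume "h \<in> space haar"
      then have h: "h \<in> carrier PSL2" by (simp add: space_haar)
      have "inv\<^bsub>PSL2\<^esub> \<gamma> \<otimes>\<^bsub>PSL2\<^esub> (\<gamma> \<otimes>\<^bsub>PSL2\<^esub> h) = h" using in_carrier[OF g] h by (simp add: G.m_assoc[symmetric])
      then show "indicator fund (inv\<^bsub>PSL2\<^esub> \<gamma> \<otimes>\<^bsub>PSL2\<^esub> (\<gamma> \<otimes>\<^bsub>PSL2\<^esub> h)) * F (\<gamma> \<otimes>\<^bsub>PSL2\<^esub> h) = F (\<gamma> \<otimes>\<^bsub>PSL2\<^esub> h) * indicator fund h"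
        by (simp add: mult.commute)
    qed
    finally show "(\<integral>\<^sup>+g. indicator fund (inv\<^bsub>PSL2\<^esub> \<gamma> \<otimes>\<^bsub>PSL2\<^esub> g) * F g \<partial>haar)
        = (\<integral>\<^sup>+h. F (\<gamma> \<otimes>\<^bsub>PSL2\<^esub> h) * indicator fund h \<partial>haar)" .
  qed
  finally show ?thesis .
qed

lemma unfolding_harea:
  fixes f :: "real \<times> real \<Rightarrow> ennreal"
  assumes f: "f \<in> borel_measurable borel"
  shows "(\<integral>\<^sup>+z. f z \<partial>harea) = (\<integral>\<^sup>+\<gamma>. \<integral>\<^sup>+z. f (gact \<gamma> z) \<partial>\<rho> \<partial>count_space \<Gamma>)"
proof -
  have fp: "(\<lambda>g. f (pt g)) \<in> borel_measurable borelG" using measurable_compose[OF pt_measurable f] .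
  have "(\<integral>\<^sup>+z. f z \<partial>harea) = (\<integral>\<^sup>+g. f (pt g) \<partial>haar)" by (rule haar_pt[OF f, symmetric])
  also have "\<dots> = (\<integral>\<^sup>+\<gamma>. \<integral>\<^sup>+g. f (pt (\<gamma> \<otimes>\<^bsub>PSL2\<^esub> g)) * indicator fund g \<partial>haar \<partial>count_space \<Gamma>)"
    by (rule unfolding_haar[OF fp])
  also have "\<dots> = (\<integral>\<^sup>+\<gamma>. \<integral>\<^sup>+z. f (gact \<gamma> z) \<partial>\<rho> \<partial>count_space \<Gamma>)"
    unfolding nn_integral_rho[OF measurable_compose[OF gact_measurable f]]
    by (intro nn_integral_cong) (simp add: gact_pt space_haar)
  finally show ?thesis .
qed

lemma nn_integral_rho_cong:
  assumes "\<And>x y. y > 0 \<Longrightarrow> f (x, y) = g (x, y)" "f \<in> borel_measurable borel" "g \<in> borel_measurable borel"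
  shows "(\<integral>\<^sup>+z. f z \<partial>\<rho>) = (\<integral>\<^sup>+z. g z \<partial>\<rho>)"
  unfolding nn_integral_rho[OF assms(2)] nn_integral_rho[OF assms(3)]
proof (rule nn_integral_cong)
  fix h assume "h \<in> space haar"
  then have "Im (hpt h) > 0" by (simp add: space_haar Im_hpt_pos)
  then show "f (pt h) * indicator fund h = g (pt h) * indicator fund h" using assms(1) by (simp add: pt_def)
qed

lemma sigma_finite_harea: "sigma_finite_measure harea"
proof -
  have d: "(\<lambda>(x, y). indicator {0<..} y * ennreal (1 / y\<^sup>2)) \<in> borel_measurable (lborel :: (real \<times> real) measure)"
    using harea_density_measurable by simp
  show ?thesis unfolding harea_def sigma_finite_measure.sigma_finite_iff_density_finite[OF
      lborel.sigma_finite_measure_axioms d]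
  proof (intro AE_I2, clarify)
    fix a b :: real
    assume "indicator {0<..} b * ennreal (1 / b\<^sup>2) = \<infinity>"
    then show False by (cases "b > 0") auto
  qed
qed

lemma emeasure_rho_le: "A \<in> sets borel \<Longrightarrow> emeasure \<rho> A \<le> emeasure harea A"
proof -
  assume A: "A \<in> sets borel"
  then have i: "(indicator A :: real \<times> real \<Rightarrow> ennreal) \<in> borel_measurable borel" by simp
  have "emeasure \<rho> A = (\<integral>\<^sup>+z. indicator A z \<partial>\<rho>)" using A by simp
  also have "\<dots> \<le> (\<integral>\<^sup>+g. indicator A (pt g) \<partial>haar)"
    unfolding nn_integral_rho[OF i] by (intro nn_integral_mono) (auto simp: indicator_def)
  also have "\<dots> = emeasure harea A" unfolding haar_pt[OF i] using A by simp
  finally show ?thesis .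
qed

lemma sigma_finite_rho: "sigma_finite_measure \<rho>"
proof -
  interpret H: sigma_finite_measure harea by (rule sigma_finite_harea)
  obtain A where A: "countable A" "A \<subseteq> sets harea" "\<Union>A = space harea" "\<forall>a\<in>A. emeasure harea a \<noteq> \<infinity>"
    using H.sigma_finite_countable by blast
  show ?thesis
  proof
    show "\<exists>A. countable A \<and> A \<subseteq> sets \<rho> \<and> \<Union>A = space \<rho> \<and> (\<forall>a\<in>A. emeasure \<rho> a \<noteq> \<infinity>)"
    proof (intro exI[of _ A] conjI ballI)
      fix a assume a: "a \<in> A"
      then have "a \<in> sets borel" using A(2) by auto
      from emeasure_rho_le[OF this] A(4) a show "emeasure \<rho> a \<noteq> \<infinity>"
        by (auto simp: top_unique)
    qed (use A in auto)
  qed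
qed

text \<open>Unfolding the integral over \<open>w\<close> into translates and moving the translations to \<open>z\<close> by
  invariance, the sum folds up again to an integral of \<open>k\<close> over all \<open>z\<close>.\<close>

lemma unfolding_kernel:
  fixes k :: "real \<times> real \<Rightarrow> real \<times> real \<Rightarrow> ennreal" and f :: "real \<times> real \<Rightarrow> ennreal"
  assumes k [measurable]: "(\<lambda>(z, w). k z w) \<in> borel_measurable (borel \<Otimes>\<^sub>M borel)"
    and f [measurable]: "f \<in> borel_measurable borel"
    and kinv: "\<And>\<gamma> z w. \<gamma> \<in> \<Gamma> \<Longrightarrow> snd z > 0 \<Longrightarrow> snd w > 0 \<Longrightarrow> k (gact \<gamma> z) (gact \<gamma> w) = k z w"
    and finv: "\<And>\<gamma> w. \<gamma> \<in> \<Gamma> \<Longrightarrow> snd w > 0 \<Longrightarrow> f (gact \<gamma> w) = f w"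
  shows "(\<integral>\<^sup>+z. \<integral>\<^sup>+w. k z w * f w \<partial>harea \<partial>\<rho>) = (\<integral>\<^sup>+w. f w * (\<integral>\<^sup>+z. k z w \<partial>harea) \<partial>\<rho>)"
proof -
  note gact_measurable [measurable]
  interpret R: sigma_finite_measure \<rho> by (rule sigma_finite_rho)
  interpret RR: pair_sigma_finite \<rho> \<rho> by (simp add: pair_sigma_finite_def sigma_finite_rho)
  interpret H: sigma_finite_measure harea by (rule sigma_finite_harea)
  have inv: "inv\<^bsub>PSL2\<^esub> \<gamma> \<in> \<Gamma>" if "\<gamma> \<in> \<Gamma>" for \<gamma> using that subgroup by (simp add: subgroup.m_inv_closed)
  let ?i = "\<lambda>\<gamma>. inv\<^bsub>PSL2\<^esub> \<gamma>"
  have "(\<integral>\<^sup>+z. \<integral>\<^sup>+w. k z w * f w \<partial>harea \<partial>\<rho>) =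
    (\<integral>\<^sup>+z. (\<integral>\<^sup>+\<gamma>. \<integral>\<^sup>+w. k z (gact \<gamma> w) * f (gact \<gamma> w) \<partial>\<rho> \<partial>count_space \<Gamma>) \<partial>\<rho>)"
    by (intro nn_integral_cong unfolding_harea) measurable
  also have "\<dots> = (\<integral>\<^sup>+\<gamma>. (\<integral>\<^sup>+z. \<integral>\<^sup>+w. k z (gact \<gamma> w) * f (gact \<gamma> w) \<partial>\<rho> \<partial>\<rho>) \<partial>count_space \<Gamma>)"
    by (intro nn_integral_count_space_nn_integral countable_group) measurable
  also have "\<dots> = (\<integral>\<^sup>+\<gamma>. (\<integral>\<^sup>+w. f w * (\<integral>\<^sup>+z. k (gact (?i \<gamma>) z) w \<partial>\<rho>) \<partial>\<rho>) \<partial>count_space \<Gamma>)"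
  proof (rule nn_integral_cong)
    fix \<gamma> assume "\<gamma> \<in> space (count_space \<Gamma>)"
    then have g: "\<gamma> \<in> \<Gamma>" by simp
    have ii: "?i (?i \<gamma>) = \<gamma>" using in_carrier[OF g] by simp
    have e: "k z (gact \<gamma> w) * f (gact \<gamma> w) = f w * k (gact (?i \<gamma>) z) w" if zw: "snd z > 0" "snd w > 0" for z w
    proof -
      have "gact (?i \<gamma>) (gact \<gamma> w) = w"
        using gact_inv(1)[OF inv[OF g], of "snd w" "fst w"] zw by (simp add: ii)
      moreover have "snd (gact \<gamma> w) > 0" using gact_inv(2)[OF g, of "snd w" "fst w"] zw by simp
      ultimately have "k (gact (?i \<gamma>) z) w = k z (gact \<gamma> w)" using kinv[OF inv[OF g] zw(1), of "gact \<gamma> w"] by simp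
      then show ?thesis using finv[OF g zw(2)] by (simp add: mult.commute)
    qed
    have "(\<integral>\<^sup>+z. \<integral>\<^sup>+w. k z (gact \<gamma> w) * f (gact \<gamma> w) \<partial>\<rho> \<partial>\<rho>) = (\<integral>\<^sup>+z. \<integral>\<^sup>+w. f w * k (gact (?i \<gamma>) z) w \<partial>\<rho> \<partial>\<rho>)"
    proof (rule nn_integral_rho_cong)
      fix x y :: real assume y: "y > 0"
      show "(\<integral>\<^sup>+w. k (x, y) (gact \<gamma> w) * f (gact \<gamma> w) \<partial>\<rho>) = (\<integral>\<^sup>+w. f w * k (gact (?i \<gamma>) (x, y)) w \<partial>\<rho>)"
        by (rule nn_integral_rho_cong) (use e y in auto)
    qed measurable
    also have "\<dots> = (\<integral>\<^sup>+w. \<integral>\<^sup>+z. f w * k (gact (?i \<gamma>) z) w \<partial>\<rho> \<partial>\<rho>)"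
      by (rule RR.Fubini'[symmetric]) measurable
    also have "\<dots> = (\<integral>\<^sup>+w. f w * (\<integral>\<^sup>+z. k (gact (?i \<gamma>) z) w \<partial>\<rho>) \<partial>\<rho>)"
      by (intro nn_integral_cong nn_integral_cmult) measurable
    finally show "(\<integral>\<^sup>+z. \<integral>\<^sup>+w. k z (gact \<gamma> w) * f (gact \<gamma> w) \<partial>\<rho> \<partial>\<rho>) = (\<integral>\<^sup>+w. f w * (\<integral>\<^sup>+z. k (gact (?i \<gamma>) z) w \<partial>\<rho>) \<partial>\<rho>)" .
  qed
  also have "\<dots> = (\<integral>\<^sup>+w. (\<integral>\<^sup>+\<gamma>. f w * (\<integral>\<^sup>+z. k (gact (?i \<gamma>) z) w \<partial>\<rho>) \<partial>count_space \<Gamma>) \<partial>\<rho>)"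
    by (intro nn_integral_count_space_nn_integral[symmetric] countable_group) measurable
  also have "\<dots> = (\<integral>\<^sup>+w. f w * (\<integral>\<^sup>+z. k z w \<partial>harea) \<partial>\<rho>)"
  proof (rule nn_integral_cong)
    fix w
    have bij: "bij_betw ?i \<Gamma> \<Gamma>"
      by (rule bij_betwI[where g = ?i]) (use inv in_carrier in auto)
    have "(\<integral>\<^sup>+\<gamma>. f w * (\<integral>\<^sup>+z. k (gact (?i \<gamma>) z) w \<partial>\<rho>) \<partial>count_space \<Gamma>)
        = f w * (\<integral>\<^sup>+\<gamma>. (\<integral>\<^sup>+z. k (gact (?i \<gamma>) z) w \<partial>\<rho>) \<partial>count_space \<Gamma>)"
      by (rule nn_integral_cmult) simp
    also have "(\<integral>\<^sup>+\<gamma>. (\<integral>\<^sup>+z. k (gact (?i \<gamma>) z) w \<partial>\<rho>) \<partial>count_space \<Gamma>) = (\<integral>\<^sup>+\<gamma>. (\<integral>\<^sup>+z. k (gact \<gamma> z) w \<partial>\<rho>) \<partial>count_space \<Gamma>)"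
      by (rule nn_integral_bij_count_space[OF bij])
    also have "\<dots> = (\<integral>\<^sup>+z. k z w \<partial>harea)"
      by (rule unfolding_harea[symmetric]) measurable
    finally show "(\<integral>\<^sup>+\<gamma>. f w * (\<integral>\<^sup>+z. k (gact (?i \<gamma>) z) w \<partial>\<rho>) \<partial>count_space \<Gamma>) = f w * (\<integral>\<^sup>+z. k z w \<partial>harea)" .
  qed
  finally show ?thesis .
qed

end


section \<open>The quotient measure\<close>

lemma continuous_pt_psl: "continuous_on (carrier SL2) (\<lambda>A. pt (psl A))"
proof -
  have "continuous_on (carrier SL2) (\<lambda>A. matpt A)"
    unfolding matpt_def num_def den_def complex_eq
    using den_nonzero unfolding den_def complex_eq
    by (intro continuous_intros ballI) (auto simp: SL2_def)
  then show ?thesis unfolding pt_def hpt_psl by (intro continuous_intros)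
qed

text \<open>Functions of \<open>(x, y)\<close> matter only for \<open>y > 0\<close>; this is the extension by zero.\<close>

definition hext :: "(real \<Rightarrow> real \<Rightarrow> real) \<Rightarrow> real \<times> real \<Rightarrow> ennreal" where
  "hext s z = ennreal (indicator {0<..} (snd z) * s (fst z) (snd z))"

lemma hext_measurable:
  assumes "continuous_on (UNIV \<times> {0<..}) (\<lambda>(x, y). s x y)"
  shows "hext s \<in> borel_measurable borel"
proof -
  have "UNIV \<times> {0<..} \<in> sets (borel :: (real \<times> real) measure)"
    by (intro borel_open open_Times) auto
  from borel_measurable_continuous_on_indicator[OF this assms]
  have "(\<lambda>z. indicator (UNIV \<times> {0<..}) z *\<^sub>R (case z of (x, y) \<Rightarrow> s x y)) \<in> borel_measurable borel" .
  moreover have "indicator (UNIV \<times> {0<..}) z *\<^sub>R (case z of (x, y) \<Rightarrow> s x y)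
      = indicator {0<..} (snd z) * s (fst z) (snd z)" for z :: "real \<times> real"
    by (cases z) (simp add: indicator_def)
  ultimately show ?thesis unfolding hext_def[abs_def] by (intro measurable_compose[OF _ measurable_ennreal]) simp
qed

context discrete_group
begin

abbreviation cosets :: "(real^2^2) set set set" where "cosets \<equiv> rcosets\<^bsub>PSL2\<^esub> \<Gamma>"

definition quotM :: "(real^2^2) set set measure" where "quotM = sigma cosets {U. openin (quot_top \<Gamma>) U}"

lemma quotM_sub: "{U. openin (quot_top \<Gamma>) U} \<subseteq> Pow cosets"
  by (auto simp: openin_quot_top[OF subgroup])

lemma space_quotM: "space quotM = cosets" and sets_quotM: "sets quotM = sigma_sets cosets {U. openin (quot_top \<Gamma>) U}"
  unfolding quotM_def using quotM_sub by (simp_all add: space_measure_of sets_measure_of)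

lemma coset_in_cosets: "g \<in> carrier PSL2 \<Longrightarrow> quot_proj \<Gamma> g \<in> cosets"
  by (auto simp: quot_proj_def RCOSETS_def)

lemma self_in_coset: "g \<in> carrier PSL2 \<Longrightarrow> g \<in> quot_proj \<Gamma> g"
  unfolding quot_proj_def by (rule G.rcos_self[OF _ subgroup])

lemma coset_eq:
  assumes "C \<in> cosets" "g \<in> C" shows "C = quot_proj \<Gamma> g" "g \<in> carrier PSL2"
proof -
  obtain h where h: "h \<in> carrier PSL2" "C = \<Gamma> #>\<^bsub>PSL2\<^esub> h" using assms by (auto simp: RCOSETS_def)
  show "C = quot_proj \<Gamma> g" unfolding quot_proj_def h(2)
    by (rule G.repr_independence[OF _ h(1) subgroup]) (use assms h in simp)
  show "g \<in> carrier PSL2" using assms(2) h in_carrier by (auto simp: r_coset_def)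
qed

lemma coset_mem: "h \<in> quot_proj \<Gamma> g \<longleftrightarrow> (\<exists>\<gamma>\<in>\<Gamma>. h = \<gamma> \<otimes>\<^bsub>PSL2\<^esub> g)"
  by (auto simp: quot_proj_def r_coset_def)

lemma quot_proj_mult: "\<gamma> \<in> \<Gamma> \<Longrightarrow> g \<in> carrier PSL2 \<Longrightarrow> quot_proj \<Gamma> (\<gamma> \<otimes>\<^bsub>PSL2\<^esub> g) = quot_proj \<Gamma> g"
  using coset_eq(1)[OF coset_in_cosets[of g], of "\<gamma> \<otimes>\<^bsub>PSL2\<^esub> g"] coset_mem by blast

lemma quot_proj_vimage: "U \<subseteq> cosets \<Longrightarrow> quot_proj \<Gamma> -` U \<inter> carrier PSL2 = \<Union>U"
  using coset_eq self_in_coset by blast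

lemma quot_proj_measurable: "quot_proj \<Gamma> \<in> measurable borelG quotM"
  unfolding quotM_def
proof (rule measurable_measure_of[OF quotM_sub])
  show "quot_proj \<Gamma> \<in> space borelG \<rightarrow> cosets" by (simp add: space_borelG coset_in_cosets)
  fix U assume "U \<in> {U. openin (quot_top \<Gamma>) U}"
  then have "U \<subseteq> cosets" "openin PSL2_top (\<Union>U)" by (auto simp: openin_quot_top[OF subgroup])
  then show "quot_proj \<Gamma> -` U \<inter> space borelG \<in> sets borelG"
    by (simp add: space_borelG quot_proj_vimage open_in_borelG)
qed

lemma Union_borel: "U \<in> sets quotM \<Longrightarrow> \<Union>U \<in> sets borelG"
  using measurable_sets[OF quot_proj_measurable, of U] sets.sets_into_space[of U quotM]
  by (simp add: space_borelG space_quotM quot_proj_vimage)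

lemma fund_unique:
  assumes "g \<in> fund" "\<gamma> \<in> \<Gamma>" "\<gamma> \<otimes>\<^bsub>PSL2\<^esub> g \<in> fund"
  shows "\<gamma> = \<one>\<^bsub>PSL2\<^esub>"
proof -
  have g: "g \<in> carrier PSL2" using assms(1) fund_sub by auto
  have "\<one>\<^bsub>PSL2\<^esub> \<in> \<Gamma> \<and> \<one>\<^bsub>PSL2\<^esub> \<otimes>\<^bsub>PSL2\<^esub> g \<in> fund" using assms(1) g subgroup.one_closed[OF subgroup] by simp
  then show ?thesis using fund(2)[OF g] assms by blast
qed

lemma inj_on_fund: "inj_on (quot_proj \<Gamma>) fund"
proof (rule inj_onI)
  fix g h assume a: "g \<in> fund" "h \<in> fund" "quot_proj \<Gamma> g = quot_proj \<Gamma> h"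
  then have c: "g \<in> carrier PSL2" "h \<in> carrier PSL2" using fund_sub by auto
  then have "h \<in> quot_proj \<Gamma> g" using self_in_coset a(3) by simp
  then obtain \<gamma> where \<gamma>: "\<gamma> \<in> \<Gamma>" "h = \<gamma> \<otimes>\<^bsub>PSL2\<^esub> g" using coset_mem by blast
  then show "g = h" using fund_unique[OF a(1) \<gamma>(1)] a(2) c by simp
qed

text \<open>The set of representatives attains the supremum.  A set \<open>B\<close> that is injective
  modulo \<open>\<Gamma>\<close> has at most that measure: unfolding \<open>haar B\<close> over the translates counts, for each
  representative \<open>g\<close>, the points of its orbit in \<open>B\<close>, and there is at most one.\<close>

lemma SUP_haar:
  assumes U: "U \<in> sets quotM"
  shows "(SUP B \<in> {B \<in> sets haar. B \<subseteq> \<Union>U \<and> inj_on (quot_proj \<Gamma>) B}. emeasure haar B) = emeasure haar (fund \<inter> \<Union>U)"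
proof (rule antisym)
  have UR: "U \<subseteq> cosets" using sets.sets_into_space[OF U] by (simp add: space_quotM)
  note Ub = Union_borel[OF U]
  show "emeasure haar (fund \<inter> \<Union>U) \<le> (SUP B \<in> {B \<in> sets haar. B \<subseteq> \<Union>U \<and> inj_on (quot_proj \<Gamma>) B}. emeasure haar B)"
    by (rule SUP_upper) (use fund(1) Ub inj_on_fund in \<open>auto simp: sets_haar intro: inj_on_subset\<close>)
  show "(SUP B \<in> {B \<in> sets haar. B \<subseteq> \<Union>U \<and> inj_on (quot_proj \<Gamma>) B}. emeasure haar B) \<le> emeasure haar (fund \<inter> \<Union>U)"
  proof (rule SUP_least)
    fix B assume "B \<in> {B \<in> sets haar. B \<subseteq> \<Union>U \<and> inj_on (quot_proj \<Gamma>) B}"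
    then have B: "B \<in> sets borelG" "B \<subseteq> \<Union>U" "inj_on (quot_proj \<Gamma>) B" by (auto simp: sets_haar)
    have Bm: "(indicator B :: _ \<Rightarrow> ennreal) \<in> borel_measurable borelG" using B(1) by simp
    have gm: "(\<lambda>g. indicator B (\<gamma> \<otimes>\<^bsub>PSL2\<^esub> g) * indicator fund g :: ennreal) \<in> borel_measurable haar" if "\<gamma> \<in> \<Gamma>" for \<gamma>
    proof -
      have "(\<lambda>g. indicator B (\<gamma> \<otimes>\<^bsub>PSL2\<^esub> g) * indicator fund g :: ennreal) \<in> borel_measurable borelG"
        using measurable_compose[OF mult_measurable[OF in_carrier[OF that]] Bm] fund(1)
            by (intro borel_measurable_times_ennreal) auto
      then show ?thesis using measurable_cong_sets[OF sets_haar refl] by blast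
    qed
    have "emeasure haar B = (\<integral>\<^sup>+g. indicator B g \<partial>haar)" using B(1) by (simp add: sets_haar)
    also have "\<dots> = (\<integral>\<^sup>+\<gamma>. \<integral>\<^sup>+g. indicator B (\<gamma> \<otimes>\<^bsub>PSL2\<^esub> g) * indicator fund g \<partial>haar \<partial>count_space \<Gamma>)"
      by (rule unfolding_haar[OF Bm])
    also have "\<dots> = (\<integral>\<^sup>+g. (\<integral>\<^sup>+\<gamma>. indicator B (\<gamma> \<otimes>\<^bsub>PSL2\<^esub> g) * indicator fund g \<partial>count_space \<Gamma>) \<partial>haar)"
      by (intro nn_integral_count_space_nn_integral[symmetric] countable_group gm)
    also have "\<dots> \<le> (\<integral>\<^sup>+g. indicator (fund \<inter> \<Union>U) g \<partial>haar)"
    proof (rule nn_integral_mono)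
      fix g assume "g \<in> space haar"
      then have g: "g \<in> carrier PSL2" by (simp add: space_haar)
      define T where "T = {\<gamma> \<in> \<Gamma>. \<gamma> \<otimes>\<^bsub>PSL2\<^esub> g \<in> B}"
      have T1: "a = b" if ab: "a \<in> T" "b \<in> T" for a b
      proof -
        have G: "a \<in> \<Gamma>" "b \<in> \<Gamma>" "a \<otimes>\<^bsub>PSL2\<^esub> g \<in> B" "b \<otimes>\<^bsub>PSL2\<^esub> g \<in> B" using ab by (auto simp: T_def)
        have "a \<otimes>\<^bsub>PSL2\<^esub> g = b \<otimes>\<^bsub>PSL2\<^esub> g"
          by (rule inj_onD[OF B(3) _ G(3,4)]) (simp add: quot_proj_mult G g)
        then show ?thesis using G.right_cancel[of g a b] g G in_carrier by simp
      qed
      have T2: "g \<in> \<Union>U" if ne: "T \<noteq> {}"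
      proof -
        obtain a where a: "a \<in> \<Gamma>" "a \<otimes>\<^bsub>PSL2\<^esub> g \<in> B" using ne by (auto simp: T_def)
        then obtain C where C: "C \<in> U" "a \<otimes>\<^bsub>PSL2\<^esub> g \<in> C" using B(2) by blast
        then have "C = quot_proj \<Gamma> g" using coset_eq(1)[of C] UR quot_proj_mult[OF a(1) g] by auto
        then show ?thesis using C(1) self_in_coset[OF g] by blast
      qed
      have "(\<integral>\<^sup>+\<gamma>. indicator B (\<gamma> \<otimes>\<^bsub>PSL2\<^esub> g) * indicator fund g \<partial>count_space \<Gamma>)
          = (\<integral>\<^sup>+\<gamma>. indicator fund g * indicator T \<gamma> \<partial>count_space \<Gamma>)"
        by (rule nn_integral_cong) (simp add: T_def indicator_def)
      also have "\<dots> = indicator fund g * emeasure (count_space \<Gamma>) T"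
        by (rule nn_integral_cmult_indicator) (auto simp: T_def)
      also have "\<dots> \<le> indicator (fund \<inter> \<Union>U) g"
      proof (cases "T = {}")
        case False
        then obtain a where a: "a \<in> T" by blast
        then have "T = {a}" "a \<in> \<Gamma>" using T1 by (auto simp: T_def)
        then show ?thesis using T2[OF False] by (simp add: indicator_def emeasure_count_space)
      qed simp
      finally show "(\<integral>\<^sup>+\<gamma>. indicator B (\<gamma> \<otimes>\<^bsub>PSL2\<^esub> g) * indicator fund g \<partial>count_space \<Gamma>) \<le> indicator (fund \<inter> \<Union>U) g" .
    qed
    also have "\<dots> = emeasure haar (fund \<inter> \<Union>U)" using fund(1) Ub by (simp add: sets_haar)
    finally show "emeasure haar B \<le> emeasure haar (fund \<inter> \<Union>U)" .
  qed
qed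

lemma fund_haar: "fund \<inter> space haar \<in> sets haar"
  using fund(1) fund_sub by (simp add: sets_haar space_haar Int_absorb2)

lemma quot_proj_measurable_restrict: "quot_proj \<Gamma> \<in> measurable (restrict_space haar fund) quotM"
proof -
  have "quot_proj \<Gamma> \<in> measurable haar quotM" using quot_proj_measurable measurable_cong_sets[OF sets_haar refl] by blast
  then show ?thesis by (rule measurable_restrict_space1)
qed

lemma quot_haar_eq: "quot_haar \<Gamma> = distr (restrict_space haar fund) quotM (quot_proj \<Gamma>)" (is "_ = ?N")
proof -
  let ?g = "{U. openin (quot_top \<Gamma>) U}"
  have sN: "sets ?N = sigma_sets cosets ?g" by (simp add: sets_quotM)
  have em: "emeasure ?N U = (SUP B \<in> {B \<in> sets haar. B \<subseteq> \<Union>U \<and> inj_on (quot_proj \<Gamma>) B}. emeasure haar B)" if U: "U \<in>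
      sigma_sets cosets ?g" for U
  proof -
    have UQ: "U \<in> sets quotM" using U by (simp add: sets_quotM)
    have UR: "U \<subseteq> cosets" using sets.sets_into_space[OF UQ] by (simp add: space_quotM)
    have s: "space (restrict_space haar fund) = fund" using fund_sub by (auto simp: space_restrict_space space_haar)
    have "quot_proj \<Gamma> -` U \<inter> fund = fund \<inter> \<Union>U"
      using quot_proj_vimage[OF UR] fund_sub by blast
    then have "emeasure ?N U = emeasure (restrict_space haar fund) (fund \<inter> \<Union>U)"
      by (simp add: emeasure_distr[OF quot_proj_measurable_restrict UQ] s)
    also have "\<dots> = emeasure haar (fund \<inter> \<Union>U)"
      by (rule emeasure_restrict_space[OF fund_haar]) simp
    finally show ?thesis using SUP_haar[OF UQ] by simp
  qed
  have "quot_haar \<Gamma> = measure_of cosets ?g (emeasure ?N)"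
    unfolding quot_haar_def by (rule measure_of_eq[OF quotM_sub]) (simp add: em)
  also have "\<dots> = ?N"
  proof (rule measure_eqI)
    show s: "sets (measure_of cosets ?g (emeasure ?N)) = sets ?N" using quotM_sub by (simp add: sets_measure_of sets_quotM)
    fix X assume "X \<in> sets (measure_of cosets ?g (emeasure ?N))"
    then show "emeasure (measure_of cosets ?g (emeasure ?N)) X = emeasure ?N X"
      using emeasure_countably_additive[of ?N] s
      by (intro emeasure_measure_of[OF refl quotM_sub]) (auto simp: positive_def)
  qed
  finally show ?thesis .
qed

lemma descend_coset:
  assumes f: "left_invariant \<Gamma> f" and g: "g \<in> carrier PSL2"
  shows "descend f (quot_proj \<Gamma> g) = f g"
proof -
  have "f ` (quot_proj \<Gamma> g) = {f g}"
  proof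
    show "f ` (quot_proj \<Gamma> g) \<subseteq> {f g}" using f g by (auto simp: left_invariant_def coset_mem)
    show "{f g} \<subseteq> f ` (quot_proj \<Gamma> g)" using self_in_coset[OF g] by blast
  qed
  then show ?thesis by (simp add: descend_def)
qed

text \<open>How norms over \<open>\<Gamma>\G\<close> are computed: for functions whose modulus depends only on the point of
  the half plane the norm is an integral over the half plane.\<close>

lemma L2_norm_rho:
  fixes f :: "(real^2^2) set \<Rightarrow> 'b::real_normed_vector"
  assumes f: "left_invariant \<Gamma> f" and s: "\<And>g. g \<in> carrier PSL2 \<Longrightarrow> (norm (f g))\<^sup>2 = s (fst (pt g)) (snd (pt g))"
    and cont: "continuous_on (UNIV \<times> {0<..}) (\<lambda>(x, y). s x y)"
  shows "L2_norm \<Gamma> f = sqrt (enn2real (\<integral>\<^sup>+z. hext s z \<partial>\<rho>))"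
proof -
  let ?\<phi> = "\<lambda>C. (norm (descend f C))\<^sup>2"
  have ptpos: "pt (psl A) \<in> UNIV \<times> {0<..}" if "A \<in> carrier SL2" for A
    using that Im_matpt_pos[of A] by (simp add: pt_def SL2_def mem_Times_iff)
  have cs: "continuous_on (carrier SL2) (\<lambda>A. case pt (psl A) of (x, y) \<Rightarrow> s x y)"
    by (rule continuous_on_compose2[OF cont continuous_pt_psl]) (use ptpos in blast)
  have m: "?\<phi> \<in> borel_measurable quotM"
  proof (rule borel_measurableI)
    fix S :: "real set" assume S: "open S"
    have "\<Union>(?\<phi> -` S \<inter> cosets) = {g \<in> carrier PSL2. s (fst (pt g)) (snd (pt g)) \<in> S}"
    proof (intro equalityI subsetI)
      fix g assume "g \<in> \<Union>(?\<phi> -` S \<inter> cosets)"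
      then obtain C where C: "C \<in> cosets" "g \<in> C" "?\<phi> C \<in> S" by auto
      note Cg = coset_eq[OF C(1,2)]
      then show "g \<in> {g \<in> carrier PSL2. s (fst (pt g)) (snd (pt g)) \<in> S}"
        using C(3) descend_coset[OF f Cg(2)] s[OF Cg(2)] by simp
    next
      fix g assume "g \<in> {g \<in> carrier PSL2. s (fst (pt g)) (snd (pt g)) \<in> S}"
      then have g: "g \<in> carrier PSL2" "s (fst (pt g)) (snd (pt g)) \<in> S" by auto
      then have "quot_proj \<Gamma> g \<in> ?\<phi> -` S \<inter> cosets"
        using descend_coset[OF f g(1)] s[OF g(1)] coset_in_cosets by simp
      then show "g \<in> \<Union>(?\<phi> -` S \<inter> cosets)" using self_in_coset[OF g(1)] by blast
    qed
    moreover have "openin PSL2_top {g \<in> carrier PSL2. s (fst (pt g)) (snd (pt g)) \<in> S}"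
    proof -
      have "openin (top_of_set (carrier SL2)) (carrier SL2 \<inter> (\<lambda>A. case pt (psl A) of (x, y) \<Rightarrow> s x y) -` S)"
        using cs S by (simp add: continuous_openin_preimage_gen)
      moreover have "carrier SL2 \<inter> (\<lambda>A. case pt (psl A) of (x, y) \<Rightarrow> s x y) -` S
         = {A \<in> carrier SL2. psl A \<in> {g \<in> carrier PSL2. s (fst (pt g)) (snd (pt g)) \<in> S}}"
        by (auto simp: SL2_def psl_in_carrier case_prod_unfold)
      ultimately show ?thesis by (simp add: openin_PSL2_iff)
    qed
    ultimately have "openin (quot_top \<Gamma>) (?\<phi> -` S \<inter> cosets)" by (simp add: openin_quot_top[OF subgroup])
    then show "?\<phi> -` S \<inter> space quotM \<in> sets quotM" by (simp add: space_quotM sets_quotM sigma_sets.Basic)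
  qed
  have "(LINT C|quot_haar \<Gamma>. ?\<phi> C) = enn2real (\<integral>\<^sup>+C. ennreal (?\<phi> C) \<partial>quot_haar \<Gamma>)"
    by (rule integral_eq_nn_integral) (use m in \<open>simp_all add: quot_haar_eq\<close>)
  also have "(\<integral>\<^sup>+C. ennreal (?\<phi> C) \<partial>quot_haar \<Gamma>) = (\<integral>\<^sup>+g. ennreal (?\<phi> (quot_proj \<Gamma> g)) \<partial>restrict_space haar fund)"
    unfolding quot_haar_eq by (rule nn_integral_distr[OF quot_proj_measurable_restrict]) (use m in simp)
  also have "\<dots> = (\<integral>\<^sup>+g. hext s (pt g) \<partial>restrict_space haar fund)"
  proof (rule nn_integral_cong)
    fix g assume "g \<in> space (restrict_space haar fund)"
    then have g: "g \<in> carrier PSL2" by (simp add: space_restrict_space space_haar)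
    then show "ennreal (?\<phi> (quot_proj \<Gamma> g)) = hext s (pt g)"
      using descend_coset[OF f g] s[OF g] Im_hpt_pos[OF g] by (simp add: hext_def pt_def)
  qed
  also have "\<dots> = (\<integral>\<^sup>+z. hext s z \<partial>\<rho>)"
    unfolding \<rho>_def by (rule nn_integral_distr[OF pt_measurable_restrict, symmetric]) (simp add: hext_measurable[OF cont])
  finally show ?thesis by (simp add: L2_norm_def)
qed

end


section \<open>Laplacians integrate to zero over the quotient\<close>

lemma uu_complex: "uu (Re z) (Im z) (Re w) (Im w) = (cmod (w - z))\<^sup>2 / (4 * Im z * Im w)"
  by (simp add: uu_def cmod_power2)

lemma uu_moebius:
  assumes A: "det A = 1" and z: "Im z > 0" and w: "Im w > 0"
  shows "uu (Re (moebius A z)) (Im (moebius A z)) (Re (moebius A w)) (Im (moebius A w)) = uu (Re z) (Im z) (Re w) (Im w)"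
proof -
  let ?j = "mden A z" and ?k = "mden A w"
  have nz: "?j \<noteq> 0" "?k \<noteq> 0" using mden_nonzero[OF A] z w by auto
  have "of_real (A$1$1) * of_real (A$2$2) - of_real (A$1$2) * of_real (A$2$1) = (1::complex)"
    using A by (simp add: det_2 flip: of_real_mult of_real_diff)
  then have d: "of_real (A$1$1) * of_real (A$2$2) = 1 + of_real (A$1$2) * (of_real (A$2$1) :: complex)"
      by (simp add: algebra_simps)
  have num: "(of_real (A$1$1) * w + of_real (A$1$2)) * ?j - (of_real (A$1$1) * z + of_real (A$1$2)) * ?k = w - z"
  proof -
    have "(of_real (A$1$1) * w + of_real (A$1$2)) * ?j - (of_real (A$1$1) * z + of_real (A$1$2)) * ?k
      = (of_real (A$1$1) * of_real (A$2$2) - of_real (A$1$2) * of_real (A$2$1)) * (w - z)"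
      by (simp add: mden_def algebra_simps)
    then show ?thesis by (simp add: d)
  qed
  have "moebius A w - moebius A z = (w - z) / (?j * ?k)"
    unfolding moebius_def mden_def[symmetric] using nz num by (simp add: field_simps)
  then have "(cmod (moebius A w - moebius A z))\<^sup>2 = (cmod (w - z))\<^sup>2 / ((cmod ?j)\<^sup>2 * (cmod ?k)\<^sup>2)"
    by (simp add: norm_divide norm_mult power_divide power_mult_distrib)
  moreover have im: "Im (moebius A z) = Im z / (cmod (mden A z))\<^sup>2" if "Im z > 0" for z
  proof -
    have "complex_of_real (Im (moebius A z)) = complex_of_real (Im z / (cmod (mden A z))\<^sup>2)"
      using Im_moebius(1)[OF A that] by (simp only: of_real_divide complex_norm_square)
    then show ?thesis by (simp only: of_real_eq_iff)
  qed
  ultimately show ?thesis unfolding uu_complex unfolding im[OF z] im[OF w] using nz by simp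
qed
lemma nn_integral_harea_ubox:
  assumes y0: "y0 > 0" and c: "continuous_on (UNIV \<times> {0<..}) (\<lambda>(x, y). g x y)"
    and nn: "\<And>x y. y > 0 \<Longrightarrow> g x y \<ge> 0" and h: "continuous_on {0..} h" "\<And>u. u \<ge> 0 \<Longrightarrow> h u \<ge> 0" "\<And>u. u \<ge> 4 \<Longrightarrow> h u = 0"
  shows "(\<integral>\<^sup>+z. hext (\<lambda>x y. g x y * h (uu x0 y0 x y)) z \<partial>harea)
      = ennreal (integral (ubox x0 y0) (\<lambda>(x, y). g x y * h (uu x0 y0 x y) / y\<^sup>2))"
    "integral (ubox x0 y0) (\<lambda>(x, y). g x y * h (uu x0 y0 x y) / y\<^sup>2) \<ge> 0"
    "(\<lambda>(x, y). g x y * h (uu x0 y0 x y) / y\<^sup>2) integrable_on ubox x0 y0"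
proof -
  let ?Q = "ubox x0 y0"
  let ?f = "\<lambda>(x, y). g x y * h (uu x0 y0 x y) / y\<^sup>2"
  note Q = ubox_subset[OF y0, of x0]
  have nzy: "snd z \<noteq> 0" if "z \<in> ?Q" for z
    using ubox_y_bound[OF y0, of "fst z" "snd z" x0] that by simp
  have cg: "continuous_on ?Q (\<lambda>z. g (fst z) (snd z))" using cont_case_prodD[OF c Q] .
  have ch: "continuous_on ?Q (\<lambda>z. h (uu x0 y0 (fst z) (snd z)))" by (rule continuous_on_radial[OF y0 Q h(1)])
  show I: "?f integrable_on ?Q"
    unfolding case_prod_unfold
    by (rule integrable_continuous, intro continuous_on_divide continuous_on_mult continuous_on_power
        continuous_on_snd continuous_on_id
      cg ch ballI power_not_zero nzy; assumption)
  have n: "?f z \<ge> 0" if "z \<in> ?Q" for z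
  proof -
    obtain x y where z: "z = (x, y)" by (cases z)
    have "y > 0" using ubox_y_bound[OF y0, of x y x0] that z by simp
    then show ?thesis using nn h(2)[OF uu_nonneg[OF y0]] by (simp add: z)
  qed
  show "integral ?Q ?f \<ge> 0" using I n by (intro Henstock_Kurzweil_Integration.integral_nonneg) auto
  have c': "continuous_on (UNIV \<times> {0<..}) (\<lambda>(x, y). g x y * h (uu x0 y0 x y))"
    unfolding case_prod_unfold
    by (intro continuous_on_mult cont_case_prodD[OF c subset_refl] continuous_on_radial[OF y0 subset_refl h(1)])
  have d: "(\<lambda>(x, y). indicator {0<..} y * ennreal (1 / y\<^sup>2)) \<in> borel_measurable (lborel :: (real \<times> real) measure)"
    using harea_density_measurable by simp
  have "(\<integral>\<^sup>+z. hext (\<lambda>x y. g x y * h (uu x0 y0 x y)) z \<partial>harea) =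
     (\<integral>\<^sup>+z. (case z of (x, y) \<Rightarrow> indicator {0<..} y * ennreal (1 / y\<^sup>2)) * hext (\<lambda>x y. g x y * h (uu x0 y0 x y)) z \<partial>lborel)"
    unfolding harea_def using hext_measurable[OF c'] by (subst nn_integral_density[OF d]) simp_all
  also have "\<dots> = (\<integral>\<^sup>+z. ennreal (?f z) * indicator ?Q z \<partial>lborel)"
  proof (rule nn_integral_cong)
    fix z :: "real \<times> real"
    obtain x y where z: "z = (x, y)" by (cases z)
    show "(case z of (x, y) \<Rightarrow> indicator {0<..} y * ennreal (1 / y\<^sup>2)) * hext (\<lambda>x y. g x y * h (uu x0 y0 x y)) z
        = ennreal (?f z) * indicator ?Q z"
    proof (cases "y > 0")
      case True
      have "z \<in> ?Q \<or> uu x0 y0 x y \<ge> 4"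
      proof (rule disjCI)
        assume u: "\<not> uu x0 y0 x y \<ge> 4"
        have "(x - x0)\<^sup>2 < (20 * y0)\<^sup>2" using uu_large_x[OF y0 True, of x x0] u by linarith
        then have "\<bar>x - x0\<bar> < 20 * y0" using y0 power2_less_imp_less[of "\<bar>x - x0\<bar>" "20 * y0"] by simp
        moreover have "y < 20 * y0" "y0 / 20 < y" using uu_large_y[OF y0 True, of x0 x] u by linarith+
        ultimately show "z \<in> ?Q" by (auto simp: z cbox_Pair_eq)
      qed
      then show ?thesis
      proof
        assume "z \<in> ?Q"
        then show ?thesis using True by (simp add: z hext_def ennreal_mult'[symmetric] mult.commute)
      qed (use True h(3) in \<open>simp add: z hext_def\<close>)
    next
      case False
      then have "z \<notin> ?Q" using ubox_y_bound[OF y0, of x y x0] z by auto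
      then show ?thesis using False by (simp add: z hext_def)
    qed
  qed
  also have "\<dots> = ennreal (integral ?Q ?f)"
    by (rule nn_integral_has_integral_lebesgue'[OF n integrable_integral[OF I]])
  finally show "(\<integral>\<^sup>+z. hext (\<lambda>x y. g x y * h (uu x0 y0 x y)) z \<partial>harea) = ennreal (integral ?Q ?f)" .
qed

text \<open>The hyperbolic Laplacian of the cutoff.\<close>

abbreviation mrad :: "real \<Rightarrow> real" where "mrad \<equiv> radial_lap bump1 bump2"

lemma mrad_cont: "continuous_on {0..} mrad" and mrad_supp: "u \<ge> 4 \<Longrightarrow> mrad u = 0"
  unfolding radial_lap_def by (intro continuous_intros bump_cont) (simp add: bump_supp)

text \<open>Green's formula for \<open>y\<^sup>2 \<Delta> s = a - b\<close> against the cutoff centred at \<open>(x0, y0)\<close>, with all negative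
  terms moved to the other side.  In this form it can be integrated over the centre with
  values in \<open>[0, \<infinity>]\<close>.\<close>

lemma green_nn:
  fixes s sx sy sxx syy a b :: "real \<Rightarrow> real \<Rightarrow> real"
  assumes y0: "y0 > 0"
    and sx: "\<And>x y. y > 0 \<Longrightarrow> ((\<lambda>x. s x y) has_real_derivative sx x y) (at x)"
    and sxx: "\<And>x y. y > 0 \<Longrightarrow> ((\<lambda>x. sx x y) has_real_derivative sxx x y) (at x)"
    and sy: "\<And>x y. y > 0 \<Longrightarrow> ((\<lambda>y. s x y) has_real_derivative sy x y) (at y)"
    and syy: "\<And>x y. y > 0 \<Longrightarrow> ((\<lambda>y. sy x y) has_real_derivative syy x y) (at y)"
    and cs: "continuous_on (UNIV \<times> {0<..}) (\<lambda>(x, y). s x y)"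
    and csxx: "continuous_on (UNIV \<times> {0<..}) (\<lambda>(x, y). sxx x y)"
    and csyy: "continuous_on (UNIV \<times> {0<..}) (\<lambda>(x, y). syy x y)"
    and ca: "continuous_on (UNIV \<times> {0<..}) (\<lambda>(x, y). a x y)"
    and cb: "continuous_on (UNIV \<times> {0<..}) (\<lambda>(x, y). b x y)"
    and nn: "\<And>x y. y > 0 \<Longrightarrow> s x y \<ge> 0" "\<And>x y. y > 0 \<Longrightarrow> a x y \<ge> 0" "\<And>x y. y > 0 \<Longrightarrow> b x y \<ge> 0"
    and lap: "\<And>x y. y > 0 \<Longrightarrow> y\<^sup>2 * (sxx x y + syy x y) = a x y - b x y"
  shows "(\<integral>\<^sup>+z. hext (\<lambda>x y. a x y * bump (uu x0 y0 x y)) z \<partial>harea)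
      + (\<integral>\<^sup>+z. hext (\<lambda>x y. s x y * max 0 (- mrad (uu x0 y0 x y))) z \<partial>harea)
       = (\<integral>\<^sup>+z. hext (\<lambda>x y. b x y * bump (uu x0 y0 x y)) z \<partial>harea)
           + (\<integral>\<^sup>+z. hext (\<lambda>x y. s x y * max 0 (mrad (uu x0 y0 x y))) z \<partial>harea)"
proof -
  let ?Q = "ubox x0 y0"
  have hb: "continuous_on {0..} bump" "\<And>u. u \<ge> 0 \<Longrightarrow> bump u \<ge> 0" "\<And>u. u \<ge> 4 \<Longrightarrow> bump u = 0"
    by (simp_all add: bump_cont bump_nonneg bump_supp)
  have hp: "continuous_on {0..} (\<lambda>u. max 0 (mrad u))" "\<And>u. u \<ge> 0 \<Longrightarrow> max 0 (mrad u) \<ge> 0" "\<And>u. u \<ge> 4 \<Longrightarrow> max 0 (mrad u) = 0"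
    by (auto intro!: continuous_intros mrad_cont simp: mrad_supp)
  have hm: "continuous_on {0..} (\<lambda>u. max 0 (- mrad u))" "\<And>u. u \<ge> 0 \<Longrightarrow> max 0 (- mrad u) \<ge> 0" "\<And>u. u \<ge> 4 \<Longrightarrow> max 0 (- mrad u) = 0"
    by (auto intro!: continuous_intros mrad_cont simp: mrad_supp)
  note A = nn_integral_harea_ubox[OF y0 ca nn(2) hb, of x0]
  note B = nn_integral_harea_ubox[OF y0 cb nn(3) hb, of x0]
  note P = nn_integral_harea_ubox[OF y0 cs nn(1) hp, of x0]
  note M = nn_integral_harea_ubox[OF y0 cs nn(1) hm, of x0]
  have G: "integral ?Q (\<lambda>(x, y). (sxx x y + syy x y) * bump (uu x0 y0 x y))
      = integral ?Q (\<lambda>(x, y). s x y * mrad (uu x0 y0 x y) / y\<^sup>2)"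
    by (rule green_radial[OF y0 sx sxx sy syy cs csxx csyy bump_d1 bump_d2 bump_cont(3) bump_supp(1,2)])
  have "integral ?Q (\<lambda>(x, y). (sxx x y + syy x y) * bump (uu x0 y0 x y)) =
     integral ?Q (\<lambda>z. (case z of (x, y) \<Rightarrow> a x y * bump (uu x0 y0 x y) / y\<^sup>2) - (case z of (x, y) \<Rightarrow> b x y * bump (uu
         x0 y0 x y) / y\<^sup>2))"
  proof (rule integral_cong)
    fix z assume zQ: "z \<in> ?Q"
    obtain x y where z: "z = (x, y)" by (cases z)
    have y: "y > 0" using ubox_y_bound[OF y0, of x y x0] zQ z by simp
    have "sxx x y + syy x y = (a x y - b x y) / y\<^sup>2" using lap[OF y, of x] y by (simp add: field_simps)
    then show "(case z of (x, y) \<Rightarrow> (sxx x y + syy x y) * bump (uu x0 y0 x y)) =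
       (case z of (x, y) \<Rightarrow> a x y * bump (uu x0 y0 x y) / y\<^sup>2) - (case z of (x, y) \<Rightarrow> b x y * bump (uu x0 y0 x y) / y\<^sup>2)"
      by (simp add: z diff_divide_distrib left_diff_distrib)
  qed
  also have "\<dots> = integral ?Q (\<lambda>(x, y). a x y * bump (uu x0 y0 x y) / y\<^sup>2) - integral ?Q (\<lambda>(x, y). b x y * bump (uu
      x0 y0 x y) / y\<^sup>2)"
    by (rule integral_diff[OF A(3) B(3)])
  finally have 1: "integral ?Q (\<lambda>(x, y). s x y * mrad (uu x0 y0 x y) / y\<^sup>2) =
     integral ?Q (\<lambda>(x, y). a x y * bump (uu x0 y0 x y) / y\<^sup>2) - integral ?Q (\<lambda>(x, y). b x y * bump (uu x0 y0 x y) / y\<^sup>2)"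
    using G by simp
  have "integral ?Q (\<lambda>(x, y). s x y * mrad (uu x0 y0 x y) / y\<^sup>2) =
    integral ?Q (\<lambda>z. (case z of (x, y) \<Rightarrow> s x y * max 0 (mrad (uu x0 y0 x y)) / y\<^sup>2) - (case z of (x, y) \<Rightarrow> s x y *
        max 0 (- mrad (uu x0 y0 x y)) / y\<^sup>2))"
    by (rule integral_cong) (auto simp: max_def)
  also have "\<dots> = integral ?Q (\<lambda>(x, y). s x y * max 0 (mrad (uu x0 y0 x y)) / y\<^sup>2) - integral ?Q (\<lambda>(x, y). s x y *
      max 0 (- mrad (uu x0 y0 x y)) / y\<^sup>2)"
    by (rule integral_diff[OF P(3) M(3)])
  finally have "integral ?Q (\<lambda>(x, y). a x y * bump (uu x0 y0 x y) / y\<^sup>2)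
      + integral ?Q (\<lambda>(x, y). s x y * max 0 (- mrad (uu x0 y0 x y)) / y\<^sup>2)
    = integral ?Q (\<lambda>(x, y). b x y * bump (uu x0 y0 x y) / y\<^sup>2)
        + integral ?Q (\<lambda>(x, y). s x y * max 0 (mrad (uu x0 y0 x y)) / y\<^sup>2)"
    using 1 by linarith
  then have "ennreal (integral ?Q (\<lambda>(x, y). a x y * bump (uu x0 y0 x y) / y\<^sup>2))
      + ennreal (integral ?Q (\<lambda>(x, y). s x y * max 0 (- mrad (uu x0 y0 x y)) / y\<^sup>2))
    = ennreal (integral ?Q (\<lambda>(x, y). b x y * bump (uu x0 y0 x y) / y\<^sup>2))
        + ennreal (integral ?Q (\<lambda>(x, y). s x y * max 0 (mrad (uu x0 y0 x y)) / y\<^sup>2))"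
    using A(2) B(2) P(2) M(2) by (simp flip: ennreal_plus)
  then show ?thesis by (simp only: A(1) B(1) P(1) M(1))
qed
definition rad :: "(real \<Rightarrow> real) \<Rightarrow> real \<times> real \<Rightarrow> real \<times> real \<Rightarrow> ennreal" where
  "rad h z w = (if snd z > 0 \<and> snd w > 0 then ennreal (h (uu (fst z) (snd z) (fst w) (snd w))) else 0)"

text \<open>The total mass of the kernel \<open>h(uu)\<close>, which is the same for all centres by \<open>rad_mass\<close>.\<close>

definition radmass :: "(real \<Rightarrow> real) \<Rightarrow> ennreal" where
  "radmass h = (\<integral>\<^sup>+z. hext (\<lambda>x y. h (uu 0 1 x y)) z \<partial>harea)"

lemma rad_measurable:
  assumes h: "continuous_on {0..} h"
  shows "(\<lambda>(z, w). rad h z w) \<in> borel_measurable (borel \<Otimes>\<^sub>M borel)"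
proof -
  let ?S = "{p :: (real \<times> real) \<times> real \<times> real. snd (fst p) > 0 \<and> snd (snd p) > 0}"
  have oS: "open ?S" by (intro open_Collect_conj open_Collect_less continuous_intros)
  have "continuous_on ?S (\<lambda>p. h (uu (fst (fst p)) (snd (fst p)) (fst (snd p)) (snd (snd p))))"
  proof (rule continuous_on_compose2[OF h])
    show "continuous_on ?S (\<lambda>p. uu (fst (fst p)) (snd (fst p)) (fst (snd p)) (snd (snd p)))"
      unfolding uu_def by (intro continuous_intros) auto
    show "(\<lambda>p. uu (fst (fst p)) (snd (fst p)) (fst (snd p)) (snd (snd p))) ` ?S \<subseteq> {0..}"
      using uu_nonneg by auto
  qed
  from borel_measurable_continuous_on_indicator[OF borel_open[OF oS] this]
  have "(\<lambda>p. ennreal (indicator ?S p *\<^sub>R h (uu (fst (fst p)) (snd (fst p)) (fst (snd p)) (snd (snd p))))) \<in>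
      borel_measurable borel"
    by (rule measurable_compose[OF _ measurable_ennreal])
  moreover have "ennreal (indicator ?S p *\<^sub>R h (uu (fst (fst p)) (snd (fst p)) (fst (snd p)) (snd (snd p))))
      = (case p of (z, w) \<Rightarrow> rad h z w)" for p
    by (auto simp: rad_def indicator_def case_prod_unfold)
  ultimately show ?thesis by (simp add: borel_prod)
qed

lemma rad_section_measurable:
  assumes h: "continuous_on {0..} h"
  shows "(\<lambda>z. rad h z w) \<in> borel_measurable borel" "(\<lambda>z. rad h w z) \<in> borel_measurable borel"
  using measurable_compose[OF _ rad_measurable[OF h], of "\<lambda>z. (z, w)" borel]
    measurable_compose[OF _ rad_measurable[OF h], of "\<lambda>z. (w, z)" borel] by simp_all

lemma rad_mass:
  assumes h: "continuous_on {0..} h" and r: "r > 0"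
  shows "(\<integral>\<^sup>+z. rad h z (b, r) \<partial>harea) = radmass h"
proof -
  note m = rad_section_measurable[OF h]
  have "(\<integral>\<^sup>+z. rad h z (b, r) \<partial>harea) = (\<integral>\<^sup>+z. rad h (b + r * fst z, r * snd z) (b, r) \<partial>harea)"
    by (rule harea_affine[OF m(1) r, symmetric])
  also have "\<dots> = (\<integral>\<^sup>+z. hext (\<lambda>x y. h (uu 0 1 x y)) z \<partial>harea)"
  proof (rule nn_integral_harea_cong)
    fix x y :: real assume y: "y > 0"
    have "uu (b + r * x) (r * y) b r = uu 0 1 x y"
    proof -
      have "(b - (b + r * x))\<^sup>2 + (r - r * y)\<^sup>2 = r\<^sup>2 * (x\<^sup>2 + (y - 1)\<^sup>2)" by (simp add: power2_eq_square algebra_simps)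
      then show ?thesis using r y by (simp add: uu_def field_simps power2_eq_square)
    qed
    then show "rad h (b + r * fst (x, y), r * snd (x, y)) (b, r) = hext (\<lambda>x y. h (uu 0 1 x y)) (x, y)"
      using y r by (simp add: rad_def hext_def)
  next
    show "(\<lambda>z. rad h (b + r * fst z, r * snd z) (b, r)) \<in> borel_measurable borel"
      by (rule measurable_compose[OF _ m(1)]) (intro borel_measurable_continuous_onI continuous_intros)
    show "hext (\<lambda>x y. h (uu 0 1 x y)) \<in> borel_measurable borel"
      by (rule hext_measurable) (use continuous_on_radial[of 1 "UNIV \<times> {0<..}" h 0] h in \<open>simp add: case_prod_unfold\<close>)
  qed
  finally show ?thesis by (simp add: radmass_def)
qed

text \<open>The lower bound comes from the box \<open>[0, 1/2] \<times> [1, 3/2]\<close>, on which the invariant is at most \<open>1\<close>.\<close>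

lemma radmass_bump: "radmass bump \<noteq> 0" "radmass bump \<noteq> \<infinity>"
proof -
  have hb: "continuous_on {0..} bump" "\<And>u. u \<ge> 0 \<Longrightarrow> bump u \<ge> 0" "\<And>u. u \<ge> 4 \<Longrightarrow> bump u = 0"
    by (simp_all add: bump_cont bump_nonneg bump_supp)
  have c1: "continuous_on (UNIV \<times> {0<..}) (\<lambda>(x::real, y::real). 1::real)" by (simp add: case_prod_unfold)
  have "radmass bump = ennreal (integral (ubox 0 1) (\<lambda>(x, y). 1 * bump (uu 0 1 x y) / y\<^sup>2))"
    using nn_integral_harea_ubox(1)[OF zero_less_one c1 _ hb, of 0] by (simp add: radmass_def)
  then show "radmass bump \<noteq> \<infinity>" by simp
  let ?B = "cbox (0, 1) (1/2, 3/2) :: (real \<times> real) set"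
  have "(\<integral>\<^sup>+z. ennreal (1/16) * indicator ?B z \<partial>harea) \<le> radmass bump"
    unfolding radmass_def
  proof (rule nn_integral_mono)
    fix z :: "real \<times> real"
    obtain x y where z: "z = (x, y)" by (cases z)
    show "ennreal (1/16) * indicator ?B z \<le> hext (\<lambda>x y. bump (uu 0 1 x y)) z"
    proof (cases "z \<in> ?B")
      case True
      then have xy: "0 \<le> x" "x \<le> 1/2" "1 \<le> y" "y \<le> 3/2" by (auto simp: z cbox_Pair_eq)
      have "x\<^sup>2 \<le> (1/2)\<^sup>2" "(y - 1)\<^sup>2 \<le> (1/2)\<^sup>2" using xy by (auto intro!: power_mono)
      then have "x\<^sup>2 + (y - 1)\<^sup>2 \<le> 4 * y" using xy by (simp add: power2_eq_square)
      then have "uu 0 1 x y \<le> 1" using xy by (simp add: uu_def divide_le_eq)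
      from bump_ge[OF this] have "1/16 \<le> bump (uu 0 1 x y)" by simp
      then show ?thesis using xy True by (simp add: z hext_def ennreal_leI)
    qed simp
  qed
  moreover have "(\<integral>\<^sup>+z. ennreal (1/16) * indicator ?B z \<partial>harea) > 0"
  proof -
    have i: "(\<lambda>z. ennreal (1/16) * indicator ?B z) \<in> borel_measurable borel" by simp
    have d: "(\<lambda>(x, y). indicator {0<..} y * ennreal (1 / y\<^sup>2)) \<in> borel_measurable (lborel :: (real \<times> real) measure)"
      using harea_density_measurable by simp
    have "0 < ennreal (1/64) * emeasure lborel ?B"
      by (simp add: ennreal_zero_less_mult_iff emeasure_lborel_cbox_eq Basis_prod_def)
    also have "\<dots> = (\<integral>\<^sup>+z. ennreal (1/64) * indicator ?B z \<partial>lborel)"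
      by (rule nn_integral_cmult_indicator[symmetric]) simp
    also have "\<dots> \<le> (\<integral>\<^sup>+z. (case z of (x, y) \<Rightarrow> indicator {0<..} y * ennreal (1 / y\<^sup>2)) * (ennreal (1/16) * indicator
        ?B z) \<partial>lborel)"
    proof (rule nn_integral_mono)
      fix z :: "real \<times> real"
      obtain x y where z: "z = (x, y)" by (cases z)
      show "ennreal (1/64) * indicator ?B z \<le> (case z of (x, y) \<Rightarrow> indicator {0<..} y * ennreal (1 / y\<^sup>2)) *
          (ennreal (1/16) * indicator ?B z)"
      proof (cases "z \<in> ?B")
        case True
        then have y: "1 \<le> y" "y \<le> 2" by (auto simp: z cbox_Pair_eq)
        then have "y\<^sup>2 \<le> 2\<^sup>2" by (intro power_mono) auto
        then have "1 / 64 \<le> 1 / y\<^sup>2 * (1 / 16)" using y by (simp add: field_simps)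
        then show ?thesis using True y by (simp add: z ennreal_leI flip: ennreal_mult')
      qed simp
    qed
    also have "\<dots> = (\<integral>\<^sup>+z. ennreal (1/16) * indicator ?B z \<partial>harea)"
      unfolding harea_def using i by (subst nn_integral_density[OF d]) simp_all
    finally show ?thesis .
  qed
  ultimately show "radmass bump \<noteq> 0" by auto
qed

text \<open>Green's formula with \<open>s = 1\<close>: the Laplacian of the cutoff has total mass zero.\<close>

lemma radmass_mrad:
  "radmass (\<lambda>u. max 0 (mrad u)) = radmass (\<lambda>u. max 0 (- mrad u))" "radmass (\<lambda>u. max 0 (mrad u)) \<noteq> \<infinity>"
proof -
  have c: "continuous_on S (\<lambda>(x::real, y::real). a::real)" for a S by (simp add: case_prod_unfold)
  have "(\<integral>\<^sup>+z. hext (\<lambda>x y. 0 * bump (uu 0 1 x y)) z \<partial>harea) + (\<integral>\<^sup>+z. hext (\<lambda>x y. 1 * max 0 (- mrad (uu 0 1 x y))) z \<partial>harea)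
       = (\<integral>\<^sup>+z. hext (\<lambda>x y. 0 * bump (uu 0 1 x y)) z \<partial>harea) + (\<integral>\<^sup>+z. hext (\<lambda>x y. 1 * max 0 (mrad (uu 0 1 x y))) z \<partial>harea)"
    by (rule green_nn[where sx = "\<lambda>x y. 0" and sy = "\<lambda>x y. 0" and sxx = "\<lambda>x y. 0" and syy = "\<lambda>x y. 0"])
       (auto intro: c)
  then show "radmass (\<lambda>u. max 0 (mrad u)) = radmass (\<lambda>u. max 0 (- mrad u))"
    by (simp add: radmass_def hext_def[abs_def])
  have hp: "continuous_on {0..} (\<lambda>u. max 0 (mrad u))" "\<And>u. u \<ge> 0 \<Longrightarrow> max 0 (mrad u) \<ge> 0" "\<And>u. u \<ge> 4 \<Longrightarrow> max 0 (mrad u) = 0"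
    by (auto intro!: continuous_intros mrad_cont simp: mrad_supp)
  have "radmass (\<lambda>u. max 0 (mrad u)) = ennreal (integral (ubox 0 1) (\<lambda>(x, y). 1 * max 0 (mrad (uu 0 1 x y)) / y\<^sup>2))"
    using nn_integral_harea_ubox(1)[OF zero_less_one c _ hp, of 1 0] by (simp add: radmass_def)
  then show "radmass (\<lambda>u. max 0 (mrad u)) \<noteq> \<infinity>" by simp
qed

context discrete_group
begin

definition invariant :: "(real \<Rightarrow> real \<Rightarrow> real) \<Rightarrow> bool" where
  "invariant s \<longleftrightarrow> (\<forall>\<gamma>\<in>\<Gamma>. \<forall>x. \<forall>y>0. s (fst (gact \<gamma> (x, y))) (snd (gact \<gamma> (x, y))) = s x y)"

definition area_integral :: "(real \<Rightarrow> real \<Rightarrow> real) \<Rightarrow> ennreal" where "area_integral s = (\<integral>\<^sup>+z. hext s z \<partial>\<rho>)"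

text \<open>Averaging an invariant function over the kernel, and then over the quotient, multiplies its integral
  by the mass of the kernel; this is \<open>unfolding_kernel\<close>.\<close>

lemma average:
  assumes h: "continuous_on {0..} h" and hn: "\<And>u. u \<ge> 0 \<Longrightarrow> h u \<ge> 0" and cg: "continuous_on (UNIV \<times> {0<..}) (\<lambda>(x, y). g x y)"
    and gn: "\<And>x y. y > 0 \<Longrightarrow> g x y \<ge> 0" and inv: "invariant g"
  shows "(\<integral>\<^sup>+z. indicator {0<..} (snd z) * (\<integral>\<^sup>+w. hext (\<lambda>x y. g x y * h (uu (fst z) (snd z) x y)) w \<partial>harea) \<partial>\<rho>)
      = area_integral g * radmass h"
    "(\<lambda>z. indicator {0<..} (snd z) * (\<integral>\<^sup>+w. hext (\<lambda>x y. g x y * h (uu (fst z) (snd z) x y)) w \<partial>harea)) \<in>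
        borel_measurable borel"
proof -
  interpret H: sigma_finite_measure harea by (rule sigma_finite_harea)
  note rm [measurable] = rad_measurable[OF h]
  note gm [measurable] = hext_measurable[OF cg]
  have e: "indicator {0<..} (snd z) * (\<integral>\<^sup>+w. hext (\<lambda>x y. g x y * h (uu (fst z) (snd z) x y)) w \<partial>harea)
      = (\<integral>\<^sup>+w. rad h z w * hext g w \<partial>harea)" for z
  proof (cases "snd z > 0")
    case True
    have "(\<integral>\<^sup>+w. hext (\<lambda>x y. g x y * h (uu (fst z) (snd z) x y)) w \<partial>harea) = (\<integral>\<^sup>+w. rad h z w * hext g w \<partial>harea)"
    proof (rule nn_integral_harea_cong)
      fix x y :: real assume y: "y > 0"
      show "hext (\<lambda>x y. g x y * h (uu (fst z) (snd z) x y)) (x, y) = rad h z (x, y) * hext g (x, y)"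
        using True y gn[OF y, of x] hn[OF uu_nonneg[OF True y, of "fst z" x]]
        by (simp add: hext_def rad_def ennreal_mult'[symmetric] mult.commute)
    next
      show "hext (\<lambda>x y. g x y * h (uu (fst z) (snd z) x y)) \<in> borel_measurable borel"
        by (rule hext_measurable) (unfold case_prod_unfold,
          intro continuous_on_mult cont_case_prodD[OF cg subset_refl] continuous_on_radial[OF True subset_refl h])
      show "(\<lambda>w. rad h z w * hext g w) \<in> borel_measurable borel"
        by (intro borel_measurable_times_ennreal rad_section_measurable[OF h] gm)
    qed
    then show ?thesis using True by simp
  qed (simp add: rad_def)
  show "(\<lambda>z. indicator {0<..} (snd z) * (\<integral>\<^sup>+w. hext (\<lambda>x y. g x y * h (uu (fst z) (snd z) x y)) w \<partial>harea)) \<in>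
      borel_measurable borel"
    unfolding e by measurable
  have "(\<integral>\<^sup>+z. indicator {0<..} (snd z) * (\<integral>\<^sup>+w. hext (\<lambda>x y. g x y * h (uu (fst z) (snd z) x y)) w \<partial>harea) \<partial>\<rho>)
     = (\<integral>\<^sup>+z. \<integral>\<^sup>+w. rad h z w * hext g w \<partial>harea \<partial>\<rho>)" unfolding e ..
  also have "\<dots> = (\<integral>\<^sup>+w. hext g w * (\<integral>\<^sup>+z. rad h z w \<partial>harea) \<partial>\<rho>)"
  proof (rule unfolding_kernel[OF rm gm])
    fix \<gamma> and z w :: "real \<times> real" assume g: "\<gamma> \<in> \<Gamma>" and w: "snd w > 0"
    have p: "snd (gact \<gamma> w) > 0" using gact_inv(2)[OF g w, of "fst w"] by simp
    then show "hext g (gact \<gamma> w) = hext g w" using inv g w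
      unfolding invariant_def hext_def by (metis prod.collapse indicator_simps(1) greaterThan_iff)
    assume z: "snd z > 0"
    have q: "snd (gact \<gamma> z) > 0" using gact_inv(2)[OF g z, of "fst z"] by simp
    have "uu (fst (gact \<gamma> z)) (snd (gact \<gamma> z)) (fst (gact \<gamma> w)) (snd (gact \<gamma> w)) = uu (fst z) (snd z) (fst w) (snd w)"
      using uu_moebius[OF lift_mat(1)[OF g], of "Complex (fst z) (snd z)" "Complex (fst w) (snd w)"] z w
      by (simp add: gact_def mob_def)
    then show "rad h (gact \<gamma> z) (gact \<gamma> w) = rad h z w" using p q z w by (simp add: rad_def)
  qed
  also have "\<dots> = (\<integral>\<^sup>+w. hext g w * radmass h \<partial>\<rho>)"
  proof (rule nn_integral_cong)
    fix w :: "real \<times> real"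
    show "hext g w * (\<integral>\<^sup>+z. rad h z w \<partial>harea) = hext g w * radmass h"
      using rad_mass[OF h, of "snd w" "fst w"] by (cases "snd w > 0") (auto simp: hext_def)
  qed
  also have "\<dots> = area_integral g * radmass h"
    unfolding area_integral_def by (rule nn_integral_multc) simp
  finally show "(\<integral>\<^sup>+z. indicator {0<..} (snd z) * (\<integral>\<^sup>+w. hext (\<lambda>x y. g x y * h (uu (fst z) (snd z) x y)) w \<partial>harea)
      \<partial>\<rho>) = area_integral g * radmass h" .
qed

text \<open>Integrate \<open>green_nn\<close> over the centre.  By \<open>average\<close> this gives
  \<open>A m + S n = B m + S n\<close>, where \<open>A\<close>, \<open>B\<close>, \<open>S\<close> are the integrals of \<open>a\<close>, \<open>b\<close>, \<open>s\<close>, \<open>m\<close> is the mass of the cutoff and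
  \<open>n\<close> the common mass of the two parts of its Laplacian.  Since \<open>S\<close> is finite, \<open>S n\<close> cancels.\<close>

theorem area_integral_laplacian:
  fixes s sx sy sxx syy a b :: "real \<Rightarrow> real \<Rightarrow> real"
  assumes sx: "\<And>x y. y > 0 \<Longrightarrow> ((\<lambda>x. s x y) has_real_derivative sx x y) (at x)"
    and sxx: "\<And>x y. y > 0 \<Longrightarrow> ((\<lambda>x. sx x y) has_real_derivative sxx x y) (at x)"
    and sy: "\<And>x y. y > 0 \<Longrightarrow> ((\<lambda>y. s x y) has_real_derivative sy x y) (at y)"
    and syy: "\<And>x y. y > 0 \<Longrightarrow> ((\<lambda>y. sy x y) has_real_derivative syy x y) (at y)"
    and cs: "continuous_on (UNIV \<times> {0<..}) (\<lambda>(x, y). s x y)"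
    and csxx: "continuous_on (UNIV \<times> {0<..}) (\<lambda>(x, y). sxx x y)"
    and csyy: "continuous_on (UNIV \<times> {0<..}) (\<lambda>(x, y). syy x y)"
    and ca: "continuous_on (UNIV \<times> {0<..}) (\<lambda>(x, y). a x y)"
    and cb: "continuous_on (UNIV \<times> {0<..}) (\<lambda>(x, y). b x y)"
    and nn: "\<And>x y. y > 0 \<Longrightarrow> s x y \<ge> 0" "\<And>x y. y > 0 \<Longrightarrow> a x y \<ge> 0" "\<And>x y. y > 0 \<Longrightarrow> b x y \<ge> 0"
    and lap: "\<And>x y. y > 0 \<Longrightarrow> y\<^sup>2 * (sxx x y + syy x y) = a x y - b x y"
    and inv: "invariant s" "invariant a" "invariant b" and fin: "area_integral s \<noteq> \<infinity>"
  shows "area_integral a = area_integral b"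
proof -
  have hb: "continuous_on {0..} bump" "\<And>u. u \<ge> 0 \<Longrightarrow> bump u \<ge> 0"
    by (simp_all add: bump_cont bump_nonneg)
  have hp: "continuous_on {0..} (\<lambda>u. max 0 (mrad u))" "\<And>u. u \<ge> 0 \<Longrightarrow> max 0 (mrad u) \<ge> 0"
    by (auto intro!: continuous_intros mrad_cont)
  have hm: "continuous_on {0..} (\<lambda>u. max 0 (- mrad u))" "\<And>u. u \<ge> 0 \<Longrightarrow> max 0 (- mrad u) \<ge> 0"
    by (auto intro!: continuous_intros mrad_cont)
  note A = average[OF hb ca nn(2) inv(2)]
  note B = average[OF hb cb nn(3) inv(3)]
  note P = average[OF hp cs nn(1) inv(1)]
  note M = average[OF hm cs nn(1) inv(1)]
  define av where "av = (\<lambda>g h z. indicator {0<..} (snd z) * (\<integral>\<^sup>+w. hext (\<lambda>x y. g x y * h (uu (fst z) (snd z) x y))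
      w \<partial>harea))"
  have m: "av a bump \<in> borel_measurable \<rho>" "av b bump \<in> borel_measurable \<rho>"
    "av s (\<lambda>u. max 0 (mrad u)) \<in> borel_measurable \<rho>" "av s (\<lambda>u. max 0 (- mrad u)) \<in> borel_measurable \<rho>"
    using A(2) B(2) P(2) M(2) measurable_cong_sets[OF sets_rho refl] unfolding av_def by blast+
  have "area_integral a * radmass bump + area_integral s * radmass (\<lambda>u. max 0 (- mrad u)) = (\<integral>\<^sup>+z. av a bump z
      + av s (\<lambda>u. max 0 (- mrad u)) z \<partial>\<rho>)"
    unfolding nn_integral_add[OF m(1) m(4)] using A(1) M(1) by (simp add: av_def)
  also have "\<dots> = (\<integral>\<^sup>+z. av b bump z + av s (\<lambda>u. max 0 (mrad u)) z \<partial>\<rho>)"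
    unfolding av_def
  proof (rule nn_integral_cong)
    fix z :: "real \<times> real"
    show "indicator {0<..} (snd z) * (\<integral>\<^sup>+w. hext (\<lambda>x y. a x y * bump (uu (fst z) (snd z) x y)) w \<partial>harea) +
       indicator {0<..} (snd z) * (\<integral>\<^sup>+w. hext (\<lambda>x y. s x y * max 0 (- mrad (uu (fst z) (snd z) x y))) w \<partial>harea) =
       indicator {0<..} (snd z) * (\<integral>\<^sup>+w. hext (\<lambda>x y. b x y * bump (uu (fst z) (snd z) x y)) w \<partial>harea) +
       indicator {0<..} (snd z) * (\<integral>\<^sup>+w. hext (\<lambda>x y. s x y * max 0 (mrad (uu (fst z) (snd z) x y))) w \<partial>harea)"
    proof (cases "snd z > 0")
      case True
      show ?thesis
        using green_nn[OF True sx sxx sy syy cs csxx csyy ca cb nn lap, of "fst z"] True by simp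
    qed simp
  qed
  also have "\<dots> = area_integral b * radmass bump + area_integral s * radmass (\<lambda>u. max 0 (mrad u))"
    unfolding nn_integral_add[OF m(2) m(3)] using B(1) P(1) by (simp add: av_def)
  finally have "area_integral a * radmass bump + area_integral s * radmass (\<lambda>u. max 0 (mrad u))
      = area_integral b * radmass bump + area_integral s * radmass (\<lambda>u. max 0 (mrad u))"
    by (simp only: radmass_mrad(1))
  moreover have "area_integral s * radmass (\<lambda>u. max 0 (mrad u)) \<noteq> \<infinity>"
    using fin radmass_mrad(2) by (simp add: ennreal_mult_eq_top_iff)
  ultimately have "area_integral a * radmass bump = area_integral b * radmass bump" by simp
  then show ?thesis using radmass_bump by (metis infinity_ennreal_def mult_divide_eq_ennreal)
qed

end


section \<open>Horocycle integrals of derivatives\<close>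

text \<open>Integrate \<open>g'(x + t)\<close> over \<open>0 \<le> t \<le> 1\<close> and all \<open>x\<close>.  In one order the result is the integral of
  \<open>g'\<close>, in the other the integral of \<open>g (x + 1) - g x\<close>, which is zero.\<close>

lemma integral_deriv_zero:
  fixes g g' :: "real \<Rightarrow> real"
  assumes d: "\<And>x. (g has_real_derivative g' x) (at x)" and c: "continuous_on UNIV g'"
    and ig: "integrable lborel g" and ig': "integrable lborel g'"
  shows "(LINT x|lborel. g' x) = 0"
proof -
  define f where "f = (\<lambda>(t::real, x). indicator {0..1} t * g' (x + t))"
  have gm: "g' \<in> borel_measurable borel" using borel_measurable_continuous_onI[OF c] .
  have fm: "f \<in> borel_measurable (lborel \<Otimes>\<^sub>M lborel)"
    unfolding f_def using gm by measurable
  have sh: "integrable lborel (\<lambda>x. h (x + t))" "(LINT x|lborel. h (x + t))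
      = (LINT x|lborel. h x)" if "integrable lborel h" for h :: "real \<Rightarrow> real" and t
    using lborel_integrable_real_affine[OF that, of 1 t] lborel_integral_real_affine[of 1 h t] by (simp_all add: add.commute)
  have fi: "integrable (lborel \<Otimes>\<^sub>M lborel) f"
  proof (rule lborel_pair.Fubini_integrable[OF fm])
    have "(LINT x|lborel. norm (f (t, x))) = indicator {0..1} t * (LINT x|lborel. norm (g' x))" for t
      using sh(2)[OF integrable_norm[OF ig'], of t] by (simp add: f_def abs_mult)
    then show "integrable lborel (\<lambda>t. LINT x|lborel. norm (f (t, x)))"
      by (simp add: integrable_real_indicator)
    show "AE t in lborel. integrable lborel (\<lambda>x. f (t, x))"
      using sh(1)[OF ig'] by (intro AE_I2) (simp add: f_def)
  qed
  have "(LINT t|lborel. LINT x|lborel. f (t, x)) = (LINT t|lborel. indicator {0..1::real} t * (LINT x|lborel. g' x))"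
    using sh(2)[OF ig'] by (simp add: f_def)
  also have "\<dots> = (LINT x|lborel. g' x)" by simp
  finally have 1: "(LINT t|lborel. LINT x|lborel. f (t, x)) = (LINT x|lborel. g' x)" .
  have "(LINT t|lborel. f (t, x)) = g (x + 1) - g x" for x
  proof -
    have "(LINT t|lborel. indicator {0..1} t *\<^sub>R g' (x + t)) = g (x + 1) - g (x + 0)"
    proof (rule integral_FTC_atLeastAtMost)
      fix t :: real
      have "((\<lambda>t. g (x + t)) has_real_derivative g' (x + t)) (at t)"
        by (rule DERIV_cong[OF DERIV_chain2[OF d]]) (auto intro!: derivative_eq_intros)
      then show "((\<lambda>t. g (x + t)) has_vector_derivative g' (x + t)) (at t within {0..1})"
        by (auto simp flip: has_real_derivative_iff_has_vector_derivative intro: DERIV_subset)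
    next
      show "continuous_on {0..1} (\<lambda>t. g' (x + t))"
        by (intro continuous_on_compose2[OF c] continuous_intros) auto
    qed simp
    then show ?thesis by (simp add: f_def)
  qed
  then have "(LINT x|lborel. LINT t|lborel. f (t, x)) = (LINT x|lborel. g (x + 1) - g x)" by simp
  also have "\<dots> = 0" using sh[OF ig, of 1] ig by simp
  finally show ?thesis using 1 lborel_pair.Fubini_integral[of "\<lambda>t x. f (t, x)"] fi by (simp add: case_prod_unfold)
qed

context eigen_system
begin

text \<open>What is needed of a horocycle domain \<open>D\<close>: the integral of \<open>u\<close> over it is \<open>I y\<close>, with
  derivative \<open>I' y\<close> obtained under the integral sign, and all \<open>x\<close>-derivatives integrate to zero.\<close>

definition horo :: "real set \<Rightarrow> (real \<Rightarrow> real) \<Rightarrow> (real \<Rightarrow> real) \<Rightarrow> bool" where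
  "horo D I I' \<longleftrightarrow> (\<forall>y>0. (\<forall>k. set_integrable lborel D (\<lambda>x. p k x y) \<and> set_integrable lborel D (\<lambda>x. q k x y) \<and>
     (LINT x:D|lborel. p (Suc k) x y) = 0 \<and> (LINT x:D|lborel. q (Suc k) x y) = 0) \<and>
     (LINT x:D|lborel. p 0 x y) = I y \<and> (LINT x:D|lborel. q 0 x y) = I' y)"

lemma p_slice_cont: "y > 0 \<Longrightarrow> continuous_on S (\<lambda>x. p k x y)"
  by (rule DERIV_continuous_on, rule DERIV_subset[OF px]) auto

lemma q_slice_cont: "y > 0 \<Longrightarrow> continuous_on S (\<lambda>x. q k x y)"
  by (rule DERIV_continuous_on, rule DERIV_subset[OF qx]) auto

lemma p_slice_measurable: "y > 0 \<Longrightarrow> (\<lambda>x. p k x y) \<in> borel_measurable borel" and q_slice_measurable: "y > 0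
    \<Longrightarrow> (\<lambda>x. q k x y) \<in> borel_measurable borel"
  by (intro borel_measurable_continuous_onI p_slice_cont q_slice_cont; simp)+

lemma horo_periodic:
  assumes T: "T > 0" and per: "\<And>x y. y > 0 \<Longrightarrow> p 0 (x + T) y = p 0 x y"
    and I: "\<And>y. y > 0 \<Longrightarrow> (LINT x:{- (T/2)..<T/2}|lborel. p 0 x y) = I y"
    and I': "\<And>y. y > 0 \<Longrightarrow> (I has_real_derivative I' y) (at y)"
  shows "horo {- (T/2)..<T/2} I I'"
proof -
  let ?D = "{- (T/2)..<T/2}" let ?E = "{- (T/2)..T/2}"
  have pp: "p k (x + T) y = p k x y" if "y > 0" for k x y
  proof (induction k arbitrary: x)
    case (Suc k)
    have "((\<lambda>x. p k (x + T) y) has_real_derivative p (Suc k) (x + T) y) (at x)"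
      by (rule DERIV_cong[OF DERIV_chain2[OF px[OF that]]]) (auto intro!: derivative_eq_intros)
    then have "((\<lambda>x. p k x y) has_real_derivative p (Suc k) (x + T) y) (at x)" using Suc by simp
    from DERIV_unique[OF this px[OF that]] show ?case .
  qed (use per that in simp)
  have qq: "q k (x + T) y = q k x y" if "y > 0" for k x y
  proof -
    have "((\<lambda>y. p k (x + T) y) has_real_derivative q k x y) (at y)"
      by (rule has_field_derivative_transform_within_open[OF py[OF that], where S = "{0<..}"]) (use that pp in auto)
    from DERIV_unique[OF this py[OF that]] show ?thesis by simp
  qed
  have DE: "(LINT x:?D|lborel. g x) = integral ?E g" "set_integrable lborel ?D g" if g: "continuous_on ?E g" for g
      :: "real \<Rightarrow> real"
  proof -
    have ie: "set_integrable lborel ?E g" unfolding set_integrable_def by (rule borel_integrable_compact[OF _ g]) simp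
    then show "set_integrable lborel ?D g" by (rule set_integrable_subset) auto
    have id: "set_integrable lborel ?D g" by (rule set_integrable_subset[OF ie]) auto
    have "(LINT x:?D|lborel. g x) = (LINT x:?E|lborel. g x)"
      unfolding set_lebesgue_integral_def
    proof (rule integral_cong_AE)
      show "AE x in lborel. indicator ?D x *\<^sub>R g x = indicator ?E x *\<^sub>R g x"
        using AE_lborel_singleton[of "T/2"] by eventually_elim (auto simp: indicator_def)
    qed (use ie id in \<open>simp_all only: set_integrable_def borel_measurable_integrable\<close>)
    then show "(LINT x:?D|lborel. g x) = integral ?E g" using set_borel_integral_eq_integral(2)[OF ie] by simp
  qed
  have z: "(LINT x:?D|lborel. g' x) = 0"
    if d: "\<And>x. (g has_real_derivative g' x) (at x)" and c: "continuous_on ?E g'" and per: "\<And>x. g (x + T) = g x" for g g'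
  proof -
    have "(g' has_integral g (T/2) - g (- (T/2))) ?E"
      using T d by (intro fundamental_theorem_of_calculus)
         (auto simp flip: has_real_derivative_iff_has_vector_derivative intro: DERIV_subset)
    moreover have "g (T/2) = g (- (T/2))" using per[of "- (T/2)"] by simp
    ultimately show ?thesis unfolding DE(1)[OF c] by (simp add: integral_unique)
  qed
  have q0: "(LINT x:?D|lborel. q 0 x y) = I' y" if y: "y > 0" for y
  proof -
    have Iy: "I y = integral ?E (\<lambda>x. p 0 x y)" if "y > 0" for y
      using I[OF that] DE(1)[OF p_slice_cont[OF that]] by simp
    have "((\<lambda>y. integral (cbox (- (T/2)) (T/2)) (\<lambda>x. p 0 x y)) has_field_derivative integral (cbox (- (T/2)) (T/2))
        (\<lambda>x. q 0 x y)) (at y within {y/2..2*y})"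
    proof (rule leibniz_rule_field_derivative)
      fix y' x assume "y' \<in> {y/2..2*y}"
      then have "y' > 0" using y by auto
      from py[OF this] show "((\<lambda>y. p 0 x y) has_field_derivative q 0 x y') (at y' within {y/2..2*y})"
          by (rule DERIV_subset) auto
    next
      fix y' assume "y' \<in> {y/2..2*y}"
      then have "y' > 0" using y by auto
      then show "(\<lambda>x. p 0 x y') integrable_on cbox (- (T/2)) (T/2)" by (intro integrable_continuous p_slice_cont)
    next
      have "continuous_on ({y/2..2*y} \<times> cbox (- (T/2)) (T/2)) (\<lambda>z. (snd z, fst z))" by (intro continuous_intros)
      moreover have "(\<lambda>z. (snd z, fst z)) ` ({y/2..2*y} \<times> cbox (- (T/2)) (T/2)) \<subseteq> UNIV \<times> {0<..}" using y by auto
      ultimately show "continuous_on ({y/2..2*y} \<times> cbox (- (T/2)) (T/2)) (\<lambda>(y, x). q 0 x y)"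
        using continuous_on_compose2[OF qcont[of 0], of "{y/2..2*y} \<times> cbox (- (T/2)) (T/2)" "\<lambda>z. (snd z, fst z)"]
        by (simp add: case_prod_unfold)
    qed (use y in auto)
    then have "((\<lambda>y. integral ?E (\<lambda>x. p 0 x y)) has_real_derivative integral ?E (\<lambda>x. q 0 x y)) (at y)"
      using y by (subst (asm) at_within_interior) (auto simp: interior_atLeastAtMost_real)
    then have "(I has_real_derivative integral ?E (\<lambda>x. q 0 x y)) (at y)"
      by (rule has_field_derivative_transform_within_open[where S = "{0<..}"]) (use y Iy in auto)
    from DERIV_unique[OF this I'[OF y]] show ?thesis unfolding DE(1)[OF q_slice_cont[OF y]] .
  qed
  show ?thesis unfolding horo_def
  proof (intro allI impI conjI)
    fix y :: real and k assume y: "0 < y"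
    show "set_integrable lborel ?D (\<lambda>x. p k x y)" "set_integrable lborel ?D (\<lambda>x. q k x y)"
      by (intro DE(2) p_slice_cont q_slice_cont y)+
    show "(LINT x:?D|lborel. p (Suc k) x y) = 0"
      by (rule z[OF px[OF y] p_slice_cont[OF y] pp[OF y]])
    show "(LINT x:?D|lborel. q (Suc k) x y) = 0"
      by (rule z[OF qx[OF y] q_slice_cont[OF y] qq[OF y]])
  qed (use I q0 in auto)
qed

text \<open>Only the two terms without \<open>x\<close>-derivative survive the integration.\<close>

lemma horo_rv:
  assumes h: "horo D I I'" and y: "y > 0" and D: "D \<in> sets borel"
  shows "(LINT x:D|lborel. rv P x y) = coeff (fst P) 0 * of_real (I y) + coeff (snd P) 0 * of_real (y * I' y)"
proof -
  have i: "set_integrable lborel D (\<lambda>x. p k x y)" "set_integrable lborel D (\<lambda>x. q k x y)"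
     "(LINT x:D|lborel. p (Suc k) x y) = 0" "(LINT x:D|lborel. q (Suc k) x y) = 0"
     "(LINT x:D|lborel. p 0 x y) = I y" "(LINT x:D|lborel. q 0 x y) = I' y" for k
    using h y unfolding horo_def by auto
  have cof: "set_integrable lborel D (\<lambda>x. c * complex_of_real (r * g x))"
      "(LINT x:D|lborel. c * complex_of_real (r * g x)) = c * of_real (r * (LINT x:D|lborel. g x))"
    if "set_integrable lborel D g" for g c r
  proof -
    have e: "indicator D x *\<^sub>R (c * complex_of_real (r * g x))
        = (c * of_real r) * complex_of_real (indicator D x *\<^sub>R g x)" for x
      by (simp add: scaleR_conv_of_real)
    show "set_integrable lborel D (\<lambda>x. c * complex_of_real (r * g x))"
      unfolding set_integrable_def e by (intro integrable_mult_right integrable_of_real that[unfolded set_integrable_def])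
    have "(LINT x:D|lborel. c * complex_of_real (r * g x))
        = (LINT x|lborel. (c * of_real r) * complex_of_real (indicator D x *\<^sub>R g x))"
      unfolding set_lebesgue_integral_def e ..
    also have "\<dots> = (c * of_real r) * of_real (LINT x|lborel. indicator D x *\<^sub>R g x)"
      by (simp only: integral_mult_right_zero integral_complex_of_real)
    finally show "(LINT x:D|lborel. c * complex_of_real (r * g x)) = c * of_real (r * (LINT x:D|lborel. g x))"
      by (simp add: set_lebesgue_integral_def)
  qed
  have sm: "set_integrable lborel D (\<lambda>x. \<Sum>j\<in>J. F j x)"
      "(LINT x:D|lborel. \<Sum>j\<in>J. F j x) = (\<Sum>j\<in>J. LINT x:D|lborel. F j x)"
    if "\<And>j. set_integrable lborel D (F j)" for J :: "nat set" and F :: "nat \<Rightarrow> real \<Rightarrow> complex"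
    using that unfolding set_integrable_def set_lebesgue_integral_def scaleR_sum_right
    by (auto intro!: Bochner_Integration.integrable_sum Bochner_Integration.integral_sum)
  have A: "(LINT x:D|lborel. pev A (pterm x y)) = coeff A 0 * of_real (I y)" "set_integrable lborel D (\<lambda>x. pev A
      (pterm x y))" for A
  proof -
    show "set_integrable lborel D (\<lambda>x. pev A (pterm x y))"
      unfolding pev_def pterm_def by (rule sm(1)[OF cof(1)[OF i(1)]])
    have "(LINT x:D|lborel. pev A (pterm x y)) = (\<Sum>j\<le>degree A. (LINT x:D|lborel. coeff A j * complex_of_real (y ^ j
        * p j x y)))"
      unfolding pev_def pterm_def by (rule sm(2)[OF cof(1)[OF i(1)]])
    also have "\<dots> = (\<Sum>j\<le>degree A. if j = 0 then coeff A 0 * of_real (I y) else 0)"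
      unfolding cof(2)[OF i(1)] by (intro sum.cong refl) (case_tac x, simp_all add: i(3,5))
    also have "\<dots> = coeff A 0 * of_real (I y)" by simp
    finally show "(LINT x:D|lborel. pev A (pterm x y)) = coeff A 0 * of_real (I y)" .
  qed
  have B: "(LINT x:D|lborel. pev A (qterm x y)) = coeff A 0 * of_real (y * I' y)" "set_integrable lborel D (\<lambda>x. pev
      A (qterm x y))" for A
  proof -
    show "set_integrable lborel D (\<lambda>x. pev A (qterm x y))"
      unfolding pev_def qterm_def by (rule sm(1)[OF cof(1)[OF i(2)]])
    have "(LINT x:D|lborel. pev A (qterm x y)) = (\<Sum>j\<le>degree A. (LINT x:D|lborel. coeff A j * complex_of_real (y ^
        Suc j * q j x y)))"
      unfolding pev_def qterm_def by (rule sm(2)[OF cof(1)[OF i(2)]])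
    also have "\<dots> = (\<Sum>j\<le>degree A. if j = 0 then coeff A 0 * of_real (y * I' y) else 0)"
      unfolding cof(2)[OF i(2)] by (intro sum.cong refl) (case_tac x, simp_all add: i(4,6))
    also have "\<dots> = coeff A 0 * of_real (y * I' y)" by simp
    finally show "(LINT x:D|lborel. pev A (qterm x y)) = coeff A 0 * of_real (y * I' y)" .
  qed
  show ?thesis unfolding rv_def using A B by (simp add: set_integral_add)
qed

end

context pos_eigen_system
begin

lemma mass_nn_integral:
  assumes y0: "y0 > 0" and R: "R \<ge> 1"
  shows "ennreal (mass R x0 y0) = (\<integral>\<^sup>+z. hext (\<lambda>x y. p 0 x y / y\<^sup>2) z * indicator (hbox R x0 y0) z \<partial>lborel)"
proof -
  let ?f = "\<lambda>(x, y). p 0 x y / y\<^sup>2"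
  have "(\<integral>\<^sup>+z. ennreal (?f z) * indicator (hbox R x0 y0) z \<partial>lborel) = ennreal (mass R x0 y0)"
    unfolding mass_def
    by (rule nn_integral_has_integral_lebesgue'[OF mass_integrand_nonneg[OF y0 R] integrable_integral[OF
        mass_integrable[OF y0 R]]])
  also have "(\<integral>\<^sup>+z. ennreal (?f z) * indicator (hbox R x0 y0) z \<partial>lborel)
      = (\<integral>\<^sup>+z. hext (\<lambda>x y. p 0 x y / y\<^sup>2) z * indicator (hbox R x0 y0) z \<partial>lborel)"
  proof (rule nn_integral_cong)
    fix z :: "real \<times> real"
    obtain x y where z: "z = (x, y)" by (cases z)
    show "ennreal (?f z) * indicator (hbox R x0 y0) z = hext (\<lambda>x y. p 0 x y / y\<^sup>2) z * indicator (hbox R x0 y0) z"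
    proof (cases "z \<in> hbox R x0 y0")
      case True
      then have "y > 0" using hbox_pos[OF y0 R, of x y x0] z by simp
      then show ?thesis by (simp add: z hext_def)
    qed simp
  qed
  finally show ?thesis ..
qed

lemma hext_p_measurable: "hext (\<lambda>x y. p 0 x y / y\<^sup>2) \<in> borel_measurable borel"
  by (rule hext_measurable) (unfold case_prod_unfold, intro continuous_intros cont_case_prodD[OF pcont subset_refl], auto)

text \<open>By Fubini, integrating the mass of a neighbourhood of \<open>(x, y0)\<close> over \<open>x\<close> gives the width of the
  neighbourhood times an integral of \<open>I\<close> over a compact interval of heights.\<close>

lemma mass_integrable_line:
  assumes y0: "y0 > 0" and R: "R \<ge> 1"
    and int: "\<And>y. y > 0 \<Longrightarrow> integrable lborel (\<lambda>x. p 0 x y)"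
    and I: "\<And>y. y > 0 \<Longrightarrow> (LINT x|lborel. p 0 x y) = I y" and Ic: "continuous_on {0<..} I"
  shows "integrable lborel (\<lambda>x. mass R x y0)"
proof -
  define f where "f = (\<lambda>(x0::real) z. hext (\<lambda>x y. p 0 x y / y\<^sup>2) z * indicator (hbox R x0 y0) z)"
  have fm: "(\<lambda>(x0, z). f x0 z) \<in> borel_measurable (lborel \<Otimes>\<^sub>M lborel)"
  proof -
    let ?S = "{w :: real \<times> real \<times> real. fst w - R * y0 \<le> fst (snd w) \<and> fst (snd w) \<le> fst w + R * y0 \<and> y0 / R
        \<le> snd (snd w) \<and> snd (snd w) \<le> R * y0}"
    have "closed ?S" by (intro closed_Collect_conj closed_Collect_le continuous_intros)
    then have S: "?S \<in> sets borel" by simp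
    have "(\<lambda>w. hext (\<lambda>x y. p 0 x y / y\<^sup>2) (snd w) * indicator ?S w) \<in> borel_measurable borel"
      using S by (intro borel_measurable_times_ennreal measurable_compose[OF _ hext_p_measurable]
          borel_measurable_continuous_onI continuous_intros borel_measurable_indicator)
    moreover have "hext (\<lambda>x y. p 0 x y / y\<^sup>2) (snd w) * indicator ?S w = (case w of (x0, z) \<Rightarrow> f x0 z)" for w
      by (cases w) (auto simp: f_def indicator_def cbox_Pair_eq mem_Times_iff)
    ultimately show ?thesis by (simp add: lborel_prod)
  qed
  have m: "(\<lambda>x0. \<integral>\<^sup>+z. f x0 z \<partial>lborel) \<in> borel_measurable lborel"
    using lborel.borel_measurable_nn_integral_fst[OF fm] by simp
  have mass: "ennreal (mass R x y0) = (\<integral>\<^sup>+z. f x z \<partial>lborel)" for x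
    unfolding f_def by (rule mass_nn_integral[OF y0 R])
  have Rp: "y0 / R > 0" using y0 R by simp
  obtain K where K: "K \<ge> 0" "\<And>y. y \<in> {y0 / R..R * y0} \<Longrightarrow> I y / y\<^sup>2 \<le> K"
  proof -
    have "continuous_on {y0 / R..R * y0} (\<lambda>y. I y / y\<^sup>2)"
      using Rp by (intro continuous_intros continuous_on_subset[OF Ic]) auto
    then have "bounded ((\<lambda>y. I y / y\<^sup>2) ` {y0 / R..R * y0})" by (intro compact_imp_bounded compact_continuous_image) auto
    then obtain K where "\<forall>v\<in>(\<lambda>y. I y / y\<^sup>2) ` {y0 / R..R * y0}. \<bar>v\<bar> \<le> K" unfolding bounded_real by blast
    then have "I y / y\<^sup>2 \<le> \<bar>K\<bar>" if "y \<in> {y0 / R..R * y0}" for y using that by (meson abs_ge_self imageI order_trans)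
    then show ?thesis using that[of "\<bar>K\<bar>"] by simp
  qed
  have "(\<integral>\<^sup>+x. ennreal (mass R x y0) \<partial>lborel) = (\<integral>\<^sup>+z. \<integral>\<^sup>+x. f x z \<partial>lborel \<partial>lborel)"
    unfolding mass by (rule lborel_pair.Fubini'[OF fm, symmetric])
  also have "\<dots> = (\<integral>\<^sup>+z. hext (\<lambda>x y. p 0 x y / y\<^sup>2) z * (ennreal (2 * R * y0) * indicator {y0 / R..R * y0} (snd z)) \<partial>lborel)"
  proof (rule nn_integral_cong)
    fix z :: "real \<times> real"
    have "(\<integral>\<^sup>+x. f x z \<partial>lborel) = (\<integral>\<^sup>+x. (hext (\<lambda>x y. p 0 x y / y\<^sup>2) z * indicator {y0 / R..R * y0} (snd z)) *
        indicator {fst z - R * y0..fst z + R * y0} x \<partial>lborel)"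
      unfolding f_def by (rule nn_integral_cong) (cases z, auto simp: indicator_def cbox_Pair_eq)
    also have "\<dots> = (hext (\<lambda>x y. p 0 x y / y\<^sup>2) z * indicator {y0 / R..R * y0} (snd z)) * ennreal (2 * R * y0)"
      using y0 R by (subst nn_integral_cmult_indicator) (auto simp: mult.assoc)
    finally show "(\<integral>\<^sup>+x. f x z \<partial>lborel) = hext (\<lambda>x y. p 0 x y / y\<^sup>2) z * (ennreal (2 * R * y0) * indicator {y0 /
        R..R * y0} (snd z))"
      by (simp only: mult_ac)
  qed
  also have "\<dots> = (\<integral>\<^sup>+y. \<integral>\<^sup>+x. hext (\<lambda>x y. p 0 x y / y\<^sup>2) (x, y) * (ennreal (2 * R * y0) * indicator {y0 / R..R *
      y0} y) \<partial>lborel \<partial>lborel)"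
  proof -
    have "(\<lambda>z. hext (\<lambda>x y. p 0 x y / y\<^sup>2) z * (ennreal (2 * R * y0) * indicator {y0 / R..R * y0} (snd z))) \<in>
        borel_measurable borel"
      by (intro borel_measurable_times_ennreal hext_p_measurable) (unfold borel_prod[symmetric], measurable)
    from nn_integral_lborel2(2)[OF this] show ?thesis by simp
  qed
  also have "\<dots> \<le> (\<integral>\<^sup>+y. ennreal (K * (2 * R * y0)) * indicator {y0 / R..R * y0} y \<partial>lborel)"
  proof (rule nn_integral_mono)
    fix y :: real
    show "(\<integral>\<^sup>+x. hext (\<lambda>x y. p 0 x y / y\<^sup>2) (x, y) * (ennreal (2 * R * y0) * indicator {y0 / R..R * y0} y) \<partial>lborel)
        \<le> ennreal (K * (2 * R * y0)) * indicator {y0 / R..R * y0} y"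
    proof (cases "y \<in> {y0 / R..R * y0}")
      case True
      then have y: "y > 0" using Rp by auto
      have "(\<integral>\<^sup>+x. hext (\<lambda>x y. p 0 x y / y\<^sup>2) (x, y) * (ennreal (2 * R * y0) * indicator {y0 / R..R * y0} y)
          \<partial>lborel) = (\<integral>\<^sup>+x. ennreal (p 0 x y) * (ennreal (1 / y\<^sup>2) * ennreal (2 * R * y0)) \<partial>lborel)"
        using True y pos[OF y] by (intro nn_integral_cong) (simp add: hext_def mult.assoc[symmetric]
            ennreal_mult'[symmetric] less_imp_le)
      also have "\<dots> = (\<integral>\<^sup>+x. ennreal (p 0 x y) \<partial>lborel) * (ennreal (1 / y\<^sup>2) * ennreal (2 * R * y0))"
        using p_slice_measurable[OF y] by (intro nn_integral_multc) simp
      also have "(\<integral>\<^sup>+x. ennreal (p 0 x y) \<partial>lborel) = ennreal (I y)"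
        using nn_integral_eq_integral[OF int[OF y]] pos[OF y] I[OF y] by (simp add: less_imp_le)
      also have "ennreal (I y) * (ennreal (1 / y\<^sup>2) * ennreal (2 * R * y0)) = ennreal (I y / y\<^sup>2 * (2 * R * y0))"
        using y0 R by (simp add: ennreal_mult'[symmetric] ennreal_mult''[symmetric])
      also have "\<dots> \<le> ennreal (K * (2 * R * y0))"
        using K(2)[OF True] y0 R by (intro ennreal_leI mult_right_mono) auto
      finally show ?thesis using True by simp
    qed simp
  qed
  also have "\<dots> < \<infinity>" by (subst nn_integral_cmult_indicator) (auto simp: ennreal_mult_less_top emeasure_lborel_Icc_eq)
  finally have fin: "(\<integral>\<^sup>+x. ennreal (mass R x y0) \<partial>lborel) < \<infinity>" .
  have "(\<lambda>x. enn2real (\<integral>\<^sup>+z. f x z \<partial>lborel)) \<in> borel_measurable lborel" using m by simp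
  then have "(\<lambda>x. mass R x y0) \<in> borel_measurable lborel"
    using mass_nonneg[OF y0 R] by (simp flip: mass)
  then show ?thesis using fin mass_nonneg[OF y0 R] by (intro integrableI_nonneg) auto
qed

text \<open>The bounds \<open>p_bound\<close> and \<open>q_bound\<close> make all derivatives integrable along the line.  For the derivative
  of \<open>I\<close> the difference quotients at \<open>y\<close> are dominated by the mass of a larger neighbourhood.\<close>

lemma horo_line:
  assumes int: "\<And>y. y > 0 \<Longrightarrow> integrable lborel (\<lambda>x. p 0 x y)"
    and I: "\<And>y. y > 0 \<Longrightarrow> (LINT x|lborel. p 0 x y) = I y"
    and I': "\<And>y. y > 0 \<Longrightarrow> (I has_real_derivative I' y) (at y)"
  shows "horo UNIV I I'"
proof -
  have Ic: "continuous_on {0<..} I" using I' by (auto intro!: DERIV_continuous_on intro: DERIV_subset)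
  note M = mass_integrable_line[OF _ _ int I Ic]
  have ip: "integrable lborel (\<lambda>x. p k x y)" if y: "y > 0" for k y
  proof -
    obtain C R where C: "C \<ge> 0" and R: "R \<ge> 1" and b: "\<And>x y. y > 0 \<Longrightarrow> \<bar>p k x y\<bar> \<le> C / y ^ k * mass R x y"
      using p_bound[of k] by blast
    show ?thesis
    proof (rule Bochner_Integration.integrable_bound)
      show "integrable lborel (\<lambda>x. C / y ^ k * mass R x y)" by (intro integrable_mult_right M y R)
      show "AE x in lborel. norm (p k x y) \<le> norm (C / y ^ k * mass R x y)"
        using b[OF y] by (intro AE_I2) (metis abs_ge_self order_trans real_norm_def)
    qed (use p_slice_measurable[OF y] in simp)
  qed
  have iq: "integrable lborel (\<lambda>x. q k x y)" if y: "y > 0" for k y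
  proof -
    obtain C R where C: "C \<ge> 0" and R: "R \<ge> 1" and b: "\<And>x y. y > 0 \<Longrightarrow> \<bar>q k x y\<bar> \<le> C / y ^ Suc k * mass R x y"
      using q_bound[of k] by blast
    show ?thesis
    proof (rule Bochner_Integration.integrable_bound)
      show "integrable lborel (\<lambda>x. C / y ^ Suc k * mass R x y)" by (intro integrable_mult_right M y R)
      show "AE x in lborel. norm (q k x y) \<le> norm (C / y ^ Suc k * mass R x y)"
        using b[OF y] by (intro AE_I2) (metis abs_ge_self order_trans real_norm_def)
    qed (use q_slice_measurable[OF y] in simp)
  qed
  have q0: "(LINT x|lborel. q 0 x y) = I' y" if y: "y > 0" for y
  proof -
    obtain C R where C: "C \<ge> 0" and R: "R \<ge> 1" and b: "\<And>x y. y > 0 \<Longrightarrow> \<bar>q 0 x y\<bar> \<le> C / y ^ Suc 0 * mass R x y"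
      using q_bound[of 0] by blast
    define h where "h = (\<lambda>n::nat. y / real (n + 2))"
    have h: "h n > 0" "h n \<le> y" for n using y by (auto simp: h_def field_simps)
    have h0: "h \<longlonglongrightarrow> 0"
      unfolding h_def by (rule LIMSEQ_ignore_initial_segment[OF lim_const_over_n])
    define s where "s = (\<lambda>n x. (p 0 x (y + h n) - p 0 x y) / h n)"
    have lim0: "(\<lambda>n. (F (y + h n) - F y) / h n) \<longlonglongrightarrow> D" if "(F has_real_derivative D) (at y)" for F D
    proof -
      have "((\<lambda>h. (F (y + h) - F y) / h) \<longlongrightarrow> D) (at 0)" using that by (simp add: DERIV_def)
      moreover have "filterlim h (at 0) sequentially"
        using h0 h(1) by (auto simp: filterlim_at intro!: always_eventually) (metis less_irrefl)
      ultimately show ?thesis by (rule filterlim_compose)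
    qed
    have "(\<lambda>n. LINT x|lborel. s n x) \<longlonglongrightarrow> (LINT x|lborel. q 0 x y)"
    proof (rule integral_dominated_convergence)
      show "integrable lborel (\<lambda>x. C / y * mass (2 * (R + 1)) x y)"
        by (intro integrable_mult_right M y) (use R in simp)
      show "AE x in lborel. (\<lambda>n. s n x) \<longlonglongrightarrow> q 0 x y"
        unfolding s_def by (intro AE_I2 lim0 py y)
      show "AE x in lborel. norm (s n x) \<le> C / y * mass (2 * (R + 1)) x y" for n
      proof (rule AE_I2)
        fix x
        obtain r where r: "r > y" "r < y + h n" "p 0 x (y + h n) - p 0 x y = (y + h n - y) * q 0 x r"
          using MVT2[of y "y + h n" "\<lambda>t. p 0 x t" "\<lambda>t. q 0 x t"] py y h(1)[of n] by auto
        have "s n x = q 0 x r" using r(3) h(1)[of n] by (simp add: s_def)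
        moreover have "\<bar>q 0 x r\<bar> \<le> C / r * mass R x r" using b[of r x] r y by simp
        moreover have "C / r * mass R x r \<le> C / y * mass (2 * (R + 1)) x y"
        proof (intro mult_mono divide_left_mono)
          have "(x, r) \<in> hbox 2 x y" using r h(2)[of n] y by (auto simp: cbox_Pair_eq)
          from mass_nearby[OF y R _ this] show "mass R x r \<le> mass (2 * (R + 1)) x y" by simp
        qed (use r y C R mass_nonneg[of r R x] in auto)
        ultimately show "norm (s n x) \<le> C / y * mass (2 * (R + 1)) x y" by simp
      qed
      show "(\<lambda>x. q 0 x y) \<in> borel_measurable lborel" using q_slice_measurable[OF y] by simp
      show "s n \<in> borel_measurable lborel" for n
        unfolding s_def using p_slice_measurable[OF y] p_slice_measurable[of "y + h n"] y h(1)[of n] by simp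
    qed
    moreover have "(LINT x|lborel. s n x) = (I (y + h n) - I y) / h n" for n
      unfolding s_def using int[of "y + h n"] int[OF y] I[OF y] I[of "y + h n"] y h(1)[of n] by simp
    ultimately have "(\<lambda>n. (I (y + h n) - I y) / h n) \<longlonglongrightarrow> (LINT x|lborel. q 0 x y)" by simp
    from LIMSEQ_unique[OF this lim0[OF I'[OF y]]] show ?thesis .
  qed
  have zp: "(LINT x|lborel. p (Suc k) x y) = 0" if y: "y > 0" for k y
    by (rule integral_deriv_zero[OF px[OF y] p_slice_cont[OF y] ip[OF y] ip[OF y]])
  have zq: "(LINT x|lborel. q (Suc k) x y) = 0" if y: "y > 0" for k y
    by (rule integral_deriv_zero[OF qx[OF y] q_slice_cont[OF y] iq[OF y] iq[OF y]])
  show ?thesis unfolding horo_def set_integrable_def set_lebesgue_integral_def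
    using ip iq zp zq q0 I by simp
qed

end


section \<open>Norms and horocycle integrals of the ladder\<close>

lemma n_elt_add: "n_elt x \<otimes>\<^bsub>PSL2\<^esub> n_elt y = n_elt (x + y)"
  unfolding n_elt_def by (subst psl_mult[OF det_nak_factors(1) det_nak_factors(1)]) (rule arg_cong[where f
      = psl], rule mat2_eqI, simp_all)

lemma n_elt_in_carrier: "n_elt x \<in> carrier PSL2"
  unfolding n_elt_def by (rule psl_in_carrier[OF det_nak_factors(1)])

lemma n_elt_0: "n_elt 0 = \<one>\<^bsub>PSL2\<^esub>"
  unfolding n_elt_def one_PSL2 by (rule arg_cong[where f = psl], rule mat2_eqI) (simp_all add: mat_def)

lemma n_elt_eq_one: "n_elt x = \<one>\<^bsub>PSL2\<^esub> \<Longrightarrow> x = 0"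
proof -
  assume "n_elt x = \<one>\<^bsub>PSL2\<^esub>"
  then have "mat2 1 x 0 1 = mat 1 \<or> mat2 1 x 0 1 = - mat 1" unfolding n_elt_def one_PSL2 psl_eq_iff .
  then have "mat2 1 x 0 1 $ 1 $ 2 = (mat 1 :: real^2^2) $ 1 $ 2 \<or> mat2 1 x 0 1 $ 1 $ 2
      = (- mat 1 :: real^2^2) $ 1 $ 2" by metis
  then show "x = 0" by (simp add: mat_def)
qed

lemma n_elt_uminus: "n_elt (- x) = inv\<^bsub>PSL2\<^esub> (n_elt x)"
proof -
  interpret G: group PSL2 by (rule group_PSL2)
  show ?thesis by (rule G.inv_equality[symmetric]) (simp_all add: n_elt_add n_elt_0 n_elt_in_carrier)
qed

lemma hpt_n_elt_mult: "g \<in> carrier PSL2 \<Longrightarrow> hpt (n_elt T \<otimes>\<^bsub>PSL2\<^esub> g) = hpt g + of_real T"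
  unfolding n_elt_def by (subst hpt_mult[OF det_nak_factors(1)]) (simp_all add: moebius_def)

lemma open_n_elt_vimage:
  assumes "openin PSL2_top U" shows "open {x. n_elt x \<in> U}"
proof -
  from assms obtain W where W: "open W" "{A \<in> carrier SL2. psl A \<in> U} = carrier SL2 \<inter> W"
    unfolding openin_PSL2_iff openin_open by blast
  have "{x. n_elt x \<in> U} = (\<lambda>x. mat2 1 x 0 1) -` W"
  proof (intro equalityI subsetI)
    fix x assume "x \<in> {x. n_elt x \<in> U}"
    then have "mat2 1 x 0 1 \<in> {A \<in> carrier SL2. psl A \<in> U}" using det_nak_factors(1)[of x] by (simp add: n_elt_def SL2_def)
    then show "x \<in> (\<lambda>x. mat2 1 x 0 1) -` W" unfolding W(2) by simp
  next
    fix x assume "x \<in> (\<lambda>x. mat2 1 x 0 1) -` W"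
    then have "mat2 1 x 0 1 \<in> carrier SL2 \<inter> W" using det_nak_factors(1)[of x] by (simp add: SL2_def)
    then show "x \<in> {x. n_elt x \<in> U}" unfolding W(2)[symmetric] by (simp add: n_elt_def)
  qed
  moreover have "continuous_on UNIV (\<lambda>x. mat2 1 x 0 1)" by (intro continuous_on_mat2 continuous_intros)
  ultimately show ?thesis using open_vimage[OF W(1)] by simp
qed

text \<open>Differences of translations in \<open>\<Gamma>\<close> are again in \<open>\<Gamma>\<close>, so by discreteness they are bounded below, and
  the infimum of the positive ones is attained.\<close>

lemma (in discrete_group) smallest_translation:
  assumes "N_group \<inter> \<Gamma> \<noteq> {\<one>\<^bsub>PSL2\<^esub>}"
  defines "T \<equiv> LEAST x. 0 < x \<and> n_elt x \<in> \<Gamma>"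
  shows "T > 0" "n_elt T \<in> \<Gamma>"
proof -
  have one: "\<one>\<^bsub>PSL2\<^esub> \<in> \<Gamma>" by (rule subgroup.one_closed[OF subgroup])
  let ?S = "{x. 0 < x \<and> n_elt x \<in> \<Gamma>}"
  have diff: "n_elt (x - y) \<in> \<Gamma>" if "n_elt x \<in> \<Gamma>" "n_elt y \<in> \<Gamma>" for x y
    using subgroup.m_closed[OF subgroup that(1) subgroup.m_inv_closed[OF subgroup that(2)]]
    by (simp add: n_elt_uminus[symmetric] n_elt_add)
  obtain U where U: "openin PSL2_top U" "U \<inter> \<Gamma> = {\<one>\<^bsub>PSL2\<^esub>}" by (rule discrete_isolated[OF one discrete])
  have "0 \<in> {x. n_elt x \<in> U}" using U(2) by (auto simp: n_elt_0)
  then obtain e where "e > 0" "ball 0 e \<subseteq> {x. n_elt x \<in> U}"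
    using open_n_elt_vimage[OF U(1)] open_contains_ball by blast
  then have e: "e > 0" "\<And>x. \<bar>x\<bar> < e \<Longrightarrow> n_elt x \<in> U"
    by (auto simp: subset_iff)
  have gap: "\<not> (0 < x \<and> x < e)" if "n_elt x \<in> \<Gamma>" for x
  proof
    assume x: "0 < x \<and> x < e"
    then have "n_elt x \<in> U \<inter> \<Gamma>" using e(2)[of x] that by simp
    then have "n_elt x = \<one>\<^bsub>PSL2\<^esub>" unfolding U(2) by simp
    then show False using n_elt_eq_one x by blast
  qed
  obtain g where "g \<in> N_group \<inter> \<Gamma>" "g \<noteq> \<one>\<^bsub>PSL2\<^esub>"
    using assms(1) one n_elt_0 by (auto simp: N_group_def)
  then obtain x where x: "n_elt x \<in> \<Gamma>" "x \<noteq> 0" using n_elt_0 by (auto simp: N_group_def)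
  have "x \<in> ?S \<or> - x \<in> ?S" using x diff[of 0 x] one by (auto simp: n_elt_0)
  then have ne: "?S \<noteq> {}" by blast
  have bb: "bdd_below ?S" by (rule bdd_belowI[of _ 0]) auto
  obtain s where s: "s \<in> ?S" "s < Inf ?S + e" using cInf_lessD[OF ne, of "Inf ?S + e"] e by auto
  have "s \<le> s'" if s': "s' \<in> ?S" for s'
  proof (rule ccontr)
    assume "\<not> s \<le> s'"
    moreover have "Inf ?S \<le> s'" by (rule cInf_lower[OF s' bb])
    ultimately show False using gap[of "s - s'"] s s' diff[of s s'] by auto
  qed
  then have "T = s" unfolding T_def using s by (intro Least_equality) auto
  then show "T > 0" "n_elt T \<in> \<Gamma>" using s by auto
qed

text \<open>For the linear form \<open>a + (1 - \<delta>) b\<close>, which is the value of the horocycle integral, the recursion of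
  the two lowest coefficients is diagonal: each step multiplies it by \<open>1 - \<delta> + l\<close>.\<close>

lemma ladder_coeff_0:
  fixes \<delta> :: real
  assumes "lam = \<delta> * (1 - \<delta>)"
  shows "coeff (fst (ladder lam l)) 0 + of_real (1 - \<delta>) * coeff (snd (ladder lam l)) 0 = of_real (pochhammer (1 - \<delta>) l)"
proof (induction l)
  case (Suc l)
  let ?a = "coeff (fst (ladder lam l)) 0" and ?b = "coeff (snd (ladder lam l)) 0"
  have "coeff (fst (ladder lam (Suc l))) 0 + of_real (1 - \<delta>) * coeff (snd (ladder lam (Suc l))) 0
     = (- (of_real lam * ?b) + of_nat l * ?a) + of_real (1 - \<delta>) * (?a + ?b + of_nat l * ?b)"
    by (simp add: rais_def opX_def opY_def scl_def)
  also have "\<dots> = (?a + of_real (1 - \<delta>) * ?b) * of_real (1 - \<delta> + real l)"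
    unfolding assms by (simp add: algebra_simps)
  also have "\<dots> = of_real (pochhammer (1 - \<delta>) l) * of_real (1 - \<delta> + real l)" using Suc by (simp only:)
  also have "\<dots> = of_real (pochhammer (1 - \<delta>) (Suc l))" by (simp only: of_real_mult pochhammer_Suc)
  finally show ?case .
qed simp

text \<open>\<open>\<phi>\<close> is the base eigenfunction; \<open>p\<close> and \<open>q\<close> collect its derivatives as a function of \<open>(x, y)\<close>.\<close>

locale weight_ladder = discrete_group \<Gamma> + pos_eigen_system lam p q
  for \<Gamma> :: "(real^2^2) set set" and lam :: real and p q :: "nat \<Rightarrow> real \<Rightarrow> real \<Rightarrow> real" +
  fixes \<delta> :: real and \<phi> :: "(real^2^2) set \<Rightarrow> real"
  assumes lam_eq: "lam = \<delta> * (1 - \<delta>)" and delta: "0 < \<delta>" "\<delta> < 1"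
    and phi_invariant: "left_invariant \<Gamma> \<phi>"
    and phi_nak: "\<And>x y t. y > 0 \<Longrightarrow> \<phi> (nak x y t) = p 0 x y"
    and phi_norm: "L2_norm \<Gamma> \<phi> = 1"
begin

lemma phi_hpt: "g \<in> carrier PSL2 \<Longrightarrow> \<phi> g = p 0 (Re (hpt g)) (Im (hpt g))"
  using nak_exists[of g] phi_nak[OF Im_hpt_pos, of g] by metis

lemma p_moebius_rep:
  assumes \<gamma>: "\<gamma> \<in> \<Gamma>" and z: "Im z > 0"
  shows "p 0 (Re (moebius (lift_mat \<gamma>) z)) (Im (moebius (lift_mat \<gamma>) z)) = p 0 (Re z) (Im z)"
proof -
  let ?g = "nak (Re z) (Im z) 0"
  have g: "?g \<in> carrier PSL2" "hpt ?g = z" using z by (simp_all add: nak_in_carrier hpt_nak)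
  have m: "\<gamma> \<otimes>\<^bsub>PSL2\<^esub> ?g \<in> carrier PSL2" using in_carrier[OF \<gamma>] g by simp
  have h: "hpt (\<gamma> \<otimes>\<^bsub>PSL2\<^esub> ?g) = moebius (lift_mat \<gamma>) z" using hpt_mult[OF lift_mat(1)[OF \<gamma>] g(1)] lift_mat(2)[OF \<gamma>]
      g(2) by simp
  have "\<phi> (\<gamma> \<otimes>\<^bsub>PSL2\<^esub> ?g) = \<phi> ?g" using phi_invariant \<gamma> g by (simp add: left_invariant_def)
  then show ?thesis unfolding phi_hpt[OF m] phi_hpt[OF g(1)] h g(2) .
qed

text \<open>The vector of weight \<open>l\<close>, as a function on the group.\<close>

definition wt :: "nat \<Rightarrow> (real^2^2) set \<Rightarrow> complex" where
  "wt l g = hang g ^ l * fl l (Re (hpt g)) (Im (hpt g))"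

lemma wt_nak: "y > 0 \<Longrightarrow> wt l (nak x y t) = cis (2 * t) ^ l * fl l x y"
  by (simp add: wt_def hang_nak hpt_nak)

text \<open>The derivative in \<open>\<theta>\<close> contributes the term \<open>l f\<^sub>l\<close>.\<close>

lemma raising_wt:
  assumes F: "\<And>g. g \<in> carrier PSL2 \<Longrightarrow> F g = wt l g" and F': "\<And>g. g \<in> carrier PSL2 \<Longrightarrow> F' g = cnj (wt l g)"
    and g: "g \<in> carrier PSL2"
  shows "raising F g = wt (Suc l) g" "lowering F' g = cnj (wt (Suc l) g)"
proof -
  define x y where xy: "x = Re (hpt g)" "y = Im (hpt g)"
  have y: "y > 0" using Im_hpt_pos[OF g] by (simp add: xy)
  obtain s where s: "g = nak x y s" using nak_exists[OF g] by (auto simp: xy)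
  \<comment> \<open>the operators refer to the angle in \<open>[0, \<pi>)\<close>\<close>
  obtain n :: int where n: "s + of_int n * pi \<in> {0..<pi}" using ex_shift_pi by blast
  define t where "t = s + of_int n * pi"
  have t: "t \<in> {0..<pi}" and gt: "g = nak x y t" using n s nak_add_int_pi[OF y] by (simp_all add: t_def)
  have c: "nak_coords g = (x, y, t)" unfolding gt by (rule nak_coords_nak[OF y t])
  let ?c = "cis (2 * t)"
  have Fn: "F (nak u v r) = cis (2 * r) ^ l * fl l u v" "F' (nak u v r)
      = cnj (cis (2 * r) ^ l * fl l u v)" if "v > 0" for u v r
    using F F' nak_in_carrier[OF that] wt_nak[OF that] by auto
  have du: "((\<lambda>u. F (nak u y t)) has_vector_derivative ?c ^ l * (flX l x y / of_real y)) (at x)"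
    unfolding Fn(1)[OF y] fl_def flX_def by (intro has_vector_derivative_mult_right rv_dx y)
  have dv: "((\<lambda>v. F (nak x v t)) has_vector_derivative ?c ^ l * (flY l x y / of_real y)) (at y)"
  proof (rule has_vector_derivative_transform_within_open)
    show "((\<lambda>v. ?c ^ l * fl l x v) has_vector_derivative ?c ^ l * (flY l x y / of_real y)) (at y)"
      unfolding fl_def flY_def by (intro has_vector_derivative_mult_right rv_dy y)
  qed (use y Fn(1) in \<open>auto intro: open_greaterThan\<close>)
  have dc: "((\<lambda>r. cis (2 * r) ^ l) has_vector_derivative (2 * \<i> * of_nat l) * ?c ^ l) (at t)"
  proof -
    have "((\<lambda>r. cis (real l * (2 * r))) has_vector_derivative (2 * \<i> * of_nat l) * cis (real l * (2 * t))) (at t)"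
      unfolding has_vector_derivative_complex_iff by (auto intro!: derivative_eq_intros)
    then show ?thesis unfolding Complex.DeMoivre .
  qed
  have dt: "((\<lambda>r. F (nak x y r)) has_vector_derivative ((2 * \<i> * of_nat l) * ?c ^ l) * fl l x y) (at t)"
    unfolding Fn(1)[OF y] by (rule has_vector_derivative_mult_left[OF dc])
  have e: "exp (2 * \<i> * of_real t) = ?c" by (simp add: cis_conv_exp mult_ac)
  have e': "exp (- 2 * \<i> * of_real t) = cnj ?c" by (simp add: cis_conv_exp exp_cnj mult_ac)
  have yn: "of_real y * (w / of_real y) = w" for w :: complex using y by simp
  have main: "?c * (\<i> * of_real y * (?c ^ l * (flX l x y / of_real y)) + of_real y * (?c ^ l * (flY l x y / of_real y))
       + 1 / (2 * \<i>) * (((2 * \<i> * of_nat l) * ?c ^ l) * fl l x y)) = wt (Suc l) g"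
  proof -
    have "?c * (\<i> * of_real y * (?c ^ l * (flX l x y / of_real y)) + of_real y * (?c ^ l * (flY l x y / of_real y))
       + 1 / (2 * \<i>) * (((2 * \<i> * of_nat l) * ?c ^ l) * fl l x y))
      = ?c ^ Suc l * (\<i> * flX l x y + flY l x y + of_nat l * fl l x y)"
      using y by (simp add: field_simps)
    then show ?thesis unfolding gt wt_nak[OF y] fl_Suc .
  qed
  show "raising F g = wt (Suc l) g"
    unfolding raising_def c prod.case e vector_derivative_at[OF du] vector_derivative_at[OF dv] vector_derivative_at[OF dt]
    by (rule main)
  have F'F: "F' (nak u v r) = cnj (F (nak u v r))" if "v > 0" for u v r using Fn[OF that] by simp
  have du': "((\<lambda>u. F' (nak u y t)) has_vector_derivative cnj (?c ^ l * (flX l x y / of_real y))) (at x)"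
    unfolding F'F[OF y] by (rule has_vector_derivative_cnj[OF du])
  have dv': "((\<lambda>v. F' (nak x v t)) has_vector_derivative cnj (?c ^ l * (flY l x y / of_real y))) (at y)"
    by (rule has_vector_derivative_transform_within_open[OF has_vector_derivative_cnj[OF dv] open_greaterThan[of 0]])
       (use y F'F in auto)
  have dt': "((\<lambda>r. F' (nak x y r)) has_vector_derivative cnj (((2 * \<i> * of_nat l) * ?c ^ l) * fl l x y)) (at t)"
    unfolding F'F[OF y] by (rule has_vector_derivative_cnj[OF dt])
  show "lowering F' g = cnj (wt (Suc l) g)"
    unfolding lowering_def c prod.case e' vector_derivative_at[OF du'] vector_derivative_at[OF dv']
        vector_derivative_at[OF dt'] main[symmetric]
    by simp
qed

lemma raising_power_phi: "g \<in> carrier PSL2 \<Longrightarrow> (raising ^^ l) (\<lambda>g. complex_of_real (\<phi> g)) g = wt l g"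
  and lowering_power_phi: "g \<in> carrier PSL2 \<Longrightarrow> (lowering ^^ l) (\<lambda>g. complex_of_real (\<phi> g)) g = cnj (wt l g)"
proof -
  have "\<forall>g\<in>carrier PSL2. (raising ^^ l) (\<lambda>g. complex_of_real (\<phi> g)) g
      = wt l g \<and> (lowering ^^ l) (\<lambda>g. complex_of_real (\<phi> g)) g = cnj (wt l g)"
  proof (induction l)
    case 0
    then show ?case by (simp add: wt_def fl_0 phi_hpt)
  next
    case (Suc l)
    then show ?case using raising_wt[of "(raising ^^ l) (\<lambda>g. complex_of_real (\<phi> g))" l "(lowering ^^ l) (\<lambda>g.
        complex_of_real (\<phi> g))"] by auto
  qed
  then show "g \<in> carrier PSL2 \<Longrightarrow> (raising ^^ l) (\<lambda>g. complex_of_real (\<phi> g)) g = wt l g"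
    "g \<in> carrier PSL2 \<Longrightarrow> (lowering ^^ l) (\<lambda>g. complex_of_real (\<phi> g)) g = cnj (wt l g)" by auto
qed

lemma fl_rep:
  assumes "\<gamma> \<in> \<Gamma>" "Im z > 0"
  shows "cnj (mden (lift_mat \<gamma>) z) ^ l * fl l (Re (moebius (lift_mat \<gamma>) z)) (Im (moebius (lift_mat \<gamma>) z))
      = mden (lift_mat \<gamma>) z ^ l * fl l (Re z) (Im z)"
  using fl_equivariant[OF lift_mat(1)[OF assms(1)] p_moebius_rep[OF assms(1)] assms(2)] .

text \<open>The automorphy factors of \<open>f\<^sub>l\<close> and of the angle cancel.\<close>

lemma wt_invariant:
  assumes \<gamma>: "\<gamma> \<in> \<Gamma>" and g: "g \<in> carrier PSL2"
  shows "wt l (\<gamma> \<otimes>\<^bsub>PSL2\<^esub> g) = wt l g"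
proof -
  let ?j = "mden (lift_mat \<gamma>) (hpt g)"
  have j: "?j \<noteq> 0" by (rule mden_nonzero[OF lift_mat(1)[OF \<gamma>] Im_hpt_pos[OF g]])
  have "wt l (\<gamma> \<otimes>\<^bsub>PSL2\<^esub> g) = (cnj ?j / ?j * hang g) ^ l * fl l (Re (moebius (lift_mat \<gamma>) (hpt g))) (Im (moebius
      (lift_mat \<gamma>) (hpt g)))"
    using hpt_mult[OF lift_mat(1)[OF \<gamma>] g] hang_mult[OF lift_mat(1)[OF \<gamma>] g] by (simp add: wt_def lift_mat(2)[OF \<gamma>])
  also have "\<dots> = hang g ^ l / ?j ^ l * (cnj ?j ^ l * fl l (Re (moebius (lift_mat \<gamma>) (hpt g))) (Im (moebius
      (lift_mat \<gamma>) (hpt g))))"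
    by (simp add: power_mult_distrib power_divide)
  also have "\<dots> = wt l g" unfolding fl_rep[OF \<gamma> Im_hpt_pos[OF g]] wt_def using j by simp
  finally show ?thesis .
qed

lemma sl_invariant: "invariant (sl l)"
  unfolding invariant_def
proof (intro ballI allI impI)
  fix \<gamma> x and y :: real assume \<gamma>: "\<gamma> \<in> \<Gamma>" and y: "0 < y"
  define z where "z = Complex x y"
  have z: "Im z > 0" "Re z = x" "Im z = y" using y by (simp_all add: z_def)
  have j: "cmod (mden (lift_mat \<gamma>) z) ^ l \<noteq> 0" using mden_nonzero[OF lift_mat(1)[OF \<gamma>] z(1)] by simp
  have "cmod (mden (lift_mat \<gamma>) z) ^ l * cmod (fl l (Re (moebius (lift_mat \<gamma>) z)) (Im (moebius (lift_mat \<gamma>) z)))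
      = cmod (mden (lift_mat \<gamma>) z) ^ l * cmod (fl l x y)"
    using arg_cong[OF fl_rep[OF \<gamma> z(1), of l], of cmod] z by (simp add: norm_mult norm_power)
  then have "cmod (fl l (Re (moebius (lift_mat \<gamma>) z)) (Im (moebius (lift_mat \<gamma>) z))) = cmod (fl l x y)"
      by (rule mult_left_cancel[OF j, THEN iffD1])
  then show "sl l (fst (gact \<gamma> (x, y))) (snd (gact \<gamma> (x, y))) = sl l x y"
    by (simp add: sl_def gact_def mob_def z_def)
qed

lemma norm_wt:
  assumes "\<And>g. g \<in> carrier PSL2 \<Longrightarrow> f g = wt l g \<or> f g = cnj (wt l g)" "left_invariant \<Gamma> f"
  shows "L2_norm \<Gamma> f = sqrt (enn2real (area_integral (sl l)))"
  unfolding area_integral_def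
proof (rule L2_norm_rho[OF assms(2) _ sl_cont(1)])
  fix g assume g: "g \<in> carrier PSL2"
  show "(cmod (f g))\<^sup>2 = sl l (fst (pt g)) (snd (pt g))"
    using assms(1)[OF g] by (auto simp: wt_def norm_mult norm_power cmod_hang[OF g] sl_def pt_def)
qed

lemma area_integral_add:
  assumes "continuous_on (UNIV \<times> {0<..}) (\<lambda>(x, y). a x y)" "continuous_on (UNIV \<times> {0<..}) (\<lambda>(x, y). b x y)"
    "\<And>x y. a x y \<ge> 0" "\<And>x y. b x y \<ge> 0"
  shows "area_integral (\<lambda>x y. a x y + b x y) = area_integral a + area_integral b"
proof -
  have e: "hext (\<lambda>x y. a x y + b x y) = (\<lambda>z. hext a z + hext b z)"
    using assms(3,4) by (intro ext) (simp add: hext_def distrib_left flip: ennreal_plus)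
  show ?thesis unfolding area_integral_def e
    using hext_measurable[OF assms(1)] hext_measurable[OF assms(2)] by (simp add: nn_integral_add)
qed

lemma area_integral_cmult:
  assumes "continuous_on (UNIV \<times> {0<..}) (\<lambda>(x, y). a x y)" "c \<ge> 0"
  shows "area_integral (\<lambda>x y. c * a x y) = ennreal c * area_integral a"
proof -
  have e: "hext (\<lambda>x y. c * a x y) = (\<lambda>z. ennreal c * hext a z)"
    using assms(2) by (intro ext) (simp add: hext_def mult.left_commute flip: ennreal_mult')
  show ?thesis unfolding area_integral_def e
    using hext_measurable[OF assms(1)] by (simp add: nn_integral_cmult)
qed

text \<open>This is the normalization of \<open>\<phi>\<close>; it also makes the integral finite, which starts the
  induction.\<close>

lemma area_integral_sl_0: "area_integral (sl 0) = 1"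
proof -
  have "L2_norm \<Gamma> \<phi> = sqrt (enn2real (area_integral (sl 0)))"
    unfolding area_integral_def
    by (rule L2_norm_rho[OF phi_invariant _ sl_cont(1)]) (simp add: sl_def fl_0 phi_hpt pt_def)
  then have "enn2real (area_integral (sl 0)) = 1" using phi_norm by simp
  then show ?thesis by (cases "area_integral (sl 0)") auto
qed

lemma area_integral_recurrence:
  assumes fin: "area_integral (sl l) \<noteq> \<infinity>" and inv: "invariant (tl l)"
  shows "area_integral (sl (Suc l)) + area_integral (tl l) = ennreal (2 * lam + 2 * (real l)\<^sup>2) * area_integral (sl l)"
proof -
  have nn: "sl k x y \<ge> 0" "tl k x y \<ge> 0" for k x y by (simp_all add: sl_def tl_def)
  have "area_integral (\<lambda>x y. sl (Suc l) x y + tl l x y) = area_integral (\<lambda>x y. (2 * lam + 2 * (real l)\<^sup>2) * sl l x y)"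
  proof (rule area_integral_laplacian[OF sl_derivs(1) sl_derivs(2) sl_derivs(3) sl_derivs(4) sl_cont(1) sl_cont(3)
      sl_cont(4) _ _ _ _ _ sl_laplacian sl_invariant _ _ fin])
    show "continuous_on (UNIV \<times> {0<..}) (\<lambda>(x, y). sl (Suc l) x y + tl l x y)"
      using continuous_on_add[OF sl_cont(1)[of "Suc l"] sl_cont(2)[of l]] by (simp add: case_prod_unfold)
    show "continuous_on (UNIV \<times> {0<..}) (\<lambda>(x, y). (2 * lam + 2 * (real l)\<^sup>2) * sl l x y)"
      using continuous_on_mult_left[OF sl_cont(1)[of l], of "2 * lam + 2 * (real l)\<^sup>2"] by (simp add: case_prod_unfold)
    show "invariant (\<lambda>x y. sl (Suc l) x y + tl l x y)" "invariant (\<lambda>x y. (2 * lam + 2 * (real l)\<^sup>2) * sl l x y)"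
      using sl_invariant[of "Suc l"] sl_invariant[of l] inv by (simp_all add: invariant_def)
  qed (use nn lam(1) in auto)
  then show ?thesis
    using area_integral_add[OF sl_cont(1)[of "Suc l"] sl_cont(2)[of l] nn] area_integral_cmult[OF sl_cont(1)[of l],
        of "2 * lam + 2 * (real l)\<^sup>2"] lam(1) by simp
qed

text \<open>With \<open>c\<^sub>l = cc lam l\<close> and \<open>W\<^sub>l\<close> the claimed value, \<open>area_integral_recurrence\<close> reads
  \<open>W\<^sub>l\<^sub>+\<^sub>1 + c\<^sub>l\<^sub>-\<^sub>1\<^sup>2 W\<^sub>l\<^sub>-\<^sub>1 = (c\<^sub>l\<^sub>-\<^sub>1 + c\<^sub>l) W\<^sub>l\<close>, which is solved by \<open>W\<^sub>l\<^sub>+\<^sub>1 = c\<^sub>l W\<^sub>l\<close>.\<close>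

lemma area_integral_sl: "area_integral (sl l) = ennreal (pochhammer \<delta> l * pochhammer (1 - \<delta>) l)"
proof -
  define W where "W = (\<lambda>l. pochhammer \<delta> l * pochhammer (1 - \<delta>) l)"
  have W0: "W 0 = 1" and WS: "W (Suc l) = cc lam l * W l" for l
    by (simp_all add: W_def pochhammer_Suc cc_def lam_eq algebra_simps power2_eq_square)
  have Wp: "W l > 0" for l unfolding W_def using delta by (intro mult_pos_pos pochhammer_pos) auto
  have cancel: "x = ennreal c" if "x + ennreal a = ennreal b" "b = a + c" "a \<ge> 0" "c \<ge> 0" for x :: ennreal and a b c
    using that by (cases x) (auto simp flip: ennreal_plus)
  have tinv: "invariant (tl l)" for l
  proof (cases l)
    case 0 then show ?thesis using sl_invariant[of 1] by (simp add: invariant_def tl_0)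
  next
    case (Suc m) then show ?thesis using sl_invariant[of m] by (simp add: invariant_def tl_Suc)
  qed
  have "area_integral (sl l) = ennreal (W l) \<and> area_integral (sl (Suc l)) = ennreal (W (Suc l))" for l
  proof (induction l)
    case 0
    have "tl 0 = sl (Suc 0)" by (intro ext) (simp add: tl_0)
    then have "area_integral (sl (Suc 0)) + area_integral (sl (Suc 0)) = ennreal (2 * lam)"
      using area_integral_recurrence[OF _ tinv, of 0] area_integral_sl_0 by simp
    then have "area_integral (sl (Suc 0)) = ennreal lam"
      using lam(1) by (cases "area_integral (sl (Suc 0))") (auto simp flip: ennreal_plus)
    then show ?case using area_integral_sl_0 by (simp add: WS[of 0] W0 cc_def)
  next
    case (Suc l)
    have "tl (Suc l) = (\<lambda>x y. (cc lam l)\<^sup>2 * sl l x y)" by (intro ext) (rule tl_Suc)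
    then have "area_integral (tl (Suc l)) = ennreal ((cc lam l)\<^sup>2 * W l)"
      using area_integral_cmult[OF sl_cont(1)[of l], of "(cc lam l)\<^sup>2"] Suc.IH by (simp add: ennreal_mult')
    then have "area_integral (sl (Suc (Suc l))) + ennreal ((cc lam l)\<^sup>2 * W l) = ennreal ((2 * lam
        + 2 * (real (Suc l))\<^sup>2) * W (Suc l))"
      using area_integral_recurrence[OF _ tinv, of "Suc l"] Suc.IH lam(1) by (simp add: ennreal_mult')
    then have "area_integral (sl (Suc (Suc l))) = ennreal (W (Suc (Suc l)))"
    proof (rule cancel)
      show "(2 * lam + 2 * (real (Suc l))\<^sup>2) * W (Suc l) = (cc lam l)\<^sup>2 * W l + W (Suc (Suc l))"
        unfolding WS by (simp add: cc_def algebra_simps power2_eq_square)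
    qed (use Wp[of l] Wp[of "Suc (Suc l)"] in auto)
    then show ?case using Suc.IH by simp
  qed
  then show ?thesis by (simp add: W_def)
qed

lemma norm_ladder:
  assumes "\<And>g. g \<in> carrier PSL2 \<Longrightarrow> f g = wt l g \<or> f g = cnj (wt l g)" "left_invariant \<Gamma> f"
  shows "L2_norm \<Gamma> f = sqrt (pochhammer \<delta> l * pochhammer (1 - \<delta>) l)"
  using norm_wt[OF assms] delta by (simp add: area_integral_sl pochhammer_nonneg)

lemma N_domain_borel: "N_domain \<Gamma> \<in> sets borel"
  by (simp add: N_domain_def Let_def)

text \<open>If \<open>N \<inter> \<Gamma>\<close> is trivial, the integrand is integrable because the Bochner integral of a
  function that is not integrable is \<open>0\<close>.\<close>

lemma horo_N_domain:
  assumes I: "\<And>y. y > 0 \<Longrightarrow> (LINT x:N_domain \<Gamma>|lborel. p 0 x y) = I y" and pos: "\<And>y. y > 0 \<Longrightarrow> I y \<noteq> 0"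
    and I': "\<And>y. y > 0 \<Longrightarrow> (I has_real_derivative I' y) (at y)"
  shows "horo (N_domain \<Gamma>) I I'"
proof (cases "N_group \<inter> \<Gamma> = {\<one>\<^bsub>PSL2\<^esub>}")
  case True
  then have D: "N_domain \<Gamma> = UNIV" by (simp add: N_domain_def)
  have I0: "(LINT x|lborel. p 0 x y) = I y" if "y > 0" for y
    using I[OF that] unfolding D by (simp add: set_lebesgue_integral_def)
  have int: "integrable lborel (\<lambda>x. p 0 x y)" if "y > 0" for y
    using I0[OF that] pos[OF that] not_integrable_integral_eq by metis
  show ?thesis unfolding D by (rule horo_line[OF int I0 I'])
next
  case False
  define T where "T = (LEAST x. 0 < x \<and> n_elt x \<in> \<Gamma>)"
  have T: "T > 0" "n_elt T \<in> \<Gamma>" unfolding T_def by (rule smallest_translation[OF False])+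
  have D: "N_domain \<Gamma> = {- (T/2)..<T/2}" using False by (simp add: N_domain_def T_def Let_def)
  have per: "p 0 (x + T) y = p 0 x y" if y: "y > 0" for x y
  proof -
    let ?g = "nak x y 0"
    have g: "?g \<in> carrier PSL2" "n_elt T \<otimes>\<^bsub>PSL2\<^esub> ?g \<in> carrier PSL2" using nak_in_carrier[OF y] n_elt_in_carrier by auto
    have "\<phi> (n_elt T \<otimes>\<^bsub>PSL2\<^esub> ?g) = \<phi> ?g" using phi_invariant T g by (simp add: left_invariant_def)
    then show ?thesis unfolding phi_hpt[OF g(1)] phi_hpt[OF g(2)] hpt_n_elt_mult[OF g(1)] hpt_nak[OF y] by simp
  qed
  show ?thesis unfolding D by (rule horo_periodic[OF T(1) per _ I']) (use I in \<open>simp_all add: D\<close>)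
qed

lemma horocycle_integral_ladder:
  assumes c0: "c0 > 0" and H: "\<And>y. y > 0 \<Longrightarrow> horocycle_integral \<Gamma> \<phi> y = c0 * y powr (1 - \<delta>)" and y: "y > 0"
    and f: "(\<forall>g\<in>carrier PSL2. f g = wt l g) \<or> (\<forall>g\<in>carrier PSL2. f g = cnj (wt l g))"
  shows "horocycle_integral \<Gamma> f y = of_real (pochhammer (1 - \<delta>) l * (c0 * y powr (1 - \<delta>)))"
proof -
  define I I' where II: "I = (\<lambda>y. c0 * y powr (1 - \<delta>))" "I' = (\<lambda>y. c0 * ((1 - \<delta>) * y powr (- \<delta>)))"
  have na: "n_elt x \<otimes>\<^bsub>PSL2\<^esub> a_elt v \<in> carrier PSL2" "hpt (n_elt x \<otimes>\<^bsub>PSL2\<^esub> a_elt v) = Complex x v"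
    "hang (n_elt x \<otimes>\<^bsub>PSL2\<^esub> a_elt v) = 1" if "v > 0" for x v
    using nak_in_carrier[OF that] that by (simp_all add: na_eq_nak hpt_nak hang_nak)
  have I: "(LINT x:N_domain \<Gamma>|lborel. p 0 x v) = I v" if "v > 0" for v
    using H[OF that] na[OF that] by (simp add: horocycle_integral_def II phi_hpt)
  have h: "horo (N_domain \<Gamma>) I I'"
    by (rule horo_N_domain[OF I]) (use c0 in \<open>auto simp: II intro!: derivative_eq_intros\<close>)
  have yI: "y * I' y = (1 - \<delta>) * I y"
    using y powr_add[of y 1 "- \<delta>"] by (simp add: II)
  have "(LINT x:N_domain \<Gamma>|lborel. fl l x y) = (coeff (fst (ladder lam l)) 0
      + of_real (1 - \<delta>) * coeff (snd (ladder lam l)) 0) * of_real (I y)"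
    unfolding fl_def horo_rv[OF h y N_domain_borel] yI by (simp add: algebra_simps)
  also have "\<dots> = of_real (pochhammer (1 - \<delta>) l * I y)" unfolding ladder_coeff_0[OF lam_eq] by simp
  finally have F: "(LINT x:N_domain \<Gamma>|lborel. fl l x y) = of_real (pochhammer (1 - \<delta>) l * I y)" .
  have w: "wt l (n_elt x \<otimes>\<^bsub>PSL2\<^esub> a_elt y) = fl l x y" for x using na[OF y] by (simp add: wt_def)
  show ?thesis
  proof (rule disjE[OF f])
    assume "\<forall>g\<in>carrier PSL2. f g = wt l g"
    then have "horocycle_integral \<Gamma> f y = (LINT x:N_domain \<Gamma>|lborel. fl l x y)" using na(1)[OF y]
        by (simp add: horocycle_integral_def w)
    then show ?thesis using F by (simp add: II)
  next
    assume "\<forall>g\<in>carrier PSL2. f g = cnj (wt l g)"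
    then have "horocycle_integral \<Gamma> f y = (LINT x:N_domain \<Gamma>|lborel. cnj (fl l x y))" using na(1)[OF y]
        by (simp add: horocycle_integral_def w)
    also have "\<dots> = cnj (LINT x:N_domain \<Gamma>|lborel. fl l x y)"
      unfolding set_lebesgue_integral_def complex_cnj_scaleR[symmetric]
      by (rule integral_bounded_linear'[OF bounded_linear_cnj bounded_linear_cnj]) (auto intro: exI[of _ 1])
    finally show ?thesis unfolding F by (simp add: II)
  qed
qed

text \<open>The horocycle integral of \<open>R\<^sup>l \<phi>\<close> contains \<open>(1 - \<delta>)\<^sub>l\<close> and its norm the square root of
  \<open>(\<delta>)\<^sub>l (1 - \<delta>)\<^sub>l\<close>.  As the integral is real, the conjugate ladder gives the same value.\<close>

lemma normalized_horocycle_integral: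
  assumes c0: "c0 > 0" and H: "\<And>y. y > 0 \<Longrightarrow> horocycle_integral \<Gamma> \<phi> y = c0 * y powr (1 - \<delta>)" and y: "y > 0"
    and \<psi>: "\<psi> \<in> {phi_plus \<Gamma> \<phi> l, phi_minus \<Gamma> \<phi> l}"
  shows "horocycle_integral \<Gamma> \<psi> y = of_real (c0 * sqrt (pochhammer (1 - \<delta>) l / pochhammer \<delta> l) * y powr (1 - \<delta>))"
proof -
  have P: "pochhammer \<delta> l > 0" "pochhammer (1 - \<delta>) l > 0" using delta by (simp_all add: pochhammer_pos)
  obtain f where \<psi>f: "\<psi> = L2_normalize \<Gamma> f" and f: "(\<forall>g\<in>carrier PSL2. f g = wt l g) \<or> (\<forall>g\<in>carrier PSL2. f g = cnj (wt l g))"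
    using \<psi> raising_power_phi lowering_power_phi unfolding phi_plus_def phi_minus_def by blast
  have "left_invariant \<Gamma> f"
    unfolding left_invariant_def using f wt_invariant in_carrier by (auto 0 3)
  then have n: "L2_norm \<Gamma> f = sqrt (pochhammer \<delta> l * pochhammer (1 - \<delta>) l)" using f by (intro norm_ladder) auto
  have "horocycle_integral \<Gamma> \<psi> y = horocycle_integral \<Gamma> f y / of_real (L2_norm \<Gamma> f)"
    unfolding \<psi>f L2_normalize_def horocycle_integral_def by (rule set_integral_divide_zero)
  also have "horocycle_integral \<Gamma> f y = of_real (pochhammer (1 - \<delta>) l * (c0 * y powr (1 - \<delta>)))"
    by (rule horocycle_integral_ladder[OF c0 H y f])
  also have "\<dots> / of_real (L2_norm \<Gamma> f) = of_real (c0 * (pochhammer (1 - \<delta>) l / sqrt (pochhammer \<delta> l * pochhammer (1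
      - \<delta>) l)) * y powr (1 - \<delta>))"
    unfolding n by simp
  also have "pochhammer (1 - \<delta>) l / sqrt (pochhammer \<delta> l * pochhammer (1 - \<delta>) l)
      = sqrt (pochhammer (1 - \<delta>) l / pochhammer \<delta> l)"
    using P by (simp add: real_sqrt_mult real_sqrt_divide field_simps)
  finally show ?thesis .
qed

end

text \<open>The eigenvalue equation for \<open>u\<close>, differentiated \<open>k\<close> times in \<open>x\<close>.\<close>

lemma eigen_jets:
  fixes U :: "nat \<Rightarrow> nat \<Rightarrow> real \<Rightarrow> real \<Rightarrow> real"
  assumes Ux: "\<And>i j x y. y > 0 \<Longrightarrow> ((\<lambda>x. U i j x y) has_real_derivative U (Suc i) j x y) (at x)"
    and Uy: "\<And>i j x y. y > 0 \<Longrightarrow> ((\<lambda>y. U i j x y) has_real_derivative U i (Suc j) x y) (at y)"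
    and u: "\<And>x y. y > 0 \<Longrightarrow> u x y = U 0 0 x y"
    and eig: "\<And>x y. y > 0 \<Longrightarrow> - (y\<^sup>2 * ((deriv ^^ 2) (\<lambda>x. u x y) x + (deriv ^^ 2) (\<lambda>y. u x y) y)) = lam * u x y"
    and y: "y > 0"
  shows "U k 2 x y = - lam / y\<^sup>2 * U k 0 x y - U (Suc (Suc k)) 0 x y"
  using y
proof (induction k arbitrary: x)
  case 0
  have "deriv (\<lambda>x. u x y) = (\<lambda>x. U 1 0 x y)"
    unfolding u[OF y] using DERIV_imp_deriv[OF Ux[OF y]] by auto
  then have dx: "(deriv ^^ 2) (\<lambda>x. u x y) x = U 2 0 x y"
    using DERIV_imp_deriv[OF Ux[OF y, of 1 0 x]] by (simp add: numeral_2_eq_2)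
  have ev: "eventually (\<lambda>v. v > 0) (nhds v)" if "v > 0" for v :: real
    using that eventually_nhds_in_open[OF open_greaterThan[of 0], of v] by simp
  have 1: "deriv (\<lambda>y. u x y) v = U 0 1 x v" if v: "v > 0" for v
  proof -
    have "deriv (\<lambda>y. u x y) v = deriv (\<lambda>y. U 0 0 x y) v"
      by (rule deriv_cong_ev[OF eventually_mono[OF ev[OF v]]]) (simp_all add: u)
    then show ?thesis using DERIV_imp_deriv[OF Uy[OF v, of 0 0 x]] by simp
  qed
  have "deriv (deriv (\<lambda>y. u x y)) y = deriv (\<lambda>y. U 0 1 x y) y"
    by (rule deriv_cong_ev[OF eventually_mono[OF ev[OF y]]]) (simp_all add: 1)
  then have dy: "(deriv ^^ 2) (\<lambda>y. u x y) y = U 0 2 x y"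
    using DERIV_imp_deriv[OF Uy[OF y, of 0 1 x]] by (simp add: numeral_2_eq_2)
  have "U 2 0 x y + U 0 2 x y = - lam / y\<^sup>2 * U 0 0 x y"
    using eig[OF y, of x] y unfolding dx dy unfolding u[OF y] by (simp add: field_simps)
  then show ?case by (simp add: numeral_2_eq_2)
next
  case (Suc k)
  have "((\<lambda>x. - lam / y\<^sup>2 * U k 0 x y - U (Suc (Suc k)) 0 x y) has_real_derivative
      - lam / y\<^sup>2 * U (Suc k) 0 x y - U (Suc (Suc (Suc k))) 0 x y) (at x)"
    by (intro DERIV_diff DERIV_cmult Ux[OF y])
  then have "((\<lambda>x. U k 2 x y) has_real_derivative - lam / y\<^sup>2 * U (Suc k) 0 x y - U (Suc (Suc (Suc k))) 0 x y) (at x)"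
    using Suc.IH[OF y] by simp
  from DERIV_unique[OF Ux[OF y] this] show ?case .
qed

lemma base_eigenfunction_nak:
  assumes "base_eigenfunction \<Gamma> \<delta> \<phi>" and y: "y > 0"
  shows "\<phi> (nak x y t) = \<phi> (nak x y 0)"
proof -
  obtain n :: int where n: "t + of_int n * pi \<in> {0..<pi}" using ex_shift_pi by blast
  have "\<phi> (nak x y t) = \<phi> (nak x y (t + of_int n * pi))" using nak_add_int_pi[OF y] by simp
  also have "\<dots> = \<phi> (nak x y 0 \<otimes>\<^bsub>PSL2\<^esub> k_elt (t + of_int n * pi))"
    unfolding na_eq_nak[OF y, symmetric] nak_def[of x y "t + _"] ..
  also have "\<dots> = \<phi> (nak x y 0)"
    using assms(1) nak_in_carrier[OF y] n unfolding base_eigenfunction_def K_group_def by blast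
  finally show ?thesis .
qed

lemma weight_ladder_exists:
  assumes G: "subgroup \<Gamma> PSL2" "discrete_in_PSL2 \<Gamma>" and b: "base_eigenfunction \<Gamma> \<delta> \<phi>" and d: "0 < \<delta>" "\<delta> < 1"
  obtains p q where "weight_ladder \<Gamma> (\<delta> * (1 - \<delta>)) p q \<delta> \<phi>"
proof -
  have sm: "smooth_on_G \<phi>" and pos: "\<And>g. g \<in> carrier PSL2 \<Longrightarrow> \<phi> g > 0"
    and inv: "left_invariant \<Gamma> \<phi>" and nrm: "L2_norm \<Gamma> \<phi> = 1"
    using b by (auto simp: base_eigenfunction_def in_L2_def)
  obtain U :: "nat \<Rightarrow> nat \<Rightarrow> real \<Rightarrow> real \<Rightarrow> real" where
    U0: "\<And>x y. U 0 0 x y = \<phi> (nak x y 0)" and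
    Ux: "\<And>i j x y. y > 0 \<Longrightarrow> ((\<lambda>x. U i j x y) has_real_derivative U (Suc i) j x y) (at x)" and
    Uy: "\<And>i j x y. y > 0 \<Longrightarrow> ((\<lambda>y. U i j x y) has_real_derivative U i (Suc j) x y) (at y)" and
    Uc: "\<And>i j. continuous_on (UNIV \<times> {0<..}) (\<lambda>(x, y). U i j x y)"
    using smooth_partials[OF sm] by blast
  have eig: "U k 2 x y = - (\<delta> * (1 - \<delta>)) / y\<^sup>2 * U k 0 x y - U (Suc (Suc k)) 0 x y" if "y > 0" for k x y
    by (rule eigen_jets[where U = U, OF Ux Uy, where u = "\<lambda>x y. \<phi> (n_elt x \<otimes>\<^bsub>PSL2\<^esub> a_elt y)"])
       (use that b in \<open>auto simp: base_eigenfunction_def U0 na_eq_nak\<close>)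
  have "weight_ladder \<Gamma> (\<delta> * (1 - \<delta>)) (\<lambda>k. U k 0) (\<lambda>k. U k 1) \<delta> \<phi>"
  proof
    show "\<delta> * (1 - \<delta>) \<le> 1" using d mult_le_one[of \<delta> "1 - \<delta>"] by simp
    fix k :: nat and x y :: real assume y: "0 < y"
    show "((\<lambda>x. U k 0 x y) has_real_derivative U (Suc k) 0 x y) (at x)" by (rule Ux[OF y])
    show "((\<lambda>x. U k 1 x y) has_real_derivative U (Suc k) 1 x y) (at x)" by (rule Ux[OF y])
    show "((\<lambda>y. U k 0 x y) has_real_derivative U k 1 x y) (at y)" using Uy[OF y, of k 0 x] by simp
    show "((\<lambda>y. U k 1 x y) has_real_derivative - (\<delta> * (1 - \<delta>)) / y\<^sup>2 * U k 0 x y - U (Suc (Suc k)) 0 x y) (at y)"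
      using Uy[OF y, of k 1 x] unfolding eig[OF y, symmetric] by (simp add: numeral_2_eq_2)
    show "U 0 0 x y > 0" unfolding U0 by (rule pos[OF nak_in_carrier[OF y]])
    show "\<phi> (nak x y t) = U 0 0 x y" for t unfolding U0 by (rule base_eigenfunction_nak[OF b y])
  qed (use G subgroup.mem_carrier[OF G(1)] subgroup.m_closed[OF G(1)] subgroup.one_closed[OF G(1)]
      subgroup.m_inv_closed[OF G(1)] d inv nrm Uc in auto)
  then show ?thesis by (rule that)
qed

theorem theorem3p4:
  fixes \<Gamma> :: "(real^2^2) set set"
    and \<delta> c0 :: real
    and \<phi>0 :: "(real^2^2) set \<Rightarrow> real"
  assumes "subgroup \<Gamma> PSL2"
    and "torsion_free (PSL2\<lparr>carrier := \<Gamma>\<rparr>)"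
    and "discrete_in_PSL2 \<Gamma>"
    and "finitely_generated (PSL2\<lparr>carrier := \<Gamma>\<rparr>)"
    and "\<not> virtually_cyclic (PSL2\<lparr>carrier := \<Gamma>\<rparr>)"
    and "\<delta> = critical_exponent \<Gamma>"
    and "1/2 < \<delta>" and "\<delta> < 1"
    and "closedin (quot_top \<Gamma>) (quot_proj \<Gamma> ` N_group)"
    and "base_eigenfunction \<Gamma> \<delta> \<phi>0"
    and "c0 > 0"
    and "\<And>y. y > 0 \<Longrightarrow> horocycle_integral \<Gamma> \<phi>0 y = c0 * y powr (1 - \<delta>)"
  shows "(\<forall>l::nat. \<forall>y>0. \<forall>\<phi>\<in>{phi_plus \<Gamma> \<phi>0 l, phi_minus \<Gamma> \<phi>0 l}.
            horocycle_integral \<Gamma> \<phi> y = complex_of_real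
              (c0 * (sqrt (Gamma \<delta> * Gamma (real l + 1 - \<delta>))
                      / sqrt (Gamma (1 - \<delta>) * Gamma (\<delta> + real l)))
               * y powr (1 - \<delta>)))
         \<and> (\<exists>C. \<forall>l::nat. \<forall>y>0. \<forall>\<phi>\<in>{phi_plus \<Gamma> \<phi>0 l, phi_minus \<Gamma> \<phi>0 l}.
            cmod (horocycle_integral \<Gamma> \<phi> y) \<le> C * y powr (1 - \<delta>))"
proof -
  have d: "0 < \<delta>" "\<delta> < 1" using assms(7,8) by auto
  obtain p q where "weight_ladder \<Gamma> (\<delta> * (1 - \<delta>)) p q \<delta> \<phi>0"
    by (rule weight_ladder_exists[OF assms(1,3,10) d])
  then interpret weight_ladder \<Gamma> "\<delta> * (1 - \<delta>)" p q \<delta> \<phi>0 .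
  define r where "r = (\<lambda>l. sqrt (pochhammer (1 - \<delta>) l / pochhammer \<delta> l))"
  have *: "horocycle_integral \<Gamma> \<psi> y = complex_of_real (c0 * r l * y powr (1 - \<delta>))"
    if "y > 0" "\<psi> \<in> {phi_plus \<Gamma> \<phi>0 l, phi_minus \<Gamma> \<phi>0 l}" for l y \<psi>
    unfolding r_def by (rule normalized_horocycle_integral[OF assms(11,12) that])
  have gam: "r l = sqrt (Gamma \<delta> * Gamma (real l + 1 - \<delta>)) / sqrt (Gamma (1 - \<delta>) * Gamma (\<delta> + real l))" for l
  proof -
    have "\<delta> \<notin> \<int>\<^sub>\<le>\<^sub>0" "1 - \<delta> \<notin> \<int>\<^sub>\<le>\<^sub>0" using d nonpos_Ints_nonpos[of \<delta>] nonpos_Ints_nonpos[of "1 - \<delta>"] by auto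
    then have P: "pochhammer \<delta> l = Gamma (\<delta> + real l) / Gamma \<delta>" "pochhammer (1 - \<delta>) l = Gamma (real l
        + 1 - \<delta>) / Gamma (1 - \<delta>)"
      by (simp_all add: pochhammer_Gamma algebra_simps)
    show ?thesis unfolding r_def P by (simp add: real_sqrt_divide[symmetric] mult_ac)
  qed
  have r1: "0 \<le> r l" "r l \<le> 1" for l
  proof -
    have "pochhammer (1 - \<delta>) l \<le> pochhammer \<delta> l"
      unfolding pochhammer_prod using assms(7,8) by (intro prod_mono) auto
    then show "0 \<le> r l" "r l \<le> 1"
      using pochhammer_pos[of \<delta> l] pochhammer_pos[of "1 - \<delta>" l] d by (auto simp: r_def)
  qed
  show ?thesis
  proof (intro conjI allI impI ballI exI[of _ c0])
    fix l :: nat and y :: real and \<psi>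
    assume y: "0 < y" and \<psi>: "\<psi> \<in> {phi_plus \<Gamma> \<phi>0 l, phi_minus \<Gamma> \<phi>0 l}"
    show "horocycle_integral \<Gamma> \<psi> y = complex_of_real
              (c0 * (sqrt (Gamma \<delta> * Gamma (real l + 1 - \<delta>))
                      / sqrt (Gamma (1 - \<delta>) * Gamma (\<delta> + real l)))
               * y powr (1 - \<delta>))"
      unfolding *[OF y \<psi>] gam ..
    have "cmod (horocycle_integral \<Gamma> \<psi> y) = c0 * r l * y powr (1 - \<delta>)"
      unfolding *[OF y \<psi>] norm_of_real using r1(1)[of l] assms(11) by simp
    also have "\<dots> \<le> c0 * 1 * y powr (1 - \<delta>)"
      by (intro mult_right_mono mult_left_mono r1) (use assms(11) in auto)
    finally show "cmod (horocycle_integral \<Gamma> \<psi> y) \<le> c0 * y powr (1 - \<delta>)" by simp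
  qed
qed

end
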